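(* For all $d\in\mathbb N$ and $k\in\{1,\ldots,d\}$, $$ \mathbb E f_{k-1}(\mathrm{conv}\,\Pi_{d,2})=\binom dk\binom{d+k}{k}. $$
   Context: For $\alpha>0$, $\Pi_{d,\alpha}$ is a Poisson point process on $\mathbb R^d\setminus\{0\}$ with intensity function $x\mapsto\|x\|^{-d-\alpha}$; its convex hull $\mathrm{conv}\,\Pi_{d,\alpha}$ (convex hull of its atoms) is almost surely a simplicial polytope. $f_j(P)$ denotes the number of $j$-dimensional faces of a polytope $P$. *)

theory Defs
  imports "HOL-Analysis.Analysis" "HOL-Probability.Probability"
begin

definition stable_intensity :: "real \<Rightarrow> ('a::euclidean_space) measure" where
  "stable_intensity \<alpha> =
     density lborel (\<lambda>x. if x = 0 then 0 else ennreal (norm x powr (- (real DIM('a) + \<alpha>))))"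

definition poisson_point_process :: "'w measure \<Rightarrow> ('w \<Rightarrow> 'a set) \<Rightarrow> 'a measure \<Rightarrow> bool" where
  "poisson_point_process M N \<Lambda> \<longleftrightarrow>
     prob_space M \<and>
     (\<forall>B \<in> sets \<Lambda>. emeasure \<Lambda> B < \<infinity> \<longrightarrow>
        (AE \<omega> in M. finite (N \<omega> \<inter> B)) \<and>
        (\<forall>j::nat. measure M {\<omega> \<in> space M. card (N \<omega> \<inter> B) = j} =
                   measure \<Lambda> B ^ j / fact j * exp (- measure \<Lambda> B))) \<and>
     (\<forall>(n::nat) (B :: nat \<Rightarrow> 'a set).
        (\<forall>i<n. B i \<in> sets \<Lambda> \<and> emeasure \<Lambda> (B i) < \<infinity>) \<and> disjoint_family_on B {..<n} \<longrightarrow>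
        prob_space.indep_vars M (\<lambda>_. count_space (UNIV :: nat set))
          (\<lambda>i \<omega>. card (N \<omega> \<inter> B i)) {..<n})"

definition face_number :: "int \<Rightarrow> ('a::euclidean_space) set \<Rightarrow> nat" where
  "face_number j P = card {F. F face_of P \<and> aff_dim F = j}"

end

theory Submission
  imports Defs "HOL-Real_Asymp.Real_Asymp"
begin

text \<open>Let \<open>d\<close> be the dimension and fix a vector \<open>c \<noteq> 0\<close>. Maximising \<open>c\<close> over the face of the polar body dual to
  a given \<open>(k-1)\<close>-face singles out one facet containing that face. Hence \<open>d! f\<^sub>k\<^sub>-\<^sub>1\<close> is the number of pairs of an
  index set \<open>I\<close> of size \<open>d - k\<close> and an ordered facet \<open>(x\<^sub>i)\<close> such that the coordinates of \<open>c\<close> in the basis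
  \<open>(x\<^sub>i)\<close> are positive on \<open>I\<close>. By the Mecke formula the expected number of such facets is an integral over \<open>(x\<^sub>i)\<close>
  with weight \<open>exp (- \<kappa> |w|\<^sup>2)\<close>, where \<open>w\<close> is the facet normal and \<open>\<kappa> |w|\<^sup>2\<close> is the intensity of the halfspace cut off
  by the facet. Averaging over a Gaussian vector \<open>c\<close>, linear substitutions reduce this integral, up to a constant
  independent of \<open>I\<close>, to the integral of \<open>exp (- |q\<^sub>1 + ... + q\<^sub>d| - |q\<^sub>1| - ... - |q\<^sub>d|)\<close> over the region where
  \<open>q\<^sub>i > 0\<close> for \<open>i \<in> I\<close>, which is a multiple of the binomial coefficient \<open>d + k\<close> over \<open>k\<close>. The constant is found from the
  same identity with \<open>k = 0\<close>, where only the empty face is counted.\<close>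

section \<open>Exponential convolutions\<close>

text \<open>The exponent 2 is what makes the integral computable. The density is a Gaussian mixture
  in a radial variable, and rescaling the points leaves each of these variables to the first power.
  The resulting product of coordinates cancels exactly against the Jacobian of the last
  substitution, after which the integral splits into one-dimensional factors. Averaging over a
  Gaussian \<open>c\<close> serves the substitution \<open>c = l v* X\<close>: the coordinates of
  \<open>c\<close> become free variables \<open>l\<close>, at the price of a rank-one term in the
  exponent.

  The probabilistic obstacle is that the process is known only through the joint law of its counts
  on sets of finite intensity, while its points accumulate at the origin. The Mecke formula is
  therefore derived by discretisation, in a form that requires a region attached to the tuple to be
  empty; it yields directly only open conditions, and exceptional closed sets are handled by
  comparing counts. The geometry of a hull of infinitely many points goes through the polar body: it
  is bounded because 0 is interior, so all points on supporting hyperplanes stay away from the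
  origin and are finite in number.\<close>

definition conv_op :: "(real \<Rightarrow> ennreal) \<Rightarrow> (real \<Rightarrow> ennreal) \<Rightarrow> real \<Rightarrow> ennreal" where
  "conv_op g F t = (\<integral>\<^sup>+z. g z * F (t + z) \<partial>lborel)"

definition exp_pos :: "real \<Rightarrow> ennreal" where
  "exp_pos z = ennreal (exp (- z)) * indicator {0<..} z"

definition exp_neg :: "real \<Rightarrow> ennreal" where
  "exp_neg z = ennreal (exp z) * indicator {..<0} z"

definition exp_abs :: "real \<Rightarrow> ennreal" where
  "exp_abs z = ennreal (exp (- \<bar>z\<bar>))"

lemma exp_kernels_measurable [measurable]:
  "exp_pos \<in> borel_measurable borel" "exp_neg \<in> borel_measurable borel"
  "exp_abs \<in> borel_measurable borel"
  unfolding exp_pos_def[abs_def] exp_neg_def[abs_def] exp_abs_def[abs_def] by measurable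

lemma conv_op_measurable [measurable]:
  assumes [measurable]: "g \<in> borel_measurable borel" "F \<in> borel_measurable borel"
  shows "conv_op g F \<in> borel_measurable borel"
  unfolding conv_op_def[abs_def] by measurable

text \<open>Both sides integrate \<open>g x * h y * F (t + x + y)\<close>, so this is Tonelli's
  theorem. It allows kernels to be collected in any order.\<close>

lemma conv_op_commute:
  assumes [measurable]: "g \<in> borel_measurable borel" "h \<in> borel_measurable borel" "F \<in> borel_measurable borel"
  shows "conv_op g (conv_op h F) = conv_op h (conv_op g F)"
proof
  fix t
  have "conv_op g (conv_op h F) t = (\<integral>\<^sup>+x. \<integral>\<^sup>+y. g x * (h y * F (t + x + y)) \<partial>lborel \<partial>lborel)"
    unfolding conv_op_def by (intro nn_integral_cong nn_integral_cmult[symmetric]) measurable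
  also have "\<dots> = (\<integral>\<^sup>+y. \<integral>\<^sup>+x. g x * (h y * F (t + x + y)) \<partial>lborel \<partial>lborel)"
    by (rule lborel_pair.Fubini') measurable
  also have "\<dots> = (\<integral>\<^sup>+y. \<integral>\<^sup>+x. h y * (g x * F (t + y + x)) \<partial>lborel \<partial>lborel)"
    by (simp add: mult.left_commute add.commute add.left_commute)
  also have "\<dots> = conv_op h (conv_op g F) t"
    unfolding conv_op_def by (intro nn_integral_cong nn_integral_cmult) measurable
  finally show "conv_op g (conv_op h F) t = conv_op h (conv_op g F) t" .
qed

lemma conv_op_abs:
  assumes [measurable]: "F \<in> borel_measurable borel"
  shows "conv_op exp_abs F t = conv_op exp_pos F t + conv_op exp_neg F t"
proof -
  have "conv_op exp_pos F t + conv_op exp_neg F t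
      = (\<integral>\<^sup>+z. exp_pos z * F (t + z) + exp_neg z * F (t + z) \<partial>lborel)"
    unfolding conv_op_def by (rule nn_integral_add[symmetric]) measurable
  also have "\<dots> = conv_op exp_abs F t"
    unfolding conv_op_def
  proof (rule nn_integral_cong_AE)
    show "AE z in lborel. exp_pos z * F (t + z) + exp_neg z * F (t + z) = exp_abs z * F (t + z)"
      using AE_lborel_singleton[of "0::real"]
      by eventually_elim (auto simp: exp_pos_def exp_neg_def exp_abs_def indicator_def)
  qed
  finally show ?thesis ..
qed

text \<open>Multiplying two one-sided exponentials leaves \<open>exp (- 2 * x)\<close> on a
  half-line that starts at 0 or at \<open>max 0 z\<close>; this one integral covers both
  cases.\<close>

lemma nn_integral_exp_tail:
  fixes c :: real
  shows "(\<integral>\<^sup>+x. ennreal (exp (- 2 * x)) * indicator {c<..} x \<partial>lborel) = ennreal (exp (- 2 * c) / 2)"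
proof -
  have "(\<integral>\<^sup>+x. ennreal (exp (- 2 * x)) * indicator {c<..} x \<partial>lborel)
      = (\<integral>\<^sup>+x. ennreal (exp (- 2 * x)) * indicator {c..} x \<partial>lborel)"
    by (rule nn_integral_cong_AE) (use AE_lborel_singleton[of c] in eventually_elim, auto simp: indicator_def)
  also have "\<dots> = ennreal (0 - (- exp (- 2 * c) / 2))"
  proof (rule nn_integral_FTC_atLeast[where F="\<lambda>x. - exp (- 2 * x) / 2"])
    show "((\<lambda>x::real. - exp (- 2 * x) / 2) \<longlongrightarrow> 0) at_top"
      by real_asymp
  qed (auto intro!: derivative_eq_intros)
  finally show ?thesis by simp
qed

text \<open>The difference of two independent standard exponential variables has half the two-sided
  kernel as its density. For fixed total shift \<open>z\<close> the inner variable runs over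
  \<open>x > max 0 z\<close>, and
  \<open>exp z * exp (- 2 * max 0 z) = exp (- \<bar>z\<bar>)\<close>.\<close>

lemma conv_op_pos_neg:
  assumes [measurable]: "F \<in> borel_measurable borel"
  shows "2 * conv_op exp_pos (conv_op exp_neg F) t = conv_op exp_abs F t"
proof -
  have "conv_op exp_pos (conv_op exp_neg F) t
      = (\<integral>\<^sup>+x. exp_pos x * (\<integral>\<^sup>+z. exp_neg (z - x) * F (t + z) \<partial>lborel) \<partial>lborel)"
    unfolding conv_op_def
  proof (rule nn_integral_cong, rule arg_cong2[where f = "(*)", OF refl])
    fix x
    show "(\<integral>\<^sup>+z. exp_neg z * F (t + x + z) \<partial>lborel) = (\<integral>\<^sup>+z. exp_neg (z - x) * F (t + z) \<partial>lborel)"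
      by (subst nn_integral_real_affine[where c=1 and t="-x"]) (auto simp: algebra_simps)
  qed
  also have "\<dots> = (\<integral>\<^sup>+x. \<integral>\<^sup>+z. exp_pos x * (exp_neg (z - x) * F (t + z)) \<partial>lborel \<partial>lborel)"
    by (intro nn_integral_cong nn_integral_cmult[symmetric]) measurable
  also have "\<dots> = (\<integral>\<^sup>+z. \<integral>\<^sup>+x. exp_pos x * (exp_neg (z - x) * F (t + z)) \<partial>lborel \<partial>lborel)"
    by (rule lborel_pair.Fubini') measurable
  also have "\<dots> = (\<integral>\<^sup>+z. (ennreal (exp z) * F (t + z)) *
        (\<integral>\<^sup>+x. ennreal (exp (- 2 * x)) * indicator {max 0 z<..} x \<partial>lborel) \<partial>lborel)"
  proof (rule nn_integral_cong)
    fix z :: real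
    have "exp_pos x * (exp_neg (z - x) * F (t + z)) = (ennreal (exp z) * F (t + z)) *
       (ennreal (exp (- 2 * x)) * indicator {max 0 z<..} x)" for x
    proof (cases "x > 0 \<and> x > z")
      case True
      have "exp (- x) * exp (z - x) = exp z * exp (- 2 * x)"
        by (simp add: exp_add[symmetric])
      then have "ennreal (exp (- x)) * ennreal (exp (z - x)) = ennreal (exp z) * ennreal (exp (- 2 * x))"
        by (simp add: ennreal_mult'[symmetric])
      then show ?thesis using True by (simp add: exp_pos_def exp_neg_def mult.assoc[symmetric]) (simp add: ac_simps)
    qed (auto simp: exp_pos_def exp_neg_def indicator_def)
    then show "(\<integral>\<^sup>+x. exp_pos x * (exp_neg (z - x) * F (t + z)) \<partial>lborel) = (ennreal (exp z) * F (t + z)) *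
        (\<integral>\<^sup>+x. ennreal (exp (- 2 * x)) * indicator {max 0 z<..} x \<partial>lborel)"
      by (simp add: nn_integral_cmult)
  qed
  also have "\<dots> = (\<integral>\<^sup>+z. (exp_abs z * F (t + z)) * ennreal (1/2) \<partial>lborel)"
  proof (rule nn_integral_cong)
    fix z :: real
    have "exp z * (exp (- 2 * max 0 z) / 2) = exp (- \<bar>z\<bar>) * (1/2)"
      by (auto simp: max_def abs_if exp_add[symmetric])
    then have "ennreal (exp z) * ennreal (exp (- 2 * max 0 z) / 2) = exp_abs z * ennreal (1/2)"
      unfolding exp_abs_def by (simp only: ennreal_mult'[symmetric] exp_ge_zero)
    then show "(ennreal (exp z) * F (t + z)) *
        (\<integral>\<^sup>+x. ennreal (exp (- 2 * x)) * indicator {max 0 z<..} x \<partial>lborel) = (exp_abs z * F (t + z)) * ennreal (1/2)"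
      unfolding nn_integral_exp_tail by (simp only: mult.assoc mult.commute[of "F (t + z)"]) (simp only: mult.assoc[symmetric])
  qed
  also have "\<dots> = conv_op exp_abs F t * ennreal (1/2)"
    unfolding conv_op_def by (rule nn_integral_multc) measurable
  finally have "2 * conv_op exp_pos (conv_op exp_neg F) t = conv_op exp_abs F t * (2 * ennreal (1/2))"
    by (simp add: mult.commute mult.left_commute)
  also have "2 * ennreal (1/2) = 1"
    by (metis ennreal_numeral ennreal_mult'  zero_le_numeral mult_2 field_sum_of_halves ennreal_1)
  finally show ?thesis by simp
qed

text \<open>The order of the two powers is immaterial by \<open>conv_op_commute\<close>. A further
  two-sided kernel raises both exponents by one and costs a factor 2.\<close>

definition laplace_iter :: "nat \<Rightarrow> nat \<Rightarrow> real \<Rightarrow> ennreal" where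
  "laplace_iter p n = (conv_op exp_pos ^^ p) ((conv_op exp_neg ^^ n) exp_abs)"

lemma laplace_iter_measurable [measurable]: "laplace_iter p n \<in> borel_measurable borel"
proof -
  have *: "(conv_op exp_neg ^^ n) exp_abs \<in> borel_measurable borel"
    by (induction n) auto
  show ?thesis
    unfolding laplace_iter_def by (induction p) (use * in auto)
qed

lemma laplace_iter_Suc_left: "laplace_iter (Suc p) n = conv_op exp_pos (laplace_iter p n)"
  by (simp add: laplace_iter_def)

lemma laplace_iter_Suc_right: "laplace_iter p (Suc n) = conv_op exp_neg (laplace_iter p n)"
proof (induction p)
  case (Suc p)
  then show ?case
    by (simp add: laplace_iter_Suc_left conv_op_commute)
qed (simp add: laplace_iter_def)

text \<open>Pascal's recursion: the two-sided kernel is the sum of its halves by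
  \<open>conv_op_abs\<close> and twice their composition by \<open>conv_op_pos_neg\<close>.\<close>

lemma laplace_iter_Suc_Suc:
  "2 * laplace_iter (Suc p) (Suc n) t = laplace_iter (Suc p) n t + laplace_iter p (Suc n) t"
  "conv_op exp_abs (laplace_iter p n) t = 2 * laplace_iter (Suc p) (Suc n) t"
proof -
  have *: "2 * laplace_iter (Suc p) (Suc n) t = conv_op exp_abs (laplace_iter p n) t"
    using conv_op_pos_neg[of "laplace_iter p n" t]
    by (simp add: laplace_iter_Suc_right[symmetric] laplace_iter_Suc_left[symmetric])
  then show "2 * laplace_iter (Suc p) (Suc n) t = laplace_iter (Suc p) n t + laplace_iter p (Suc n) t"
    "conv_op exp_abs (laplace_iter p n) t = 2 * laplace_iter (Suc p) (Suc n) t"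
    using conv_op_abs[of "laplace_iter p n" t]
    by (simp_all add: laplace_iter_Suc_right[symmetric] laplace_iter_Suc_left[symmetric])
qed

text \<open>Starting from \<open>t \<ge> 0\<close>, positive shifts never leave the half-line on
  which \<open>exp_abs\<close> is a pure exponential, so each kernel merely contributes the integral
  of \<open>exp (- 2 * z)\<close>, that is 1/2.\<close>

lemma laplace_iter_0_right: "t \<ge> 0 \<Longrightarrow> 2 ^ p * laplace_iter p 0 t = exp_abs t"
proof (induction p arbitrary: t)
  case (Suc p)
  have "2 ^ p * laplace_iter (Suc p) 0 t = (\<integral>\<^sup>+z. 2 ^ p * (exp_pos z * laplace_iter p 0 (t + z)) \<partial>lborel)"
    unfolding laplace_iter_Suc_left conv_op_def by (rule nn_integral_cmult[symmetric]) measurable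
  also have "\<dots> = (\<integral>\<^sup>+z. ennreal (exp (- t)) * (ennreal (exp (- 2 * z)) * indicator {0<..} z) \<partial>lborel)"
  proof (rule nn_integral_cong)
    fix z :: real
    have "2 ^ p * (exp_pos z * laplace_iter p 0 (t + z)) = exp_pos z * exp_abs (t + z)" if "z > 0"
      using Suc.IH[of "t + z"] Suc.prems that by (metis add_increasing less_imp_le mult.left_commute)
    moreover have "exp_pos z * exp_abs (t + z) = ennreal (exp (- t)) * ennreal (exp (- 2 * z))" if "z > 0"
      using Suc.prems that
      by (simp add: exp_pos_def exp_abs_def ennreal_mult'[symmetric] exp_add[symmetric])
    ultimately show "2 ^ p * (exp_pos z * laplace_iter p 0 (t + z))
      = ennreal (exp (- t)) * (ennreal (exp (- 2 * z)) * indicator {0<..} z)"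
      by (cases "z > 0") (simp_all add: exp_pos_def)
  qed
  also have "\<dots> = ennreal (exp (- t)) * ennreal (1 / 2)"
    by (subst nn_integral_cmult) (simp_all only: nn_integral_exp_tail, simp_all)
  finally have "2 ^ p * laplace_iter (Suc p) 0 t = ennreal (exp (- t)) * ennreal (1/2)" .
  then have "2 ^ Suc p * laplace_iter (Suc p) 0 t = ennreal (exp (- t)) * (2 * ennreal (1/2))"
    by (simp add: mult.assoc mult.left_commute)
  also have "2 * ennreal (1/2) = 1"
    by (metis ennreal_numeral ennreal_mult'  zero_le_numeral mult_2 field_sum_of_halves ennreal_1)
  finally show ?case using Suc.prems by (simp add: exp_abs_def)
qed (simp add: laplace_iter_def)

lemma laplace_iter_0_left: "t \<le> 0 \<Longrightarrow> 2 ^ n * laplace_iter 0 n t = exp_abs t"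
proof (induction n arbitrary: t)
  case (Suc p)
  have "2 ^ p * laplace_iter 0 (Suc p) t = (\<integral>\<^sup>+z. 2 ^ p * (exp_neg z * laplace_iter 0 p (t + z)) \<partial>lborel)"
    unfolding laplace_iter_Suc_right conv_op_def by (rule nn_integral_cmult[symmetric]) measurable
  also have "\<dots> = (\<integral>\<^sup>+z. ennreal (exp t) * (ennreal (exp (2 * z)) * indicator {..<0} z) \<partial>lborel)"
  proof (rule nn_integral_cong)
    fix z :: real
    have "2 ^ p * (exp_neg z * laplace_iter 0 p (t + z)) = exp_neg z * exp_abs (t + z)" if "z < 0"
      using Suc.IH[of "t + z"] Suc.prems that by (metis add_nonpos_nonpos less_imp_le mult.left_commute)
    moreover have "exp_neg z * exp_abs (t + z) = ennreal (exp t) * ennreal (exp (2 * z))" if "z < 0"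
      using Suc.prems that
      by (simp add: exp_neg_def exp_abs_def ennreal_mult'[symmetric] exp_add[symmetric])
    ultimately show "2 ^ p * (exp_neg z * laplace_iter 0 p (t + z))
      = ennreal (exp t) * (ennreal (exp (2 * z)) * indicator {..<0} z)"
      by (cases "z < 0") (simp_all add: exp_neg_def)
  qed
  also have "\<dots> = ennreal (exp t) * (\<integral>\<^sup>+z. ennreal (exp (2 * z)) * indicator {..<0} z \<partial>lborel)"
    by (rule nn_integral_cmult) measurable
  also have "(\<integral>\<^sup>+z. ennreal (exp (2 * z)) * indicator {..<0} z \<partial>lborel)
     = (\<integral>\<^sup>+z. ennreal (exp (- 2 * z)) * indicator {0<..} z \<partial>lborel)"
    by (subst nn_integral_real_affine[where c="-1" and t=0]) (auto intro!: nn_integral_cong simp: indicator_def)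
  also have "\<dots> = ennreal (1/2)"
    by (simp only: nn_integral_exp_tail) simp
  finally have "2 ^ p * laplace_iter 0 (Suc p) t = ennreal (exp t) * ennreal (1/2)" .
  then have "2 ^ Suc p * laplace_iter 0 (Suc p) t = ennreal (exp t) * (2 * ennreal (1/2))"
    by (simp add: mult.assoc mult.left_commute)
  also have "2 * ennreal (1/2) = 1"
    by (metis ennreal_numeral ennreal_mult'  zero_le_numeral mult_2 field_sum_of_halves ennreal_1)
  finally show ?case using Suc.prems by (simp add: exp_abs_def)
qed (simp add: laplace_iter_def)

text \<open>The rescaled values form Pascal's triangle, with the edges \<open>p = 0\<close> and
  \<open>n = 0\<close> equal to 1. The argument 0 is the only one at which both edge formulas are
  available.\<close>

lemma laplace_iter_at_0: "2 ^ (p + n) * laplace_iter p n 0 = of_nat ((p + n) choose n)"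
proof (induction "p + n" arbitrary: p n)
  case 0
  then show ?case by (simp add: laplace_iter_def exp_abs_def)
next
  case (Suc m)
  consider "p = 0" | "n = 0" | p' n' where "p = Suc p'" "n = Suc n'"
    by (metis not0_implies_Suc)
  then show ?case
  proof cases
    case 1
    then show ?thesis using laplace_iter_0_left[of 0 n] by (simp add: exp_abs_def)
  next
    case 2
    then show ?thesis using laplace_iter_0_right[of 0 p] by (simp add: exp_abs_def)
  next
    case 3
    have "2 ^ (p + n) * laplace_iter p n 0 = 2 ^ m * (2 * laplace_iter (Suc p') (Suc n') 0)"
      using 3 Suc.hyps(2) by (metis mult.assoc power_Suc2)
    also have "\<dots> = 2 ^ m * laplace_iter (Suc p') n' 0 + 2 ^ m * laplace_iter p' (Suc n') 0"
      by (simp add: laplace_iter_Suc_Suc(1) distrib_left)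
    also have "2 ^ m * laplace_iter (Suc p') n' 0 = of_nat (m choose n')"
      using Suc.hyps(1)[of "Suc p'" n'] 3 Suc.hyps(2) by simp
    also have "2 ^ m * laplace_iter p' (Suc n') 0 = of_nat (m choose Suc n')"
      using Suc.hyps(1)[of p' "Suc n'"] 3 Suc.hyps(2) by simp
    finally show ?thesis
      using 3 Suc.hyps(2) by (simp flip: of_nat_add)
  qed
qed

text \<open>Integrating out one coordinate applies one kernel in the shift \<open>t\<close>, which
  is kept general for the induction. A coordinate in \<open>I\<close> raises the first index, any
  other raises both and costs a factor 2; hence the first index counts all coordinates and the
  second those outside \<open>I\<close>.\<close>

lemma nn_integral_exp_kernels:
  fixes I S :: "'i set"
  assumes "finite S"
  shows "(\<integral>\<^sup>+q. (\<Prod>i\<in>S. if i \<in> I then exp_pos (q i) else exp_abs (q i)) * exp_abs (t + (\<Sum>i\<in>S. q i)) \<partial>(PiM S (\<lambda>_. lborel)))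
    = 2 ^ card (S - I) * laplace_iter (card S) (card (S - I)) t"
  using assms
proof (induction S arbitrary: t)
  case empty
  then show ?case
    by (subst product_sigma_finite.nn_integral_empty)
       (auto simp: laplace_iter_def product_sigma_finite_def intro: lborel.sigma_finite_measure_axioms)
next
  case (insert a S)
  interpret P: product_sigma_finite "\<lambda>_::'i. lborel :: real measure"
    by (simp add: product_sigma_finite_def lborel.sigma_finite_measure_axioms)
  let ?g = "\<lambda>i x. if i \<in> I then exp_pos x else exp_abs x"
  have [measurable]: "?g i \<in> borel_measurable borel" for i by measurable
  have "(\<integral>\<^sup>+q. (\<Prod>i\<in>insert a S. ?g i (q i)) * exp_abs (t + (\<Sum>i\<in>insert a S. q i)) \<partial>(PiM (insert a S) (\<lambda>_. lborel)))
    = (\<integral>\<^sup>+y. \<integral>\<^sup>+q. (\<Prod>i\<in>insert a S. ?g i ((q(a := y)) i)) * exp_abs (t + (\<Sum>i\<in>insert a S. (q(a := y)) i)) \<partial>(PiM S (\<lambda>_. lborel)) \<partial>lborel)"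
    using insert by (intro P.product_nn_integral_insert_rev) measurable
  also have "\<dots> = (\<integral>\<^sup>+y. \<integral>\<^sup>+q. ?g a y * ((\<Prod>i\<in>S. ?g i (q i)) * exp_abs (t + y + (\<Sum>i\<in>S. q i))) \<partial>(PiM S (\<lambda>_. lborel)) \<partial>lborel)"
  proof (intro nn_integral_cong)
    fix y q
    have "(\<Prod>i\<in>S. ?g i ((q(a := y)) i)) = (\<Prod>i\<in>S. ?g i (q i))"
      using insert by (intro prod.cong) auto
    moreover have "(\<Sum>i\<in>S. (q(a := y)) i) = (\<Sum>i\<in>S. q i)"
      using insert by (intro sum.cong) auto
    ultimately show "(\<Prod>i\<in>insert a S. ?g i ((q(a := y)) i)) * exp_abs (t + (\<Sum>i\<in>insert a S. (q(a := y)) i)) =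
       ?g a y * ((\<Prod>i\<in>S. ?g i (q i)) * exp_abs (t + y + (\<Sum>i\<in>S. q i)))"
      using insert by (simp only: prod.insert[OF insert.hyps] sum.insert[OF insert.hyps] fun_upd_same mult.assoc add.assoc)
  qed
  also have "\<dots> = (\<integral>\<^sup>+y. ?g a y * (2 ^ card (S - I) * laplace_iter (card S) (card (S - I)) (t + y)) \<partial>lborel)"
    by (intro nn_integral_cong, subst nn_integral_cmult) (measurable, simp only: insert.IH)
  also have "\<dots> = (\<integral>\<^sup>+y. 2 ^ card (S - I) * (?g a y * laplace_iter (card S) (card (S - I)) (t + y)) \<partial>lborel)"
    by (simp only: mult.left_commute)
  also have "\<dots> = 2 ^ card (S - I) * conv_op (?g a) (laplace_iter (card S) (card (S - I))) t"
    unfolding conv_op_def by (rule nn_integral_cmult) measurable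
  also have "\<dots> = 2 ^ card (insert a S - I) * laplace_iter (card (insert a S)) (card (insert a S - I)) t"
  proof (cases "a \<in> I")
    case True
    then show ?thesis using insert by (simp add: insert_Diff_if laplace_iter_Suc_left)
  next
    case False
    then show ?thesis using insert
      by (simp add: insert_Diff_if laplace_iter_Suc_Suc(2) ac_simps)
  qed
  finally show ?case .
qed

lemma nn_integral_exp_kernels_UNIV:
  fixes I :: "'i::finite set"
  shows "2 ^ CARD('i) * (\<integral>\<^sup>+q. (\<Prod>i\<in>UNIV. if i \<in> I then exp_pos (q i) else exp_abs (q i)) * exp_abs (\<Sum>i\<in>UNIV. q i) \<partial>(PiM UNIV (\<lambda>_. lborel)))
    = of_nat ((CARD('i) + card (- I)) choose card (- I))"
proof -
  have "2 ^ CARD('i) * (2 ^ card (- I) * laplace_iter (CARD('i)) (card (- I)) 0) = of_nat ((CARD('i) + card (- I)) choose card (- I))"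
    using laplace_iter_at_0[of "CARD('i)" "card (- I)"] by (simp add: power_add mult.assoc)
  then show ?thesis
    using nn_integral_exp_kernels[of UNIV I 0] by (simp add: Compl_eq_Diff_UNIV)
qed

section \<open>The integral that produces the two-sided exponential from Gaussians\<close>

lemma std_normal_cdf_DERIV: "DERIV (cdf std_normal_distribution) x :> std_normal_density x"
proof -
  interpret real_distribution std_normal_distribution by (rule real_dist_normal_dist)
  have cont: "isCont std_normal_density y" for y
    unfolding std_normal_density_def by (intro continuous_intros) auto
  \<comment> \<open>Continuity of the density gives an antiderivative on the whole line. The
    distribution function has the same increments, so the two differ by the constant
    \<open>K\<close> below.\<close>
  obtain F where F: "\<And>y. (F has_vector_derivative std_normal_density y) (at y)"
    using einterval_antiderivative[of "-\<infinity>" "\<infinity>" std_normal_density] cont by auto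
  have eq: "cdf std_normal_distribution b - cdf std_normal_distribution a = F b - F a" if "a < b" for a b
  proof -
    have "cdf std_normal_distribution b - cdf std_normal_distribution a = measure std_normal_distribution {a<..b}"
      using that by (rule cdf_diff_eq)
    also have "emeasure std_normal_distribution {a<..b} = (\<integral>\<^sup>+y. ennreal (std_normal_density y) * indicator {a..b} y \<partial>lborel)"
      by (subst emeasure_density) (auto intro!: nn_integral_cong_AE intro: eventually_mono[OF AE_lborel_singleton[of a]] simp: indicator_def)
    then have "measure std_normal_distribution {a<..b} = enn2real (\<integral>\<^sup>+y. ennreal (std_normal_density y) * indicator {a..b} y \<partial>lborel)"
      by (simp add: measure_def)
    also have "(\<integral>\<^sup>+y. ennreal (std_normal_density y) * indicator {a..b} y \<partial>lborel) = ennreal (F b - F a)"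
      using that F by (intro nn_integral_FTC_Icc) (auto simp: has_real_derivative_iff_has_vector_derivative intro: has_vector_derivative_at_within)
    also have "F a \<le> F b"
      using that F by (intro DERIV_nonneg_imp_nondecreasing[of a b F]) (auto simp: has_real_derivative_iff_has_vector_derivative intro!: exI[of _ "std_normal_density _"])
    then have "enn2real (ennreal (F b - F a)) = F b - F a" by simp
    finally show ?thesis .
  qed
  define K where "K = cdf std_normal_distribution 0 - F 0"
  have "cdf std_normal_distribution y = F y + K" for y
    using eq[of y 0] eq[of 0 y] unfolding K_def by (cases y "0::real" rule: linorder_cases) auto
  then have *: "cdf std_normal_distribution = (\<lambda>y. F y + K)"
    by (rule ext)
  have "DERIV F x :> std_normal_density x"
    using F[of x] by (simp only: has_real_derivative_iff_has_vector_derivative)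
  then have "DERIV (\<lambda>y. F y + K) x :> std_normal_density x"
    using DERIV_add[OF _ DERIV_const] by fastforce
  then show ?thesis
    unfolding * .
qed

text \<open>Limits at both ends are used because the intended integrand contains
  \<open>b\<^sup>2 / s\<^sup>2\<close> and is discontinuous at 0, where division by zero yields
  0.\<close>

lemma nn_integral_Ioi_FTC:
  fixes f F :: "real \<Rightarrow> real"
  assumes F: "\<And>x. 0 < x \<Longrightarrow> DERIV F x :> f x"
    and f: "\<And>x. 0 < x \<Longrightarrow> isCont f x" "\<And>x. 0 < x \<Longrightarrow> 0 \<le> f x"
    and A: "(F \<longlongrightarrow> A) (at_right 0)" and B: "(F \<longlongrightarrow> B) at_top"
  shows "(\<integral>\<^sup>+x. ennreal (f x) * indicator {0<..} x \<partial>lborel) = ennreal (B - A)"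
proof -
  have 1: "((F \<circ> real_of_ereal) \<longlongrightarrow> A) (at_right (0::ereal))"
    using A by (simp add: zero_ereal_def ereal_tendsto_simps)
  have 2: "((F \<circ> real_of_ereal) \<longlongrightarrow> B) (at_left \<infinity>)"
    using B by (simp add: ereal_tendsto_simps)
  have int: "set_integrable lborel (einterval 0 \<infinity>) f" "(LBINT x=0..\<infinity>. f x) = B - A"
    by (rule interval_integral_FTC_nonneg[OF _ _ _ _ 1 2]; use F f in simp)+
  have e: "einterval 0 \<infinity> = {0::real<..}"
    by (auto simp: einterval_def)
  have "(\<integral>\<^sup>+x. ennreal (f x) * indicator {0<..} x \<partial>lborel) = (\<integral>\<^sup>+x. ennreal (indicator {0<..} x * f x) \<partial>lborel)"
    by (intro nn_integral_cong) (auto simp: indicator_def)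
  also have "\<dots> = ennreal (LINT x|lborel. indicator {0<..} x * f x)"
    using int(1) f by (intro nn_integral_eq_integral) (auto simp: set_integrable_def e indicator_def)
  also have "(LINT x|lborel. indicator {0<..} x * f x) = B - A"
    using int(2) by (simp add: interval_lebesgue_integral_def set_lebesgue_integral_def e)
  finally show ?thesis .
qed

text \<open>The squares of \<open>s - b / s\<close> and \<open>s + b / s\<close> differ from
  \<open>s\<^sup>2 + b\<^sup>2 / s\<^sup>2\<close> only by the constants -2 b and 2 b, so the normal
  distribution function at these two arguments provides an antiderivative.\<close>

lemma nn_integral_gauss_inverse_gauss:
  fixes a :: real
  shows "(\<integral>\<^sup>+s. ennreal (exp (- (s\<^sup>2 + a\<^sup>2 / s\<^sup>2) / 2)) * indicator {0<..} s \<partial>lborel) = ennreal (sqrt (pi / 2)) * exp_abs a"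
proof (cases "a = 0")
  case True
  have "(\<integral>\<^sup>+s. ennreal (exp (- s\<^sup>2 / 2)) * indicator {0<..} s \<partial>lborel)
      = ennreal (sqrt 2) * (\<integral>\<^sup>+s. ennreal (exp (- s\<^sup>2)) * indicator {0<..} s \<partial>lborel)"
    by (subst nn_integral_real_affine[where c="sqrt 2" and t=0])
       (auto intro!: nn_integral_cong simp: indicator_def power_mult_distrib zero_less_mult_iff)
  also have "(\<integral>\<^sup>+s. ennreal (exp (- s\<^sup>2)) * indicator {0<..} s \<partial>lborel)
      = (\<integral>\<^sup>+s. ennreal (indicator {0..} s *\<^sub>R exp (- s\<^sup>2)) \<partial>lborel)"
    by (rule nn_integral_cong_AE) (use AE_lborel_singleton[of "0::real"] in eventually_elim, auto simp: indicator_def)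
  also have "\<dots> = ennreal (sqrt pi / 2)"
    using gaussian_moment_0 by (intro nn_integral_eq_integral[THEN trans])
      (auto simp: has_bochner_integral_iff)
  also have "ennreal (sqrt 2) * ennreal (sqrt pi / 2) = ennreal (sqrt (pi / 2))"
    by (simp add: ennreal_mult'[symmetric] real_sqrt_divide field_simps flip: power2_eq_square)
  finally show ?thesis using True by (simp add: exp_abs_def)
next
  case False
  \<comment> \<open>Positivity of \<open>b\<close> matters at the left endpoint: only then does
    \<open>s - b / s\<close> tend to minus infinity at 0, which is why \<open>a = 0\<close> is
    treated apart.\<close>
  define b where "b = \<bar>a\<bar>"
  have b: "b > 0" "a\<^sup>2 = b\<^sup>2" using False by (auto simp: b_def)
  interpret real_distribution std_normal_distribution by (rule real_dist_normal_dist)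
  let ?C = "cdf std_normal_distribution"
  \<comment> \<open>The two terms contribute the integrand times
    \<open>(1 + b / s\<^sup>2) / 2\<close> and times \<open>(1 - b / s\<^sup>2) / 2\<close> to the
    derivative, which add up to the integrand.\<close>
  define F where "F = (\<lambda>s. sqrt (2 * pi) / 2 * (exp (- b) * ?C (s - b / s) + exp b * ?C (s + b / s)))"
  have top: "(?C \<longlongrightarrow> 1) at_top" and bot: "(?C \<longlongrightarrow> 0) at_bot"
    using cdf_lim_at_top_prob cdf_lim_at_bot by auto
  have "(\<integral>\<^sup>+s. ennreal (exp (- (s\<^sup>2 + b\<^sup>2 / s\<^sup>2) / 2)) * indicator {0<..} s \<partial>lborel) =
     ennreal (sqrt (2 * pi) / 2 * (exp (- b) * 1 + exp b * 1) - sqrt (2 * pi) / 2 * (exp (- b) * 0 + exp b * 1))"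
  proof (rule nn_integral_Ioi_FTC)
    fix s :: real assume s: "0 < s"
    have e1: "exp (- b) * std_normal_density (s - b / s) * sqrt (2 * pi) = exp (- (s\<^sup>2 + b\<^sup>2 / s\<^sup>2) / 2)"
    proof -
      have "(s - b / s)\<^sup>2 = s\<^sup>2 + b\<^sup>2 / s\<^sup>2 - 2 * b"
        using s by (simp add: power2_eq_square field_simps)
      then show ?thesis
        unfolding std_normal_density_def by (simp add: exp_add[symmetric] diff_divide_distrib add_divide_distrib)
    qed
    have e2: "exp b * std_normal_density (s + b / s) * sqrt (2 * pi) = exp (- (s\<^sup>2 + b\<^sup>2 / s\<^sup>2) / 2)"
    proof -
      have "(s + b / s)\<^sup>2 = s\<^sup>2 + b\<^sup>2 / s\<^sup>2 + 2 * b"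
        using s by (simp add: power2_eq_square field_simps)
      then show ?thesis
        unfolding std_normal_density_def by (simp add: exp_add[symmetric] diff_divide_distrib add_divide_distrib)
    qed
    have "DERIV F s :> sqrt (2 * pi) / 2 * (exp (- b) * (std_normal_density (s - b / s) * (1 + b / s\<^sup>2)) + exp b * (std_normal_density (s + b / s) * (1 - b / s\<^sup>2)))"
      unfolding F_def using s
      by (auto intro!: derivative_eq_intros DERIV_chain2[OF std_normal_cdf_DERIV] simp: power2_eq_square)
    also have "sqrt (2 * pi) / 2 * (exp (- b) * (std_normal_density (s - b / s) * (1 + b / s\<^sup>2)) + exp b * (std_normal_density (s + b / s) * (1 - b / s\<^sup>2)))
      = ((exp (- b) * std_normal_density (s - b / s) * sqrt (2 * pi)) * (1 + b / s\<^sup>2) + (exp b * std_normal_density (s + b / s) * sqrt (2 * pi)) * (1 - b / s\<^sup>2)) / 2"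
      by (simp add: algebra_simps)
    also have "\<dots> = exp (- (s\<^sup>2 + b\<^sup>2 / s\<^sup>2) / 2)"
      unfolding e1 e2 by (simp add: algebra_simps)
    finally show "DERIV F s :> exp (- (s\<^sup>2 + b\<^sup>2 / s\<^sup>2) / 2)" .
    show "isCont (\<lambda>s. exp (- (s\<^sup>2 + b\<^sup>2 / s\<^sup>2) / 2)) s"
      using s by (intro continuous_intros) auto
  next
    have "filterlim (\<lambda>s. s - b / s) at_top at_top" "filterlim (\<lambda>s. s + b / s) at_top at_top"
      by real_asymp+
    then show "(F \<longlongrightarrow> sqrt (2 * pi) / 2 * (exp (- b) * 1 + exp b * 1)) at_top"
      unfolding F_def by (intro tendsto_intros filterlim_compose[OF top])
  next
    have "filterlim (\<lambda>s. s - b / s) at_bot (at_right 0)" "filterlim (\<lambda>s. s + b / s) at_top (at_right 0)"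
      using b by real_asymp+
    then show "(F \<longlongrightarrow> sqrt (2 * pi) / 2 * (exp (- b) * 0 + exp b * 1)) (at_right 0)"
      unfolding F_def by (intro tendsto_intros filterlim_compose[OF top] filterlim_compose[OF bot])
  qed auto
  also have "sqrt (2 * pi) / 2 * (exp (- b) * 1 + exp b * 1) - sqrt (2 * pi) / 2 * (exp (- b) * 0 + exp b * 1) = sqrt (pi / 2) * exp (- b)"
  proof -
    have "sqrt (2 * pi) / 2 = sqrt (pi / 2)"
      by (simp add: real_sqrt_mult real_sqrt_divide field_simps)
    then show ?thesis by (simp add: algebra_simps)
  qed
  finally show ?thesis
    by (simp add: b(2) exp_abs_def ennreal_mult' flip: b_def)
qed

section \<open>Linear substitutions in vectors and matrices\<close>

lemma borel_measurable_vec_nth [measurable (raw)]: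
  fixes f :: "'b \<Rightarrow> 'a::euclidean_space ^ 'm"
  assumes "f \<in> borel_measurable M"
  shows "(\<lambda>x. f x $ i) \<in> borel_measurable M"
proof -
  have "continuous_on UNIV (\<lambda>x::'a ^ 'm. x $ i)"
    by (intro continuous_intros)
  then show ?thesis
    using assms by (rule borel_measurable_continuous_on)
qed

lemma borel_measurable_vec_lambda [measurable (raw)]:
  fixes f :: "'m::finite \<Rightarrow> 'b \<Rightarrow> 'a::euclidean_space"
  assumes [measurable]: "\<And>i. f i \<in> borel_measurable M"
  shows "(\<lambda>x. \<chi> i. f i x) \<in> borel_measurable M"
  by (subst borel_measurable_euclidean_space) (auto simp: Basis_vec_def inner_axis)

lemma borel_measurable_det [measurable (raw)]:
  fixes f :: "'b \<Rightarrow> real ^ 'n ^ 'n"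
  assumes [measurable]: "f \<in> borel_measurable M"
  shows "(\<lambda>x. det (f x)) \<in> borel_measurable M"
  unfolding det_def by measurable

lemma borel_measurable_matrix_vector_mult [measurable (raw)]:
  fixes f :: "'b \<Rightarrow> real ^ 'n ^ 'm"
  assumes [measurable]: "f \<in> borel_measurable M" "g \<in> borel_measurable M"
  shows "(\<lambda>x. f x *v g x) \<in> borel_measurable M"
  unfolding matrix_vector_mult_def by measurable

lemma product_sigma_finite_lborel: "product_sigma_finite (\<lambda>_. lborel :: 'a::euclidean_space measure)"
  by (simp add: product_sigma_finite_def lborel.sigma_finite_measure_axioms)

section \<open>Lebesgue measure on vectors as a product measure\<close>

lemma mem_box_vec:
  fixes l u :: "'a::euclidean_space ^ 'm"
  shows "x \<in> box l u \<longleftrightarrow> (\<forall>i. x $ i \<in> box (l $ i) (u $ i))"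
  by (auto simp: mem_box Basis_vec_def inner_axis)

lemma prod_Basis_vec:
  fixes f :: "'a::euclidean_space ^ 'm \<Rightarrow> 'c::comm_monoid_mult"
  shows "(\<Prod>b\<in>Basis. f b) = (\<Prod>i\<in>UNIV. \<Prod>b\<in>Basis. f (axis i b))"
proof -
  have eq: "(Basis :: ('a ^ 'm) set) = (\<lambda>(i, b). axis i b) ` (UNIV \<times> Basis)"
    by (auto simp: Basis_vec_def)
  have "inj_on (\<lambda>(i::'m, b::'a). axis i b) (UNIV \<times> Basis)"
    by (auto simp: inj_on_def axis_eq_axis)
  then show ?thesis
    unfolding eq by (simp add: prod.reindex prod.cartesian_product case_prod_unfold)
qed

text \<open>Both measures give a box the product of its side lengths, and boxes determine Lebesgue
  measure. The entries may themselves be vectors, so matrices are covered as vectors of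
  rows.\<close>

lemma lborel_vec:
  "(lborel :: ('a::euclidean_space ^ 'm) measure) = distr (PiM UNIV (\<lambda>_. lborel)) borel (\<lambda>x. \<chi> i. x i)"
proof (rule lborel_eqI)
  fix l u :: "'a ^ 'm"
  assume lu: "\<And>b. b \<in> Basis \<Longrightarrow> l \<bullet> b \<le> u \<bullet> b"
  interpret P: product_sigma_finite "\<lambda>_::'m. lborel :: 'a measure"
    by (rule product_sigma_finite_lborel)
  have lu': "l $ i \<bullet> b \<le> u $ i \<bullet> b" if "b \<in> Basis" for i b
    using lu[of "axis i b"] that by (auto simp: inner_axis)
  have [measurable]: "(\<lambda>x. \<chi> i. x i) \<in> PiM UNIV (\<lambda>_. lborel) \<rightarrow>\<^sub>M (borel :: ('a ^ 'm) measure)"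
    by measurable
  have "emeasure (distr (PiM UNIV (\<lambda>_. lborel)) borel (\<lambda>x. \<chi> i. x i)) (box l u)
     = emeasure (PiM UNIV (\<lambda>_. lborel)) ((\<lambda>x. \<chi> i. x i) -` box l u \<inter> space (PiM UNIV (\<lambda>_. lborel)))"
    by (rule emeasure_distr) auto
  also have "(\<lambda>x. \<chi> i. x i) -` box l u \<inter> space (PiM UNIV (\<lambda>_. lborel)) = PiE UNIV (\<lambda>i. box (l $ i) (u $ i))"
    by (auto simp: space_PiM mem_box_vec PiE_UNIV_domain Pi_iff)
  also have "emeasure (PiM UNIV (\<lambda>_. lborel)) \<dots> = (\<Prod>i\<in>UNIV. emeasure lborel (box (l $ i) (u $ i)))"
    by (rule P.emeasure_PiM) auto
  also have "\<dots> = (\<Prod>i\<in>UNIV. ennreal (\<Prod>b\<in>Basis. (u $ i - l $ i) \<bullet> b))"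
    using lu' by (intro prod.cong refl emeasure_lborel_box) auto
  also have "\<dots> = ennreal (\<Prod>i\<in>UNIV. \<Prod>b\<in>Basis. (u $ i - l $ i) \<bullet> b)"
    using lu' by (intro prod_ennreal prod_nonneg) (auto simp: inner_diff_left)
  also have "(\<Prod>i\<in>UNIV. \<Prod>b\<in>Basis. (u $ i - l $ i) \<bullet> b) = (\<Prod>b\<in>Basis. (u - l) \<bullet> b)"
    unfolding prod_Basis_vec by (simp add: inner_axis)
  finally show "emeasure (distr (PiM UNIV (\<lambda>_. lborel)) borel (\<lambda>x. \<chi> i. x i)) (box l u) = ennreal (\<Prod>b\<in>Basis. (u - l) \<bullet> b)" .
qed simp

lemma nn_integral_lborel_vec:
  fixes f :: "'a::euclidean_space ^ 'm \<Rightarrow> ennreal"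
  assumes [measurable]: "f \<in> borel_measurable borel"
  shows "(\<integral>\<^sup>+X. f X \<partial>lborel) = (\<integral>\<^sup>+x. f (\<chi> i. x i) \<partial>(PiM UNIV (\<lambda>_. lborel)))"
  by (subst lborel_vec, subst nn_integral_distr) auto

text \<open>Tonelli with coordinate \<open>k\<close> innermost. The map applied to that coordinate
  may depend on the others, as \<open>h (x(k := y)) = h x\<close> expresses, provided its Jacobian
  is the constant \<open>a\<close>; this covers shears as well as scalings.\<close>

lemma nn_integral_PiM_subst_component:
  fixes F :: "('m \<Rightarrow> 'a::euclidean_space) \<Rightarrow> ennreal" and h :: "('m \<Rightarrow> 'a) \<Rightarrow> 'a \<Rightarrow> 'a"
  assumes "finite S" and k: "k \<in> S"
    and [measurable]: "F \<in> borel_measurable (PiM S (\<lambda>_. lborel))"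
    and hm: "(\<lambda>x. h x (x k)) \<in> borel_measurable (PiM S (\<lambda>_. lborel))"
    and h: "\<And>x y. h (x(k := y)) = h x"
    and a: "\<And>x g. g \<in> borel_measurable borel \<Longrightarrow> (\<integral>\<^sup>+y. g y \<partial>lborel) = a * (\<integral>\<^sup>+y. g (h x y) \<partial>lborel)"
  shows "(\<integral>\<^sup>+x. F x \<partial>(PiM S (\<lambda>_. lborel))) = a * (\<integral>\<^sup>+x. F (x(k := h x (x k))) \<partial>(PiM S (\<lambda>_. lborel)))"
proof -
  interpret P: product_sigma_finite "\<lambda>_::'m. lborel :: 'a measure"
    by (rule product_sigma_finite_lborel)
  let ?P = "PiM S (\<lambda>_::'m. lborel :: 'a measure)"
  let ?Q = "PiM (S - {k}) (\<lambda>_::'m. lborel :: 'a measure)"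
  have U: "insert k (S - {k}) = S" using k by auto
  have split: "(\<integral>\<^sup>+x. G x \<partial>?P) = (\<integral>\<^sup>+x. \<integral>\<^sup>+y. G (x(k := y)) \<partial>lborel \<partial>?Q)" if "G \<in> borel_measurable ?P" for G
    using P.product_nn_integral_insert[of "S - {k}" k G] that \<open>finite S\<close> unfolding U by simp
  have "(\<lambda>x. x(k := h x (x k))) \<in> ?P \<rightarrow>\<^sub>M ?P"
  proof (rule measurable_PiM_single')
    show "(\<lambda>x. (x(k := h x (x k))) i) \<in> ?P \<rightarrow>\<^sub>M lborel" if "i \<in> S" for i
      using hm that by (cases "i = k") auto
    show "(\<lambda>x. x(k := h x (x k))) \<in> space ?P \<rightarrow> (\<Pi>\<^sub>E i\<in>S. space lborel)"
      using k by (auto simp: space_PiM PiE_def extensional_def)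
  qed
  then have upd: "(\<lambda>x. F (x(k := h x (x k)))) \<in> borel_measurable ?P"
    by (rule measurable_compose) fact
  have ins: "(\<lambda>y. x(k := y)) \<in> lborel \<rightarrow>\<^sub>M ?P" if "x \<in> space ?Q" for x
  proof -
    have "(\<lambda>y. x(k := y)) \<in> lborel \<rightarrow>\<^sub>M PiM (insert k (S - {k})) (\<lambda>_::'m. lborel :: 'a measure)"
      using that by (intro measurable_component_update) auto
    then show ?thesis
      unfolding U .
  qed
  have Fm: "(\<lambda>y. F (x(k := y))) \<in> borel_measurable borel" if "x \<in> space ?Q" for x
    using measurable_compose[OF ins[OF that] assms(3)] by simp
  have "(\<integral>\<^sup>+x. F x \<partial>?P) = (\<integral>\<^sup>+x. a * (\<integral>\<^sup>+y. F (x(k := h x y)) \<partial>lborel) \<partial>?Q)"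
    unfolding split[OF assms(3)] by (intro nn_integral_cong a Fm)
  also have "\<dots> = (\<integral>\<^sup>+x. (\<integral>\<^sup>+y. a * F (x(k := h x y)) \<partial>lborel) \<partial>?Q)"
  proof (intro nn_integral_cong nn_integral_cmult[symmetric])
    fix x assume x: "x \<in> space ?Q"
    from measurable_compose[OF ins[OF x] upd] show "(\<lambda>y. F (x(k := h x y))) \<in> borel_measurable lborel"
      by (simp add: h)
  qed
  also have "\<dots> = (\<integral>\<^sup>+x. a * F (x(k := h x (x k))) \<partial>?P)"
  proof -
    have "(\<lambda>x. a * F (x(k := h x (x k)))) \<in> borel_measurable ?P"
      using upd by measurable
    then show ?thesis
      by (subst split) (simp_all add: h)
  qed
  also have "\<dots> = a * (\<integral>\<^sup>+x. F (x(k := h x (x k))) \<partial>?P)"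
    by (rule nn_integral_cmult[OF upd])
  finally show ?thesis .
qed

lemma nn_integral_PiM_subst_components:
  fixes F :: "('m \<Rightarrow> 'a::euclidean_space) \<Rightarrow> ennreal" and f :: "'m \<Rightarrow> 'a \<Rightarrow> 'a"
  assumes "finite S"
    and [measurable]: "F \<in> borel_measurable (PiM S (\<lambda>_. lborel))"
    and [measurable]: "\<And>i. f i \<in> borel_measurable borel"
    and a: "\<And>i g. g \<in> borel_measurable borel \<Longrightarrow> (\<integral>\<^sup>+y. g y \<partial>lborel) = a i * (\<integral>\<^sup>+y. g (f i y) \<partial>lborel)"
  shows "(\<integral>\<^sup>+x. F x \<partial>(PiM S (\<lambda>_. lborel))) = (\<Prod>i\<in>S. a i) * (\<integral>\<^sup>+x. F (\<lambda>i. if i \<in> S then f i (x i) else x i) \<partial>(PiM S (\<lambda>_. lborel)))"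
proof -
  let ?P = "PiM S (\<lambda>_::'m. lborel :: 'a measure)"
  have "(\<integral>\<^sup>+x. F x \<partial>?P) = (\<Prod>i\<in>T. a i) * (\<integral>\<^sup>+x. F (\<lambda>i. if i \<in> T then f i (x i) else x i) \<partial>?P)"
    if "T \<subseteq> S" for T
    using finite_subset[OF that \<open>finite S\<close>] that
  proof (induction T rule: finite_induct)
    case (insert k T)
    have "(\<lambda>x i. if i \<in> T then f i (x i) else x i) \<in> ?P \<rightarrow>\<^sub>M ?P"
      using insert by (intro measurable_PiM_single') (auto simp: space_PiM PiE_def extensional_def)
    then have m: "(\<lambda>x. F (\<lambda>i. if i \<in> T then f i (x i) else x i)) \<in> borel_measurable ?P"
      by (rule measurable_compose) fact
    have "(\<integral>\<^sup>+x. F (\<lambda>i. if i \<in> T then f i (x i) else x i) \<partial>?P)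
      = a k * (\<integral>\<^sup>+x. F (\<lambda>i. if i \<in> T then f i ((x(k := f k (x k))) i) else (x(k := f k (x k))) i) \<partial>?P)"
      by (rule nn_integral_PiM_subst_component[where h = "\<lambda>_. f k"]) (use insert m a \<open>finite S\<close> in auto)
    also have "(\<lambda>x. F (\<lambda>i. if i \<in> T then f i ((x(k := f k (x k))) i) else (x(k := f k (x k))) i))
      = (\<lambda>x. F (\<lambda>i. if i \<in> insert k T then f i (x i) else x i))"
      using insert by (intro ext arg_cong[where f=F]) auto
    finally show ?case
      using insert by (simp add: mult.assoc mult.left_commute)
  qed simp
  from this[of S] show ?thesis by simp
qed

text \<open>The rows are substituted one at a time and the Jacobians multiply. It serves for one
  linear map acting on all rows and for scalings that differ from row to row.\<close>

lemma nn_integral_lborel_vec_subst_rows: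
  fixes F :: "'a::euclidean_space ^ 'm \<Rightarrow> ennreal" and f :: "'m \<Rightarrow> 'a \<Rightarrow> 'a"
  assumes [measurable]: "F \<in> borel_measurable borel"
    and [measurable]: "\<And>i. f i \<in> borel_measurable borel"
    and a: "\<And>i g. g \<in> borel_measurable borel \<Longrightarrow> (\<integral>\<^sup>+y. g y \<partial>lborel) = a i * (\<integral>\<^sup>+y. g (f i y) \<partial>lborel)"
  shows "(\<integral>\<^sup>+X. F X \<partial>lborel) = (\<Prod>i\<in>UNIV. a i) * (\<integral>\<^sup>+X. F (\<chi> i. f i (X $ i)) \<partial>lborel)"
  using nn_integral_PiM_subst_components[where S=UNIV and F="\<lambda>x. F (\<chi> i. x i)", OF finite _ assms(2) a]
  by (simp add: nn_integral_lborel_vec)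

section \<open>Change of variables for invertible matrices\<close>

definition lborel_jacobian :: "real ^ 'n ^ 'n \<Rightarrow> bool" where
  "lborel_jacobian A \<longleftrightarrow> (\<forall>F\<in>borel_measurable borel. (\<integral>\<^sup>+x. F x \<partial>lborel) = ennreal \<bar>det A\<bar> * (\<integral>\<^sup>+x. F (A *v x) \<partial>lborel))"

lemma lborel_jacobian_mult:
  fixes A B :: "real ^ 'n ^ 'n"
  assumes "lborel_jacobian A" "lborel_jacobian B"
  shows "lborel_jacobian (A ** B)"
  unfolding lborel_jacobian_def
proof
  fix F :: "real ^ 'n \<Rightarrow> ennreal"
  assume [measurable]: "F \<in> borel_measurable borel"
  have "(\<integral>\<^sup>+x. F x \<partial>lborel) = ennreal \<bar>det A\<bar> * (\<integral>\<^sup>+x. F (A *v x) \<partial>lborel)"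
    using assms(1) unfolding lborel_jacobian_def by (rule bspec) measurable
  also have "(\<integral>\<^sup>+x. F (A *v x) \<partial>lborel) = ennreal \<bar>det B\<bar> * (\<integral>\<^sup>+x. F (A *v (B *v x)) \<partial>lborel)"
    using assms(2) unfolding lborel_jacobian_def by (rule bspec) measurable
  finally show "(\<integral>\<^sup>+x. F x \<partial>lborel) = ennreal \<bar>det (A ** B)\<bar> * (\<integral>\<^sup>+x. F ((A ** B) *v x) \<partial>lborel)"
    by (simp add: det_mul abs_mult ennreal_mult' matrix_vector_mul_assoc mult.assoc)
qed

text \<open>Acting on a column vector it changes coordinate \<open>k\<close> alone, so its change of
  variables is one-dimensional. Pivoting and column additions are both of this form.\<close>

definition row_matrix :: "'n \<Rightarrow> real ^ 'n \<Rightarrow> real ^ 'n ^ 'n" where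
  "row_matrix k v = (\<chi> i. if i = k then v else axis i 1)"

lemma axis_inner_left: "axis i (1::real) \<bullet> x = x $ i"
  by (simp add: inner_axis')

lemma row_matrix_vector_mult: "row_matrix k v *v x = (\<chi> i. if i = k then v \<bullet> x else x $ i)"
  by (auto simp: row_matrix_def vec_eq_iff matrix_mult_dot axis_inner_left)

lemma row_mat_1:
  fixes i :: "'n::finite"
  shows "row i (mat 1 :: real ^ 'n ^ 'n) = (axis i 1 :: real ^ 'n)"
  by (auto simp: row_def mat_def axis_def vec_eq_iff)

lemma det_row_matrix:
  fixes v :: "real ^ 'n"
  shows "det (row_matrix k v) = v $ k"
proof -
  have "(\<Sum>i\<in>UNIV. v $ i *s row i (mat 1)) = v"
    unfolding row_mat_1 by (rule basis_expansion)
  then have "row_matrix k v = (\<chi> i. if i = k then (\<Sum>i\<in>UNIV. v $ i *s row i (mat 1)) else row i (mat 1))"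
    by (simp add: row_matrix_def row_mat_1 vec_eq_iff)
  then show ?thesis
    using cramer_lemma_transpose[of k v "mat 1"] by simp
qed

text \<open>With the other coordinates fixed, coordinate \<open>k\<close> undergoes an affine map of
  slope \<open>v $ k\<close>, which is also the determinant.\<close>

lemma lborel_jacobian_row_matrix:
  fixes v :: "real ^ 'n"
  assumes "v $ k \<noteq> 0"
  shows "lborel_jacobian (row_matrix k v)"
  unfolding lborel_jacobian_def
proof
  fix F :: "real ^ 'n \<Rightarrow> ennreal"
  assume [measurable]: "F \<in> borel_measurable borel"
  let ?P = "PiM UNIV (\<lambda>_::'n. lborel :: real measure)"
  define h where "h = (\<lambda>(x::'n \<Rightarrow> real) y. (\<Sum>j\<in>UNIV - {k}. v $ j * x j) + v $ k * y)"
  have hk: "h x (x k) = v \<bullet> (\<chi> i. x i)" for x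
    by (simp add: h_def inner_vec_def sum.remove[where x=k] add.commute)
  have "(\<integral>\<^sup>+x. F x \<partial>lborel) = (\<integral>\<^sup>+x. F (\<chi> i. x i) \<partial>?P)"
    by (rule nn_integral_lborel_vec) measurable
  also have "\<dots> = ennreal \<bar>v $ k\<bar> * (\<integral>\<^sup>+x. F (\<chi> i. (x(k := h x (x k))) i) \<partial>?P)"
  proof (rule nn_integral_PiM_subst_component[OF finite UNIV_I])
    show "(\<lambda>x. h x (x k)) \<in> borel_measurable ?P"
      unfolding h_def by measurable
    show "h (x(k := y)) = h x" for x y
      unfolding h_def by (intro ext arg_cong2[where f="(+)"] sum.cong) auto
    show "(\<integral>\<^sup>+y. g y \<partial>lborel) = ennreal \<bar>v $ k\<bar> * (\<integral>\<^sup>+y. g (h x y) \<partial>lborel)"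
      if [measurable]: "g \<in> borel_measurable borel" for x g
      unfolding h_def using assms by (intro nn_integral_real_affine) auto
  qed measurable
  also have "(\<integral>\<^sup>+x. F (\<chi> i. (x(k := h x (x k))) i) \<partial>?P) = (\<integral>\<^sup>+x. F (row_matrix k v *v (\<chi> i. x i)) \<partial>?P)"
    unfolding row_matrix_vector_mult hk
    by (intro nn_integral_cong arg_cong[where f=F]) (auto simp: vec_eq_iff)
  also have "\<dots> = (\<integral>\<^sup>+x. F (row_matrix k v *v x) \<partial>lborel)"
    by (rule nn_integral_lborel_vec[symmetric]) measurable
  finally show "(\<integral>\<^sup>+x. F x \<partial>lborel) = ennreal \<bar>det (row_matrix k v)\<bar> * (\<integral>\<^sup>+x. F (row_matrix k v *v x) \<partial>lborel)"
    by (simp add: det_row_matrix)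
qed

lemma row_matrix_mult: "row i (A ** B) = row i A v* B"
  by (simp add: row_def matrix_matrix_mult_def vector_matrix_mult_def vec_eq_iff)

lemma vector_mult_row_matrix:
  "x v* row_matrix k v = (x $ k) *\<^sub>R v + x - (x $ k) *\<^sub>R axis k 1"
proof -
  have "(x v* row_matrix k v) $ j = (x $ k) * v $ j + (if j = k then 0 else x $ j)" for j
  proof -
    have "(x v* row_matrix k v) $ j = (\<Sum>i\<in>UNIV. x $ i * (if i = k then v $ j else axis i 1 $ j))"
      by (simp add: vector_matrix_mult_def row_matrix_def)
        (intro sum.cong refl, auto)
    also have "\<dots> = x $ k * v $ j + (\<Sum>i\<in>UNIV - {k}. x $ i * axis i 1 $ j)"
      by (subst sum.remove[where x=k]) auto
    also have "(\<Sum>i\<in>UNIV - {k}. x $ i * axis i 1 $ j) = (\<Sum>i\<in>UNIV - {k}. if i = j then x $ i else 0)"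
      by (intro sum.cong) (auto simp: axis_def)
    also have "\<dots> = (if j = k then 0 else x $ j)"
      by (simp add: sum.delta)
    finally show ?thesis by simp
  qed
  then show ?thesis
    by (auto simp: vec_eq_iff axis_def)
qed

text \<open>Elimination, by induction on the set \<open>U\<close> of rows that may still differ from
  unit vectors. If row \<open>k\<close> has a nonzero pivot, dividing on the right by
  \<open>row_matrix k (row k A)\<close> makes it a unit vector and leaves the existing unit rows
  alone.\<close>

theorem lborel_jacobian_invertible:
  fixes A :: "real ^ 'n ^ 'n"
  assumes "det A \<noteq> 0"
  shows "lborel_jacobian A"
proof -
  have "\<forall>A::real^'n^'n. det A \<noteq> 0 \<and> (\<forall>j\<in>- U. row j A = axis j 1) \<longrightarrow> lborel_jacobian A" for U :: "'n set"
    using finite[of U]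
  proof (induction U rule: finite_induct)
    case empty
    show ?case
    proof safe
      fix A :: "real ^ 'n ^ 'n" assume "\<forall>j\<in>-{}. row j A = axis j 1"
      then have "A = mat 1"
        by (auto simp: row_def mat_def vec_eq_iff axis_def)
      then show "lborel_jacobian A"
        by (simp add: lborel_jacobian_def)
    qed
  next
    case (insert k U)
    have step: "lborel_jacobian A" if A: "det A \<noteq> 0" "\<forall>j\<in>-insert k U. row j A = axis j 1" "row k A $ k \<noteq> 0"
      for A :: "real ^ 'n ^ 'n"
    proof -
      define R where "R = row_matrix k (row k A)"
      have dR: "det R \<noteq> 0" using A by (simp add: R_def det_row_matrix)
      then obtain R' where R': "R ** R' = mat 1" "R' ** R = mat 1"
        unfolding invertible_det_nz[symmetric] invertible_def by auto
      define A' where "A' = A ** R'"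
      have AA: "A = A' ** R"
        by (simp add: A'_def matrix_mul_assoc[symmetric] R')
      have T: "(x v* R) v* R' = x" for x
        by (simp add: vector_matrix_mul_assoc R')
      have "row j A' = axis j 1" if "j \<in> - U" for j
      proof -
        have "row j A = axis j 1 v* R"
          using that A(2) by (cases "j = k") (auto simp: R_def vector_mult_row_matrix axis_def vec_eq_iff)
        then show ?thesis
          by (simp add: A'_def row_matrix_mult T)
      qed
      moreover have "det A' \<noteq> 0"
        using A(1) AA by (metis det_mul mult_eq_0_iff)
      ultimately have "lborel_jacobian A'" using insert.IH by blast
      moreover have "lborel_jacobian R"
        unfolding R_def using A(3) by (rule lborel_jacobian_row_matrix)
      ultimately show ?thesis
        unfolding AA by (rule lborel_jacobian_mult)
    qed
    show ?case
    proof safe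
      fix A :: "real ^ 'n ^ 'n" assume A: "det A \<noteq> 0" "\<forall>j\<in>-insert k U. row j A = axis j 1"
      show "lborel_jacobian A"
      proof (cases "row k A $ k = 0")
        case False
        then show ?thesis using step A by blast
      next
        case True
        \<comment> \<open>A zero pivot is repaired by a column addition, which needs a nonzero entry
          of row \<open>k\<close> in a column from \<open>U\<close>. Without one, row
          \<open>k\<close> would be a combination of unit rows outside \<open>insert k U\<close>;
          \<open>u\<close> holds the coefficients of that relation and contradicts
          invertibility.\<close>
        have "\<exists>i. i \<in> U \<and> row k A $ i \<noteq> 0"
        proof (rule ccontr)
          assume H: "\<not> ?thesis"
          define u where "u = axis k 1 - (\<chi> i. if i \<in> U then 0 else row k A $ i)"
          have "transpose A *v u = 0"
          proof -
            have "transpose A *v u = transpose A *v axis k 1 - transpose A *v (\<chi> i. if i \<in> U then 0 else row k A $ i)"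
              by (simp add: u_def matrix_vector_mult_diff_distrib)
            also have "transpose A *v axis k 1 = row k A"
              by (simp add: matrix_vector_mul_component vec_eq_iff matrix_mult_dot inner_axis transpose_def row_def)
            also have "transpose A *v (\<chi> i. if i \<in> U then 0 else row k A $ i) = row k A"
            proof -
              have "(transpose A *v (\<chi> i. if i \<in> U then 0 else row k A $ i)) $ j = row k A $ j" for j
              proof -
                have "(transpose A *v (\<chi> i. if i \<in> U then 0 else row k A $ i)) $ j
                   = (\<Sum>i\<in>UNIV. A $ i $ j * (if i \<in> U then 0 else row k A $ i))"
                  by (simp add: matrix_vector_mult_def transpose_def)
                also have "\<dots> = (\<Sum>i\<in>UNIV. if i = j then row k A $ j else 0)"
                proof (intro sum.cong refl)
                  fix i
                  show "A $ i $ j * (if i \<in> U then 0 else row k A $ i) = (if i = j then row k A $ j else 0)"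
                  proof (cases "i \<in> U \<or> i = k")
                    case True
                    then show ?thesis using H \<open>row k A $ k = 0\<close> by auto
                  next
                    case False
                    then have "row i A = axis i 1" using A by auto
                    then have "row i A $ j = axis i 1 $ j" by simp
                    then have "A $ i $ j = (if i = j then 1 else 0)"
                      by (auto simp: row_def axis_def)
                    then show ?thesis using False by auto
                  qed
                qed
                also have "\<dots> = row k A $ j" by simp
                finally show ?thesis .
              qed
              then show ?thesis by (simp add: vec_eq_iff)
            qed
            finally show ?thesis by simp
          qed
          moreover have "invertible (transpose A)"
            using A(1) by (simp add: invertible_det_nz)
          ultimately have "u = 0"
            using inj_matrix_vector_mult[of "transpose A"] by (auto dest!: injD[of _ u 0])
          then have "u $ k = 0" by simp
          then show False using insert.hyps True by (simp add: u_def)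
        qed
        then obtain i where i: "i \<in> U" "row k A $ i \<noteq> 0" by blast
        then have ik: "i \<noteq> k" using insert by auto
        \<comment> \<open>Multiplication by \<open>R\<close> from the right adds column
          \<open>i\<close> to column \<open>k\<close>, and \<open>R'\<close> undoes this.\<close>
        define R where "R = row_matrix i (axis i 1 + axis k 1 :: real ^ 'n)"
        define R' where "R' = row_matrix i (axis i 1 - axis k 1 :: real ^ 'n)"
        have [simp]: "det R = 1" "det R' = 1" using ik by (auto simp: R_def R'_def det_row_matrix axis_def)
        have RR: "R ** R' = mat 1"
        proof -
          have "(R ** R') *v x = mat 1 *v x" for x
            using ik by (auto simp flip: matrix_vector_mul_assoc simp: R_def R'_def row_matrix_vector_mult vec_eq_iff
              inner_diff_left inner_add_left axis_inner_left)
          then show ?thesis using matrix_eq by blast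
        qed
        have "lborel_jacobian (A ** R)"
        proof (rule step)
          show "det (A ** R) \<noteq> 0" using A by (simp add: det_mul)
          show "\<forall>j\<in>- insert k U. row j (A ** R) = axis j 1"
            using A i by (auto simp: row_matrix_mult R_def vector_mult_row_matrix axis_def vec_eq_iff)
          show "row k (A ** R) $ k \<noteq> 0"
            using i ik True by (simp add: row_matrix_mult R_def vector_mult_row_matrix axis_def)
        qed
        moreover have "lborel_jacobian R'"
          unfolding R'_def using ik by (intro lborel_jacobian_row_matrix) (simp add: axis_def)
        ultimately have "lborel_jacobian ((A ** R) ** R')"
          by (rule lborel_jacobian_mult)
        then show ?thesis by (simp add: matrix_mul_assoc[symmetric] RR)
      qed
    qed
  qed
  from this[of UNIV] show ?thesis using assms by simp
qed

lemma nn_integral_lborel_linear: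
  fixes A :: "real ^ 'n ^ 'n"
  assumes "det A \<noteq> 0" "F \<in> borel_measurable borel"
  shows "(\<integral>\<^sup>+x. F x \<partial>lborel) = ennreal \<bar>det A\<bar> * (\<integral>\<^sup>+x. F (A *v x) \<partial>lborel)"
  using lborel_jacobian_invertible[OF assms(1)] assms(2) unfolding lborel_jacobian_def by blast

lemma nn_integral_lborel_matrix_rows:
  fixes A :: "real ^ 'n ^ 'n" and F :: "real ^ 'n ^ 'm \<Rightarrow> ennreal"
  assumes "det A \<noteq> 0" and [measurable]: "F \<in> borel_measurable borel"
  shows "(\<integral>\<^sup>+X. F X \<partial>lborel) = ennreal \<bar>det A\<bar> ^ CARD('m) * (\<integral>\<^sup>+X. F (\<chi> i. A *v (X $ i)) \<partial>lborel)"
proof -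
  have "(\<lambda>x. A *v x) \<in> borel_measurable borel" by measurable
  then show ?thesis
    using nn_integral_lborel_vec_subst_rows[where f = "\<lambda>_ x. A *v x" and a = "\<lambda>_. ennreal \<bar>det A\<bar>",
        OF assms(2) _ nn_integral_lborel_linear[OF assms(1)]]
    by (simp only: prod_constant)
qed

text \<open>Transposition only permutes coordinates. It mediates between substitutions, which act on
  rows, and the determinant integral, which is taken apart by columns.\<close>

lemma nn_integral_lborel_transpose:
  fixes F :: "real ^ 'n ^ 'm \<Rightarrow> ennreal"
  assumes [measurable]: "F \<in> borel_measurable borel"
  shows "(\<integral>\<^sup>+X. F X \<partial>lborel) = (\<integral>\<^sup>+X. F (transpose X) \<partial>lborel)"
proof -
  have [measurable]: "(transpose :: real ^ 'm ^ 'n \<Rightarrow> _) \<in> borel_measurable borel"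
    unfolding transpose_def by measurable
  have "(lborel :: (real ^ 'n ^ 'm) measure) = distr lborel borel transpose"
  proof (rule lborel_eqI)
    fix l u :: "real ^ 'n ^ 'm"
    assume lu: "\<And>b. b \<in> Basis \<Longrightarrow> l \<bullet> b \<le> u \<bullet> b"
    have lu': "l $ i $ j \<le> u $ i $ j" for i j
      using lu[of "axis i (axis j 1)"] by (simp add: inner_axis)
    have "emeasure (distr lborel borel transpose) (box l u) = emeasure lborel (transpose -` box l u \<inter> space (lborel :: (real ^ 'm ^ 'n) measure))"
      by (rule emeasure_distr) auto
    also have "transpose -` box l u \<inter> space (lborel :: (real ^ 'm ^ 'n) measure) = box (transpose l) (transpose u)"
      by (auto simp: mem_box_vec transpose_def)
    also have "emeasure lborel (box (transpose l) (transpose u)) = ennreal (\<Prod>b\<in>Basis. (transpose u - transpose l) \<bullet> b)"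
      using lu' by (intro emeasure_lborel_box) (auto simp: Basis_vec_def inner_axis transpose_def)
    also have "(\<Prod>b\<in>Basis. (transpose u - transpose l) \<bullet> b) = (\<Prod>i\<in>UNIV. \<Prod>j\<in>UNIV. u $ j $ i - l $ j $ i)"
      by (simp add: prod_Basis_vec inner_axis transpose_def)
    also have "\<dots> = (\<Prod>b\<in>Basis. (u - l) \<bullet> b)"
      by (subst prod.swap) (simp add: prod_Basis_vec inner_axis)
    finally show "emeasure (distr lborel borel transpose) (box l u) = ennreal (\<Prod>b\<in>Basis. (u - l) \<bullet> b)" .
  qed simp
  then have "(\<integral>\<^sup>+X. F X \<partial>lborel) = (\<integral>\<^sup>+X. F X \<partial>distr (lborel :: (real ^ 'm ^ 'n) measure) borel transpose)"
    by (rule arg_cong)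
  then show ?thesis
    by (simp add: nn_integral_distr)
qed

lemma det_rows_linear: "det (\<chi> i. A *v (X $ i)) = det A * det (X :: real ^ 'n ^ 'n)"
proof -
  have "(\<chi> i. A *v (X $ i)) = X ** transpose A"
    by (simp add: vec_eq_iff matrix_vector_mult_def matrix_matrix_mult_def transpose_def mult.commute)
  then show ?thesis by (simp add: det_mul)
qed

section \<open>The Gaussian facet integral\<close>

lemma nn_integral_lborel_scale:
  fixes g :: "'a::euclidean_space \<Rightarrow> ennreal"
  assumes "c \<noteq> 0" and [measurable]: "g \<in> borel_measurable borel"
  shows "(\<integral>\<^sup>+x. g x \<partial>lborel) = ennreal (\<bar>c\<bar> ^ DIM('a)) * (\<integral>\<^sup>+x. g (c *\<^sub>R x) \<partial>lborel)"
proof -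
  have "(\<integral>\<^sup>+x. g x \<partial>lborel) = (\<integral>\<^sup>+x. g x \<partial>density (distr lborel borel (\<lambda>x. 0 + c *\<^sub>R x)) (\<lambda>_. \<bar>c\<bar> ^ DIM('a)))"
    using lborel_affine[OF assms(1), of "0::'a"] by simp
  then show ?thesis
    by (simp add: nn_integral_density nn_integral_distr nn_integral_cmult)
qed

text \<open>The constants of the radial integrals. They are positive and finite, so they can be
  divided out.\<close>

definition gauss_moment :: "nat \<Rightarrow> ennreal" where
  "gauss_moment m = (\<integral>\<^sup>+\<rho>. ennreal (\<rho> ^ m * exp (- (\<rho>\<^sup>2) / 2)) * indicator {0<..} \<rho> \<partial>lborel)"

lemma gauss_moment_finite: "gauss_moment m < \<infinity>"
proof -
  have "integrable std_normal_distribution (\<lambda>x. x ^ m)"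
    by (rule integrable_std_normal_distribution_moment)
  then have "integrable lborel (\<lambda>x. std_normal_density x * x ^ m)"
    by (simp add: integrable_density)
  then have "(\<integral>\<^sup>+x. norm (std_normal_density x * x ^ m) \<partial>lborel) < \<infinity>"
    by (simp add: integrable_iff_bounded)
  then have fin: "ennreal (sqrt (2 * pi)) * (\<integral>\<^sup>+x. norm (std_normal_density x * x ^ m) \<partial>lborel) < \<infinity>"
    by (simp add: ennreal_mult_less_top)
  have "gauss_moment m \<le> (\<integral>\<^sup>+x. ennreal (sqrt (2 * pi)) * norm (std_normal_density x * x ^ m) \<partial>lborel)"
    unfolding gauss_moment_def
  proof (rule nn_integral_mono)
    fix x :: real
    have "x ^ m * exp (- (x\<^sup>2) / 2) \<le> sqrt (2 * pi) * \<bar>std_normal_density x * x ^ m\<bar>"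
      by (simp add: std_normal_density_def abs_mult)
    then show "ennreal (x ^ m * exp (- (x\<^sup>2) / 2)) * indicator {0<..} x
        \<le> ennreal (sqrt (2 * pi)) * ennreal (norm (std_normal_density x * x ^ m))"
      by (auto simp: indicator_def ennreal_mult'[symmetric] intro!: ennreal_leI)
  qed
  also have "\<dots> = ennreal (sqrt (2 * pi)) * (\<integral>\<^sup>+x. norm (std_normal_density x * x ^ m) \<partial>lborel)"
    by (rule nn_integral_cmult) measurable
  also note fin
  finally show ?thesis .
qed

lemma gauss_moment_pos: "gauss_moment m > 0"
proof -
  have "\<not> (AE \<rho>::real in lborel. ennreal (\<rho> ^ m * exp (- (\<rho>\<^sup>2) / 2)) * indicator {0<..} \<rho> = 0)"
  proof
    assume "AE \<rho>::real in lborel. ennreal (\<rho> ^ m * exp (- (\<rho>\<^sup>2) / 2)) * indicator {0<..} \<rho> = 0"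
    then have "AE \<rho>::real in lborel. \<rho> \<notin> {0<..<1}"
      by eventually_elim (auto simp: indicator_def zero_less_mult_iff not_le dest!: leD)
    then have "emeasure lborel {0<..<1::real} = 0"
      by (subst (asm) AE_iff_measurable[where N="{0<..<1::real}"]) auto
    then show False by simp
  qed
  then show ?thesis
    unfolding gauss_moment_def zero_less_iff_neq_zero by (subst nn_integral_0_iff_AE) auto
qed

lemma nn_integral_gauss_moment_scaled:
  assumes "a > 0"
  shows "(\<integral>\<^sup>+\<rho>. ennreal (\<rho> ^ m * exp (- (\<rho>\<^sup>2 * a\<^sup>2) / 2)) * indicator {0<..} \<rho> \<partial>lborel) = ennreal (1 / a ^ Suc m) * gauss_moment m"
proof -
  have "(\<integral>\<^sup>+\<rho>. ennreal (\<rho> ^ m * exp (- (\<rho>\<^sup>2 * a\<^sup>2) / 2)) * indicator {0<..} \<rho> \<partial>lborel)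
    = ennreal (1 / a) * (\<integral>\<^sup>+\<rho>. ennreal (1 / a ^ m) * (ennreal (\<rho> ^ m * exp (- (\<rho>\<^sup>2) / 2)) * indicator {0<..} \<rho>) \<partial>lborel)"
    using assms
    by (subst nn_integral_real_affine[where c="1/a" and t=0])
       (auto intro!: arg_cong2[where f="(*)", OF refl] nn_integral_cong simp: indicator_def power_divide zero_less_divide_iff ennreal_mult'[symmetric])
  also have "\<dots> = ennreal (1 / a) * (ennreal (1 / a ^ m) * gauss_moment m)"
    unfolding gauss_moment_def by (subst nn_integral_cmult) auto
  also have "\<dots> = ennreal (1 / a * (1 / a ^ m)) * gauss_moment m"
    using assms by (simp only: ennreal_mult' mult.assoc zero_le_divide_1_iff less_imp_le)
  finally show ?thesis by simp
qed

text \<open>Cramer's rule: the coordinates of \<open>c\<close> in the rows of \<open>X\<close>, and the solution \<open>w\<close> of \<open>X *v w = b\<close>;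
  both are \<open>0\<close> for singular \<open>X\<close>.\<close>

definition coef :: "real ^ 'n ^ 'n \<Rightarrow> real ^ 'n \<Rightarrow> 'n \<Rightarrow> real" where
  "coef X c i = det (\<chi> j. if j = i then c else X $ j) / det X"

definition dual_vec :: "real ^ 'n ^ 'n \<Rightarrow> real ^ 'n \<Rightarrow> real ^ 'n" where
  "dual_vec X b = (\<chi> k. det (\<chi> i j. if j = k then b $ i else X $ i $ j) / det X)"

lemma coef_eq:
  assumes "det X \<noteq> 0"
  shows "coef X (l v* X) i = l $ i"
proof -
  have 1: "l v* X = (\<Sum>i\<in>UNIV. l $ i *s row i X)"
    by (simp add: vec_eq_iff vector_matrix_mult_def row_def)
  have "det (\<chi> j. if j = i then l v* X else X $ j) = l $ i * det X"
    using cramer_lemma_transpose[of i l X] unfolding 1 by (simp add: row_def cong: if_cong)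
  then show ?thesis using assms by (simp add: coef_def)
qed

lemma dual_vec_iff: "det X \<noteq> 0 \<Longrightarrow> X *v w = b \<longleftrightarrow> w = dual_vec X b"
  unfolding dual_vec_def by (rule cramer)

lemma dual_vec_eq: "det X \<noteq> 0 \<Longrightarrow> dual_vec X (X *v w) = w"
  using dual_vec_iff[of X w "X *v w"] by simp

lemma coef_surj:
  fixes X :: "real ^ 'n ^ 'n"
  assumes "det X \<noteq> 0"
  obtains l where "c = l v* X"
proof -
  have "det (transpose X) \<noteq> 0" using assms by (simp only: det_transpose not_False_eq_True)
  then have "invertible (transpose X)" by (simp only: invertible_det_nz not_False_eq_True)
  then obtain Y where "transpose X ** Y = mat 1" unfolding invertible_def by blast
  then have "c = transpose X *v (Y *v c)"
    by (simp only: matrix_vector_mul_assoc matrix_vector_mul_lid)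
  then show ?thesis using that by simp
qed

lemma coef_measurable [measurable (raw)]:
  assumes [measurable]: "f \<in> borel_measurable M" "g \<in> borel_measurable M"
  shows "(\<lambda>x. coef (f x) (g x) i) \<in> borel_measurable M"
  unfolding coef_def by measurable

lemma dual_vec_measurable [measurable (raw)]:
  assumes [measurable]: "f \<in> borel_measurable M" "g \<in> borel_measurable M"
  shows "(\<lambda>x. dual_vec (f x) (g x)) \<in> borel_measurable M"
  unfolding dual_vec_def by measurable

text \<open>Written as a product of indicators so that it passes through substitutions as a factor.
  The determinant factor removes singular matrices, for which \<open>coef\<close> is 0 by division
  by zero.\<close>

definition pos_ind :: "'n::finite set \<Rightarrow> real ^ 'n ^ 'n \<Rightarrow> real ^ 'n \<Rightarrow> ennreal" where
  "pos_ind I X c = indicator (- {0}) (det X) * (\<Prod>i\<in>I. indicator {0<..} (coef X c i))"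

lemma pos_ind_measurable [measurable (raw)]:
  fixes f :: "'b \<Rightarrow> real ^ 'n ^ 'n"
  assumes [measurable]: "f \<in> borel_measurable M" "g \<in> borel_measurable M"
  shows "(\<lambda>x. pos_ind I (f x) (g x)) \<in> borel_measurable M"
  unfolding pos_ind_def by measurable

lemma borel_measurable_vector_matrix_mult [measurable (raw)]:
  fixes f :: "'b \<Rightarrow> real ^ 'n ^ 'm"
  assumes [measurable]: "f \<in> borel_measurable M" "g \<in> borel_measurable M"
  shows "(\<lambda>x. g x v* f x) \<in> borel_measurable M"
  unfolding vector_matrix_mult_def by measurable

text \<open>Scaling row \<open>i\<close> by a positive number divides the \<open>i\<close>-th
  coordinate of \<open>c\<close> by it and so keeps the sign.\<close>

lemma pos_ind_scale_rows:
  assumes "\<And>i. r $ i > 0"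
  shows "pos_ind I (\<chi> i. r $ i *\<^sub>R X $ i) c = pos_ind I X c"
proof -
  have D: "det (\<chi> i. r $ i *\<^sub>R X $ i) = (\<Prod>i\<in>UNIV. r $ i) * det X"
    using det_rows_mul[of "\<lambda>i. r $ i" "\<lambda>i. X $ i"] by (simp add: scalar_mult_eq_scaleR)
  have p: "(\<Prod>i\<in>UNIV. r $ i) \<noteq> 0" using assms by (auto simp: less_le)
  show ?thesis
  proof (cases "det X = 0")
    case False
    obtain l where l: "c = l v* X" using coef_surj[OF False] .
    define m where "m = (\<chi> i. l $ i / r $ i)"
    have "c = m v* (\<chi> i. r $ i *\<^sub>R X $ i)"
      using assms by (auto simp: l m_def vec_eq_iff vector_matrix_mult_def less_le intro!: sum.cong)
    moreover have "det (\<chi> i. r $ i *\<^sub>R X $ i) \<noteq> 0" using D p False by simp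
    ultimately have "coef (\<chi> i. r $ i *\<^sub>R X $ i) c i = coef X c i / r $ i" for i
      using coef_eq[of "\<chi> i. r $ i *\<^sub>R X $ i" m i] coef_eq[OF False, of l i] l by (simp add: m_def)
    moreover have "det (\<chi> i. r $ i *\<^sub>R X $ i) \<noteq> 0" using D p False by simp
    moreover have "(0 < coef X c i / r $ i) = (0 < coef X c i)" for i
      using assms[of i] by (simp add: zero_less_divide_iff less_asym)
    ultimately show ?thesis using False
      by (simp add: pos_ind_def indicator_def)
  qed (simp add: pos_ind_def D)
qed

lemma prod_nn_integral_lborel_vec:
  fixes f :: "'m::finite \<Rightarrow> 'a::euclidean_space \<Rightarrow> ennreal"
  assumes [measurable]: "\<And>i. f i \<in> borel_measurable borel"
  shows "(\<Prod>i\<in>UNIV. \<integral>\<^sup>+x. f i x \<partial>lborel) = (\<integral>\<^sup>+X. (\<Prod>i\<in>UNIV. f i (X $ i)) \<partial>lborel)"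
proof -
  interpret P: product_sigma_finite "\<lambda>_::'m. lborel :: 'a measure"
    by (rule product_sigma_finite_lborel)
  show ?thesis
    by (subst nn_integral_lborel_vec) (auto simp: P.product_nn_integral_prod)
qed

text \<open>At the origin this is \<open>1 / 0 = 0\<close>, the value that \<^const>\<open>stable_intensity\<close> prescribes there.\<close>

definition power_density :: "real ^ 'n \<Rightarrow> ennreal" where
  "power_density x = ennreal (1 / norm x ^ (CARD('n) + 2))"

text \<open>The right-hand side \<open>\<chi> i. 1\<close> makes \<open>dual_vec\<close> the vector
  \<open>w\<close> with \<open>w \<bullet> X $ i = 1\<close> for every row, that is, the normal of
  the facet hyperplane scaled to level 1.\<close>

definition facet_integral :: "real \<Rightarrow> 'n::finite set \<Rightarrow> ennreal" where
  "facet_integral \<kappa> I = (\<integral>\<^sup>+(c::real^'n). \<integral>\<^sup>+X. ennreal (exp (- (norm c)\<^sup>2 / 2)) * (pos_ind I X c *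
     ennreal (exp (- \<kappa> * (norm (dual_vec X (\<chi> i. 1)))\<^sup>2)) * (\<Prod>i\<in>UNIV. power_density (X $ i))) \<partial>lborel \<partial>lborel)"

lemma power_density_measurable [measurable]: "power_density \<in> borel_measurable borel"
  unfolding power_density_def[abs_def] by measurable

text \<open>Turns the radial parts of the points into independent scaling variables.\<close>

lemma power_density_eq:
  fixes x :: "real ^ 'n"
  assumes "x \<noteq> 0"
  shows "gauss_moment (CARD('n) + 1) * power_density x
    = (\<integral>\<^sup>+\<rho>. ennreal (\<rho> ^ (CARD('n) + 1) * exp (- (\<rho>\<^sup>2 * (norm x)\<^sup>2) / 2)) * indicator {0<..} \<rho> \<partial>lborel)"
  using nn_integral_gauss_moment_scaled[of "norm x" "CARD('n) + 1"] assms
  by (simp add: power_density_def mult.commute)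

text \<open>Each density factor becomes an integral over its own \<open>\<rho> $ i\<close> by
  \<open>power_density_eq\<close>, and row \<open>i\<close> is rescaled by
  \<open>1 / \<rho> $ i\<close>. Of the power d + 1 the Jacobian takes d, leaving
  \<open>\<rho> $ i\<close> itself; the rows become Gaussian, and the facet equations acquire the
  free right-hand side \<open>\<rho>\<close>.\<close>

lemma facet_integral_eq1:
  fixes I :: "'n::finite set"
  shows "gauss_moment (CARD('n) + 1) ^ CARD('n) * facet_integral \<kappa> I =
    (\<integral>\<^sup>+(X::real^'n^'n). \<integral>\<^sup>+\<rho>. \<integral>\<^sup>+c. ennreal (exp (- (norm c)\<^sup>2 / 2)) * pos_ind I X c *
     ennreal (exp (- \<kappa> * (norm (dual_vec X \<rho>))\<^sup>2)) * ((\<Prod>i\<in>UNIV. ennreal (\<rho> $ i)) * (\<Prod>i\<in>UNIV. ennreal (exp (- ((norm (X $ i))\<^sup>2) / 2)))) \<partial>lborel \<partial>lborel \<partial>lborel)"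
proof -
  let ?d = "CARD('n)"
  let ?G = "gauss_moment (?d + 1)"
  define h where "h = (\<lambda>(\<rho>::real) (x::real^'n). ennreal (\<rho> ^ (?d + 1) * exp (- (\<rho>\<^sup>2 * (norm x)\<^sup>2) / 2)) * indicator {0<..} \<rho>)"
  have [measurable]: "case_prod h \<in> borel_measurable (borel \<Otimes>\<^sub>M borel)"
    unfolding h_def by measurable
  define W where "W = (\<lambda>X (c::real^'n). ennreal (exp (- (norm c)\<^sup>2 / 2)) * (pos_ind I X c *
     ennreal (exp (- \<kappa> * (norm (dual_vec X (\<chi> i. 1)))\<^sup>2))))"
  have [measurable]: "case_prod W \<in> borel_measurable (borel \<Otimes>\<^sub>M borel)"
    unfolding W_def by measurable
  have "?G ^ ?d * facet_integral \<kappa> I = (\<integral>\<^sup>+c. \<integral>\<^sup>+X. W X c * (\<Prod>i\<in>UNIV. ?G * power_density (X $ i)) \<partial>lborel \<partial>lborel)"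
    unfolding facet_integral_def W_def
    by (simp add: nn_integral_cmult[symmetric] prod.distrib ac_simps)
  also have "\<dots> = (\<integral>\<^sup>+c. \<integral>\<^sup>+X. \<integral>\<^sup>+\<rho>. W X c * (\<Prod>i\<in>UNIV. h (\<rho> $ i) (X $ i)) \<partial>lborel \<partial>lborel \<partial>lborel)"
  proof (rule nn_integral_cong, rule nn_integral_cong)
    fix c :: "real^'n" and X :: "real^'n^'n"
    show "W X c * (\<Prod>i\<in>UNIV. ?G * power_density (X $ i)) = (\<integral>\<^sup>+\<rho>. W X c * (\<Prod>i\<in>UNIV. h (\<rho> $ i) (X $ i)) \<partial>lborel)"
    proof (cases "det X = 0")
      case True
      then show ?thesis by (simp add: W_def pos_ind_def)
    next
      case False
      then have "X $ i \<noteq> 0" for i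
        using det_zero_row(1)[of i X] by (auto simp: row_def vec_eq_iff)
      then have "(\<Prod>i\<in>UNIV. ?G * power_density (X $ i)) = (\<Prod>i\<in>UNIV. \<integral>\<^sup>+\<rho>. h \<rho> (X $ i) \<partial>lborel)"
        unfolding h_def by (intro prod.cong refl power_density_eq)
      also have "\<dots> = (\<integral>\<^sup>+\<rho>. (\<Prod>i\<in>UNIV. h (\<rho> $ i) (X $ i)) \<partial>lborel)"
        by (rule prod_nn_integral_lborel_vec) measurable
      finally show ?thesis by (simp add: nn_integral_cmult)
    qed
  qed
  also have "\<dots> = (\<integral>\<^sup>+c. \<integral>\<^sup>+\<rho>. \<integral>\<^sup>+X. W X c * (\<Prod>i\<in>UNIV. h (\<rho> $ i) (X $ i)) \<partial>lborel \<partial>lborel \<partial>lborel)"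
    by (intro nn_integral_cong lborel_pair.Fubini') measurable
  also have "\<dots> = (\<integral>\<^sup>+c. \<integral>\<^sup>+\<rho>. \<integral>\<^sup>+X. ennreal (exp (- (norm c)\<^sup>2 / 2)) * pos_ind I X c *
     ennreal (exp (- \<kappa> * (norm (dual_vec X \<rho>))\<^sup>2)) * ((\<Prod>i\<in>UNIV. ennreal (\<rho> $ i)) * (\<Prod>i\<in>UNIV. ennreal (exp (- ((norm (X $ i))\<^sup>2) / 2)))) \<partial>lborel \<partial>lborel \<partial>lborel)"
  proof (rule nn_integral_cong, rule nn_integral_cong)
    fix c \<rho> :: "real^'n"
    show "(\<integral>\<^sup>+X. W X c * (\<Prod>i\<in>UNIV. h (\<rho> $ i) (X $ i)) \<partial>lborel) = (\<integral>\<^sup>+X. ennreal (exp (- (norm c)\<^sup>2 / 2)) * pos_ind I X c *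
     ennreal (exp (- \<kappa> * (norm (dual_vec X \<rho>))\<^sup>2)) * ((\<Prod>i\<in>UNIV. ennreal (\<rho> $ i)) * (\<Prod>i\<in>UNIV. ennreal (exp (- ((norm (X $ i))\<^sup>2) / 2)))) \<partial>lborel)"
    proof (cases "\<forall>i. \<rho> $ i > 0")
      case False
      \<comment> \<open>Outside the positive orthant both sides vanish: \<open>h\<close> by its
        indicator, and the other product because \<open>ennreal\<close> sends negative numbers to
        0.\<close>
      then obtain i where i: "\<rho> $ i \<le> 0" by (auto simp: not_less)
      have "(\<Prod>i\<in>UNIV. h (\<rho> $ i) (X $ i)) = 0" for X
        using i by (intro prod_zero) (auto simp: h_def intro!: exI[of _ i])
      moreover have "(\<Prod>i\<in>UNIV. ennreal (\<rho> $ i)) = 0"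
        using i by (intro prod_zero) (auto simp: ennreal_neg intro!: exI[of _ i])
      ultimately show ?thesis by (simp only: mult_zero_left mult_zero_right)
    next
      case True
      have "(\<integral>\<^sup>+X. W X c * (\<Prod>i\<in>UNIV. h (\<rho> $ i) (X $ i)) \<partial>lborel)
        = (\<Prod>i\<in>UNIV. ennreal (\<bar>1 / \<rho> $ i\<bar> ^ DIM(real^'n))) * (\<integral>\<^sup>+X. W (\<chi> i. (1 / \<rho> $ i) *\<^sub>R X $ i) c * (\<Prod>i\<in>UNIV. h (\<rho> $ i) ((\<chi> i. (1 / \<rho> $ i) *\<^sub>R X $ i) $ i)) \<partial>lborel)"
        using True by (intro nn_integral_lborel_vec_subst_rows nn_integral_lborel_scale) (auto simp: less_le)
      also have "\<dots> = (\<integral>\<^sup>+X. (\<Prod>i\<in>UNIV. ennreal (\<bar>1 / \<rho> $ i\<bar> ^ DIM(real^'n))) * (W (\<chi> i. (1 / \<rho> $ i) *\<^sub>R X $ i) c * (\<Prod>i\<in>UNIV. h (\<rho> $ i) ((\<chi> i. (1 / \<rho> $ i) *\<^sub>R X $ i) $ i))) \<partial>lborel)"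
        by (rule nn_integral_cmult[symmetric]) measurable
      also have "\<dots> = (\<integral>\<^sup>+X. ennreal (exp (- (norm c)\<^sup>2 / 2)) * pos_ind I X c *
     ennreal (exp (- \<kappa> * (norm (dual_vec X \<rho>))\<^sup>2)) * ((\<Prod>i\<in>UNIV. ennreal (\<rho> $ i)) * (\<Prod>i\<in>UNIV. ennreal (exp (- ((norm (X $ i))\<^sup>2) / 2)))) \<partial>lborel)"
      proof (rule nn_integral_cong)
        fix X :: "real^'n^'n"
        have pi: "pos_ind I (\<chi> i. (1 / \<rho> $ i) *\<^sub>R X $ i) c = pos_ind I X c"
          using pos_ind_scale_rows[of "\<chi> i. 1 / \<rho> $ i" I X c] True by simp
        have D: "det (\<chi> i. (1 / \<rho> $ i) *\<^sub>R X $ i) = (\<Prod>i\<in>UNIV. 1 / \<rho> $ i) * det X"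
          using det_rows_mul[of "\<lambda>i. 1 / \<rho> $ i" "\<lambda>i. X $ i"] by (simp add: scalar_mult_eq_scaleR)
        have p: "(\<Prod>i\<in>UNIV. 1 / \<rho> $ i) \<noteq> 0" using True by (auto simp: less_le)
        have dv: "dual_vec (\<chi> i. (1 / \<rho> $ i) *\<^sub>R X $ i) (\<chi> i. 1) = dual_vec X \<rho>" if "det X \<noteq> 0"
        proof (rule sym, subst dual_vec_iff[symmetric])
          show "det (\<chi> i. (1 / \<rho> $ i) *\<^sub>R X $ i) \<noteq> 0" using D p that by simp
          have "X *v dual_vec X \<rho> = \<rho>" using dual_vec_iff[OF that] by blast
          then have "X $ i \<bullet> dual_vec X \<rho> = \<rho> $ i" for i
            by (metis matrix_vector_mul_component)
          then show "(\<chi> i. (1 / \<rho> $ i) *\<^sub>R X $ i) *v dual_vec X \<rho> = (\<chi> i. 1)"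
            using True by (auto simp: vec_eq_iff matrix_vector_mul_component less_le)
        qed
        have "(\<Prod>i\<in>UNIV. ennreal (\<bar>1 / \<rho> $ i\<bar> ^ DIM(real^'n))) * (\<Prod>i\<in>UNIV. h (\<rho> $ i) ((\<chi> i. (1 / \<rho> $ i) *\<^sub>R X $ i) $ i))
           = (\<Prod>i\<in>UNIV. ennreal (\<rho> $ i)) * (\<Prod>i\<in>UNIV. ennreal (exp (- ((norm (X $ i))\<^sup>2) / 2)))"
          unfolding prod.distrib[symmetric]
        proof (intro prod.cong refl)
          fix i
          have r: "\<rho> $ i > 0" using True by blast
          have "norm ((1 / \<rho> $ i) *\<^sub>R X $ i) = norm (X $ i) / \<rho> $ i" using r by simp
          then have "(\<rho> $ i)\<^sup>2 * (norm ((1 / \<rho> $ i) *\<^sub>R X $ i))\<^sup>2 = (norm (X $ i))\<^sup>2"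
            using r by (simp add: power_divide)
          then have hi: "h (\<rho> $ i) ((\<chi> i. (1 / \<rho> $ i) *\<^sub>R X $ i) $ i) = ennreal (\<rho> $ i ^ (?d + 1) * exp (- ((norm (X $ i))\<^sup>2) / 2))"
            using r by (simp add: h_def del: norm_scaleR)
          have "(1 / \<rho> $ i) ^ ?d * \<rho> $ i ^ ?d = 1"
            using r by (simp add: power_mult_distrib[symmetric])
          then have "\<bar>1 / \<rho> $ i\<bar> ^ ?d * (\<rho> $ i ^ (?d + 1) * e) = \<rho> $ i * e" for e
            using r by (simp add: mult.assoc[symmetric])
          then show "ennreal (\<bar>1 / \<rho> $ i\<bar> ^ DIM(real^'n)) * h (\<rho> $ i) ((\<chi> i. (1 / \<rho> $ i) *\<^sub>R X $ i) $ i) = ennreal (\<rho> $ i) * ennreal (exp (- ((norm (X $ i))\<^sup>2) / 2))"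
            unfolding hi using r by (subst (1 2) ennreal_mult'[symmetric]) auto
        qed
        note * = this
        show "(\<Prod>i\<in>UNIV. ennreal (\<bar>1 / \<rho> $ i\<bar> ^ DIM(real^'n))) * (W (\<chi> i. (1 / \<rho> $ i) *\<^sub>R X $ i) c * (\<Prod>i\<in>UNIV. h (\<rho> $ i) ((\<chi> i. (1 / \<rho> $ i) *\<^sub>R X $ i) $ i)))
         = ennreal (exp (- (norm c)\<^sup>2 / 2)) * pos_ind I X c *
     ennreal (exp (- \<kappa> * (norm (dual_vec X \<rho>))\<^sup>2)) * ((\<Prod>i\<in>UNIV. ennreal (\<rho> $ i)) * (\<Prod>i\<in>UNIV. ennreal (exp (- ((norm (X $ i))\<^sup>2) / 2))))"
        proof (cases "det X = 0")
          case True
          then show ?thesis by (simp add: W_def pi) (simp add: pos_ind_def)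
        next
          case False
          show ?thesis
            unfolding *[symmetric] W_def pi dv[OF False] by (simp only: ac_simps)
        qed
      qed
      finally show ?thesis .
    qed
  qed
  also have "\<dots> = (\<integral>\<^sup>+c. \<integral>\<^sup>+X. \<integral>\<^sup>+\<rho>. ennreal (exp (- (norm c)\<^sup>2 / 2)) * pos_ind I X c *
     ennreal (exp (- \<kappa> * (norm (dual_vec X \<rho>))\<^sup>2)) * ((\<Prod>i\<in>UNIV. ennreal (\<rho> $ i)) * (\<Prod>i\<in>UNIV. ennreal (exp (- ((norm (X $ i))\<^sup>2) / 2)))) \<partial>lborel \<partial>lborel \<partial>lborel)"
    by (intro nn_integral_cong lborel_pair.Fubini') measurable
  also have "\<dots> = (\<integral>\<^sup>+X. \<integral>\<^sup>+c. \<integral>\<^sup>+\<rho>. ennreal (exp (- (norm c)\<^sup>2 / 2)) * pos_ind I X c *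
     ennreal (exp (- \<kappa> * (norm (dual_vec X \<rho>))\<^sup>2)) * ((\<Prod>i\<in>UNIV. ennreal (\<rho> $ i)) * (\<Prod>i\<in>UNIV. ennreal (exp (- ((norm (X $ i))\<^sup>2) / 2)))) \<partial>lborel \<partial>lborel \<partial>lborel)"
    by (intro lborel_pair.Fubini') measurable
  also have "\<dots> = (\<integral>\<^sup>+X. \<integral>\<^sup>+\<rho>. \<integral>\<^sup>+c. ennreal (exp (- (norm c)\<^sup>2 / 2)) * pos_ind I X c *
     ennreal (exp (- \<kappa> * (norm (dual_vec X \<rho>))\<^sup>2)) * ((\<Prod>i\<in>UNIV. ennreal (\<rho> $ i)) * (\<Prod>i\<in>UNIV. ennreal (exp (- ((norm (X $ i))\<^sup>2) / 2)))) \<partial>lborel \<partial>lborel \<partial>lborel)"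
    by (intro nn_integral_cong lborel_pair.Fubini') measurable
  finally show ?thesis .
qed


text \<open>The quadratic form of the identity plus the rank-one matrix built from \<open>l\<close>.
  It is what one column \<open>z\<close> of \<open>X\<close> contributes to the exponent in
  \<open>det_integral\<close>.\<close>

definition quad :: "real ^ 'n \<Rightarrow> real ^ 'n \<Rightarrow> real" where
  "quad l z = (norm z)\<^sup>2 + (z \<bullet> l)\<^sup>2"

lemma quad_measurable [measurable (raw)]:
  fixes f g :: "'b \<Rightarrow> real ^ 'n"
  assumes [measurable]: "f \<in> borel_measurable M" "g \<in> borel_measurable M"
  shows "(\<lambda>x. quad (f x) (g x)) \<in> borel_measurable M"
  unfolding quad_def by measurable

text \<open>The squared determinant collects the Jacobians of two substitutions by \<open>X\<close>.
  Since \<open>ennreal\<close> truncates at 0, the product over \<open>X *v w\<close> also carries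
  the condition that \<open>\<rho> = X *v w\<close> lies in the positive orthant.\<close>

definition det_integral :: "real ^ 'n \<Rightarrow> real ^ 'n \<Rightarrow> ennreal" where
  "det_integral w l = (\<integral>\<^sup>+(X::real^'n^'n). ennreal ((det X)\<^sup>2) * ((\<Prod>i\<in>UNIV. ennreal ((X *v w) $ i)) *
     ennreal (exp (- ((\<Sum>i\<in>UNIV. (norm (X $ i))\<^sup>2) + (norm (l v* X))\<^sup>2) / 2))) \<partial>lborel)"

lemma prod_ennreal_exp_norm:
  fixes X :: "real ^ 'n ^ 'm"
  shows "(\<Prod>i\<in>UNIV. ennreal (exp (- ((norm (X $ i))\<^sup>2) / 2))) = ennreal (exp (- (\<Sum>i\<in>UNIV. (norm (X $ i))\<^sup>2) / 2))"
proof -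
  have "(\<Prod>i\<in>UNIV. ennreal (exp (- ((norm (X $ i))\<^sup>2) / 2))) = ennreal (\<Prod>i\<in>UNIV. exp (- ((norm (X $ i))\<^sup>2) / 2))"
    by (rule prod_ennreal) simp
  also have "(\<Prod>i\<in>UNIV. exp (- ((norm (X $ i))\<^sup>2) / 2)) = exp (\<Sum>i\<in>UNIV. - ((norm (X $ i))\<^sup>2) / 2)"
    by (rule exp_sum[symmetric]) simp
  also have "(\<Sum>i\<in>UNIV. - ((norm (X $ i))\<^sup>2) / 2) = - (\<Sum>i\<in>UNIV. (norm (X $ i))\<^sup>2) / 2"
    by (simp add: sum_negf sum_divide_distrib)
  finally show ?thesis .
qed

text \<open>For nonsingular \<open>X\<close> the substitutions \<open>\<rho> = X *v w\<close> and
  \<open>c = l v* X\<close> make the facet normal \<open>w\<close> and the coordinates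
  \<open>l\<close> of \<open>c\<close> free variables, each at the price of one factor
  \<open>\<bar>det X\<bar>\<close>.\<close>

lemma facet_integral_eq2:
  fixes I :: "'n::finite set"
  shows "gauss_moment (CARD('n) + 1) ^ CARD('n) * facet_integral \<kappa> I =
    (\<integral>\<^sup>+(w::real^'n). ennreal (exp (- \<kappa> * (norm w)\<^sup>2)) * (\<integral>\<^sup>+l. (\<Prod>i\<in>I. indicator {0<..} (l $ i)) * det_integral w l \<partial>lborel) \<partial>lborel)"
proof -
  define K where "K = (\<lambda>(X::real^'n^'n) w l. ennreal (exp (- \<kappa> * (norm w)\<^sup>2)) * ((\<Prod>i\<in>I. indicator {0<..} (l $ i)) *
    (ennreal ((det X)\<^sup>2) * ((\<Prod>i\<in>UNIV. ennreal ((X *v w) $ i)) *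
     ennreal (exp (- ((\<Sum>i\<in>UNIV. (norm (X $ i))\<^sup>2) + (norm (l v* X))\<^sup>2) / 2))))))"
  have K [measurable]: "(\<lambda>p. K (f p) (g p) (h p)) \<in> borel_measurable M"
    if [measurable]: "f \<in> borel_measurable M" "g \<in> borel_measurable M" "h \<in> borel_measurable M"
    for M :: "'q measure" and f g h
    unfolding K_def by measurable
  have "gauss_moment (CARD('n) + 1) ^ CARD('n) * facet_integral \<kappa> I = (\<integral>\<^sup>+X. \<integral>\<^sup>+w. \<integral>\<^sup>+l. K X w l \<partial>lborel \<partial>lborel \<partial>lborel)"
    unfolding facet_integral_eq1
  proof (rule nn_integral_cong)
    fix X :: "real^'n^'n"
    define E where "E = (\<lambda>\<rho> c. ennreal (exp (- (norm c)\<^sup>2 / 2)) * pos_ind I X c *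
     ennreal (exp (- \<kappa> * (norm (dual_vec X \<rho>))\<^sup>2)) * ((\<Prod>i\<in>UNIV. ennreal (\<rho> $ i)) * (\<Prod>i\<in>UNIV. ennreal (exp (- ((norm (X $ i))\<^sup>2) / 2)))))"
    have [measurable]: "case_prod E \<in> borel_measurable (borel \<Otimes>\<^sub>M borel)"
      unfolding E_def by measurable
    have "(\<integral>\<^sup>+\<rho>. \<integral>\<^sup>+c. E \<rho> c \<partial>lborel \<partial>lborel) = (\<integral>\<^sup>+w. \<integral>\<^sup>+l. K X w l \<partial>lborel \<partial>lborel)"
    proof (cases "det X = 0")
      case True
      then show ?thesis by (simp add: E_def K_def pos_ind_def)
    next
      case False
      then have Ft: "det (transpose X) \<noteq> 0" by (simp only: det_transpose not_False_eq_True)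
      have "(\<integral>\<^sup>+\<rho>. \<integral>\<^sup>+c. E \<rho> c \<partial>lborel \<partial>lborel) = ennreal \<bar>det X\<bar> * (\<integral>\<^sup>+w. \<integral>\<^sup>+c. E (X *v w) c \<partial>lborel \<partial>lborel)"
        by (rule nn_integral_lborel_linear[OF False]) measurable
      also have "\<dots> = ennreal \<bar>det X\<bar> * (\<integral>\<^sup>+w. ennreal \<bar>det X\<bar> * (\<integral>\<^sup>+l. E (X *v w) (l v* X) \<partial>lborel) \<partial>lborel)"
      proof (intro arg_cong2[where f="(*)"] refl nn_integral_cong)
        fix w
        show "(\<integral>\<^sup>+c. E (X *v w) c \<partial>lborel) = ennreal \<bar>det X\<bar> * (\<integral>\<^sup>+l. E (X *v w) (l v* X) \<partial>lborel)"
          using nn_integral_lborel_linear[OF Ft, of "E (X *v w)"] by simp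
      qed
      also have "\<dots> = (\<integral>\<^sup>+w. \<integral>\<^sup>+l. ennreal \<bar>det X\<bar> * (ennreal \<bar>det X\<bar> * E (X *v w) (l v* X)) \<partial>lborel \<partial>lborel)"
        by (simp add: nn_integral_cmult)
      also have "\<dots> = (\<integral>\<^sup>+w. \<integral>\<^sup>+l. K X w l \<partial>lborel \<partial>lborel)"
      proof (intro nn_integral_cong)
        fix w l :: "real^'n"
        have 1: "pos_ind I X (l v* X) = (\<Prod>i\<in>I. indicator {0<..} (l $ i))"
          using False by (simp add: pos_ind_def coef_eq)
        have 2: "ennreal \<bar>det X\<bar> * ennreal \<bar>det X\<bar> = ennreal ((det X)\<^sup>2)"
          by (simp add: ennreal_mult'[symmetric] power2_eq_square flip: abs_mult)
        have 3: "ennreal (exp (- (norm (l v* X))\<^sup>2 / 2)) * ennreal (exp (- (\<Sum>i\<in>UNIV. (norm (X $ i))\<^sup>2) / 2)) =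
          ennreal (exp (- ((\<Sum>i\<in>UNIV. (norm (X $ i))\<^sup>2) + (norm (l v* X))\<^sup>2) / 2))"
          by (simp add: ennreal_mult'[symmetric] exp_add[symmetric] add_divide_distrib diff_divide_distrib)
        show "ennreal \<bar>det X\<bar> * (ennreal \<bar>det X\<bar> * E (X *v w) (l v* X)) = K X w l"
          unfolding E_def K_def 1 dual_vec_eq[OF False] prod_ennreal_exp_norm 2[symmetric] 3[symmetric]
          by (simp only: ac_simps)
      qed
      finally show ?thesis .
    qed
    then show "(\<integral>\<^sup>+\<rho>. \<integral>\<^sup>+c. ennreal (exp (- (norm c)\<^sup>2 / 2)) * pos_ind I X c *
     ennreal (exp (- \<kappa> * (norm (dual_vec X \<rho>))\<^sup>2)) * ((\<Prod>i\<in>UNIV. ennreal (\<rho> $ i)) * (\<Prod>i\<in>UNIV. ennreal (exp (- ((norm (X $ i))\<^sup>2) / 2)))) \<partial>lborel \<partial>lborel) = (\<integral>\<^sup>+w. \<integral>\<^sup>+l. K X w l \<partial>lborel \<partial>lborel)"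
      unfolding E_def .
  qed
  also have "\<dots> = (\<integral>\<^sup>+w. \<integral>\<^sup>+X. \<integral>\<^sup>+l. K X w l \<partial>lborel \<partial>lborel \<partial>lborel)"
    by (rule lborel_pair.Fubini') measurable
  also have "\<dots> = (\<integral>\<^sup>+w. \<integral>\<^sup>+l. \<integral>\<^sup>+X. K X w l \<partial>lborel \<partial>lborel \<partial>lborel)"
    by (intro nn_integral_cong lborel_pair.Fubini') measurable
  also have "\<dots> = (\<integral>\<^sup>+w. ennreal (exp (- \<kappa> * (norm w)\<^sup>2)) * (\<integral>\<^sup>+l. (\<Prod>i\<in>I. indicator {0<..} (l $ i)) * det_integral w l \<partial>lborel) \<partial>lborel)"
    unfolding K_def det_integral_def by (simp add: nn_integral_cmult)
  finally show ?thesis .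
qed

section \<open>Rotations and integration over the columns of the matrix\<close>

lemma orthogonal_matrix_exists:
  fixes a b :: "real ^ 'n"
  assumes "norm a = norm b"
  obtains B :: "real ^ 'n ^ 'n" where "\<bar>det B\<bar> = 1" "\<And>x y. (B *v x) \<bullet> (B *v y) = x \<bullet> y" "\<And>x. norm (B *v x) = norm x" "B *v a = b"
proof -
  obtain f where f: "orthogonal_transformation f" "f a = b"
    using orthogonal_transformation_exists[OF assms] .
  then have l: "linear f" and om: "orthogonal_matrix (matrix f)"
    using orthogonal_transformation_matrix by blast+
  have w: "matrix f *v x = f x" for x
    using l by (simp add: matrix_works)
  show ?thesis
  proof (rule that)
    show "\<bar>det (matrix f)\<bar> = 1" using det_orthogonal_matrix[OF om] by auto
    show "(matrix f *v x) \<bullet> (matrix f *v y) = x \<bullet> y" for x y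
      unfolding w using f(1) by (simp add: orthogonal_transformation_def)
    show "norm (matrix f *v x) = norm x" for x
      unfolding w using f(1) by (simp add: orthogonal_transformation)
    show "matrix f *v a = b" unfolding w by (rule f(2))
  qed
qed

lemma vector_matrix_mult_rows:
  fixes X :: "real ^ 'n ^ 'm"
  shows "l v* (\<chi> i. B *v X $ i) = B *v (l v* X)"
  by (simp add: vec_eq_iff vector_matrix_mult_def matrix_vector_mult_def sum_distrib_left sum_distrib_right)
     (subst sum.swap, simp add: ac_simps)

text \<open>Rotating all rows carries the direction of \<open>w\<close> to a coordinate axis and
  preserves the squared determinant, the norms of the rows and that of \<open>l v* X\<close>. The
  length of \<open>w\<close> comes out of the d linear factors.\<close>

lemma det_integral_rotate:
  fixes w :: "real ^ 'n"
  shows "det_integral w l = ennreal (norm w ^ CARD('n)) * det_integral (axis e 1) l"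
proof (cases "w = 0")
  case True
  then show ?thesis by (simp add: det_integral_def power_0_left)
next
  case False
  note assms = this
  obtain B :: "real ^ 'n ^ 'n" where B: "\<bar>det B\<bar> = 1" "\<And>x y. (B *v x) \<bullet> (B *v y) = x \<bullet> y" "\<And>x. norm (B *v x) = norm x" "B *v axis e 1 = w /\<^sub>R norm w"
    using orthogonal_matrix_exists[of "axis e 1" "w /\<^sub>R norm w"] assms by auto
  then have d0: "det B \<noteq> 0" by auto
  have "det_integral w l = (\<integral>\<^sup>+(X::real^'n^'n). ennreal ((det (\<chi> i. B *v X $ i))\<^sup>2) * ((\<Prod>i\<in>UNIV. ennreal (((\<chi> i. B *v X $ i) *v w) $ i)) *
     ennreal (exp (- ((\<Sum>i\<in>UNIV. (norm ((\<chi> i. B *v X $ i) $ i))\<^sup>2) + (norm (l v* (\<chi> i. B *v X $ i)))\<^sup>2) / 2))) \<partial>lborel)"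
    unfolding det_integral_def by (subst nn_integral_lborel_matrix_rows[OF d0]) (measurable, simp add: B(1))
  also have "\<dots> = (\<integral>\<^sup>+(X::real^'n^'n). ennreal (norm w ^ CARD('n)) * (ennreal ((det X)\<^sup>2) * ((\<Prod>i\<in>UNIV. ennreal ((X *v axis e 1) $ i)) *
     ennreal (exp (- ((\<Sum>i\<in>UNIV. (norm (X $ i))\<^sup>2) + (norm (l v* X))\<^sup>2) / 2)))) \<partial>lborel)"
  proof (rule nn_integral_cong)
    fix X :: "real^'n^'n"
    have 1: "(det (\<chi> i. B *v X $ i))\<^sup>2 = (det X)\<^sup>2"
      using B(1) by (simp add: det_rows_linear power_mult_distrib abs_square_eq_1)
    have "((\<chi> i. B *v X $ i) *v w) $ i = norm w * (X *v axis e 1) $ i" for i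
    proof -
      have "w = norm w *\<^sub>R (B *v axis e 1)" using assms by (simp add: B(4))
      then have "(B *v X $ i) \<bullet> w = norm w * ((B *v X $ i) \<bullet> (B *v axis e 1))"
        by (metis inner_scaleR_right)
      then show ?thesis by (simp add: matrix_vector_mul_component B(2))
    qed
    then have 2: "(\<Prod>i\<in>UNIV. ennreal (((\<chi> i. B *v X $ i) *v w) $ i)) = ennreal (norm w ^ CARD('n)) * (\<Prod>i\<in>UNIV. ennreal ((X *v axis e 1) $ i))"
      by (simp add: ennreal_mult' prod.distrib ennreal_power)
    show "ennreal ((det (\<chi> i. B *v X $ i))\<^sup>2) * ((\<Prod>i\<in>UNIV. ennreal (((\<chi> i. B *v X $ i) *v w) $ i)) *
     ennreal (exp (- ((\<Sum>i\<in>UNIV. (norm ((\<chi> i. B *v X $ i) $ i))\<^sup>2) + (norm (l v* (\<chi> i. B *v X $ i)))\<^sup>2) / 2)))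
      = ennreal (norm w ^ CARD('n)) * (ennreal ((det X)\<^sup>2) * ((\<Prod>i\<in>UNIV. ennreal ((X *v axis e 1) $ i)) *
     ennreal (exp (- ((\<Sum>i\<in>UNIV. (norm (X $ i))\<^sup>2) + (norm (l v* X))\<^sup>2) / 2))))"
      unfolding 1 2 vector_matrix_mult_rows by (simp only: vec_lambda_beta B(3)) (simp only: ac_simps)
  qed
  also have "\<dots> = ennreal (norm w ^ CARD('n)) * det_integral (axis e 1) l"
    unfolding det_integral_def by (rule nn_integral_cmult) measurable
  finally show ?thesis .
qed

text \<open>A square root of the form \<open>quad l\<close>: rotate \<open>l\<close> onto the axis
  \<open>e\<close>, stretch this axis by \<open>sqrt (1 + (norm l)\<^sup>2)\<close>, and finally
  rotate the image of \<open>s\<close> onto the same axis. The last rotation changes no norm and can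
  therefore be chosen to suit \<open>s\<close>.\<close>

lemma quad_linear:
  fixes l s :: "real ^ 'n"
  obtains A :: "real ^ 'n ^ 'n" where "\<bar>det A\<bar> = sqrt (1 + (norm l)\<^sup>2)" "\<And>z. (norm (A *v z))\<^sup>2 = quad l z"
    "A *v s = sqrt (quad l s) *\<^sub>R axis e 1"
proof -
  obtain Q :: "real ^ 'n ^ 'n" where Q: "\<bar>det Q\<bar> = 1" "\<And>x y. (Q *v x) \<bullet> (Q *v y) = x \<bullet> y" "\<And>x. norm (Q *v x) = norm x" "Q *v l = norm l *\<^sub>R axis e 1"
    using orthogonal_matrix_exists[of l "norm l *\<^sub>R axis e 1"] by auto
  define S where "S = row_matrix e (sqrt (1 + (norm l)\<^sup>2) *\<^sub>R axis e 1 :: real ^ 'n)"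
  have dS: "det S = sqrt (1 + (norm l)\<^sup>2)" by (simp add: S_def det_row_matrix)
  have nS: "(norm (S *v x))\<^sup>2 = (norm x)\<^sup>2 + (norm l)\<^sup>2 * (x $ e)\<^sup>2" for x
  proof -
    have "(norm (S *v x))\<^sup>2 = (\<Sum>i\<in>UNIV. ((S *v x) $ i)\<^sup>2)"
      by (simp add: norm_vec_def L2_set_def sum_nonneg)
    also have "\<dots> = (\<Sum>i\<in>UNIV. (x $ i)\<^sup>2 + (if i = e then (norm l)\<^sup>2 * (x $ e)\<^sup>2 else 0))"
      by (intro sum.cong) (auto simp: S_def row_matrix_vector_mult axis_inner_left power_mult_distrib algebra_simps)
    also have "\<dots> = (norm x)\<^sup>2 + (norm l)\<^sup>2 * (x $ e)\<^sup>2"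
      by (simp add: sum.distrib norm_vec_def L2_set_def sum_nonneg)
    finally show ?thesis .
  qed
  have n1: "(norm (S *v (Q *v z)))\<^sup>2 = quad l z" for z
  proof -
    have "norm l * (Q *v z) $ e = (Q *v z) \<bullet> (Q *v l)"
      by (simp add: Q(4) inner_axis)
    also have "\<dots> = z \<bullet> l" by (rule Q(2))
    finally have "(norm l)\<^sup>2 * ((Q *v z) $ e)\<^sup>2 = (z \<bullet> l)\<^sup>2"
      by (metis power_mult_distrib)
    then show ?thesis by (simp add: nS quad_def Q(3))
  qed
  then have ns: "norm (S *v (Q *v s)) = sqrt (quad l s)"
    by (metis norm_ge_zero real_sqrt_unique)
  then have ns': "norm (S *v (Q *v s)) = norm (sqrt (quad l s) *\<^sub>R axis e 1 :: real ^ 'n)"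
    by (simp add: quad_def)
  obtain R :: "real ^ 'n ^ 'n" where R: "\<bar>det R\<bar> = 1" "\<And>x. norm (R *v x) = norm x" "R *v (S *v (Q *v s)) = sqrt (quad l s) *\<^sub>R axis e 1"
    using orthogonal_matrix_exists[OF ns'] by metis
  show ?thesis
  proof (rule that[of "R ** (S ** Q)"])
    show "\<bar>det (R ** (S ** Q))\<bar> = sqrt (1 + (norm l)\<^sup>2)"
      by (simp add: det_mul abs_mult Q R dS)
    show "(norm ((R ** (S ** Q)) *v z))\<^sup>2 = quad l z" for z
      by (simp flip: matrix_vector_mul_assoc add: R n1)
    show "(R ** (S ** Q)) *v s = sqrt (quad l s) *\<^sub>R axis e 1"
      by (simp flip: matrix_vector_mul_assoc add: R)
  qed
qed

text \<open>An unnormalised Gaussian mean of the squared determinant with row \<open>e\<close> fixed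
  to a unit vector. It depends neither on \<open>l\<close> nor on \<open>s\<close> and ends up in
  the common constant.\<close>

definition det_const :: "'n::finite \<Rightarrow> ennreal" where
  "det_const e = (\<integral>\<^sup>+x. ennreal ((det (\<chi> j. if j = e then axis e 1 else x j))\<^sup>2) *
     (\<Prod>j\<in>UNIV - {e}. ennreal (exp (- (norm (x j))\<^sup>2 / 2))) \<partial>(PiM (UNIV - {e}) (\<lambda>_. lborel :: (real^'n) measure)))"

text \<open>Under the matrix \<open>A\<close> of \<open>quad_linear\<close> the free rows become
  standard Gaussian. With r for its determinant up to sign, the d - 1 free rows give the Jacobian r
  to the power d - 1, and pulling \<open>A\<close> out of the squared determinant gives the square
  of r; hence the exponent d + 1. The fixed row becomes a multiple of a unit vector, whence
  \<open>quad l s\<close>.\<close>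

lemma det_conditional_integral:
  fixes l s :: "real ^ 'n"
  shows "(\<integral>\<^sup>+x. ennreal ((det (\<chi> j. if j = e then s else x j))\<^sup>2) *
     (\<Prod>j\<in>UNIV - {e}. ennreal (exp (- quad l (x j) / 2))) \<partial>(PiM (UNIV - {e}) (\<lambda>_. lborel :: (real^'n) measure)))
    = ennreal (1 / sqrt (1 + (norm l)\<^sup>2) ^ (CARD('n) + 1)) * (ennreal (quad l s) * det_const e)"
proof -
  let ?P = "PiM (UNIV - {e}) (\<lambda>_. lborel :: (real^'n) measure)"
  let ?r = "sqrt (1 + (norm l)\<^sup>2)"
  obtain A :: "real ^ 'n ^ 'n" where A: "\<bar>det A\<bar> = ?r" "\<And>z. (norm (A *v z))\<^sup>2 = quad l z" "A *v s = sqrt (quad l s) *\<^sub>R axis e 1"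
    using quad_linear[of l s e] by metis
  have r0: "?r > 0" by (simp add: add_pos_nonneg)
  then have A0: "det A \<noteq> 0" using A(1) by auto
  have q0: "quad l s \<ge> 0" by (simp add: quad_def)
  define G where "G = (\<lambda>x. ennreal ((det (\<chi> j. if j = e then A *v s else x j))\<^sup>2) * (\<Prod>j\<in>UNIV - {e}. ennreal (exp (- (norm (x j))\<^sup>2 / 2))))"
  have Gm: "G \<in> borel_measurable ?P"
  proof -
    have [measurable]: "(\<lambda>x. if j = e then A *v s else x j) \<in> borel_measurable ?P" for j
      by (cases "j = e") auto
    show ?thesis unfolding G_def by measurable
  qed
  have G1: "(\<integral>\<^sup>+x. G x \<partial>?P) = ennreal (quad l s) * det_const e"
  proof -
    have [measurable]: "(\<lambda>x. if j = e then axis e 1 else x j) \<in> borel_measurable ?P" for j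
      by (cases "j = e") auto
    have "(det (\<chi> j. if j = e then A *v s else x j))\<^sup>2 = quad l s * (det (\<chi> j. if j = e then axis e 1 else x j))\<^sup>2" for x
      using det_row_mul[of e "sqrt (quad l s)" "\<lambda>_. axis e 1" x] q0
      unfolding A(3) scalar_mult_eq_scaleR by (simp add: power_mult_distrib)
    then have "(\<integral>\<^sup>+x. G x \<partial>?P) = (\<integral>\<^sup>+x. ennreal (quad l s) * (ennreal ((det (\<chi> j. if j = e then axis e 1 else x j))\<^sup>2) *
     (\<Prod>j\<in>UNIV - {e}. ennreal (exp (- (norm (x j))\<^sup>2 / 2)))) \<partial>?P)"
      using q0 by (simp add: G_def ennreal_mult' mult.assoc)
    also have "\<dots> = ennreal (quad l s) * det_const e"
      unfolding det_const_def by (rule nn_integral_cmult) measurable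
    finally show ?thesis .
  qed
  have G2: "(\<integral>\<^sup>+x. G x \<partial>?P) = ennreal (?r ^ (CARD('n) - 1)) * (\<integral>\<^sup>+x. G (\<lambda>j. if j \<in> UNIV - {e} then A *v x j else x j) \<partial>?P)"
  proof -
    have "(\<lambda>x. A *v x) \<in> borel_measurable borel" by measurable
    then have "(\<integral>\<^sup>+x. G x \<partial>?P) = (\<Prod>j\<in>UNIV - {e}. ennreal \<bar>det A\<bar>) * (\<integral>\<^sup>+x. G (\<lambda>j. if j \<in> UNIV - {e} then A *v x j else x j) \<partial>?P)"
      by (intro nn_integral_PiM_subst_components[where f = "\<lambda>_ x. A *v x"] Gm nn_integral_lborel_linear[OF A0]) auto
    then show ?thesis
      by (simp only: A(1) prod_constant card_Diff_singleton UNIV_I ennreal_power less_imp_le[OF r0])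
  qed
  have G3: "G (\<lambda>j. if j \<in> UNIV - {e} then A *v x j else x j) = ennreal (?r\<^sup>2) * (ennreal ((det (\<chi> j. if j = e then s else x j))\<^sup>2) *
     (\<Prod>j\<in>UNIV - {e}. ennreal (exp (- quad l (x j) / 2))))" for x
  proof -
    have "(\<chi> j. if j = e then A *v s else if j \<in> UNIV - {e} then A *v x j else x j) = (\<chi> j. A *v (\<chi> j. if j = e then s else x j) $ j)"
      by (simp add: vec_eq_iff)
    then have "(det (\<chi> j. if j = e then A *v s else if j \<in> UNIV - {e} then A *v x j else x j))\<^sup>2 = ?r\<^sup>2 * (det (\<chi> j. if j = e then s else x j))\<^sup>2"
      by (simp only: det_rows_linear power_mult_distrib A(1)[symmetric] power2_abs)
    moreover have "(\<Prod>j\<in>UNIV - {e}. ennreal (exp (- (norm (if j \<in> UNIV - {e} then A *v x j else x j))\<^sup>2 / 2))) = (\<Prod>j\<in>UNIV - {e}. ennreal (exp (- quad l (x j) / 2)))"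
      by (intro prod.cong) (auto simp: A(2))
    ultimately show ?thesis
      unfolding G_def by (simp only: ennreal_mult' zero_le_power2 mult.assoc)
  qed
  let ?I = "\<integral>\<^sup>+x. ennreal ((det (\<chi> j. if j = e then s else x j))\<^sup>2) * (\<Prod>j\<in>UNIV - {e}. ennreal (exp (- quad l (x j) / 2))) \<partial>?P"
  have [measurable]: "(\<lambda>x. if j = e then s else x j) \<in> borel_measurable ?P" for j
    by (cases "j = e") auto
  have c: "CARD('n) - 1 + 2 = CARD('n) + 1"
    using zero_less_card_finite[where 'a='n] by linarith
  have "ennreal (quad l s) * det_const e = ennreal (?r ^ (CARD('n) - 1)) * (ennreal (?r\<^sup>2) * ?I)"
    unfolding G1[symmetric] G2 G3 by (rule arg_cong[where f="(*) _"], rule nn_integral_cmult) measurable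
  also have "\<dots> = ennreal (?r ^ (CARD('n) + 1)) * ?I"
    unfolding mult.assoc[symmetric] c[symmetric] power_add using r0 by (simp add: ennreal_mult')
  finally have "ennreal (1 / ?r ^ (CARD('n) + 1)) * (ennreal (quad l s) * det_const e) =
    (ennreal (1 / ?r ^ (CARD('n) + 1)) * ennreal (?r ^ (CARD('n) + 1))) * ?I"
    by (simp add: mult.assoc)
  also have "ennreal (1 / ?r ^ (CARD('n) + 1)) * ennreal (?r ^ (CARD('n) + 1)) = 1"
    using r0 by (subst ennreal_mult'[symmetric]) auto
  finally show ?thesis by simp
qed


text \<open>After transposition the linear factors involve row \<open>e\<close> alone and the
  exponent splits into one \<open>quad\<close> per row, so the remaining rows can be integrated out
  with row \<open>e\<close> fixed as \<open>s\<close>.\<close>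

lemma det_integral_axis:
  fixes l :: "real ^ 'n"
  shows "det_integral (axis e 1) l = ennreal (1 / sqrt (1 + (norm l)\<^sup>2) ^ (CARD('n) + 1)) * (det_const e *
    (\<integral>\<^sup>+(s::real^'n). (\<Prod>i\<in>UNIV. ennreal (s $ i)) * (ennreal (quad l s) * ennreal (exp (- quad l s / 2))) \<partial>lborel))"
proof -
  let ?U = "UNIV - {e}"
  interpret P: product_sigma_finite "\<lambda>_::'n. lborel :: (real^'n) measure"
    by (rule product_sigma_finite_lborel)
  define F where "F = (\<lambda>Z::real^'n^'n. ennreal ((det Z)\<^sup>2) * ((\<Prod>i\<in>UNIV. ennreal (Z $ e $ i)) * (\<Prod>j\<in>UNIV. ennreal (exp (- quad l (Z $ j) / 2)))))"
  have Fm [measurable]: "F \<in> borel_measurable borel"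
    unfolding F_def by measurable
  have "det_integral (axis e 1) l = (\<integral>\<^sup>+Z. F Z \<partial>lborel)"
    unfolding det_integral_def
  proof (subst nn_integral_lborel_transpose, measurable, rule nn_integral_cong)
    fix Z :: "real^'n^'n"
    have 1: "(transpose Z *v axis e 1) $ i = Z $ e $ i" for i
      by (simp add: matrix_vector_mul_component transpose_def inner_axis)
    have "(\<Sum>i\<in>UNIV. (norm (transpose Z $ i))\<^sup>2) = (\<Sum>i\<in>UNIV. \<Sum>j\<in>UNIV. (Z $ j $ i)\<^sup>2)"
      by (simp add: norm_vec_def L2_set_def sum_nonneg transpose_def)
    also have "\<dots> = (\<Sum>j\<in>UNIV. (norm (Z $ j))\<^sup>2)"
      by (subst sum.swap) (simp add: norm_vec_def L2_set_def sum_nonneg)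
    also have "l v* transpose Z = Z *v l"
      by (metis transpose_transpose transpose_matrix_vector)
    then have "(norm (l v* transpose Z))\<^sup>2 = (\<Sum>j\<in>UNIV. (Z $ j \<bullet> l)\<^sup>2)"
      by (simp add: norm_vec_def L2_set_def sum_nonneg matrix_vector_mul_component)
    ultimately have 2: "(\<Sum>i\<in>UNIV. (norm (transpose Z $ i))\<^sup>2) + (norm (l v* transpose Z))\<^sup>2 = (\<Sum>j\<in>UNIV. quad l (Z $ j))"
      by (simp add: quad_def sum.distrib)
    have 3: "ennreal (exp (- (\<Sum>j\<in>UNIV. quad l (Z $ j)) / 2)) = (\<Prod>j\<in>UNIV. ennreal (exp (- quad l (Z $ j) / 2)))"
    proof -
      have "(\<Prod>j\<in>UNIV. exp (- quad l (Z $ j) / 2)) = exp (\<Sum>j\<in>UNIV. - quad l (Z $ j) / 2)"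
        by (rule exp_sum[symmetric]) simp
      also have "(\<Sum>j\<in>UNIV. - quad l (Z $ j) / 2) = - (\<Sum>j\<in>UNIV. quad l (Z $ j)) / 2"
        by (simp add: sum_negf sum_divide_distrib)
      finally show ?thesis by (subst prod_ennreal) auto
    qed
    show "ennreal ((det (transpose Z))\<^sup>2) * ((\<Prod>i\<in>UNIV. ennreal ((transpose Z *v axis e 1) $ i)) *
     ennreal (exp (- ((\<Sum>i\<in>UNIV. (norm (transpose Z $ i))\<^sup>2) + (norm (l v* transpose Z))\<^sup>2) / 2))) = F Z"
      unfolding F_def 1 2 3 det_transpose ..
  qed
  also have "\<dots> = (\<integral>\<^sup>+x. F (\<chi> j. x j) \<partial>(PiM (insert e ?U) (\<lambda>_. lborel)))"
    by (simp add: nn_integral_lborel_vec insert_absorb)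
  also have "\<dots> = (\<integral>\<^sup>+s. \<integral>\<^sup>+x. F (\<chi> j. (x(e := s)) j) \<partial>(PiM ?U (\<lambda>_. lborel)) \<partial>lborel)"
  proof (rule P.product_nn_integral_insert_rev)
    have "(\<lambda>x. \<chi> j. x j) \<in> borel_measurable (PiM UNIV (\<lambda>_::'n. lborel :: (real^'n) measure))"
      by measurable
    then show "(\<lambda>x. F (\<chi> j. x j)) \<in> borel_measurable (PiM (insert e ?U) (\<lambda>_. lborel))"
      by (simp add: insert_absorb)
  qed auto
  also have "\<dots> = (\<integral>\<^sup>+s. (\<Prod>i\<in>UNIV. ennreal (s $ i)) * ennreal (exp (- quad l s / 2)) *
      (\<integral>\<^sup>+x. ennreal ((det (\<chi> j. if j = e then s else x j))\<^sup>2) * (\<Prod>j\<in>?U. ennreal (exp (- quad l (x j) / 2))) \<partial>(PiM ?U (\<lambda>_. lborel))) \<partial>lborel)"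
  proof (rule nn_integral_cong)
    fix s :: "real^'n"
    have [measurable]: "(\<lambda>x. if j = e then s else x j) \<in> borel_measurable (PiM ?U (\<lambda>_. lborel))" for j
      by (cases "j = e") auto
    have "F (\<chi> j. (x(e := s)) j) = (\<Prod>i\<in>UNIV. ennreal (s $ i)) * ennreal (exp (- quad l s / 2)) *
      (ennreal ((det (\<chi> j. if j = e then s else x j))\<^sup>2) * (\<Prod>j\<in>?U. ennreal (exp (- quad l (x j) / 2))))" for x
    proof -
      have 1: "(\<chi> j. (x(e := s)) j) = (\<chi> j. if j = e then s else x j)"
        by (simp add: vec_eq_iff)
      have 2: "(\<Prod>j\<in>UNIV. ennreal (exp (- quad l (if j = e then s else x j) / 2))) = ennreal (exp (- quad l s / 2)) * (\<Prod>j\<in>?U. ennreal (exp (- quad l (x j) / 2)))"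
        by (subst prod.remove[where x=e]) (auto intro!: arg_cong2[where f="(*)"] prod.cong)
      show ?thesis
        unfolding F_def 1 vec_lambda_beta 2 by (simp add: ac_simps)
    qed
    then show "(\<integral>\<^sup>+x. F (\<chi> j. (x(e := s)) j) \<partial>(PiM ?U (\<lambda>_. lborel))) = (\<Prod>i\<in>UNIV. ennreal (s $ i)) * ennreal (exp (- quad l s / 2)) *
      (\<integral>\<^sup>+x. ennreal ((det (\<chi> j. if j = e then s else x j))\<^sup>2) * (\<Prod>j\<in>?U. ennreal (exp (- quad l (x j) / 2))) \<partial>(PiM ?U (\<lambda>_. lborel)))"
      by (simp only:) (rule nn_integral_cmult, measurable)
  qed
  also have "\<dots> = (\<integral>\<^sup>+s. ennreal (1 / sqrt (1 + (norm l)\<^sup>2) ^ (CARD('n) + 1)) * (det_const e * ((\<Prod>i\<in>UNIV. ennreal (s $ i)) * (ennreal (quad l s) * ennreal (exp (- quad l s / 2))))) \<partial>lborel)"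
    unfolding det_conditional_integral by (simp only: ac_simps)
  also have "\<dots> = ennreal (1 / sqrt (1 + (norm l)\<^sup>2) ^ (CARD('n) + 1)) * (\<integral>\<^sup>+s. det_const e * ((\<Prod>i\<in>UNIV. ennreal (s $ i)) * (ennreal (quad l s) * ennreal (exp (- quad l s / 2)))) \<partial>lborel)"
    by (rule nn_integral_cmult) measurable
  also have "(\<integral>\<^sup>+s. det_const e * ((\<Prod>i\<in>UNIV. ennreal (s $ i)) * (ennreal (quad l s) * ennreal (exp (- quad l s / 2)))) \<partial>lborel)
    = det_const e * (\<integral>\<^sup>+s. (\<Prod>i\<in>UNIV. ennreal (s $ i)) * (ennreal (quad l s) * ennreal (exp (- quad l s / 2))) \<partial>lborel)"
    by (rule nn_integral_cmult) measurable
  finally show ?thesis .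
qed

text \<open>The factor \<open>quad l s\<close> only contributes a constant, by homogeneity: write \<open>exp (- q / 2)\<close> as an
  integral of \<open>q * v * exp (- v\<^sup>2 * q / 2)\<close> over \<open>v \<ge> 1\<close> and rescale.\<close>

lemma nn_integral_quad_factor:
  fixes l :: "real ^ 'n"
  shows "(\<integral>\<^sup>+s. (\<Prod>i\<in>UNIV. ennreal (s $ i)) * (ennreal (quad l s) * ennreal (exp (- quad l s / 2))) \<partial>lborel)
    = ennreal (2 * CARD('n)) * (\<integral>\<^sup>+s. (\<Prod>i\<in>UNIV. ennreal (s $ i)) * ennreal (exp (- quad l s / 2)) \<partial>lborel)"
proof -
  let ?d = "CARD('n)"
  have d0: "?d > 0" by (rule zero_less_card_finite)
  define H where "H = (\<lambda>s::real^'n. (\<Prod>i\<in>UNIV. ennreal (s $ i)) * (ennreal (quad l s) * ennreal (exp (- quad l s / 2))))"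
  have [measurable]: "H \<in> borel_measurable borel"
    unfolding H_def by measurable
  have int1: "ennreal (exp (- q / 2)) = (\<integral>\<^sup>+v. ennreal (q * v * exp (- v\<^sup>2 * q / 2)) * indicator {1..} v \<partial>lborel)" if "q > 0" for q :: real
  proof -
    have "(\<integral>\<^sup>+v. ennreal (q * v * exp (- v\<^sup>2 * q / 2)) * indicator {1..} v \<partial>lborel) = ennreal (0 - (- exp (- 1\<^sup>2 * q / 2)))"
    proof (rule nn_integral_FTC_atLeast[where F = "\<lambda>v. - exp (- v\<^sup>2 * q / 2)"])
      show "((\<lambda>v. - exp (- v\<^sup>2 * q / 2)) \<longlongrightarrow> 0) at_top"
        using that by real_asymp
    qed (use that in \<open>auto intro!: derivative_eq_intros\<close>)
    then show ?thesis by simp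
  qed
  \<comment> \<open>The exponent has three sources: degree d of the product and degree 2 of
    \<open>quad\<close> in \<open>H (v *\<^sub>R s)\<close>, and a further d from rescaling
    \<open>s\<close>. Its integral is the reciprocal of the factor 2 d in the claim.\<close>
  have int2: "(\<integral>\<^sup>+v. ennreal (v / v ^ (2 * ?d + 2)) * indicator {1..} v \<partial>lborel) = ennreal (1 / (2 * ?d))"
  proof -
    obtain p where p: "2 * ?d = Suc p" using d0 by (metis mult_pos_pos not0_implies_Suc less_not_refl zero_less_numeral)
    then have p': "2 * real ?d = real (Suc p)" by (metis of_nat_mult of_nat_numeral)
    have "(\<integral>\<^sup>+v. ennreal (v / v ^ (Suc p + 2)) * indicator {1..} v \<partial>lborel) = ennreal (0 - (- 1 / real (Suc p) * (1 / 1) ^ Suc p))"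
    proof (rule nn_integral_FTC_atLeast[where F = "\<lambda>v. - 1 / real (Suc p) * (1 / v) ^ Suc p"])
      have "((\<lambda>v::real. 1 / v) \<longlongrightarrow> 0) at_top"
        by real_asymp
      from tendsto_mult_left[OF tendsto_power[OF this, of "Suc p"], of "- 1 / real (Suc p)"]
      show "((\<lambda>v::real. - 1 / real (Suc p) * (1 / v) ^ Suc p) \<longlongrightarrow> 0) at_top"
        by simp
      fix v :: real assume v: "1 \<le> v"
      show "DERIV (\<lambda>v. - 1 / real (Suc p) * (1 / v) ^ Suc p) v :> v / v ^ (Suc p + 2)"
        using v by (auto intro!: derivative_eq_intros simp: divide_simps power2_eq_square power_one_over simp del: of_nat_Suc)
          (cases p, simp_all add: algebra_simps)
    qed auto
    then show ?thesis unfolding p p' by simp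
  qed
  have "(\<integral>\<^sup>+s. (\<Prod>i\<in>UNIV. ennreal (s $ i)) * ennreal (exp (- quad l s / 2)) \<partial>lborel)
    = (\<integral>\<^sup>+s. \<integral>\<^sup>+v. ennreal (v / v ^ (?d + 2)) * indicator {1..} v * H (v *\<^sub>R s) \<partial>lborel \<partial>lborel)"
  proof (rule nn_integral_cong)
    fix s :: "real^'n"
    show "(\<Prod>i\<in>UNIV. ennreal (s $ i)) * ennreal (exp (- quad l s / 2)) = (\<integral>\<^sup>+v. ennreal (v / v ^ (?d + 2)) * indicator {1..} v * H (v *\<^sub>R s) \<partial>lborel)"
    proof (cases "\<forall>i. s $ i > 0")
      case False
      then obtain i where i: "s $ i \<le> 0" by (auto simp: not_less)
      have 1: "(\<Prod>i\<in>UNIV. ennreal (s $ i)) = 0"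
        using i by (intro prod_zero) (auto simp: ennreal_neg intro!: exI[of _ i])
      have z: "indicator {1..} v * H (v *\<^sub>R s) = 0" for v
      proof (cases "v \<ge> 1")
        case True
        then have "v * s $ i \<le> 0" using i by (simp add: mult_nonneg_nonpos)
        then have "(\<Prod>i\<in>UNIV. ennreal ((v *\<^sub>R s) $ i)) = 0"
          by (intro prod_zero) (auto simp: ennreal_neg intro!: exI[of _ i])
        then show ?thesis by (simp add: H_def)
      qed simp
      show ?thesis by (simp only: 1 mult.assoc z mult_zero_left mult_zero_right nn_integral_const)
    next
      case True
      then have "s \<noteq> 0" by (auto simp: vec_eq_iff less_le)
      then have q: "quad l s > 0" by (simp add: quad_def add_pos_nonneg)
      have "(\<Prod>i\<in>UNIV. ennreal (s $ i)) * ennreal (exp (- quad l s / 2)) = (\<integral>\<^sup>+v. (\<Prod>i\<in>UNIV. ennreal (s $ i)) * (ennreal (quad l s * v * exp (- v\<^sup>2 * quad l s / 2)) * indicator {1..} v) \<partial>lborel)"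
        unfolding int1[OF q] by (rule nn_integral_cmult[symmetric]) measurable
      also have "\<dots> = (\<integral>\<^sup>+v. ennreal (v / v ^ (?d + 2)) * indicator {1..} v * H (v *\<^sub>R s) \<partial>lborel)"
      proof (rule nn_integral_cong)
        fix v :: real
        show "(\<Prod>i\<in>UNIV. ennreal (s $ i)) * (ennreal (quad l s * v * exp (- v\<^sup>2 * quad l s / 2)) * indicator {1..} v) = ennreal (v / v ^ (?d + 2)) * indicator {1..} v * H (v *\<^sub>R s)"
        proof (cases "v \<ge> 1")
          case v: True
          have p: "(\<Prod>i\<in>UNIV. ennreal (c * s $ i)) = ennreal (\<Prod>i\<in>UNIV. c * s $ i)" if "c \<ge> 0" for c
            using True that by (intro prod_ennreal) (auto simp: less_imp_le)
          have qv: "quad l (v *\<^sub>R s) = v\<^sup>2 * quad l s"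
            by (simp add: quad_def power_mult_distrib algebra_simps)
          have P0: "(\<Prod>i\<in>UNIV. s $ i) \<ge> 0" using True by (intro prod_nonneg) (auto simp: less_imp_le)
          have "(\<Prod>i\<in>UNIV. s $ i) * (quad l s * v * exp (- v\<^sup>2 * quad l s / 2))
            = v / v ^ (?d + 2) * ((\<Prod>i\<in>UNIV. v * s $ i) * (v\<^sup>2 * quad l s * exp (- (v\<^sup>2 * quad l s) / 2)))"
            using v by (simp add: prod.distrib power_add power2_eq_square)
          then have "ennreal (\<Prod>i\<in>UNIV. 1 * s $ i) * ennreal (quad l s * v * exp (- v\<^sup>2 * quad l s / 2))
            = ennreal (v / v ^ (?d + 2)) * (ennreal (\<Prod>i\<in>UNIV. v * s $ i) * (ennreal (v\<^sup>2 * quad l s) * ennreal (exp (- (v\<^sup>2 * quad l s) / 2))))"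
            using v q P0 by (simp add: ennreal_mult'[symmetric] prod.distrib)
          then have "(\<Prod>i\<in>UNIV. ennreal (1 * s $ i)) * ennreal (quad l s * v * exp (- v\<^sup>2 * quad l s / 2))
            = ennreal (v / v ^ (?d + 2)) * ((\<Prod>i\<in>UNIV. ennreal (v * s $ i)) * (ennreal (v\<^sup>2 * quad l s) * ennreal (exp (- (v\<^sup>2 * quad l s) / 2))))"
            using v by (simp only: p zero_le_one order_trans[OF zero_le_one])
          then show ?thesis using v by (simp add: H_def qv)
        qed simp
      qed
      finally show ?thesis .
    qed
  qed
  also have "\<dots> = (\<integral>\<^sup>+v. \<integral>\<^sup>+s. ennreal (v / v ^ (?d + 2)) * indicator {1..} v * H (v *\<^sub>R s) \<partial>lborel \<partial>lborel)"
    by (rule lborel_pair.Fubini') measurable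
  also have "\<dots> = (\<integral>\<^sup>+v. ennreal (v / v ^ (2 * ?d + 2)) * indicator {1..} v * (\<integral>\<^sup>+s. H s \<partial>lborel) \<partial>lborel)"
  proof (rule nn_integral_cong)
    fix v :: real
    show "(\<integral>\<^sup>+s. ennreal (v / v ^ (?d + 2)) * indicator {1..} v * H (v *\<^sub>R s) \<partial>lborel) = ennreal (v / v ^ (2 * ?d + 2)) * indicator {1..} v * (\<integral>\<^sup>+s. H s \<partial>lborel)"
    proof (cases "v \<ge> 1")
      case True
      have "(\<integral>\<^sup>+s. H s \<partial>lborel) = ennreal (\<bar>v\<bar> ^ ?d) * (\<integral>\<^sup>+s. H (v *\<^sub>R s) \<partial>lborel)"
        using True nn_integral_lborel_scale[of v H] by simp
      moreover have "ennreal (v / v ^ (2 * ?d + 2)) * ennreal (\<bar>v\<bar> ^ ?d) = ennreal (v / v ^ (?d + 2))"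
        using True by (subst ennreal_mult'[symmetric]) (auto simp: mult_2 power_add)
      ultimately show ?thesis using True
        by (simp add: nn_integral_cmult mult.assoc[symmetric])
    qed simp
  qed
  also have "\<dots> = ennreal (1 / (2 * ?d)) * (\<integral>\<^sup>+s. H s \<partial>lborel)"
    by (subst nn_integral_multc) (measurable, simp only: int2)
  finally have "ennreal (2 * ?d) * (\<integral>\<^sup>+s. (\<Prod>i\<in>UNIV. ennreal (s $ i)) * ennreal (exp (- quad l s / 2)) \<partial>lborel)
    = (ennreal (2 * ?d) * ennreal (1 / (2 * ?d))) * (\<integral>\<^sup>+s. H s \<partial>lborel)"
    by (simp add: mult.assoc)
  also have "ennreal (2 * ?d) * ennreal (1 / (2 * ?d)) = 1"
    using d0 by (subst ennreal_mult'[symmetric]) auto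
  finally show ?thesis by (simp add: H_def)
qed

text \<open>The power of \<open>1 + (norm l)\<^sup>2\<close> is an integral over
  \<open>\<tau>\<close> with weight \<open>\<tau>\<close> to the power d. Putting
  \<open>l $ i = q $ i / (\<tau> * s $ i)\<close> makes \<open>s \<bullet> l\<close> the sum of the
  \<open>q $ i\<close> divided by \<open>\<tau>\<close>, so the exponent separates into d + 1 terms
  of the shape \<open>s\<^sup>2 + q\<^sup>2 / s\<^sup>2\<close>, each evaluated by
  \<open>nn_integral_gauss_inverse_gauss\<close>.\<close>

lemma orthant_integral:
  fixes I :: "'n::finite set"
  shows "gauss_moment (CARD('n)) * (\<integral>\<^sup>+(l::real^'n). (\<Prod>i\<in>I. indicator {0<..} (l $ i)) * (ennreal (1 / sqrt (1 + (norm l)\<^sup>2) ^ (CARD('n) + 1)) *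
     (\<integral>\<^sup>+s. (\<Prod>i\<in>UNIV. ennreal (s $ i)) * ennreal (exp (- quad l s / 2)) \<partial>lborel)) \<partial>lborel)
    = ennreal (sqrt (pi / 2)) ^ (CARD('n) + 1) * (\<integral>\<^sup>+q. (\<Prod>i\<in>UNIV. if i \<in> I then exp_pos (q i) else exp_abs (q i)) * exp_abs (\<Sum>i\<in>UNIV. q i) \<partial>(PiM UNIV (\<lambda>_. lborel)))"
proof -
  let ?d = "CARD('n)"
  define T where "T = (\<lambda>\<tau> (l::real^'n). ennreal (\<tau> ^ ?d * exp (- (\<tau>\<^sup>2 * (1 + (norm l)\<^sup>2)) / 2)) * indicator {0<..} \<tau>)"
  define IP where "IP = (\<lambda>l::real^'n. (\<Prod>i\<in>I. indicator {0<..} (l $ i)) :: ennreal)"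
  define S where "S = (\<lambda>s l::real^'n. (\<Prod>i\<in>UNIV. ennreal (s $ i)) * ennreal (exp (- quad l s / 2)))"
  have [measurable]: "case_prod T \<in> borel_measurable (borel \<Otimes>\<^sub>M borel)" "IP \<in> borel_measurable borel"
     "case_prod S \<in> borel_measurable (borel \<Otimes>\<^sub>M borel)"
    unfolding T_def IP_def S_def by measurable
  define R where "R = (\<lambda>q s. ennreal (exp (- (s\<^sup>2 + q\<^sup>2 / s\<^sup>2) / 2)) * indicator {0<..} (s::real))"
  have R: "(\<integral>\<^sup>+s. R q s \<partial>lborel) = ennreal (sqrt (pi / 2)) * exp_abs q" for q
    unfolding R_def by (rule nn_integral_gauss_inverse_gauss)
  have [measurable]: "case_prod R \<in> borel_measurable (borel \<Otimes>\<^sub>M borel)"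
    unfolding R_def by measurable
  have "gauss_moment ?d * (\<integral>\<^sup>+l. IP l * (ennreal (1 / sqrt (1 + (norm l)\<^sup>2) ^ (?d + 1)) * (\<integral>\<^sup>+s. S s l \<partial>lborel)) \<partial>lborel)
    = (\<integral>\<^sup>+l. IP l * ((\<integral>\<^sup>+\<tau>. T \<tau> l \<partial>lborel) * (\<integral>\<^sup>+s. S s l \<partial>lborel)) \<partial>lborel)"
  proof -
    have "(\<integral>\<^sup>+\<tau>. T \<tau> l \<partial>lborel) = ennreal (1 / sqrt (1 + (norm l)\<^sup>2) ^ (?d + 1)) * gauss_moment ?d" for l
      using nn_integral_gauss_moment_scaled[of "sqrt (1 + (norm l)\<^sup>2)" ?d]
      by (simp add: T_def add_pos_nonneg)
    then show ?thesis
      by (subst nn_integral_cmult[symmetric]) (measurable, simp add: ac_simps)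
  qed
  also have "\<dots> = (\<integral>\<^sup>+l. \<integral>\<^sup>+\<tau>. \<integral>\<^sup>+s. IP l * T \<tau> l * S s l \<partial>lborel \<partial>lborel \<partial>lborel)"
    by (simp add: nn_integral_cmult nn_integral_multc mult.assoc)
  also have "\<dots> = (\<integral>\<^sup>+\<tau>. \<integral>\<^sup>+l. \<integral>\<^sup>+s. IP l * T \<tau> l * S s l \<partial>lborel \<partial>lborel \<partial>lborel)"
    by (rule lborel_pair.Fubini') measurable
  also have "\<dots> = (\<integral>\<^sup>+\<tau>. \<integral>\<^sup>+s. \<integral>\<^sup>+l. IP l * T \<tau> l * S s l \<partial>lborel \<partial>lborel \<partial>lborel)"
    by (intro nn_integral_cong lborel_pair.Fubini') measurable
  also have "\<dots> = (\<integral>\<^sup>+\<tau>. \<integral>\<^sup>+s. \<integral>\<^sup>+q. IP q * R (\<Sum>i\<in>UNIV. q $ i) \<tau> * (\<Prod>i\<in>UNIV. R (q $ i) (s $ i)) \<partial>lborel \<partial>lborel \<partial>lborel)"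
  proof (rule nn_integral_cong, rule nn_integral_cong)
    fix \<tau> :: real and s :: "real^'n"
    show "(\<integral>\<^sup>+l. IP l * T \<tau> l * S s l \<partial>lborel) = (\<integral>\<^sup>+q. IP q * R (\<Sum>i\<in>UNIV. q $ i) \<tau> * (\<Prod>i\<in>UNIV. R (q $ i) (s $ i)) \<partial>lborel)"
    proof (cases "\<tau> > 0 \<and> (\<forall>i. s $ i > 0)")
      case False
      then consider "\<tau> \<le> 0" | i where "s $ i \<le> 0" by (auto simp: not_less)
      then show ?thesis
      proof cases
        case 1
        then show ?thesis by (simp add: T_def R_def)
      next
        case 2
        have "(\<Prod>i\<in>UNIV. ennreal (s $ i)) = 0" "(\<Prod>i\<in>UNIV. R (q $ i) (s $ i)) = 0" for q
          using 2 by (intro prod_zero; auto simp: ennreal_neg R_def intro!: exI[of _ i])+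
        then show ?thesis by (simp only: S_def mult_zero_left mult_zero_right nn_integral_const)
      qed
    next
      case True
      then have t: "\<tau> > 0" and s: "\<And>i. s $ i > 0" by auto
      have "(\<integral>\<^sup>+l. IP l * T \<tau> l * S s l \<partial>lborel) = (\<Prod>i\<in>UNIV. ennreal (\<bar>1 / (\<tau> * s $ i)\<bar> ^ DIM(real))) * (\<integral>\<^sup>+q. IP (\<chi> i. (1 / (\<tau> * s $ i)) *\<^sub>R q $ i) * T \<tau> (\<chi> i. (1 / (\<tau> * s $ i)) *\<^sub>R q $ i) * S s (\<chi> i. (1 / (\<tau> * s $ i)) *\<^sub>R q $ i) \<partial>lborel)"
        using t s by (intro nn_integral_lborel_vec_subst_rows nn_integral_lborel_scale) (auto simp: less_le)
      also have "\<dots> = (\<integral>\<^sup>+q. (\<Prod>i\<in>UNIV. ennreal (\<bar>1 / (\<tau> * s $ i)\<bar> ^ DIM(real))) * (IP (\<chi> i. (1 / (\<tau> * s $ i)) *\<^sub>R q $ i) * T \<tau> (\<chi> i. (1 / (\<tau> * s $ i)) *\<^sub>R q $ i) * S s (\<chi> i. (1 / (\<tau> * s $ i)) *\<^sub>R q $ i)) \<partial>lborel)"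
        by (rule nn_integral_cmult[symmetric]) measurable
      also have "\<dots> = (\<integral>\<^sup>+q. IP q * R (\<Sum>i\<in>UNIV. q $ i) \<tau> * (\<Prod>i\<in>UNIV. R (q $ i) (s $ i)) \<partial>lborel)"
      proof (rule nn_integral_cong)
        fix q :: "real^'n"
        define l where "l = (\<chi> i. (1 / (\<tau> * s $ i)) *\<^sub>R q $ i)"
        have li: "l $ i = q $ i / (\<tau> * s $ i)" for i by (simp add: l_def)
        have "(0 < q $ i / (\<tau> * s $ i)) = (0 < q $ i)" for i
          using mult_pos_pos[OF t s[of i]] by (simp only: zero_less_divide_iff) (auto dest: less_asym)
        then have 1: "IP l = IP q"
          by (simp only: IP_def li indicator_def greaterThan_iff)
        have nl: "\<tau>\<^sup>2 * (norm l)\<^sup>2 = (\<Sum>i\<in>UNIV. (q $ i)\<^sup>2 / (s $ i)\<^sup>2)"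
          using t by (simp add: norm_vec_def L2_set_def sum_nonneg li sum_distrib_left power_divide power_mult_distrib)
        have "s \<bullet> l = (\<Sum>i\<in>UNIV. q $ i / \<tau>)"
          unfolding inner_vec_def using s by (intro sum.cong) (auto simp: li less_le)
        then have sl: "s \<bullet> l = (\<Sum>i\<in>UNIV. q $ i) / \<tau>" by (simp add: sum_divide_distrib)
        have ns: "(norm s)\<^sup>2 = (\<Sum>i\<in>UNIV. (s $ i)\<^sup>2)"
          by (simp add: norm_vec_def L2_set_def sum_nonneg)
        have "exp (- (\<tau>\<^sup>2 * (1 + (norm l)\<^sup>2)) / 2) * exp (- quad l s / 2) = exp (- (\<tau>\<^sup>2 + (\<Sum>i\<in>UNIV. q $ i)\<^sup>2 / \<tau>\<^sup>2) / 2) * exp (\<Sum>i\<in>UNIV. - ((s $ i)\<^sup>2 + (q $ i)\<^sup>2 / (s $ i)\<^sup>2) / 2)"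
        proof -
          have "(\<Sum>i\<in>UNIV. - ((s $ i)\<^sup>2 + (q $ i)\<^sup>2 / (s $ i)\<^sup>2) / 2) = - ((norm s)\<^sup>2 + \<tau>\<^sup>2 * (norm l)\<^sup>2) / 2"
            unfolding ns nl by (simp add: sum.distrib sum_divide_distrib sum_negf sum_subtractf diff_divide_distrib add_divide_distrib)
          then show ?thesis
            unfolding exp_add[symmetric] quad_def sl by (simp add: algebra_simps power_divide add_divide_distrib diff_divide_distrib)
        qed
        moreover have "exp (\<Sum>i\<in>UNIV. - ((s $ i)\<^sup>2 + (q $ i)\<^sup>2 / (s $ i)\<^sup>2) / 2) = (\<Prod>i\<in>UNIV. exp (- ((s $ i)\<^sup>2 + (q $ i)\<^sup>2 / (s $ i)\<^sup>2) / 2))"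
          by (rule exp_sum) simp
        ultimately have e: "ennreal (exp (- (\<tau>\<^sup>2 * (1 + (norm l)\<^sup>2)) / 2)) * ennreal (exp (- quad l s / 2)) = R (\<Sum>i\<in>UNIV. q $ i) \<tau> * (\<Prod>i\<in>UNIV. R (q $ i) (s $ i))"
          using t s by (simp add: R_def ennreal_mult'[symmetric] prod_ennreal)
        \<comment> \<open>The Jacobian cancels the power of \<open>\<tau>\<close> and the product of
          the \<open>s $ i\<close> completely. This is where the exponent 2 of the intensity is
          decisive: another exponent would leave powers of the \<open>s $ i\<close> behind.\<close>
        have "(\<Prod>i\<in>UNIV. \<bar>1 / (\<tau> * s $ i)\<bar>) * (\<tau> ^ ?d * (\<Prod>i\<in>UNIV. s $ i)) = (\<Prod>i\<in>UNIV. \<bar>1 / (\<tau> * s $ i)\<bar> * (\<tau> * s $ i))"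
          by (simp only: prod.distrib prod_constant)
        also have "\<dots> = 1" using t s by (intro prod.neutral) (auto simp: less_le mult_pos_pos abs_mult)
        finally have "ennreal ((\<Prod>i\<in>UNIV. \<bar>1 / (\<tau> * s $ i)\<bar>) * (\<tau> ^ ?d * (\<Prod>i\<in>UNIV. s $ i))) = 1" by simp
        then have "ennreal (\<Prod>i\<in>UNIV. \<bar>1 / (\<tau> * s $ i)\<bar>) * (ennreal (\<tau> ^ ?d) * ennreal (\<Prod>i\<in>UNIV. s $ i)) = 1"
          using t s by (simp add: ennreal_mult' prod_nonneg less_imp_le)
        then have c: "(\<Prod>i\<in>UNIV. ennreal \<bar>1 / (\<tau> * s $ i)\<bar>) * (ennreal (\<tau> ^ ?d) * (\<Prod>i\<in>UNIV. ennreal (s $ i))) = 1"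
          using s by (simp add: prod_ennreal less_imp_le)
        have "(\<Prod>i\<in>UNIV. ennreal (\<bar>1 / (\<tau> * s $ i)\<bar> ^ DIM(real))) * (IP l * T \<tau> l * S s l)
           = ((\<Prod>i\<in>UNIV. ennreal \<bar>1 / (\<tau> * s $ i)\<bar>) * (ennreal (\<tau> ^ ?d) * (\<Prod>i\<in>UNIV. ennreal (s $ i)))) * (IP q * (ennreal (exp (- (\<tau>\<^sup>2 * (1 + (norm l)\<^sup>2)) / 2)) * ennreal (exp (- quad l s / 2))))"
          unfolding T_def S_def 1 using t by (simp add: ennreal_mult' ac_simps)
        also have "\<dots> = IP q * R (\<Sum>i\<in>UNIV. q $ i) \<tau> * (\<Prod>i\<in>UNIV. R (q $ i) (s $ i))"
          unfolding c e by (simp add: mult.assoc)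
        finally show "(\<Prod>i\<in>UNIV. ennreal (\<bar>1 / (\<tau> * s $ i)\<bar> ^ DIM(real))) * (IP (\<chi> i. (1 / (\<tau> * s $ i)) *\<^sub>R q $ i) * T \<tau> (\<chi> i. (1 / (\<tau> * s $ i)) *\<^sub>R q $ i) * S s (\<chi> i. (1 / (\<tau> * s $ i)) *\<^sub>R q $ i)) = IP q * R (\<Sum>i\<in>UNIV. q $ i) \<tau> * (\<Prod>i\<in>UNIV. R (q $ i) (s $ i))"
          unfolding l_def .
      qed
      finally show ?thesis .
    qed
  qed
  also have "\<dots> = (\<integral>\<^sup>+\<tau>. \<integral>\<^sup>+q. \<integral>\<^sup>+s. IP q * R (\<Sum>i\<in>UNIV. q $ i) \<tau> * (\<Prod>i\<in>UNIV. R (q $ i) (s $ i)) \<partial>lborel \<partial>lborel \<partial>lborel)"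
    by (intro nn_integral_cong lborel_pair.Fubini') measurable
  also have "\<dots> = (\<integral>\<^sup>+q. \<integral>\<^sup>+\<tau>. \<integral>\<^sup>+s. IP q * R (\<Sum>i\<in>UNIV. q $ i) \<tau> * (\<Prod>i\<in>UNIV. R (q $ i) (s $ i)) \<partial>lborel \<partial>lborel \<partial>lborel)"
    by (rule lborel_pair.Fubini') measurable
  also have "\<dots> = (\<integral>\<^sup>+(q::real^'n). IP q * ((\<integral>\<^sup>+\<tau>. R (\<Sum>i\<in>UNIV. q $ i) \<tau> \<partial>lborel) * (\<integral>\<^sup>+(s::real^'n). (\<Prod>i\<in>UNIV. R (q $ i) (s $ i)) \<partial>lborel)) \<partial>lborel)"
    by (simp add: nn_integral_cmult nn_integral_multc mult.assoc)
  also have "\<dots> = (\<integral>\<^sup>+(q::real^'n). ennreal (sqrt (pi / 2)) ^ (?d + 1) * ((\<Prod>i\<in>UNIV. if i \<in> I then exp_pos (q $ i) else exp_abs (q $ i)) * exp_abs (\<Sum>i\<in>UNIV. q $ i)) \<partial>lborel)"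
  proof (rule nn_integral_cong)
    fix q :: "real^'n"
    have "(\<integral>\<^sup>+(s::real^'n). (\<Prod>i\<in>UNIV. R (q $ i) (s $ i)) \<partial>lborel) = (\<Prod>i\<in>UNIV. \<integral>\<^sup>+s. R (q $ i) s \<partial>lborel)"
      by (rule prod_nn_integral_lborel_vec[symmetric]) measurable
    also have "\<dots> = ennreal (sqrt (pi / 2)) ^ ?d * (\<Prod>i\<in>UNIV. exp_abs (q $ i))"
      by (simp add: R prod.distrib)
    finally have 1: "(\<integral>\<^sup>+(s::real^'n). (\<Prod>i\<in>UNIV. R (q $ i) (s $ i)) \<partial>lborel) = ennreal (sqrt (pi / 2)) ^ ?d * (\<Prod>i\<in>UNIV. exp_abs (q $ i))" .
    have "IP q = (\<Prod>i\<in>UNIV. if i \<in> I then indicator {0<..} (q $ i) else 1)"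
      unfolding IP_def by (simp add: prod.If_cases)
    then have 2: "IP q * (\<Prod>i\<in>UNIV. exp_abs (q $ i)) = (\<Prod>i\<in>UNIV. if i \<in> I then exp_pos (q $ i) else exp_abs (q $ i))"
      by (simp add: prod.distrib[symmetric]) (auto intro!: prod.cong simp: exp_pos_def exp_abs_def indicator_def)
    show "IP q * ((\<integral>\<^sup>+\<tau>. R (\<Sum>i\<in>UNIV. q $ i) \<tau> \<partial>lborel) * (\<integral>\<^sup>+(s::real^'n). (\<Prod>i\<in>UNIV. R (q $ i) (s $ i)) \<partial>lborel))
      = ennreal (sqrt (pi / 2)) ^ (?d + 1) * ((\<Prod>i\<in>UNIV. if i \<in> I then exp_pos (q $ i) else exp_abs (q $ i)) * exp_abs (\<Sum>i\<in>UNIV. q $ i))"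
      unfolding 1 R 2[symmetric] by (simp add: ac_simps)
  qed
  also have "\<dots> = ennreal (sqrt (pi / 2)) ^ (?d + 1) * (\<integral>\<^sup>+(q::real^'n). (\<Prod>i\<in>UNIV. if i \<in> I then exp_pos (q $ i) else exp_abs (q $ i)) * exp_abs (\<Sum>i\<in>UNIV. q $ i) \<partial>lborel)"
    by (rule nn_integral_cmult) measurable
  also have "(\<integral>\<^sup>+(q::real^'n). (\<Prod>i\<in>UNIV. if i \<in> I then exp_pos (q $ i) else exp_abs (q $ i)) * exp_abs (\<Sum>i\<in>UNIV. q $ i) \<partial>lborel)
    = (\<integral>\<^sup>+q. (\<Prod>i\<in>UNIV. if i \<in> I then exp_pos (q i) else exp_abs (q i)) * exp_abs (\<Sum>i\<in>UNIV. q i) \<partial>(PiM UNIV (\<lambda>_. lborel)))"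
    by (subst nn_integral_lborel_vec) (measurable, simp cong: if_cong)
  finally show ?thesis
    unfolding IP_def S_def .
qed

text \<open>The dependence on \<open>I\<close> sits entirely in the orthant integral. The integral
  over \<open>w\<close>, \<open>det_const\<close> and the Gaussian constants are collected in
  \<open>A\<close>, whose value and finiteness emerge only when the empty face is counted.\<close>

theorem facet_integral_binomial:
  fixes \<kappa> :: real
  shows "\<exists>A. \<forall>I::'n::finite set. facet_integral \<kappa> I = A * of_nat ((CARD('n) + card (- I)) choose card (- I))"
proof -
  let ?d = "CARD('n)"
  obtain e :: 'n where True by simp
  define B where "B = (\<integral>\<^sup>+(w::real^'n). ennreal (exp (- \<kappa> * (norm w)\<^sup>2)) * ennreal (norm w ^ ?d) \<partial>lborel)"
  let ?G = "gauss_moment (?d + 1) ^ ?d"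
  let ?H = "gauss_moment ?d"
  have G: "?G \<noteq> 0" "?G \<noteq> \<infinity>" and H: "?H \<noteq> 0" "?H \<noteq> \<infinity>"
    using gauss_moment_finite gauss_moment_pos by (auto simp: less_le power_eq_top_ennreal zero_less_iff_neq_zero)
  define A where "A = inverse ?G * (inverse ?H * (B * (det_const e * (ennreal (2 * ?d) * (ennreal (sqrt (pi / 2)) ^ (?d + 1) * inverse (2 ^ ?d))))))"
  have "facet_integral \<kappa> I = A * of_nat ((?d + card (- I)) choose card (- I))" for I :: "'n set"
  proof -
    let ?J = "\<integral>\<^sup>+q. (\<Prod>i\<in>UNIV. if i \<in> I then exp_pos (q i) else exp_abs (q i)) * exp_abs (\<Sum>i\<in>UNIV. q i) \<partial>(PiM UNIV (\<lambda>_. lborel))"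
    define S where "S = (\<lambda>l::real^'n. \<integral>\<^sup>+s. (\<Prod>i\<in>UNIV. ennreal (s $ i)) * ennreal (exp (- quad l s / 2)) \<partial>lborel)"
    have [measurable]: "S \<in> borel_measurable borel"
      unfolding S_def by measurable
    have cmult3: "(\<integral>\<^sup>+l. a * (b * (c * f l)) \<partial>lborel) = a * (b * (c * (\<integral>\<^sup>+l. f l \<partial>lborel)))"
      if "f \<in> borel_measurable borel" for a b c and f :: "real^'n \<Rightarrow> ennreal"
      using that by (simp add: nn_integral_cmult)
    define Q where "Q = (\<integral>\<^sup>+(l::real^'n). (\<Prod>i\<in>I. indicator {0<..} (l $ i)) * (ennreal (1 / sqrt (1 + (norm l)\<^sup>2) ^ (?d + 1)) * S l) \<partial>lborel)"
    have "?G * facet_integral \<kappa> I = (\<integral>\<^sup>+(w::real^'n). (ennreal (exp (- \<kappa> * (norm w)\<^sup>2)) * ennreal (norm w ^ ?d)) * (det_const e * (ennreal (2 * ?d) * Q)) \<partial>lborel)"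
      unfolding facet_integral_eq2
    proof (rule nn_integral_cong)
      fix w :: "real^'n"
      have "(\<integral>\<^sup>+l. (\<Prod>i\<in>I. indicator {0<..} (l $ i)) * det_integral w l \<partial>lborel)
        = (\<integral>\<^sup>+l. ennreal (norm w ^ ?d) * (det_const e * (ennreal (2 * ?d) * ((\<Prod>i\<in>I. indicator {0<..} (l $ i)) * (ennreal (1 / sqrt (1 + (norm l)\<^sup>2) ^ (?d + 1)) * S l)))) \<partial>lborel)"
        unfolding det_integral_rotate[of w _ e] det_integral_axis nn_integral_quad_factor S_def by (simp only: ac_simps)
      also have "\<dots> = ennreal (norm w ^ ?d) * (det_const e * (ennreal (2 * ?d) * Q))"
        unfolding Q_def by (rule cmult3) measurable
      finally show "ennreal (exp (- \<kappa> * (norm w)\<^sup>2)) * (\<integral>\<^sup>+l. (\<Prod>i\<in>I. indicator {0<..} (l $ i)) * det_integral w l \<partial>lborel) =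
        (ennreal (exp (- \<kappa> * (norm w)\<^sup>2)) * ennreal (norm w ^ ?d)) * (det_const e * (ennreal (2 * ?d) * Q))"
        by (simp add: mult.assoc)
    qed
    also have "\<dots> = B * (det_const e * (ennreal (2 * ?d) * Q))"
      unfolding B_def by (rule nn_integral_multc) measurable
    finally have 1: "?G * facet_integral \<kappa> I = B * (det_const e * (ennreal (2 * ?d) * Q))" .
    have 2: "?H * Q = ennreal (sqrt (pi / 2)) ^ (?d + 1) * ?J"
      unfolding Q_def S_def by (rule orthant_integral)
    have 3: "2 ^ ?d * ?J = of_nat ((?d + card (- I)) choose card (- I))"
      by (rule nn_integral_exp_kernels_UNIV)
    have c: "inverse x * (x * y) = y" if "x \<noteq> 0" "x \<noteq> \<infinity>" for x y :: ennreal
    proof -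
      have "inverse x * x = 1"
        using ennreal_divide_self[of x] that by (simp add: divide_ennreal_def mult.commute less_top)
      then show ?thesis by (simp add: mult.assoc[symmetric])
    qed
    have J: "?J = inverse (2 ^ ?d) * of_nat ((?d + card (- I)) choose card (- I))"
      unfolding 3[symmetric] by (rule c[symmetric]) (auto simp: power_eq_top_ennreal)
    have "facet_integral \<kappa> I = inverse ?G * (B * (det_const e * (ennreal (2 * ?d) * Q)))"
      using c[OF G, of "facet_integral \<kappa> I"] unfolding 1 by simp
    also have "Q = inverse ?H * (ennreal (sqrt (pi / 2)) ^ (?d + 1) * ?J)"
      using c[OF H, of Q] unfolding 2 by simp
    finally show ?thesis
      unfolding J A_def by (simp only: ac_simps)
  qed
  then show ?thesis by blast
qed

section \<open>The stable intensity\<close>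

lemma stable_intensity_2: "stable_intensity 2 = density lborel (power_density :: real ^ 'n \<Rightarrow> ennreal)"
  unfolding stable_intensity_def
proof (rule arg_cong[where f = "density lborel"], rule ext)
  fix x :: "real ^ 'n"
  show "(if x = 0 then 0 else ennreal (norm x powr - (real DIM(real ^ 'n) + 2))) = power_density x"
  proof (cases "x = 0")
    case False
    then have "norm x powr - (real DIM(real ^ 'n) + 2) = inverse (norm x powr real (CARD('n) + 2))"
      by (simp add: powr_minus[symmetric] algebra_simps)
    also have "\<dots> = 1 / norm x ^ (CARD('n) + 2)"
      using False by (subst powr_realpow) (auto simp: inverse_eq_divide)
    finally show ?thesis using False by (simp add: power_density_def)
  qed (simp add: power_density_def power_0_left)
qed

lemma sets_stable_intensity [simp, measurable_cong]: "sets (stable_intensity a) = sets borel"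
  by (simp add: stable_intensity_def)

lemma space_stable_intensity [simp]: "space (stable_intensity a) = UNIV"
  by (simp add: stable_intensity_def)

lemma emeasure_stable_intensity_2:
  fixes B :: "(real ^ 'n) set"
  assumes "B \<in> sets borel"
  shows "emeasure (stable_intensity 2) B = (\<integral>\<^sup>+x. power_density x * indicator B x \<partial>lborel)"
  using assms by (simp add: stable_intensity_2 emeasure_density)

lemma stable_intensity_2_null:
  fixes B :: "(real ^ 'n) set"
  assumes "B \<in> sets borel" "emeasure lborel B = 0"
  shows "emeasure (stable_intensity 2) B = 0"
proof -
  have "AE x in lborel. x \<notin> B"
    using assms by (auto intro!: AE_not_in null_setsI)
  then have "AE x in lborel. power_density x * indicator B x = 0"
    by eventually_elim simp
  then show ?thesis
    using assms(1) by (simp add: emeasure_stable_intensity_2 nn_integral_0_iff_AE)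
qed

section \<open>Halfspaces, dilates and open sets under the stable intensity\<close>

lemma nn_integral_gauss_vec:
  fixes f :: "real \<Rightarrow> ennreal" and e :: "'n::finite"
  assumes [measurable]: "f \<in> borel_measurable borel"
  shows "(\<integral>\<^sup>+(y::real^'n). ennreal (exp (- (norm y)\<^sup>2 / 2)) * f (y $ e) \<partial>lborel)
    = (\<integral>\<^sup>+y. ennreal (exp (- y\<^sup>2 / 2)) * f y \<partial>lborel) * (\<integral>\<^sup>+y. ennreal (exp (- y\<^sup>2 / 2)) \<partial>lborel) ^ (CARD('n) - 1)"
proof -
  let ?g = "\<lambda>i y. ennreal (exp (- y\<^sup>2 / 2)) * (if i = e then f y else 1)"
  have "ennreal (exp (- (norm y)\<^sup>2 / 2)) * f (y $ e) = (\<Prod>i\<in>UNIV. ?g i (y $ i))" for y :: "real^'n"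
  proof -
    have "exp (- (norm y)\<^sup>2 / 2) = exp (\<Sum>i\<in>UNIV. - (y $ i)\<^sup>2 / 2)"
      by (simp add: norm_vec_def L2_set_def sum_nonneg sum_negf sum_divide_distrib)
    also have "\<dots> = (\<Prod>i\<in>UNIV. exp (- (y $ i)\<^sup>2 / 2))"
      by (rule exp_sum) simp
    finally show ?thesis
      by (simp add: prod.distrib prod_ennreal prod.delta)
  qed
  then have "(\<integral>\<^sup>+(y::real^'n). ennreal (exp (- (norm y)\<^sup>2 / 2)) * f (y $ e) \<partial>lborel) = (\<integral>\<^sup>+(y::real^'n). (\<Prod>i\<in>UNIV. ?g i (y $ i)) \<partial>lborel)"
    by simp
  also have "\<dots> = (\<Prod>i\<in>UNIV. \<integral>\<^sup>+y. ?g i y \<partial>lborel)"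
    by (rule prod_nn_integral_lborel_vec[symmetric]) measurable
  also have "\<dots> = (\<integral>\<^sup>+y. ?g e y \<partial>lborel) * (\<Prod>i\<in>UNIV - {e}. \<integral>\<^sup>+y. ?g i y \<partial>lborel)"
    by (subst prod.remove[where x=e]) auto
  also have "(\<Prod>i\<in>UNIV - {e}. \<integral>\<^sup>+y. ?g i y \<partial>lborel) = (\<Prod>i\<in>UNIV - {e}. \<integral>\<^sup>+y. ennreal (exp (- y\<^sup>2 / 2)) \<partial>lborel)"
    by (intro prod.cong) auto
  finally show ?thesis by (simp add: card_Diff_singleton)
qed

lemma nn_integral_gauss: "(\<integral>\<^sup>+y. ennreal (exp (- y\<^sup>2 / 2)) \<partial>lborel) = ennreal (sqrt (2 * pi))"
proof -
  interpret prob_space std_normal_distribution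
    using real_dist_normal_dist by (simp add: real_distribution_def)
  have "1 = emeasure std_normal_distribution UNIV"
    using emeasure_space_1 by simp
  also have "\<dots> = (\<integral>\<^sup>+y. ennreal (std_normal_density y) \<partial>lborel)"
    by (simp add: emeasure_density)
  finally have "ennreal (sqrt (2 * pi)) = (\<integral>\<^sup>+y. ennreal (sqrt (2 * pi)) * ennreal (std_normal_density y) \<partial>lborel)"
    by (subst nn_integral_cmult) auto
  also have "\<dots> = (\<integral>\<^sup>+y. ennreal (exp (- y\<^sup>2 / 2)) \<partial>lborel)"
    by (intro nn_integral_cong) (simp add: ennreal_mult'[symmetric] std_normal_density_def)
  finally show ?thesis ..
qed

text \<open>With the radial variable, \<open>w \<bullet> x > 1\<close> becomes
  \<open>w \<bullet> y > \<rho>\<close> for a Gaussian \<open>y\<close> and weight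
  \<open>\<rho>\<close>. Integrating \<open>\<rho>\<close> up to \<open>w \<bullet> y\<close> gives
  half the square of the positive part, and a rotation turns this into
  \<open>(norm w)\<^sup>2\<close> times a one-dimensional second moment.\<close>

lemma stable_intensity_halfspace_aux:
  fixes w :: "real ^ 'n" and e :: 'n
  shows "gauss_moment (CARD('n) + 1) * emeasure (stable_intensity 2) {y. w \<bullet> y > 1}
    = ennreal ((norm w)\<^sup>2) * (ennreal (1/2) * gauss_moment 2 * ennreal (sqrt (2 * pi)) ^ (CARD('n) - 1))"
proof (cases "w = 0")
  case True
  then show ?thesis by simp
next
  case False
  let ?d = "CARD('n)"
  define h where "h = (\<lambda>(\<rho>::real) (x::real^'n). ennreal (\<rho> ^ (?d + 1) * exp (- (\<rho>\<^sup>2 * (norm x)\<^sup>2) / 2)) * indicator {0<..} \<rho> * indicator {y. w \<bullet> y > 1} x)"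
  have [measurable]: "case_prod h \<in> borel_measurable (borel \<Otimes>\<^sub>M borel)"
    unfolding h_def by measurable
  have "gauss_moment (?d + 1) * emeasure (stable_intensity 2) {y. w \<bullet> y > 1}
    = (\<integral>\<^sup>+x. (gauss_moment (?d + 1) * power_density x) * indicator {y. w \<bullet> y > 1} x \<partial>lborel)"
    by (subst emeasure_stable_intensity_2) (simp_all add: nn_integral_cmult mult.assoc)
  also have "\<dots> = (\<integral>\<^sup>+x. \<integral>\<^sup>+\<rho>. h \<rho> x \<partial>lborel \<partial>lborel)"
  proof (rule nn_integral_cong)
    fix x :: "real^'n"
    show "(gauss_moment (?d + 1) * power_density x) * indicator {y. w \<bullet> y > 1} x = (\<integral>\<^sup>+\<rho>. h \<rho> x \<partial>lborel)"
    proof (cases "w \<bullet> x > 1")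
      case True
      then have "x \<noteq> 0" by auto
      then show ?thesis unfolding h_def using True power_density_eq[of x] by (simp del: power_Suc)
    qed (simp add: h_def)
  qed
  also have "\<dots> = (\<integral>\<^sup>+\<rho>. \<integral>\<^sup>+x. h \<rho> x \<partial>lborel \<partial>lborel)"
    by (rule lborel_pair.Fubini') measurable
  also have "\<dots> = (\<integral>\<^sup>+\<rho>. \<integral>\<^sup>+y. ennreal (exp (- (norm y)\<^sup>2 / 2)) * (ennreal \<rho> * indicator {0..w \<bullet> y} \<rho>) \<partial>lborel \<partial>lborel)"
  proof (rule nn_integral_cong_AE, rule eventually_mono[OF AE_lborel_singleton[of "0::real"]])
    fix \<rho> :: real assume \<rho>: "\<rho> \<noteq> 0"
    show "(\<integral>\<^sup>+x. h \<rho> x \<partial>lborel) = (\<integral>\<^sup>+y. ennreal (exp (- (norm y)\<^sup>2 / 2)) * (ennreal \<rho> * indicator {0..w \<bullet> y} \<rho>) \<partial>lborel)"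
    proof (cases "\<rho> > 0")
      case True
      have "(\<integral>\<^sup>+x. h \<rho> x \<partial>lborel) = (\<integral>\<^sup>+y. ennreal (\<bar>1 / \<rho>\<bar> ^ ?d) * h \<rho> ((1 / \<rho>) *\<^sub>R y) \<partial>lborel)"
        using \<rho> by (subst nn_integral_lborel_scale[of "1 / \<rho>"]) (auto simp: nn_integral_cmult)
      also have "\<dots> = (\<integral>\<^sup>+y. ennreal (exp (- (norm y)\<^sup>2 / 2)) * (ennreal \<rho> * indicator {y. w \<bullet> y > \<rho>} y) \<partial>lborel)"
      proof (rule nn_integral_cong)
        fix y :: "real^'n"
        have "norm ((1 / \<rho>) *\<^sub>R y) = norm y / \<rho>" using True by simp
        then have 1: "\<rho>\<^sup>2 * (norm ((1 / \<rho>) *\<^sub>R y))\<^sup>2 = (norm y)\<^sup>2"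
          using True by (simp add: power_divide)
        have 2: "indicator {y. w \<bullet> y > 1} ((1 / \<rho>) *\<^sub>R y) = (indicator {y. w \<bullet> y > \<rho>} y :: ennreal)"
          using True by (auto simp: indicator_def field_simps)
        have "(1 / \<rho>) ^ ?d * \<rho> ^ ?d = 1"
          using True by (simp add: power_mult_distrib[symmetric])
        then have 3: "\<bar>1 / \<rho>\<bar> ^ ?d * (\<rho> ^ (?d + 1) * x) = x * \<rho>" for x
          using True by (simp add: mult.assoc[symmetric])
        have "ennreal (\<bar>1 / \<rho>\<bar> ^ ?d) * ennreal (\<rho> ^ (?d + 1) * exp (- (norm y)\<^sup>2 / 2)) = ennreal (exp (- (norm y)\<^sup>2 / 2)) * ennreal \<rho>"
          by (simp only: ennreal_mult'[symmetric] 3 zero_le_power abs_ge_zero exp_ge_zero)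
        then show "ennreal (\<bar>1 / \<rho>\<bar> ^ ?d) * h \<rho> ((1 / \<rho>) *\<^sub>R y) = ennreal (exp (- (norm y)\<^sup>2 / 2)) * (ennreal \<rho> * indicator {y. w \<bullet> y > \<rho>} y)"
          unfolding h_def 1 2 using True by (simp add: mult.assoc[symmetric])
      qed
      also have "\<dots> = (\<integral>\<^sup>+y. ennreal (exp (- (norm y)\<^sup>2 / 2)) * (ennreal \<rho> * indicator {0..w \<bullet> y} \<rho>) \<partial>lborel)"
      proof (rule nn_integral_cong_AE)
        \<comment> \<open>The closed interval in \<open>\<rho>\<close> and the strict inequality
          differ, for fixed \<open>\<rho>\<close>, on a hyperplane only.\<close>
        have "negligible {y. w \<bullet> y = \<rho>}" using False by (intro negligible_hyperplane) auto
        then have "AE y in lebesgue. w \<bullet> y \<noteq> \<rho>"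
          using AE_not_in[of "{y. w \<bullet> y = \<rho>}" lebesgue] by (simp add: negligible_iff_null_sets)
        then have "AE y in lborel. w \<bullet> y \<noteq> \<rho>"
          by (simp add: AE_completion_iff)
        then show "AE y in lborel. ennreal (exp (- (norm y)\<^sup>2 / 2)) * (ennreal \<rho> * indicator {y. w \<bullet> y > \<rho>} y) = ennreal (exp (- (norm y)\<^sup>2 / 2)) * (ennreal \<rho> * indicator {0..w \<bullet> y} \<rho>)"
          by eventually_elim (use True in \<open>auto simp: indicator_def\<close>)
      qed
      finally show ?thesis .
    qed (use \<rho> in \<open>simp add: h_def indicator_def\<close>)
  qed
  also have "\<dots> = (\<integral>\<^sup>+y. \<integral>\<^sup>+\<rho>. ennreal (exp (- (norm y)\<^sup>2 / 2)) * (ennreal \<rho> * indicator {0..w \<bullet> y} \<rho>) \<partial>lborel \<partial>lborel)"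
    unfolding indicator_def atLeastAtMost_iff by (rule lborel_pair.Fubini') measurable
  also have "\<dots> = (\<integral>\<^sup>+y. ennreal (exp (- (norm y)\<^sup>2 / 2)) * ennreal ((max 0 (w \<bullet> y))\<^sup>2 / 2) \<partial>lborel)"
  proof (rule nn_integral_cong)
    fix y :: "real^'n"
    have "(\<integral>\<^sup>+\<rho>. ennreal \<rho> * indicator {0..a} \<rho> \<partial>lborel) = ennreal ((max 0 a)\<^sup>2 / 2)" for a :: real
    proof (cases "a \<ge> 0")
      case True
      have "(\<integral>\<^sup>+\<rho>. ennreal \<rho> * indicator {0..a} \<rho> \<partial>lborel) = ennreal (a\<^sup>2 / 2 - 0\<^sup>2 / 2)"
        using True by (intro nn_integral_FTC_Icc) (auto intro!: derivative_eq_intros)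
      then show ?thesis using True by (simp add: max_def)
    qed (simp add: max_def)
    then show "(\<integral>\<^sup>+\<rho>. ennreal (exp (- (norm y)\<^sup>2 / 2)) * (ennreal \<rho> * indicator {0..w \<bullet> y} \<rho>) \<partial>lborel) = ennreal (exp (- (norm y)\<^sup>2 / 2)) * ennreal ((max 0 (w \<bullet> y))\<^sup>2 / 2)"
      by (simp add: nn_integral_cmult)
  qed
  also have "\<dots> = (\<integral>\<^sup>+y. ennreal ((norm w)\<^sup>2) * (ennreal (exp (- (norm y)\<^sup>2 / 2)) * ennreal ((max 0 (y $ e))\<^sup>2 / 2)) \<partial>lborel)"
  proof -
    obtain B :: "real ^ 'n ^ 'n" where B: "\<bar>det B\<bar> = 1" "\<And>x y. (B *v x) \<bullet> (B *v y) = x \<bullet> y" "\<And>x. norm (B *v x) = norm x" "B *v axis e 1 = w /\<^sub>R norm w"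
      using orthogonal_matrix_exists[of "axis e 1" "w /\<^sub>R norm w"] False by auto
    then have d0: "det B \<noteq> 0" by auto
    have "(\<integral>\<^sup>+y. ennreal (exp (- (norm y)\<^sup>2 / 2)) * ennreal ((max 0 (w \<bullet> y))\<^sup>2 / 2) \<partial>lborel)
      = (\<integral>\<^sup>+y. ennreal (exp (- (norm (B *v y))\<^sup>2 / 2)) * ennreal ((max 0 (w \<bullet> (B *v y)))\<^sup>2 / 2) \<partial>lborel)"
      by (subst nn_integral_lborel_linear[OF d0]) (measurable, simp add: B(1))
    also have "\<dots> = (\<integral>\<^sup>+y. ennreal ((norm w)\<^sup>2) * (ennreal (exp (- (norm y)\<^sup>2 / 2)) * ennreal ((max 0 (y $ e))\<^sup>2 / 2)) \<partial>lborel)"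
    proof (rule nn_integral_cong)
      fix y :: "real^'n"
      have "w = norm w *\<^sub>R (B *v axis e 1)" using False by (simp add: B(4))
      then have "w \<bullet> (B *v y) = norm w * ((B *v axis e 1) \<bullet> (B *v y))"
        by (metis inner_scaleR_left)
      then have "w \<bullet> (B *v y) = norm w * y $ e" by (simp add: B(2) axis_inner_left)
      then have "max 0 (w \<bullet> (B *v y)) = norm w * max 0 (y $ e)"
        by (simp add: max_def zero_le_mult_iff)
      then have "ennreal ((max 0 (w \<bullet> (B *v y)))\<^sup>2 / 2) = ennreal ((norm w)\<^sup>2) * ennreal ((max 0 (y $ e))\<^sup>2 / 2)"
        by (simp add: ennreal_mult'[symmetric] power_mult_distrib)
      then show "ennreal (exp (- (norm (B *v y))\<^sup>2 / 2)) * ennreal ((max 0 (w \<bullet> (B *v y)))\<^sup>2 / 2) = ennreal ((norm w)\<^sup>2) * (ennreal (exp (- (norm y)\<^sup>2 / 2)) * ennreal ((max 0 (y $ e))\<^sup>2 / 2))"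
        unfolding B(3) by (simp add: ac_simps)
    qed
    finally show ?thesis .
  qed
  also have "\<dots> = ennreal ((norm w)\<^sup>2) * (\<integral>\<^sup>+(y::real^'n). ennreal (exp (- (norm y)\<^sup>2 / 2)) * ennreal ((max 0 (y $ e))\<^sup>2 / 2) \<partial>lborel)"
    by (rule nn_integral_cmult) measurable
  also have "(\<integral>\<^sup>+(y::real^'n). ennreal (exp (- (norm y)\<^sup>2 / 2)) * ennreal ((max 0 (y $ e))\<^sup>2 / 2) \<partial>lborel) = (\<integral>\<^sup>+y. ennreal (exp (- y\<^sup>2 / 2)) * ennreal ((max 0 y)\<^sup>2 / 2) \<partial>lborel) * ennreal (sqrt (2 * pi)) ^ (?d - 1)"
    using nn_integral_gauss_vec[of "\<lambda>y. ennreal ((max 0 y)\<^sup>2 / 2)" e] unfolding nn_integral_gauss by simp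
  also have "(\<integral>\<^sup>+y. ennreal (exp (- y\<^sup>2 / 2)) * ennreal ((max 0 y)\<^sup>2 / 2) \<partial>lborel) = ennreal (1/2) * gauss_moment 2"
  proof -
    have "ennreal (exp (- y\<^sup>2 / 2)) * ennreal ((max 0 y)\<^sup>2 / 2) = ennreal (1/2) * (ennreal (y\<^sup>2 * exp (- (y\<^sup>2) / 2)) * indicator {0<..} y)" for y :: real
    proof (cases "y > 0")
      case True
      have "exp (- y\<^sup>2 / 2) * (y\<^sup>2 / 2) = 1/2 * (y\<^sup>2 * exp (- (y\<^sup>2) / 2))" by simp
      then have "ennreal (exp (- y\<^sup>2 / 2)) * ennreal (y\<^sup>2 / 2) = ennreal (1/2) * ennreal (y\<^sup>2 * exp (- (y\<^sup>2) / 2))"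
        by (simp only: ennreal_mult'[symmetric] exp_ge_zero zero_le_divide_1_iff zero_le_numeral)
      then show ?thesis using True by (simp only: max_def) simp
    qed (simp add: max_def)
    note eq = this
    show ?thesis
      unfolding gauss_moment_def eq by (rule nn_integral_cmult) measurable
  qed
  finally show ?thesis .
qed

text \<open>\<open>\<kappa>\<close> is the intensity of a halfspace at distance 1 from the origin.
  It is a real number because the radial constants are positive and finite.\<close>

lemma stable_intensity_halfspace:
  obtains \<kappa> :: real where "\<And>w::real^'n. emeasure (stable_intensity 2) {y. w \<bullet> y > 1} = ennreal (\<kappa> * (norm w)\<^sup>2)" "\<kappa> \<ge> 0"
proof -
  let ?G = "gauss_moment (CARD('n) + 1)"
  define K where "K = inverse ?G * (ennreal (1/2) * gauss_moment 2 * ennreal (sqrt (2 * pi)) ^ (CARD('n) - 1))"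
  have "inverse ?G < \<top>"
    using gauss_moment_pos[of "CARD('n) + 1"] by (simp add: less_top[symmetric])
  moreover have m: "a < \<top> \<Longrightarrow> b < \<top> \<Longrightarrow> a * b < \<top>" for a b :: ennreal
    by (simp add: ennreal_mult_less_top)
  moreover have "gauss_moment 2 < \<top>" using gauss_moment_finite[of 2] by simp
  ultimately have "K < \<top>"
    unfolding K_def by (intro m ennreal_less_top) (simp_all add: power_less_top_ennreal)
  then obtain \<kappa> where \<kappa>: "K = ennreal \<kappa>" "\<kappa> \<ge> 0" by (cases K) auto
  have "emeasure (stable_intensity 2) {y. w \<bullet> y > 1} = ennreal (\<kappa> * (norm w)\<^sup>2)" for w :: "real^'n"
  proof -
    have "inverse ?G * ?G = 1"
      using ennreal_divide_self[of ?G] gauss_moment_pos[of "CARD('n) + 1"] gauss_moment_finite[of "CARD('n) + 1"]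
      by (simp add: divide_ennreal_def mult.commute less_top)
    then have "emeasure (stable_intensity 2) {y. w \<bullet> y > 1} = inverse ?G * (?G * emeasure (stable_intensity 2) {y. w \<bullet> y > 1})"
      by (simp add: mult.assoc[symmetric])
    also have "\<dots> = K * ennreal ((norm w)\<^sup>2)"
      unfolding stable_intensity_halfspace_aux K_def by (simp only: ac_simps)
    finally show ?thesis using \<kappa> by (simp add: ennreal_mult')
  qed
  then show ?thesis using \<kappa>(2) that by blast
qed

text \<open>The complement of the ball is covered by 2 d coordinate halfspaces of finite intensity.
  Their threshold is r / (2 d), so a point outside all of them has norm at most r / 2.\<close>

lemma stable_intensity_away_from_0:
  assumes "r > 0"
  shows "emeasure (stable_intensity 2) {y :: real^'n. norm y \<ge> r} < \<infinity>"
proof -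
  let ?L = "stable_intensity 2 :: (real^'n) measure"
  let ?c = "2 * real CARD('n) / r"
  let ?H = "\<lambda>(i, s). {y::real^'n. (s *\<^sub>R (?c *\<^sub>R axis i 1)) \<bullet> y > 1}"
  have c0: "?c > 0" using assms by simp
  have sub: "{y :: real^'n. norm y \<ge> r} \<subseteq> (\<Union>p\<in>UNIV \<times> {1, -1}. ?H p)"
  proof
    fix y :: "real^'n" assume "y \<in> {y. norm y \<ge> r}"
    then have y: "norm y \<ge> r" by simp
    have "\<exists>i. \<bar>y $ i\<bar> > 1 / ?c"
    proof (rule ccontr)
      assume "\<not> ?thesis"
      then have *: "\<bar>y $ i\<bar> \<le> 1 / ?c" for i by (simp add: not_less)
      have "norm y \<le> (\<Sum>i\<in>UNIV. \<bar>y $ i\<bar>)" by (rule norm_le_l1_cart)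
      also have "\<dots> \<le> (\<Sum>i\<in>(UNIV::'n set). 1 / ?c)" by (intro sum_mono *)
      also have "\<dots> = r / 2" by simp
      finally show False using y assms by simp
    qed
    then obtain i where "\<bar>y $ i\<bar> > 1 / ?c" ..
    then have "?c * \<bar>y $ i\<bar> > 1" using pos_divide_less_eq[OF c0, of 1 "\<bar>y $ i\<bar>"] by (simp only: mult.commute)
    then have "(1 *\<^sub>R (?c *\<^sub>R axis i 1)) \<bullet> y > 1 \<or> ((-1) *\<^sub>R (?c *\<^sub>R axis i 1)) \<bullet> y > 1"
      by (auto simp: axis_inner_left abs_if split: if_splits)
    then show "y \<in> (\<Union>p\<in>UNIV \<times> {1, -1}. ?H p)" by auto
  qed
  have meas: "?H p \<in> sets ?L" for p
    by (cases p) auto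
  have "emeasure ?L {y :: real^'n. norm y \<ge> r} \<le> emeasure ?L (\<Union>p\<in>UNIV \<times> {1, -1}. ?H p)"
    by (rule emeasure_mono[OF sub]) (use meas in auto)
  also have "\<dots> \<le> (\<Sum>p\<in>UNIV \<times> {1, -1}. emeasure ?L (?H p))"
    by (rule emeasure_subadditive_finite) (use meas in auto)
  also have "\<dots> < \<infinity>"
  proof -
    obtain \<kappa> where K: "\<And>w::real^'n. emeasure (stable_intensity 2) {y. w \<bullet> y > 1} = ennreal (\<kappa> * (norm w)\<^sup>2)"
      using stable_intensity_halfspace by metis
    then have "emeasure ?L (?H p) < \<infinity>" for p by (cases p) (simp only: case_prod_conv K ennreal_less_top infinity_ennreal_def)
    then show ?thesis by simp
  qed
  finally show ?thesis .
qed

text \<open>Degree count: the volume scales with exponent d and the density with exponent - d -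
  2.\<close>

lemma stable_intensity_scale:
  fixes B :: "(real^'n) set"
  assumes "t > 0" and [measurable]: "B \<in> sets borel"
  shows "emeasure (stable_intensity 2) ((\<lambda>x. t *\<^sub>R x) ` B) = ennreal (1 / t\<^sup>2) * emeasure (stable_intensity 2) B"
proof -
  have eq: "(\<lambda>x. t *\<^sub>R x) ` B = (\<lambda>x. (1 / t) *\<^sub>R x) -` B"
  proof safe
    fix x assume "(1 / t) *\<^sub>R x \<in> B"
    then show "x \<in> (\<lambda>x. t *\<^sub>R x) ` B"
      using assms(1) by (intro image_eqI[of _ _ "(1 / t) *\<^sub>R x"]) auto
  qed (use assms(1) in auto)
  have [measurable]: "(\<lambda>x. (1 / t) *\<^sub>R x) -` B \<in> sets borel"
    using measurable_sets[of "\<lambda>x::real^'n. (1 / t) *\<^sub>R x" borel borel B] by simp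
  have "emeasure (stable_intensity 2) ((\<lambda>x. t *\<^sub>R x) ` B) = (\<integral>\<^sup>+x. power_density x * indicator ((\<lambda>x. (1 / t) *\<^sub>R x) -` B) x \<partial>lborel)"
    unfolding eq by (rule emeasure_stable_intensity_2) measurable
  also have "\<dots> = (\<integral>\<^sup>+x. ennreal (\<bar>t\<bar> ^ CARD('n)) * (power_density (t *\<^sub>R x) * indicator ((\<lambda>x. (1 / t) *\<^sub>R x) -` B) (t *\<^sub>R x)) \<partial>lborel)"
    using assms(1) by (subst nn_integral_lborel_scale[of t]) (simp_all add: nn_integral_cmult)
  also have "\<dots> = (\<integral>\<^sup>+x. ennreal (1 / t\<^sup>2) * (power_density x * indicator B x) \<partial>lborel)"
  proof (rule nn_integral_cong)
    fix x :: "real^'n"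
    have "ennreal (\<bar>t\<bar> ^ CARD('n)) * power_density (t *\<^sub>R x) = ennreal (1 / t\<^sup>2) * power_density x"
      using assms(1) by (simp add: power_density_def ennreal_mult'[symmetric] power_add power_mult_distrib power2_eq_square)
    moreover have "indicator ((\<lambda>x. (1 / t) *\<^sub>R x) -` B) (t *\<^sub>R x) = (indicator B x :: ennreal)"
      using assms(1) by (simp add: indicator_def)
    ultimately show "ennreal (\<bar>t\<bar> ^ CARD('n)) * (power_density (t *\<^sub>R x) * indicator ((\<lambda>x. (1 / t) *\<^sub>R x) -` B) (t *\<^sub>R x)) = ennreal (1 / t\<^sup>2) * (power_density x * indicator B x)"
      by (metis mult.assoc)
  qed
  also have "\<dots> = ennreal (1 / t\<^sup>2) * emeasure (stable_intensity 2) B"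
    by (subst nn_integral_cmult) (measurable, simp add: emeasure_stable_intensity_2)
  finally show ?thesis .
qed

lemma stable_intensity_open_pos:
  fixes B :: "(real^'n) set"
  assumes "open B" "B \<noteq> {}"
  shows "emeasure (stable_intensity 2) B > 0"
proof -
  have B: "B \<in> sets borel" using assms by simp
  have "\<not> (AE x in lborel. power_density x * indicator B x = 0)"
  proof
    assume "AE x in lborel. power_density x * indicator B x = 0"
    with AE_lborel_singleton[of "0::real^'n"] have "AE x in lborel. x \<notin> B"
      by eventually_elim (auto simp: power_density_def indicator_def split: if_splits)
    then have "emeasure lborel B = 0"
      using B by (subst (asm) AE_iff_measurable[where N=B]) auto
    then have "negligible B"
      using B by (simp add: negligible_iff_null_sets null_sets_def)
    then show False using open_not_negligible[OF assms] by blast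
  qed
  then show ?thesis
    using B by (simp add: emeasure_stable_intensity_2 zero_less_iff_neq_zero nn_integral_0_iff_AE)
qed

section \<open>The Mecke formula\<close>

text \<open>The corner of the half-open dyadic cube containing \<open>x\<close>. It serves as the
  label of the cube: equal labels mean the same cube.\<close>

definition dyadic :: "nat \<Rightarrow> 'a::euclidean_space \<Rightarrow> 'a" where
  "dyadic n x = (\<Sum>b\<in>Basis. (of_int \<lfloor>2 ^ n * (x \<bullet> b)\<rfloor> / 2 ^ n) *\<^sub>R b)"

lemma dyadic_inner: "b \<in> Basis \<Longrightarrow> dyadic n x \<bullet> b = of_int \<lfloor>2 ^ n * (x \<bullet> b)\<rfloor> / 2 ^ n"
  by (simp add: dyadic_def)

lemma dyadic_eq_iff: "dyadic n x = dyadic n y \<longleftrightarrow> (\<forall>b\<in>Basis. \<lfloor>2 ^ n * (x \<bullet> b)\<rfloor> = \<lfloor>2 ^ n * (y \<bullet> b)\<rfloor>)"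
  by (subst euclidean_eq_iff) (simp add: dyadic_inner)

lemma countable_range_dyadic: "countable (range (dyadic n :: 'a::euclidean_space \<Rightarrow> 'a))"
proof -
  let ?F = "PiE Basis (\<lambda>_. UNIV) :: ('a \<Rightarrow> int) set"
  have "range (dyadic n) \<subseteq> (\<lambda>f. \<Sum>b\<in>Basis. (of_int (f b) / 2 ^ n) *\<^sub>R b) ` ?F"
  proof safe
    fix x :: 'a
    show "dyadic n x \<in> (\<lambda>f. \<Sum>b\<in>Basis. (of_int (f b) / 2 ^ n) *\<^sub>R b) ` ?F"
      by (rule image_eqI[of _ _ "restrict (\<lambda>b. \<lfloor>2 ^ n * (x \<bullet> b)\<rfloor>) Basis"]) (auto simp: dyadic_def)
  qed
  then show ?thesis
    by (rule countable_subset) (intro countable_image countable_PiE, auto)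
qed

lemma dyadic_measurable [measurable]: "dyadic n \<in> borel_measurable borel"
  unfolding dyadic_def[abs_def] by measurable

text \<open>The cubes are nested because
  \<open>\<lfloor>t\<rfloor> = \<lfloor>2 * t\<rfloor> div 2\<close>.\<close>

lemma dyadic_refine:
  assumes "dyadic (Suc n) x = dyadic (Suc n) y"
  shows "dyadic n x = dyadic n y"
proof -
  have half: "\<lfloor>t\<rfloor> = \<lfloor>2 * t\<rfloor> div 2" for t :: real
    by linarith
  have "\<lfloor>2 ^ n * (x \<bullet> b)\<rfloor> = \<lfloor>2 ^ Suc n * (x \<bullet> b)\<rfloor> div 2" for x :: 'a and b
    using half[of "2 ^ n * (x \<bullet> b)"] by (simp add: mult.assoc)
  then show ?thesis
    using assms unfolding dyadic_eq_iff by metis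
qed

lemma dyadic_dist:
  assumes "dyadic n x = dyadic n y"
  shows "dist x (y::'a::euclidean_space) \<le> DIM('a) / 2 ^ n"
proof -
  have "norm (x - y) \<le> (\<Sum>b\<in>Basis. \<bar>(x - y) \<bullet> b\<bar>)"
    by (rule norm_le_l1)
  also have "\<dots> \<le> (\<Sum>b\<in>(Basis::'a set). 1 / 2 ^ n)"
  proof (rule sum_mono)
    fix b :: 'a assume "b \<in> Basis"
    then have "\<lfloor>2 ^ n * (x \<bullet> b)\<rfloor> = \<lfloor>2 ^ n * (y \<bullet> b)\<rfloor>"
      using assms unfolding dyadic_eq_iff by blast
    then have "\<bar>2 ^ n * (x \<bullet> b) - 2 ^ n * (y \<bullet> b)\<bar> \<le> 1" by linarith
    then have "2 ^ n * \<bar>(x - y) \<bullet> b\<bar> \<le> 1"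
      by (simp add: inner_diff_left right_diff_distrib[symmetric] abs_mult)
    then show "\<bar>(x - y) \<bullet> b\<bar> \<le> 1 / 2 ^ n"
      by (simp add: pos_le_divide_eq mult.commute)
  qed
  finally show ?thesis by (simp add: dist_norm)
qed

lemma dyadic_eventually_near:
  assumes "e > 0"
  shows "\<exists>n0. \<forall>n\<ge>n0. \<forall>x y::'a::euclidean_space. dyadic n x = dyadic n y \<longrightarrow> dist x y < e"
proof -
  have "(\<lambda>n. real DIM('a) / 2 ^ n) \<longlonglongrightarrow> 0"
    by real_asymp
  then have "\<forall>\<^sub>F n in sequentially. real DIM('a) / 2 ^ n < e"
    using assms by (rule order_tendstoD(2))
  then show ?thesis
    unfolding eventually_sequentially using dyadic_dist by (meson order_le_less_trans)
qed

text \<open>The setting for a process whose points may accumulate at the origin: the counts are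
  controlled on sets bounded away from 0, and these exhaust the space up to the null set
  \<open>{0}\<close>.\<close>

locale punctured_ppp =
  fixes M :: "'w measure" and N :: "'w \<Rightarrow> 'a::euclidean_space set" and \<Lambda> :: "'a measure"
  assumes ppp: "poisson_point_process M N \<Lambda>"
    and sets_Lam: "sets \<Lambda> = sets borel"
    and finite_away: "\<And>r. r > 0 \<Longrightarrow> emeasure \<Lambda> {y. norm y \<ge> r} < \<infinity>"
    and zero_null: "emeasure \<Lambda> {0} = 0"
begin

sublocale prob_space M
  using ppp by (simp add: poisson_point_process_def)

lemma space_Lam: "space \<Lambda> = UNIV"
  using sets_eq_imp_space_eq[OF sets_Lam] by simp

lemma Lam_finite_mono:
  assumes "B \<subseteq> {y. norm y \<ge> r}" "r > 0"
  shows "emeasure \<Lambda> B < \<infinity>"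
  using emeasure_mono[OF assms(1), of \<Lambda>] finite_away[OF assms(2)] sets_Lam
  by (auto simp: intro: le_less_trans)

lemma sigma_finite_Lam: "sigma_finite_measure \<Lambda>"
proof
  let ?A = "insert {0} (range (\<lambda>n. {y. norm y \<ge> 1 / Suc n}))"
  have "x \<in> \<Union>?A" for x
  proof (cases "x = 0")
    case False
    then obtain n where "1 / Suc n < norm x"
      using reals_Archimedean[of "norm x"] by (auto simp: inverse_eq_divide)
    then show ?thesis by (auto intro!: exI[of _ n] less_imp_le)
  qed auto
  moreover have "emeasure \<Lambda> {y. norm y \<ge> 1 / Suc n} \<noteq> \<infinity>" for n
    using finite_away[of "1 / Suc n"] by simp
  ultimately show "\<exists>A. countable A \<and> A \<subseteq> sets \<Lambda> \<and> \<Union>A = space \<Lambda> \<and> (\<forall>a\<in>A. emeasure \<Lambda> a \<noteq> \<infinity>)"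
    by (intro exI[of _ ?A]) (auto simp: sets_Lam space_Lam zero_null)
qed

lemma AE_locally_finite: "AE \<omega> in M. \<forall>r>0. finite (N \<omega> \<inter> {y. norm y \<ge> r})"
proof -
  have "AE \<omega> in M. finite (N \<omega> \<inter> {y. norm y \<ge> 1 / Suc n})" for n
    using ppp finite_away[of "1 / Suc n"] by (auto simp: poisson_point_process_def sets_Lam)
  then have "AE \<omega> in M. \<forall>n. finite (N \<omega> \<inter> {y. norm y \<ge> 1 / Suc n})"
    by (simp add: AE_all_countable)
  then show ?thesis
  proof eventually_elim
    case (elim \<omega>)
    show ?case
    proof (intro allI impI)
      fix r :: real assume "r > 0"
      then obtain n where "1 / Suc n < r"
        using reals_Archimedean[of r] by (auto simp: inverse_eq_divide)
      then have "N \<omega> \<inter> {y. norm y \<ge> r} \<subseteq> N \<omega> \<inter> {y. norm y \<ge> 1 / Suc n}" by auto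
      then show "finite (N \<omega> \<inter> {y. norm y \<ge> r})" using elim finite_subset by blast
    qed
  qed
qed

text \<open>The definition of the process asserts measurability of counts only through independence,
  so it is read off a family with a single member.\<close>

lemma count_measurable:
  assumes "B \<in> sets borel" "emeasure \<Lambda> B < \<infinity>"
  shows "(\<lambda>\<omega>. card (N \<omega> \<inter> B)) \<in> measurable M (count_space UNIV)"
proof -
  have "indep_vars (\<lambda>_. count_space (UNIV :: nat set)) (\<lambda>i \<omega>. card (N \<omega> \<inter> (\<lambda>_::nat. B) i)) {..<1}"
    using ppp assms by (auto simp: poisson_point_process_def sets_Lam disjoint_family_on_def)
  then show ?thesis
    by (auto simp: indep_vars_def2)
qed

lemma prob_count:
  assumes "B \<in> sets borel" "emeasure \<Lambda> B < \<infinity>"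
  shows "prob {\<omega> \<in> space M. card (N \<omega> \<inter> B) = j} = measure \<Lambda> B ^ j / fact j * exp (- measure \<Lambda> B)"
  using ppp assms by (auto simp: poisson_point_process_def sets_Lam)

text \<open>The Poisson weights for exactly one point in each \<open>C i\<close> and for none in
  \<open>D\<close> multiply by independence, and the exponents add up to the intensity of the union.
  The indices are moved to an initial segment of the naturals, with \<open>D\<close> in the last
  place.\<close>

lemma prob_singletons_void:
  fixes C :: "'i::finite \<Rightarrow> 'a set"
  assumes C: "\<And>i. C i \<in> sets borel" "\<And>i. emeasure \<Lambda> (C i) < \<infinity>" "disjoint_family C"
    and D: "D \<in> sets borel" "emeasure \<Lambda> D < \<infinity>" "\<And>i. D \<inter> C i = {}"
  shows "emeasure M {\<omega> \<in> space M. (\<forall>i. card (N \<omega> \<inter> C i) = 1) \<and> card (N \<omega> \<inter> D) = 0}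
    = (\<Prod>i\<in>UNIV. emeasure \<Lambda> (C i)) * ennreal (exp (- measure \<Lambda> (D \<union> (\<Union>i. C i))))"
proof -
  let ?m = "CARD('i)"
  obtain h where h: "bij_betw h {..<?m} (UNIV :: 'i set)"
    using ex_bij_betw_nat_finite[OF finite[of "UNIV :: 'i set"]] by (auto simp: atLeast0LessThan)
  define B where "B = (\<lambda>j. if j < ?m then C (h j) else D)"
  define c where "c = (\<lambda>j. if j < ?m then 1 else 0 :: nat)"
  have B: "B j \<in> sets borel" "emeasure \<Lambda> (B j) < \<infinity>" for j
    using C D by (auto simp: B_def)
  have "disjoint_family_on B {..<Suc ?m}"
  proof (unfold disjoint_family_on_def, intro ballI impI)
    fix i j assume ij: "i \<in> {..<Suc ?m}" "j \<in> {..<Suc ?m}" "i \<noteq> j"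
    have "h i \<noteq> h j" if "i < ?m" "j < ?m" using that ij h by (auto simp: bij_betw_def inj_on_def)
    then show "B i \<inter> B j = {}"
      using C(3) D(3) ij by (auto simp: B_def disjoint_family_on_def)
  qed
  then have "indep_vars (\<lambda>_. count_space (UNIV :: nat set)) (\<lambda>i \<omega>. card (N \<omega> \<inter> B i)) {..<Suc ?m}"
    using ppp B by (auto simp: poisson_point_process_def sets_Lam)
  then have ind: "indep_sets (\<lambda>i. {(\<lambda>\<omega>. card (N \<omega> \<inter> B i)) -` A \<inter> space M | A. A \<in> sets (count_space UNIV)}) {..<Suc ?m}"
    by (auto simp: indep_vars_def2)
  have "prob (\<Inter>j\<in>{..<Suc ?m}. (\<lambda>\<omega>. card (N \<omega> \<inter> B j)) -` {c j} \<inter> space M)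
    = (\<Prod>j\<in>{..<Suc ?m}. prob ((\<lambda>\<omega>. card (N \<omega> \<inter> B j)) -` {c j} \<inter> space M))"
    by (rule indep_setsD[OF ind]) auto
  also have "\<dots> = (\<Prod>j\<in>{..<Suc ?m}. measure \<Lambda> (B j) ^ c j * exp (- measure \<Lambda> (B j)))"
  proof (rule prod.cong)
    fix j
    have "(\<lambda>\<omega>. card (N \<omega> \<inter> B j)) -` {c j} \<inter> space M = {\<omega> \<in> space M. card (N \<omega> \<inter> B j) = c j}" by auto
    then show "prob ((\<lambda>\<omega>. card (N \<omega> \<inter> B j)) -` {c j} \<inter> space M) = measure \<Lambda> (B j) ^ c j * exp (- measure \<Lambda> (B j))"
      using prob_count[OF B, of j "c j"] by (simp add: c_def)
  qed simp
  also have "\<dots> = (\<Prod>j\<in>{..<?m}. measure \<Lambda> (C (h j)) * exp (- measure \<Lambda> (C (h j)))) * exp (- measure \<Lambda> D)"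
    by (simp add: B_def c_def)
  also have "(\<Prod>j\<in>{..<?m}. measure \<Lambda> (C (h j)) * exp (- measure \<Lambda> (C (h j)))) = (\<Prod>i\<in>UNIV. measure \<Lambda> (C i) * exp (- measure \<Lambda> (C i)))"
    by (rule prod.reindex_bij_betw[OF h])
  also have "\<dots> * exp (- measure \<Lambda> D) = (\<Prod>i\<in>UNIV. measure \<Lambda> (C i)) * exp (- (measure \<Lambda> D + (\<Sum>i\<in>UNIV. measure \<Lambda> (C i))))"
    by (simp only: prod.distrib exp_sum[OF finite, symmetric] sum_negf exp_add[symmetric] mult.assoc)
       (simp add: add.commute)
  also have "measure \<Lambda> D + (\<Sum>i\<in>UNIV. measure \<Lambda> (C i)) = measure \<Lambda> (D \<union> (\<Union>i. C i))"
  proof -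
    have fin: "emeasure \<Lambda> (C i) \<noteq> \<top>" for i
      using C(2)[of i] by simp
    have "measure \<Lambda> (\<Union>i\<in>UNIV. C i) = (\<Sum>i\<in>UNIV. measure \<Lambda> (C i))"
      using C fin by (intro measure_finite_Union) (auto simp: sets_Lam)
    moreover have "emeasure \<Lambda> (\<Union>i\<in>UNIV. C i) \<le> (\<Sum>i\<in>UNIV. emeasure \<Lambda> (C i))"
      using C by (intro emeasure_subadditive_finite) (auto simp: sets_Lam)
    moreover have "(\<Sum>i\<in>UNIV. emeasure \<Lambda> (C i)) < \<infinity>"
      using fin by (simp add: less_top[symmetric])
    ultimately have "emeasure \<Lambda> (\<Union>i. C i) < \<infinity>"
      using le_less_trans by blast
    moreover note \<open>measure \<Lambda> (\<Union>i\<in>UNIV. C i) = (\<Sum>i\<in>UNIV. measure \<Lambda> (C i))\<close>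
    ultimately show ?thesis
      using C D by (subst measure_Union) (auto simp: sets_Lam)
  qed
  finally have p: "prob (\<Inter>j\<in>{..<Suc ?m}. (\<lambda>\<omega>. card (N \<omega> \<inter> B j)) -` {c j} \<inter> space M)
    = (\<Prod>i\<in>UNIV. measure \<Lambda> (C i)) * exp (- measure \<Lambda> (D \<union> (\<Union>i. C i)))" .
  have "(\<Inter>j\<in>{..<Suc ?m}. (\<lambda>\<omega>. card (N \<omega> \<inter> B j)) -` {c j} \<inter> space M) = {\<omega> \<in> space M. (\<forall>i. card (N \<omega> \<inter> C i) = 1) \<and> card (N \<omega> \<inter> D) = 0}"
    (is "?L = ?R")
  proof (intro set_eqI iffI)
    fix \<omega> assume \<omega>: "\<omega> \<in> ?L"
    then have *: "card (N \<omega> \<inter> B j) = c j" if "j < Suc ?m" for j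
      using INT_D[OF \<omega>, of j] that by simp
    have "\<omega> \<in> space M" using INT_D[OF \<omega>, of 0] by simp
    moreover
    have "card (N \<omega> \<inter> C i) = 1" for i
    proof -
      obtain j where "j < ?m" "h j = i" using h unfolding bij_betw_def by (metis imageE lessThan_iff UNIV_I)
      then show ?thesis using *[of j] by (simp add: B_def c_def)
    qed
    moreover have "card (N \<omega> \<inter> D) = 0" using *[of ?m] by (simp add: B_def c_def)
    ultimately show "\<omega> \<in> ?R" by auto
  next
    fix \<omega> assume "\<omega> \<in> ?R"
    then show "\<omega> \<in> ?L" by (intro INT_I) (auto simp: B_def c_def)
  qed
  then show ?thesis
    using p C(2) by (simp add: emeasure_eq_measure ennreal_mult' prod_nonneg prod_ennreal[symmetric] emeasure_eq_ennreal_measure less_top)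
qed

lemma cell_sets: "{y. dyadic n y = z} \<in> sets \<Lambda>"
  unfolding sets_Lam by measurable

text \<open>Labels take only countably many values, so any function of them is measurable. This
  matters because the later \<open>h\<close> involves unions over all tuples in a product of
  cubes.\<close>

lemma dyadic_tuple_measurable:
  fixes h :: "('i::finite \<Rightarrow> 'a) \<Rightarrow> ennreal"
  shows "(\<lambda>x. h (\<lambda>i. dyadic n (x i))) \<in> borel_measurable (PiM UNIV (\<lambda>_. \<Lambda>))"
proof -
  let ?D = "PiE UNIV (\<lambda>_::'i. range (dyadic n :: 'a \<Rightarrow> 'a))"
  have c: "countable ?D"
    by (intro countable_PiE countable_range_dyadic) auto
  have "(\<lambda>x i. dyadic n (x i)) \<in> measurable (PiM UNIV (\<lambda>_::'i. \<Lambda>)) (count_space ?D)"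
    unfolding measurable_count_space_eq_countable[OF c]
  proof safe
    fix Z :: "'i \<Rightarrow> 'a"
    have "(\<lambda>x i. dyadic n (x i)) -` {Z} \<inter> space (PiM UNIV (\<lambda>_::'i. \<Lambda>)) = PiE UNIV (\<lambda>i. {y. dyadic n y = Z i})"
      by (auto simp: space_PiM space_Lam fun_eq_iff PiE_UNIV_domain)
    then show "(\<lambda>x i. dyadic n (x i)) -` {Z} \<inter> space (PiM UNIV (\<lambda>_::'i. \<Lambda>)) \<in> sets (PiM UNIV (\<lambda>_. \<Lambda>))"
      by (simp add: sets_PiM_I_finite cell_sets)
  qed (auto simp: PiE_UNIV_domain)
  then show ?thesis
    by (rule measurable_compose) simp
qed

text \<open>The product space is split into countably many products of cubes, and the integrand is
  constant on each.\<close>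

lemma nn_integral_cells:
  fixes h :: "('i::finite \<Rightarrow> 'a) \<Rightarrow> ennreal"
  shows "(\<integral>\<^sup>+x. h (\<lambda>i. dyadic n (x i)) \<partial>(PiM UNIV (\<lambda>_. \<Lambda>)))
    = (\<integral>\<^sup>+Z. h Z * (\<Prod>i\<in>UNIV. emeasure \<Lambda> {y. dyadic n y = Z i}) \<partial>count_space (PiE UNIV (\<lambda>_. range (dyadic n))))"
proof -
  interpret P: product_sigma_finite "\<lambda>_::'i. \<Lambda>"
    by (simp add: product_sigma_finite_def sigma_finite_Lam)
  let ?P = "PiM UNIV (\<lambda>_::'i. \<Lambda>)"
  let ?D = "PiE UNIV (\<lambda>_::'i. range (dyadic n :: 'a \<Rightarrow> 'a))"
  let ?C = "\<lambda>Z. PiE UNIV (\<lambda>i. {y. dyadic n y = Z i})"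
  have c: "countable ?D"
    by (intro countable_PiE countable_range_dyadic) auto
  interpret PP: pair_sigma_finite "count_space ?D" ?P
    by (intro pair_sigma_finite.intro sigma_finite_measure_count_space_countable c P.sigma_finite) auto
  have C: "?C Z \<in> sets ?P" for Z
    by (intro sets_PiM_I_finite) (auto simp: cell_sets)
  have "(\<integral>\<^sup>+Z. h Z * (\<Prod>i\<in>UNIV. emeasure \<Lambda> {y. dyadic n y = Z i}) \<partial>count_space ?D) = (\<integral>\<^sup>+Z. (\<integral>\<^sup>+x. h Z * indicator (?C Z) x \<partial>?P) \<partial>count_space ?D)"
    using C by (intro nn_integral_cong) (simp add: nn_integral_cmult P.emeasure_PiM cell_sets)
  also have "\<dots> = (\<integral>\<^sup>+x. (\<integral>\<^sup>+Z. h Z * indicator (?C Z) x \<partial>count_space ?D) \<partial>?P)"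
    by (rule PP.Fubini'[symmetric]) (intro measurable_pair_measure_countable1 c, use C in simp)
  also have "\<dots> = (\<integral>\<^sup>+x. h (\<lambda>i. dyadic n (x i)) \<partial>?P)"
  proof (rule nn_integral_cong)
    fix x :: "'i \<Rightarrow> 'a"
    let ?Z = "\<lambda>i. dyadic n (x i)"
    have Z: "?Z \<in> ?D" by (auto simp: PiE_UNIV_domain)
    have "(\<integral>\<^sup>+Z. h Z * indicator (?C Z) x \<partial>count_space ?D) = (\<integral>\<^sup>+Z. h Z * indicator {?Z} Z \<partial>count_space ?D)"
      by (intro nn_integral_cong) (auto simp: indicator_def PiE_UNIV_domain Pi_iff fun_eq_iff)
    also have "\<dots> = h ?Z"
      using Z by (subst nn_integral_indicator_singleton) auto
    finally show "(\<integral>\<^sup>+Z. h Z * indicator (?C Z) x \<partial>count_space ?D) = h ?Z" .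
  qed
  finally show ?thesis ..
qed

text \<open>The tuples are located by dyadic cells of level \<open>n\<close>; a tuple is detected at level \<open>n\<close> if its cells
  contain no other point and all sets \<open>A x'\<close> with \<open>x'\<close> in the same cells contain no further point. Detection
  is monotone in \<open>n\<close> and its probability is a finite product by independence.\<close>

theorem mecke_void:
  fixes P :: "('i::finite \<Rightarrow> 'a) \<Rightarrow> bool" and A Ab :: "('i \<Rightarrow> 'a) \<Rightarrow> 'a set"
  assumes P_inj: "\<And>x. P x \<Longrightarrow> inj x" "\<And>x i. P x \<Longrightarrow> x i \<noteq> 0"
    and P_open: "\<And>x. P x \<Longrightarrow> \<exists>e>0. \<exists>r>0. \<forall>x'. (\<forall>i. dist (x' i) (x i) < e) \<longrightarrow> P x' \<and> A x' \<subseteq> {y. norm y \<ge> r}"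
    and A_open: "\<And>x. P x \<Longrightarrow> open (A x)"
    and A_self: "\<And>x i. P x \<Longrightarrow> x i \<notin> A x"
    and Ab: "\<And>x. P x \<Longrightarrow> A x \<subseteq> Ab x" "\<And>x i. P x \<Longrightarrow> x i \<in> Ab x"
    and Ab_closed: "\<And>x y. P x \<Longrightarrow> y \<notin> Ab x \<Longrightarrow> \<exists>e>0. \<forall>x'. (\<forall>i. dist (x' i) (x i) < e) \<longrightarrow> y \<notin> A x'"
    and Ab_null: "\<And>x. P x \<Longrightarrow> Ab x \<in> sets borel" "\<And>x. P x \<Longrightarrow> emeasure \<Lambda> (Ab x - A x) = 0"
    and generic: "AE \<omega> in M. \<forall>x. P x \<and> range x \<subseteq> N \<omega> \<longrightarrow> N \<omega> \<inter> Ab x \<subseteq> A x \<union> range x"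
  defines "S \<equiv> \<lambda>\<omega>. emeasure (count_space UNIV) {x. P x \<and> range x \<subseteq> N \<omega> \<and> N \<omega> \<inter> A x = {}}"
  shows "\<exists>S'\<in>borel_measurable M. AE \<omega> in M. S \<omega> = S' \<omega>"
    and "(\<integral>\<^sup>+\<omega>. S \<omega> \<partial>M) = (\<integral>\<^sup>+x. indicator {x. P x} x * ennreal (exp (- measure \<Lambda> (A x))) \<partial>(PiM UNIV (\<lambda>_. \<Lambda>)))"
proof -
  let ?P = "PiM UNIV (\<lambda>_::'i. \<Lambda>)"
  let ?R = "\<lambda>n. {y :: 'a. norm y \<ge> 1 / real (Suc n)}"
  let ?D = "\<lambda>n. PiE UNIV (\<lambda>_::'i. range (dyadic n :: 'a \<Rightarrow> 'a))"
  define cell where "cell = (\<lambda>n z. {y::'a. dyadic n y = z})"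
  define cells where "cells = (\<lambda>n Z. {x::'i \<Rightarrow> 'a. \<forall>i. dyadic n (x i) = Z i})"
  \<comment> \<open>A product of cubes is good if its labels are distinct, all its tuples satisfy
    \<open>P\<close>, and everything relevant stays at distance \<open>1 / Suc n\<close> from 0,
    where the intensity is finite. Since this radius shrinks with \<open>n\<close>, goodness passes
    to finer levels and every tuple in \<open>P\<close> acquires it eventually.\<close>
  define good where "good = (\<lambda>n Z. inj Z \<and> (\<forall>x\<in>cells n Z. P x \<and> A x \<subseteq> ?R n \<and> range x \<subseteq> ?R n))"
  \<comment> \<open>A replacement for \<open>A x\<close> that depends on labels alone. Together with
    the cubes of the tuple it decreases to a set between \<open>A x\<close> and
    \<open>Ab x\<close>.\<close>
  define As where "As = (\<lambda>n Z. \<Union>x\<in>cells n Z. A x)"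
  define Cs where "Cs = (\<lambda>n (Z::'i \<Rightarrow> 'a). \<Union>i. cell n (Z i))"
  \<comment> \<open>The cubes are removed from \<open>As\<close> to obtain disjoint sets, as
    independence demands. Since \<open>card\<close> of an infinite set is 0, a zero count means
    emptiness only where local finiteness holds.\<close>
  define ev where "ev = (\<lambda>n Z \<omega>. (\<forall>i. card (N \<omega> \<inter> cell n (Z i)) = 1) \<and> card (N \<omega> \<inter> (As n Z - Cs n Z)) = 0)"
  define q where "q = (\<lambda>n x. \<lambda>i::'i. dyadic n (x i :: 'a))"
  define S' where "S' = (\<lambda>n \<omega>. \<integral>\<^sup>+Z. indicator {Z. good n Z \<and> ev n Z \<omega>} Z \<partial>count_space (?D n))"

  have cell_borel: "cell n z \<in> sets borel" for n z
    unfolding cell_def by measurable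
  have Cs_borel: "Cs n Z \<in> sets borel" for n Z
    unfolding Cs_def using cell_borel by auto
  have q_cells: "x \<in> cells n (q n x)" for n x by (simp add: cells_def q_def)
  have q_D: "q n x \<in> ?D n" for n x by (auto simp: q_def PiE_UNIV_domain)
  have As_open: "open (As n Z)" if "good n Z" for n Z
    using that A_open unfolding As_def good_def by auto
  have As_R: "As n Z \<subseteq> ?R n" if "good n Z" for n Z
    using that unfolding As_def good_def by auto
  have cell_R: "cell n (Z i) \<subseteq> ?R n" if g: "good n Z" and Z: "Z \<in> ?D n" for n Z i
  proof
    fix y assume y: "y \<in> cell n (Z i)"
    have "Z j \<in> range (dyadic n)" for j using Z by (auto simp: PiE_iff)
    then have "\<forall>j. \<exists>u. dyadic n u = Z j" by (metis imageE)
    then obtain u where u: "\<And>j. dyadic n (u j) = Z j" by metis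
    have "u(i := y) \<in> cells n Z" using u y by (simp add: cells_def cell_def)
    then have "range (u(i := y)) \<subseteq> ?R n" using g unfolding good_def by blast
    then show "y \<in> ?R n" by (auto simp: image_subset_iff dest: spec[of _ i])
  qed
  have R_fin: "emeasure \<Lambda> B < \<infinity>" if "B \<subseteq> ?R n" for B n
    using that by (rule Lam_finite_mono) simp

  have ev_prob: "emeasure M {\<omega> \<in> space M. ev n Z \<omega>} = (\<Prod>i\<in>UNIV. emeasure \<Lambda> (cell n (Z i))) * ennreal (exp (- measure \<Lambda> (As n Z \<union> Cs n Z)))"
    if g: "good n Z" and Z: "Z \<in> ?D n" for n Z
  proof -
    have "emeasure M {\<omega> \<in> space M. (\<forall>i. card (N \<omega> \<inter> cell n (Z i)) = 1) \<and> card (N \<omega> \<inter> (As n Z - Cs n Z)) = 0}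
      = (\<Prod>i\<in>UNIV. emeasure \<Lambda> (cell n (Z i))) * ennreal (exp (- measure \<Lambda> ((As n Z - Cs n Z) \<union> (\<Union>i. cell n (Z i)))))"
    proof (rule prob_singletons_void)
      show "disjoint_family (\<lambda>i. cell n (Z i))"
        using g by (auto simp: disjoint_family_on_def cell_def good_def inj_def)
      show "As n Z - Cs n Z \<in> sets borel"
        using As_open[OF g] Cs_borel by auto
      show "emeasure \<Lambda> (As n Z - Cs n Z) < \<infinity>"
        using As_R[OF g] by (intro R_fin[of _ n]) auto
      show "emeasure \<Lambda> (cell n (Z i)) < \<infinity>" for i
        using cell_R[OF g Z] by (intro R_fin[of _ n]) auto
      show "(As n Z - Cs n Z) \<inter> cell n (Z i) = {}" for i
        by (auto simp: Cs_def)
    qed (rule cell_borel)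
    moreover have "(As n Z - Cs n Z) \<union> (\<Union>i. cell n (Z i)) = As n Z \<union> Cs n Z"
      by (auto simp: Cs_def)
    ultimately show ?thesis by (simp add: ev_def)
  qed
  have ev_meas: "{\<omega> \<in> space M. ev n Z \<omega>} \<in> sets M" if g: "good n Z" and Z: "Z \<in> ?D n" for n Z
  proof -
    have m1: "(\<lambda>\<omega>. card (N \<omega> \<inter> cell n (Z i))) \<in> measurable M (count_space UNIV)" for i
      using cell_R[OF g Z] by (intro count_measurable cell_borel R_fin[of _ n]) auto
    have m2: "(\<lambda>\<omega>. card (N \<omega> \<inter> (As n Z - Cs n Z))) \<in> measurable M (count_space UNIV)"
      using As_R[OF g] As_open[OF g] Cs_borel[of n Z] by (intro count_measurable R_fin[of _ n]) auto
    note m1[measurable] m2[measurable]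
    show ?thesis unfolding ev_def by measurable
  qed
  have ev_ind: "(\<lambda>\<omega>. indicator {Z. good n Z \<and> ev n Z \<omega>} Z :: ennreal) \<in> borel_measurable M" if Z: "Z \<in> ?D n" for n Z
  proof (cases "good n Z")
    case True
    have "(\<lambda>\<omega>. indicator {\<omega> \<in> space M. ev n Z \<omega>} \<omega> :: ennreal) \<in> borel_measurable M"
      using ev_meas[OF True Z] by simp
    then show ?thesis
      by (rule measurable_cong[THEN iffD1, rotated]) (simp add: True indicator_def)
  qed simp
  have cD: "countable (?D n)" for n
    by (intro countable_PiE countable_range_dyadic) auto
  interpret CM: pair_sigma_finite "count_space (?D n)" M for n
    by (intro pair_sigma_finite.intro sigma_finite_measure_count_space_countable cD sigma_finite_measure_axioms)
  have joint: "(\<lambda>(Z, \<omega>). indicator {Z. good n Z \<and> ev n Z \<omega>} Z :: ennreal) \<in> borel_measurable (count_space (?D n) \<Otimes>\<^sub>M M)" for n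
    by (intro measurable_pair_measure_countable1 cD) (use ev_ind in simp)
  have S'_meas: "S' n \<in> borel_measurable M" for n
  proof -
    have "(\<lambda>(\<omega>, Z). indicator {Z. good n Z \<and> ev n Z \<omega>} Z :: ennreal) \<in> borel_measurable (M \<Otimes>\<^sub>M count_space (?D n))"
      using measurable_pair_swap[OF joint[of n]] by (simp add: case_prod_unfold)
    then show ?thesis
      unfolding S'_def by (rule sigma_finite_measure.borel_measurable_nn_integral[OF sigma_finite_measure_count_space_countable[OF cD]])
  qed
  define f where "f = (\<lambda>n x. indicator {x. good n (q n x)} x * ennreal (exp (- measure \<Lambda> (As n (q n x) \<union> Cs n (q n x)))))"
  have S'_int: "(\<integral>\<^sup>+\<omega>. S' n \<omega> \<partial>M) = (\<integral>\<^sup>+x. f n x \<partial>?P)" for n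
  proof -
    let ?h = "\<lambda>Z. indicator {Z. good n Z} Z * ennreal (exp (- measure \<Lambda> (As n Z \<union> Cs n Z)))"
    have "(\<integral>\<^sup>+\<omega>. S' n \<omega> \<partial>M) = (\<integral>\<^sup>+Z. \<integral>\<^sup>+\<omega>. indicator {Z. good n Z \<and> ev n Z \<omega>} Z \<partial>M \<partial>count_space (?D n))"
      unfolding S'_def by (rule CM.Fubini') (rule joint)
    also have "\<dots> = (\<integral>\<^sup>+Z. ?h Z * (\<Prod>i\<in>UNIV. emeasure \<Lambda> {y. dyadic n y = Z i}) \<partial>count_space (?D n))"
    proof (rule nn_integral_cong)
      fix Z assume "Z \<in> space (count_space (?D n))"
      then have Z: "Z \<in> ?D n" by simp
      show "(\<integral>\<^sup>+\<omega>. indicator {Z. good n Z \<and> ev n Z \<omega>} Z \<partial>M) = ?h Z * (\<Prod>i\<in>UNIV. emeasure \<Lambda> {y. dyadic n y = Z i})"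
      proof (cases "good n Z")
        case True
        have "(\<integral>\<^sup>+\<omega>. indicator {Z. good n Z \<and> ev n Z \<omega>} Z \<partial>M) = (\<integral>\<^sup>+\<omega>. indicator {\<omega> \<in> space M. ev n Z \<omega>} \<omega> \<partial>M)"
          by (intro nn_integral_cong) (simp add: True indicator_def)
        also have "\<dots> = emeasure M {\<omega> \<in> space M. ev n Z \<omega>}"
          using ev_meas[OF True Z] by simp
        finally show ?thesis
          using True by (simp add: ev_prob[OF True Z] cell_def mult.commute)
      qed simp
    qed
    also have "\<dots> = (\<integral>\<^sup>+x. f n x \<partial>?P)"
      unfolding nn_integral_cells[symmetric] f_def q_def by (simp add: indicator_def)
    finally show ?thesis .
  qed
  have f_meas: "f n \<in> borel_measurable ?P" for n
  proof -
    have "f n = (\<lambda>x. (\<lambda>Z. indicator {Z. good n Z} Z * ennreal (exp (- measure \<Lambda> (As n Z \<union> Cs n Z)))) (\<lambda>i. dyadic n (x i)))"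
      unfolding f_def q_def by (auto simp: indicator_def)
    then show ?thesis using dyadic_tuple_measurable by simp
  qed

  have refine: "cells (Suc n) (q (Suc n) x) \<subseteq> cells n (q n x)" for n x
    unfolding cells_def q_def using dyadic_refine by blast
  have good_Suc: "good (Suc n) (q (Suc n) x)" if g: "good n (q n x)" for n x
  proof -
    have "1 / real (Suc (Suc n)) \<le> 1 / real (Suc n)" by (intro divide_left_mono) auto
    then have R: "?R n \<subseteq> ?R (Suc n)" by auto
    have "inj (q (Suc n) x)"
    proof (rule injI)
      fix i j assume "q (Suc n) x i = q (Suc n) x j"
      then have "q n x i = q n x j" unfolding q_def by (rule dyadic_refine)
      then show "i = j" using g by (auto simp: good_def inj_def)
    qed
    then show ?thesis
      using g refine[of n x] R unfolding good_def by blast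
  qed
  have As_Suc: "As (Suc n) (q (Suc n) x) \<subseteq> As n (q n x)" for n x
    unfolding As_def using refine[of n x] by blast
  have Cs_Suc: "Cs (Suc n) (q (Suc n) x) \<subseteq> Cs n (q n x)" for n x
    unfolding Cs_def cell_def q_def using dyadic_refine by blast

  have eventually_good: "\<exists>n0. \<forall>n\<ge>n0. good n (q n x)" if Px: "P x" for x
  proof -
    obtain e r where e: "e > 0" "r > 0" "\<And>x'. (\<forall>i. dist (x' i) (x i) < e) \<Longrightarrow> P x' \<and> A x' \<subseteq> {y. norm y \<ge> r}"
      using P_open[OF Px] by blast
    define r1 where "r1 = Min (insert 1 ((\<lambda>i. norm (x i)) ` UNIV))"
    have r1: "r1 > 0" "\<And>i. r1 \<le> norm (x i)"
    proof -
      have fin: "finite (insert 1 ((\<lambda>i. norm (x i)) ` UNIV))" by auto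
      show "r1 > 0"
        unfolding r1_def using fin P_inj(2)[OF Px] by (subst Min_gr_iff) auto
      show "r1 \<le> norm (x i)" for i
        unfolding r1_def by (rule Min_le[OF fin]) auto
    qed
    define r2 where "r2 = Min (insert 1 ((\<lambda>(i, j). dist (x i) (x j)) ` {(i, j). i \<noteq> j}))"
    have r2: "r2 > 0" "\<And>i j. i \<noteq> j \<Longrightarrow> r2 \<le> dist (x i) (x j)"
    proof -
      have fin: "finite (insert 1 ((\<lambda>(i, j). dist (x i) (x j)) ` {(i, j). i \<noteq> j}))" by auto
      show "r2 > 0"
        unfolding r2_def using fin P_inj(1)[OF Px] by (subst Min_gr_iff) (auto simp: inj_def)
      show "r2 \<le> dist (x i) (x j)" if "i \<noteq> j" for i j
        unfolding r2_def by (rule Min_le[OF fin]) (use that in auto)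
    qed
    define d where "d = min (min e (r1 / 2)) r2"
    have "d > 0" using e r1 r2 by (simp add: d_def)
    then obtain n1 where n1: "\<And>n u v. n \<ge> n1 \<Longrightarrow> dyadic n u = dyadic n (v::'a) \<Longrightarrow> dist u v < d"
      using dyadic_eventually_near[of d] by blast
    obtain n2 where n2: "1 / Suc n2 < min r (r1 / 2)"
      using reals_Archimedean[of "min r (r1 / 2)"] e r1 by (auto simp: inverse_eq_divide)
    show ?thesis
    proof (intro exI[of _ "max n1 n2"] allI impI)
      fix n assume n: "max n1 n2 \<le> n"
      have "1 / real (Suc n) \<le> 1 / real (Suc n2)" using n by (intro divide_left_mono) auto
      with n2 have nr: "1 / real (Suc n) \<le> r" "1 / real (Suc n) \<le> r1 / 2" by auto
      have "inj (q n x)"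
      proof (rule injI, rule ccontr)
        fix i j assume "q n x i = q n x j" "i \<noteq> j"
        then have "dist (x i) (x j) < d" using n1[of n "x i" "x j"] n by (auto simp: q_def)
        then show False using r2(2)[OF \<open>i \<noteq> j\<close>] by (simp add: d_def)
      qed
      moreover have "P x' \<and> A x' \<subseteq> ?R n \<and> range x' \<subseteq> ?R n" if "x' \<in> cells n (q n x)" for x'
      proof -
        have near: "dist (x' i) (x i) < d" for i
          using that n1[of n "x' i" "x i"] n by (auto simp: cells_def q_def)
        then have "P x' \<and> A x' \<subseteq> {y. norm y \<ge> r}" by (intro e(3)) (auto simp: d_def)
        moreover have "r1 / 2 \<le> norm (x' i)" for i
        proof -
          have "norm (x i) \<le> norm (x' i) + dist (x' i) (x i)"
            by (metis dist_commute dist_norm norm_triangle_sub add.commute norm_minus_commute)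
          moreover have "dist (x' i) (x i) < r1 / 2" using near[of i] by (simp add: d_def)
          ultimately show ?thesis using r1(2)[of i] by linarith
        qed
        then have "1 / real (Suc n) \<le> norm (x' i)" for i
          using nr(2) order_trans by blast
        ultimately show ?thesis using nr(1) by (auto simp del: of_nat_Suc)
      qed
      ultimately show "good n (q n x)" unfolding good_def by blast
    qed
  qed
  have good_P: "P x" if "good n (q n x)" for n x
    using that q_cells[of x n] unfolding good_def by blast
  \<comment> \<open>\<open>Ab_closed\<close> keeps \<open>y\<close> out of the union of the nearby
    \<open>A x'\<close>. Since \<open>Ab x\<close> contains the points of the tuple,
    \<open>y\<close> also has positive distance from them and leaves their cubes.\<close>
  have leave: "\<exists>n0. \<forall>n\<ge>n0. y \<notin> As n (q n x) \<union> Cs n (q n x)" if Px: "P x" and y: "y \<notin> Ab x" for x y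
  proof -
    obtain e where e: "e > 0" "\<And>x'. (\<forall>i. dist (x' i) (x i) < e) \<Longrightarrow> y \<notin> A x'"
      using Ab_closed[OF Px y] by blast
    define r2 where "r2 = Min (insert 1 ((\<lambda>i. dist y (x i)) ` UNIV))"
    have r2: "r2 > 0" "\<And>i. r2 \<le> dist y (x i)"
    proof -
      have fin: "finite (insert 1 ((\<lambda>i. dist y (x i)) ` UNIV))" by auto
      show "r2 > 0"
        unfolding r2_def using fin Ab(2)[OF Px] y by (subst Min_gr_iff) auto
      show "r2 \<le> dist y (x i)" for i
        unfolding r2_def by (rule Min_le[OF fin]) auto
    qed
    define d where "d = min e r2"
    have "d > 0" using e r2 by (simp add: d_def)
    then obtain n1 where n1: "\<And>n u v. n \<ge> n1 \<Longrightarrow> dyadic n u = dyadic n (v::'a) \<Longrightarrow> dist u v < d"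
      using dyadic_eventually_near[of d] by blast
    show ?thesis
    proof (intro exI[of _ n1] allI impI notI)
      fix n assume n: "n1 \<le> n" and "y \<in> As n (q n x) \<union> Cs n (q n x)"
      then consider "y \<in> As n (q n x)" | "y \<in> Cs n (q n x)" by blast
      then show False
      proof cases
        case 1
        then obtain x' where x': "x' \<in> cells n (q n x)" "y \<in> A x'" unfolding As_def by blast
        then have "dist (x' i) (x i) < d" for i
          using n1[OF n, of "x' i" "x i"] by (auto simp: cells_def q_def)
        then show False using e(2) x' by (auto simp: d_def)
      next
        case 2
        then obtain i where "dyadic n y = dyadic n (x i)" by (auto simp: Cs_def cell_def q_def)
        then have "dist y (x i) < d" by (rule n1[OF n])
        then show False using r2(2)[of i] by (simp add: d_def)
      qed
    qed
  qed

  have f_mono: "incseq f"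
  proof (intro incseq_SucI le_funI)
    fix n x
    show "f n x \<le> f (Suc n) x"
    proof (cases "good n (q n x)")
      case True
      have sub: "As (Suc n) (q (Suc n) x) \<union> Cs (Suc n) (q (Suc n) x) \<subseteq> As n (q n x) \<union> Cs n (q n x)"
        using As_Suc Cs_Suc by blast
      have "As n (q n x) \<union> Cs n (q n x) \<subseteq> ?R n"
        using As_R[OF True] cell_R[OF True q_D] by (auto simp: Cs_def)
      then have "emeasure \<Lambda> (As n (q n x) \<union> Cs n (q n x)) < \<infinity>" by (rule R_fin)
      then have "measure \<Lambda> (As (Suc n) (q (Suc n) x) \<union> Cs (Suc n) (q (Suc n) x)) \<le> measure \<Lambda> (As n (q n x) \<union> Cs n (q n x))"
        using sub As_open[OF True] As_open[OF good_Suc[OF True]] Cs_borel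
        by (intro measure_mono_fmeasurable) (auto simp: fmeasurable_def sets_Lam)
      then show ?thesis
        using True good_Suc[OF True] by (simp add: f_def ennreal_leI)
    qed (simp add: f_def)
  qed
  \<comment> \<open>The enlarged regions decrease to a set squeezed between \<open>A x\<close> and
    \<open>Ab x\<close>, whose difference is null, so the void probabilities converge to the one for
    \<open>A x\<close>.\<close>
  have f_sup: "(SUP n. f n x) = indicator {x. P x} x * ennreal (exp (- measure \<Lambda> (A x)))" for x
  proof (cases "P x")
    case False
    then have "f n x = 0" for n using good_P[of n x] by (cases "good n (q n x)") (auto simp: f_def)
    then show ?thesis using False by simp
  next
    case True
    obtain n0 where n0: "\<And>n. n \<ge> n0 \<Longrightarrow> good n (q n x)" using eventually_good[OF True] by blast
    define V where "V = (\<lambda>n. As (n + n0) (q (n + n0) x) \<union> Cs (n + n0) (q (n + n0) x))"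
    have V_sets: "V n \<in> sets \<Lambda>" for n
      using As_open[OF n0[of "n + n0"]] Cs_borel by (auto simp: V_def sets_Lam)
    have "V n \<subseteq> ?R (n + n0)" for n
    proof -
      have g: "good (n + n0) (q (n + n0) x)" by (rule n0) simp
      show ?thesis
        using As_R[OF g] cell_R[OF g q_D] unfolding V_def Cs_def by blast
    qed
    then have V_fin: "emeasure \<Lambda> (V n) < \<infinity>" for n by (rule R_fin)
    have V_dec: "decseq V"
      by (intro decseq_SucI) (use As_Suc Cs_Suc in \<open>fastforce simp: V_def\<close>)
    have "(\<lambda>n. measure \<Lambda> (V n)) \<longlonglongrightarrow> measure \<Lambda> (\<Inter>n. V n)"
      using V_sets V_dec V_fin by (intro Lim_measure_decseq) (auto simp: less_top)
    also have "measure \<Lambda> (\<Inter>n. V n) = measure \<Lambda> (A x)"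
    proof -
      have sub1: "A x \<subseteq> (\<Inter>n. V n)" using q_cells by (auto simp: V_def As_def)
      have sub2: "(\<Inter>n. V n) \<subseteq> Ab x"
      proof (rule ccontr)
        assume "\<not> ?thesis"
        then obtain y where y: "\<And>n. y \<in> V n" "y \<notin> Ab x" by blast
        obtain n1 where "\<forall>n\<ge>n1. y \<notin> As n (q n x) \<union> Cs n (q n x)" using leave[OF True y(2)] by blast
        then have "y \<notin> V n1" by (simp add: V_def)
        then show False using y(1) by blast
      qed
      have m: "(\<Inter>n. V n) \<in> sets \<Lambda>" "A x \<in> sets \<Lambda>" "Ab x \<in> sets \<Lambda>"
        using V_sets A_open[OF True] Ab_null(1)[OF True] by (auto simp: sets_Lam)
      have "emeasure \<Lambda> (\<Inter>n. V n) = emeasure \<Lambda> (A x)"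
      proof (rule antisym)
        have "emeasure \<Lambda> (\<Inter>n. V n) \<le> emeasure \<Lambda> (A x \<union> (Ab x - A x))"
          using m sub2 by (intro emeasure_mono) auto
        also have "\<dots> \<le> emeasure \<Lambda> (A x) + emeasure \<Lambda> (Ab x - A x)"
          using m by (intro emeasure_subadditive) auto
        finally show "emeasure \<Lambda> (\<Inter>n. V n) \<le> emeasure \<Lambda> (A x)"
          using Ab_null(2)[OF True] by simp
        show "emeasure \<Lambda> (A x) \<le> emeasure \<Lambda> (\<Inter>n. V n)"
          using m sub1 by (intro emeasure_mono) auto
      qed
      then show ?thesis by (simp add: measure_def)
    qed
    finally have "(\<lambda>n. ennreal (exp (- measure \<Lambda> (V n)))) \<longlonglongrightarrow> ennreal (exp (- measure \<Lambda> (A x)))"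
      by (intro tendsto_ennrealI tendsto_intros)
    moreover have "f (n + n0) x = ennreal (exp (- measure \<Lambda> (V n)))" for n
      using n0[of "n + n0"] by (simp add: f_def V_def)
    ultimately have "(\<lambda>n. f (n + n0) x) \<longlonglongrightarrow> ennreal (exp (- measure \<Lambda> (A x)))" by simp
    then have "(\<lambda>n. f n x) \<longlonglongrightarrow> ennreal (exp (- measure \<Lambda> (A x)))" by (rule LIMSEQ_offset)
    moreover have "(\<lambda>n. f n x) \<longlonglongrightarrow> (SUP n. f n x)"
      by (rule LIMSEQ_SUP) (use f_mono in \<open>auto simp: incseq_def le_fun_def\<close>)
    ultimately show ?thesis using True LIMSEQ_unique by fastforce
  qed

  \<comment> \<open>The tuples detected at level \<open>n\<close>. They correspond one to one to the
    detected products of cubes, each of which holds exactly one tuple of points of the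
    process.\<close>
  define U where "U = (\<lambda>n \<omega>. {x. range x \<subseteq> N \<omega> \<and> good n (q n x) \<and> (\<forall>i. N \<omega> \<inter> cell n (q n x i) = {x i}) \<and> N \<omega> \<inter> As n (q n x) \<subseteq> range x})"
  have U_mono: "U n \<omega> \<subseteq> U (Suc n) \<omega>" for n \<omega>
  proof
    fix x assume x: "x \<in> U n \<omega>"
    have "N \<omega> \<inter> cell (Suc n) (q (Suc n) x i) = {x i}" for i
    proof -
      have "cell (Suc n) (q (Suc n) x i) \<subseteq> cell n (q n x i)"
        unfolding cell_def q_def using dyadic_refine by blast
      moreover have "x i \<in> cell (Suc n) (q (Suc n) x i)" by (simp add: cell_def q_def)
      moreover have "x i \<in> N \<omega>" "N \<omega> \<inter> cell n (q n x i) = {x i}" using x by (auto simp: U_def)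
      ultimately show ?thesis by blast
    qed
    moreover have "N \<omega> \<inter> As (Suc n) (q (Suc n) x) \<subseteq> range x"
      using x As_Suc[of n x] by (auto simp: U_def)
    ultimately show "x \<in> U (Suc n) \<omega>" using x good_Suc by (auto simp: U_def)
  qed
  have U_S': "emeasure (count_space UNIV) (U n \<omega>) = S' n \<omega>" if lf: "\<forall>r>0. finite (N \<omega> \<inter> {y. norm y \<ge> r})" for n \<omega>
  proof -
    let ?E = "{Z \<in> ?D n. good n Z \<and> ev n Z \<omega>}"
    have fin: "finite (N \<omega> \<inter> (As n Z - Cs n Z))" if "good n Z" for Z
    proof -
      have "N \<omega> \<inter> (As n Z - Cs n Z) \<subseteq> N \<omega> \<inter> ?R n" using As_R[OF that] by blast
      moreover have "finite (N \<omega> \<inter> ?R n)" using lf by simp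
      ultimately show ?thesis by (rule finite_subset)
    qed
    have "bij_betw (q n) (U n \<omega>) ?E"
      unfolding bij_betw_def
    proof
      show "inj_on (q n) (U n \<omega>)"
      proof (rule inj_onI, rule ext)
        fix x y i assume "x \<in> U n \<omega>" "y \<in> U n \<omega>" and eq: "q n x = q n y"
        then have "N \<omega> \<inter> cell n (q n x i) = {x i}" "N \<omega> \<inter> cell n (q n y i) = {y i}" by (auto simp: U_def)
        then show "x i = y i" using eq by auto
      qed
      show "q n ` U n \<omega> = ?E"
      proof (intro equalityI subsetI)
        fix Z assume "Z \<in> q n ` U n \<omega>"
        then obtain x where x: "x \<in> U n \<omega>" "Z = q n x" by blast
        have "N \<omega> \<inter> (As n Z - Cs n Z) = {}"
        proof -
          have "range x \<subseteq> Cs n Z" by (auto simp: Cs_def cell_def x(2) q_def)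
          moreover have "N \<omega> \<inter> As n Z \<subseteq> range x" using x by (auto simp: U_def)
          ultimately show ?thesis by blast
        qed
        then show "Z \<in> ?E" using x q_D by (auto simp: ev_def U_def)
      next
        fix Z assume Z: "Z \<in> ?E"
        then have "\<forall>i. \<exists>u. N \<omega> \<inter> cell n (Z i) = {u}"
          by (auto simp: ev_def card_1_singleton_iff)
        then obtain x where x: "\<And>i. N \<omega> \<inter> cell n (Z i) = {x i}" by metis
        then have "x i \<in> cell n (Z i)" for i by blast
        then have qx: "q n x = Z" by (auto simp: q_def cell_def fun_eq_iff)
        have "N \<omega> \<inter> (As n Z - Cs n Z) = {}"
          using Z fin[of Z] by (auto simp: ev_def)
        then have "N \<omega> \<inter> As n Z \<subseteq> N \<omega> \<inter> Cs n Z" by blast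
        also have "\<dots> \<subseteq> range x" using x by (auto simp: Cs_def)
        finally have "x \<in> U n \<omega>" using Z x qx by (auto simp: U_def)
        then show "Z \<in> q n ` U n \<omega>" using qx by blast
      qed
    qed
    then have "finite (U n \<omega>) \<longleftrightarrow> finite ?E" "card (U n \<omega>) = card ?E"
      using bij_betw_finite bij_betw_same_card by auto
    then have "emeasure (count_space UNIV) (U n \<omega>) = emeasure (count_space (?D n)) ?E"
      by (subst (1 2) emeasure_count_space) auto
    also have "\<dots> = (\<integral>\<^sup>+Z. indicator ?E Z \<partial>count_space (?D n))"
      by (rule nn_integral_indicator[symmetric]) auto
    also have "\<dots> = S' n \<omega>"
      unfolding S'_def by (intro nn_integral_cong) (auto simp: indicator_def)
    finally show ?thesis .
  qed
  have U_union: "(\<Union>n. U n \<omega>) = {x. P x \<and> range x \<subseteq> N \<omega> \<and> N \<omega> \<inter> A x = {}}"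
    if lf: "\<forall>r>0. finite (N \<omega> \<inter> {y. norm y \<ge> r})" and gen: "\<forall>x. P x \<and> range x \<subseteq> N \<omega> \<longrightarrow> N \<omega> \<inter> Ab x \<subseteq> A x \<union> range x" for \<omega>
  proof (intro equalityI subsetI)
    fix x assume "x \<in> (\<Union>n. U n \<omega>)"
    then obtain n where x: "x \<in> U n \<omega>" by blast
    then have Px: "P x" using good_P by (auto simp: U_def)
    have "A x \<subseteq> As n (q n x)" using q_cells by (auto simp: As_def)
    then have "N \<omega> \<inter> A x \<subseteq> range x" using x by (auto simp: U_def)
    then have "N \<omega> \<inter> A x = {}" using A_self[OF Px] by blast
    then show "x \<in> {x. P x \<and> range x \<subseteq> N \<omega> \<and> N \<omega> \<inter> A x = {}}" using x Px by (auto simp: U_def)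
  next
    fix x assume "x \<in> {x. P x \<and> range x \<subseteq> N \<omega> \<and> N \<omega> \<inter> A x = {}}"
    then have x: "P x" "range x \<subseteq> N \<omega>" "N \<omega> \<inter> A x = {}" by auto
    have NA: "N \<omega> \<inter> Ab x \<subseteq> range x" using gen x by blast
    obtain n0 where n0: "\<And>n. n \<ge> n0 \<Longrightarrow> good n (q n x)" using eventually_good[OF x(1)] by blast
    \<comment> \<open>The enlarged region stays in \<open>?R n0\<close>, where only finitely many
      further points exist. Each of them leaves the region at some level, and the largest of these
      levels detects the tuple.\<close>
    let ?F = "N \<omega> \<inter> ?R n0 - range x"
    have finF: "finite ?F" using lf by simp
    have "\<forall>y\<in>?F. \<exists>n1. \<forall>n\<ge>n1. y \<notin> As n (q n x) \<union> Cs n (q n x)"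
      using leave[OF x(1)] NA by blast
    then obtain n1 where n1: "\<And>y n. y \<in> ?F \<Longrightarrow> n \<ge> n1 y \<Longrightarrow> y \<notin> As n (q n x) \<union> Cs n (q n x)" by metis
    define m where "m = Max (insert n0 (n1 ` ?F))"
    have m: "m \<ge> n0" "\<And>y. y \<in> ?F \<Longrightarrow> m \<ge> n1 y"
      unfolding m_def using finF by auto
    have dec: "As m (q m x) \<union> Cs m (q m x) \<subseteq> As n0 (q n0 x) \<union> Cs n0 (q n0 x)"
    proof -
      have "decseq (\<lambda>n. As n (q n x) \<union> Cs n (q n x))"
        by (intro decseq_SucI) (use As_Suc Cs_Suc in fastforce)
      then show ?thesis using m(1) by (auto simp: decseq_def)
    qed
    also have "\<dots> \<subseteq> ?R n0"
      using As_R[OF n0[OF order_refl]] cell_R[OF n0[OF order_refl] q_D] by (auto simp: Cs_def)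
    finally have subR: "As m (q m x) \<union> Cs m (q m x) \<subseteq> ?R n0" .
    have only: "N \<omega> \<inter> (As m (q m x) \<union> Cs m (q m x)) \<subseteq> range x"
      using n1 m(2) subR by blast
    have "N \<omega> \<inter> cell m (q m x i) = {x i}" for i
    proof (intro equalityI subsetI)
      fix y assume y: "y \<in> N \<omega> \<inter> cell m (q m x i)"
      then have "y \<in> range x" using only by (auto simp: Cs_def)
      then obtain j where j: "y = x j" by blast
      then have "q m x j = q m x i" using y by (simp add: cell_def q_def)
      then have "j = i" using n0[OF m(1)] by (auto simp: good_def inj_def)
      then show "y \<in> {x i}" using j by simp
    qed (use x in \<open>auto simp: cell_def q_def\<close>)
    then have "x \<in> U m \<omega>"
      using x n0[OF m(1)] only by (auto simp: U_def)
    then show "x \<in> (\<Union>n. U n \<omega>)" by blast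
  qed
  \<comment> \<open>The count is an increasing limit of the counts \<open>S' n\<close>, and their
    expectations are known from \<open>S'_int\<close>; monotone convergence on both sides does the
    rest.\<close>
  have AE_S: "AE \<omega> in M. S \<omega> = (SUP n. S' n \<omega>) \<and> (\<forall>n. S' n \<omega> \<le> S' (Suc n) \<omega>)"
    using AE_locally_finite generic
  proof eventually_elim
    case (elim \<omega>)
    have "(SUP n. emeasure (count_space UNIV) (U n \<omega>)) = emeasure (count_space UNIV) (\<Union>n. U n \<omega>)"
      by (rule SUP_emeasure_incseq) (auto intro!: incseq_SucI U_mono)
    then have "S \<omega> = (SUP n. S' n \<omega>)"
      unfolding S_def U_union[OF elim] U_S'[OF elim(1)] by simp
    moreover have "S' n \<omega> \<le> S' (Suc n) \<omega>" for n
      unfolding U_S'[OF elim(1), symmetric] by (rule emeasure_mono[OF U_mono]) simp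
    ultimately show ?case by blast
  qed
  show "\<exists>S'\<in>borel_measurable M. AE \<omega> in M. S \<omega> = S' \<omega>"
  proof (intro bexI)
    show "AE \<omega> in M. S \<omega> = (SUP n. S' n \<omega>)" using AE_S by eventually_elim simp
    show "(\<lambda>\<omega>. SUP n. S' n \<omega>) \<in> borel_measurable M" using S'_meas by measurable
  qed
  have "(\<integral>\<^sup>+\<omega>. S \<omega> \<partial>M) = (\<integral>\<^sup>+\<omega>. (SUP n. S' n \<omega>) \<partial>M)"
    by (rule nn_integral_cong_AE) (use AE_S in eventually_elim, simp)
  also have "\<dots> = (SUP n. \<integral>\<^sup>+\<omega>. S' n \<omega> \<partial>M)"
    by (rule nn_integral_monotone_convergence_SUP_AE) (use AE_S S'_meas in auto)
  also have "\<dots> = (SUP n. \<integral>\<^sup>+x. f n x \<partial>?P)"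
    unfolding S'_int ..
  also have "\<dots> = (\<integral>\<^sup>+x. (SUP n. f n x) \<partial>?P)"
    by (rule nn_integral_monotone_convergence_SUP[symmetric, OF f_mono f_meas])
  also have "\<dots> = (\<integral>\<^sup>+x. indicator {x. P x} x * ennreal (exp (- measure \<Lambda> (A x))) \<partial>?P)"
    unfolding f_sup ..
  finally show "(\<integral>\<^sup>+\<omega>. S \<omega> \<partial>M) = (\<integral>\<^sup>+x. indicator {x. P x} x * ennreal (exp (- measure \<Lambda> (A x))) \<partial>?P)" .
qed

end

section \<open>Faces of the convex hull of a generic configuration\<close>

definition row_mat :: "('n::finite \<Rightarrow> real ^ 'n) \<Rightarrow> real ^ 'n ^ 'n" where
  "row_mat x = (\<chi> i. x i)"

text \<open>Hyperplanes missing the origin are normalised to level 1, so that their normals are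
  points of the polar space. For dependent points the value is 0.\<close>

definition facet_normal :: "('n::finite \<Rightarrow> real ^ 'n) \<Rightarrow> real ^ 'n" where
  "facet_normal x = dual_vec (row_mat x) (\<chi> i. 1)"

definition facet_beyond :: "('n::finite \<Rightarrow> real ^ 'n) \<Rightarrow> (real ^ 'n) set" where
  "facet_beyond x = {y. facet_normal x \<bullet> y > 1}"

definition pos_coefs :: "'n::finite set \<Rightarrow> real ^ 'n \<Rightarrow> ('n \<Rightarrow> real ^ 'n) \<Rightarrow> bool" where
  "pos_coefs I c x \<longleftrightarrow> det (row_mat x) \<noteq> 0 \<and> (\<forall>i\<in>I. coef (row_mat x) c i > 0)"

lemma vector_matrix_mult_row_mat: "l v* row_mat x = (\<Sum>i\<in>UNIV. l $ i *\<^sub>R x i)"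
  by (simp add: vec_eq_iff vector_matrix_mult_def row_mat_def)

lemma row_mat_vector_mult: "row_mat x *v w = (\<chi> i. x i \<bullet> w)"
  by (simp add: vec_eq_iff matrix_vector_mul_component row_mat_def)

lemma facet_normal_iff:
  assumes "det (row_mat x) \<noteq> 0"
  shows "(\<forall>i. w \<bullet> x i = 1) \<longleftrightarrow> w = facet_normal x"
  using dual_vec_iff[OF assms, of w "\<chi> i. 1"]
  by (auto simp: facet_normal_def row_mat_vector_mult vec_eq_iff inner_commute)

lemma facet_normal_inner: "det (row_mat x) \<noteq> 0 \<Longrightarrow> facet_normal x \<bullet> x i = 1"
  using facet_normal_iff by blast

lemma det_row_mat_inj:
  assumes "det (row_mat x) \<noteq> 0"
  shows "inj x"
proof (rule injI, rule ccontr)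
  fix i j assume "x i = x j" "i \<noteq> j"
  then have "det (row_mat x) = 0"
    by (intro det_identical_rows[of i j]) (auto simp: row_def row_mat_def)
  then show False using assms by simp
qed

lemma coef_sum:
  assumes "det (row_mat x) \<noteq> 0"
  shows "c = (\<Sum>i\<in>UNIV. coef (row_mat x) c i *\<^sub>R x i)"
proof -
  obtain l where l: "c = l v* row_mat x" using coef_surj[OF assms] .
  then show ?thesis using coef_eq[OF assms] by (simp add: vector_matrix_mult_row_mat)
qed

lemma coef_unique:
  assumes "det (row_mat x) \<noteq> 0" "c = (\<Sum>i\<in>UNIV. u i *\<^sub>R x i)"
  shows "coef (row_mat x) c i = u i"
  using coef_eq[OF assms(1), of "\<chi> i. u i" i] assms(2) by (simp add: vector_matrix_mult_row_mat)

lemma card_bij_betw_fact: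
  fixes F :: "'b set"
  assumes "finite F" "card F = CARD('i::finite)"
  shows "card {x :: 'i \<Rightarrow> 'b. bij_betw x UNIV F} = fact (CARD('i))"
proof -
  obtain x0 :: "'i \<Rightarrow> 'b" where x0: "bij_betw x0 UNIV F"
    using assms finite_same_card_bij[of "UNIV :: 'i set" F] by auto
  have "{x :: 'i \<Rightarrow> 'b. bij_betw x UNIV F} = (\<lambda>p. x0 \<circ> p) ` {p. p permutes UNIV}"
  proof (intro equalityI subsetI)
    fix x :: "'i \<Rightarrow> 'b" assume "x \<in> {x. bij_betw x UNIV F}"
    then have x: "bij_betw x UNIV F" by simp
    have "bij_betw (inv_into UNIV x0 \<circ> x) UNIV UNIV"
      using x bij_betw_inv_into[OF x0] by (rule bij_betw_trans)
    moreover have "x = x0 \<circ> (inv_into UNIV x0 \<circ> x)"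
      using x x0 by (auto simp: fun_eq_iff bij_betw_def f_inv_into_f)
    ultimately show "x \<in> (\<lambda>p. x0 \<circ> p) ` {p. p permutes UNIV}"
      using bij_imp_permutes by blast
  next
    fix x assume "x \<in> (\<lambda>p. x0 \<circ> p) ` {p. p permutes UNIV}"
    then show "x \<in> {x. bij_betw x UNIV F}"
      using x0 bij_betw_trans permutes_imp_bij by blast
  qed
  moreover have "inj_on (\<lambda>p. x0 \<circ> p) {p. p permutes UNIV}"
    using x0 by (auto simp: inj_on_def bij_betw_def fun_eq_iff)
  ultimately show ?thesis
    by (simp add: card_image card_permutations)
qed

text \<open>Deterministic properties that hold almost surely and carry the combinatorics. Points
  accumulate at 0 inside every open halfspace through it (\<open>surround\<close>), and at most d of
  them share a hyperplane missing 0: \<open>'n option\<close> has one element more than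
  \<open>'n\<close>. By \<open>c_generic\<close>, \<open>c\<close> avoids the span of any fewer than
  d points.\<close>

locale generic_configuration =
  fixes N :: "(real ^ 'n) set" and c :: "real ^ 'n"
  assumes locally_finite: "\<And>r. r > 0 \<Longrightarrow> finite (N \<inter> {y. norm y \<ge> r})"
    and no_zero: "0 \<notin> N"
    and surround: "\<And>a r. a \<noteq> 0 \<Longrightarrow> r > 0 \<Longrightarrow> \<exists>y\<in>N. a \<bullet> y > 0 \<and> norm y < r"
    and det_nz: "\<And>x. inj x \<Longrightarrow> range x \<subseteq> N \<Longrightarrow> det (row_mat x) \<noteq> 0"
    and no_hyperplane: "\<And>x :: 'n option \<Rightarrow> real ^ 'n. inj x \<Longrightarrow> range x \<subseteq> N \<Longrightarrow> \<not> (\<exists>w. \<forall>i. w \<bullet> x i = 1)"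
    and c_generic: "\<And>x i. inj x \<Longrightarrow> range x \<subseteq> N \<Longrightarrow> coef (row_mat x) c i \<noteq> 0"
begin

abbreviation "P \<equiv> convex hull N"

text \<open>Membership in the polar body of \<open>P\<close>. The points in \<open>tight w\<close>
  are those whose constraints are active at \<open>w\<close>.\<close>

definition feasible :: "real ^ 'n \<Rightarrow> bool" where
  "feasible w \<longleftrightarrow> (\<forall>y\<in>N. w \<bullet> y \<le> 1)"

definition tight :: "real ^ 'n \<Rightarrow> (real ^ 'n) set" where
  "tight w = {y \<in> N. w \<bullet> y = 1}"

section \<open>The polar body and its active constraints\<close>

lemma infinite_N: "infinite N"
proof
  assume fin: "finite N"
  obtain y where "y \<in> N" using surround[of "axis undefined 1" 1] by auto
  then have ne: "norm ` N \<noteq> {}" by blast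
  have "Min (norm ` N) > 0"
    using fin ne no_zero by (subst Min_gr_iff) (auto intro: ccontr)
  then obtain z where "z \<in> N" "norm z < Min (norm ` N)"
    using surround[of "axis undefined 1" "Min (norm ` N)"] by auto
  then show False using fin by (meson Min_le finite_imageI imageI not_less)
qed

text \<open>Otherwise a closed halfspace through 0 would contain \<open>N\<close>, against
  \<open>surround\<close>. If \<open>P\<close> has empty interior it lies in a hyperplane
  \<open>a \<bullet> x = b\<close>, and the sign of \<open>b\<close> decides between
  \<open>a\<close> and \<open>- a\<close>.\<close>

lemma zero_interior: "0 \<in> interior P"
proof (rule ccontr)
  assume z: "0 \<notin> interior P"
  have "\<exists>a. a \<noteq> 0 \<and> (\<forall>y\<in>N. a \<bullet> y \<le> 0)"
  proof (cases "interior P = {}")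
    case True
    then obtain a b where a: "a \<noteq> 0" "P \<subseteq> {x. a \<bullet> x = b}"
      using empty_interior_subset_hyperplane[of P] by auto
    then have "a \<bullet> y = b" if "y \<in> N" for y using that hull_subset[of N convex] by blast
    then show ?thesis
    proof (cases "b \<le> 0")
      case False
      then show ?thesis using a \<open>\<And>y. y \<in> N \<Longrightarrow> a \<bullet> y = b\<close> by (intro exI[of _ "- a"]) auto
    qed (use a in auto)
  next
    case False
    obtain a b where a: "a \<noteq> 0" "\<forall>x\<in>interior P. a \<bullet> x \<le> b" "\<forall>x\<in>{0}. b \<le> a \<bullet> x"
      using separating_hyperplane_sets[of "interior P" "{0}"] False z by auto
    have "interior P \<subseteq> {x. a \<bullet> x \<le> 0}" using a by auto
    then have "closure (interior P) \<subseteq> {x. a \<bullet> x \<le> 0}"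
      by (intro closure_minimal closed_halfspace_le)
    moreover have "P \<subseteq> closure (interior P)"
      using convex_closure_interior[of P] False closure_subset[of P] by simp
    ultimately show ?thesis using a(1) hull_subset[of N convex] by blast
  qed
  then obtain a where "a \<noteq> 0" "\<forall>y\<in>N. a \<bullet> y \<le> 0" by blast
  then show False using surround[of a 1] by force
qed

lemma feasible_hull:
  assumes "feasible w" "p \<in> P"
  shows "w \<bullet> p \<le> 1"
proof -
  have "P \<subseteq> {p. w \<bullet> p \<le> 1}"
    using assms(1) by (intro hull_minimal convex_halfspace_le) (auto simp: feasible_def)
  then show ?thesis using assms(2) by blast
qed

text \<open>A ball of radius \<open>\<delta>\<close> inside \<open>P\<close> bounds the polar body
  by \<open>1 / \<delta>\<close>, and \<open>w \<bullet> y = 1\<close> then keeps active points at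
  distance \<open>\<delta>\<close> from 0, although \<open>N\<close> accumulates there. With local
  finiteness this makes all later counts finite.\<close>

lemma feasible_bounded:
  obtains \<delta> where "\<delta> > 0" "\<And>w. feasible w \<Longrightarrow> norm w \<le> 1 / \<delta>" "\<And>w y. feasible w \<Longrightarrow> y \<in> tight w \<Longrightarrow> norm y \<ge> \<delta>"
proof -
  obtain \<delta> where \<delta>: "\<delta> > 0" "cball 0 \<delta> \<subseteq> P"
    using zero_interior by (auto simp: mem_interior_cball)
  have b: "norm w \<le> 1 / \<delta>" if w: "feasible w" for w
  proof (cases "w = 0")
    case False
    have "(\<delta> / norm w) *\<^sub>R w \<in> cball 0 \<delta>" using False \<delta> by simp
    then have "w \<bullet> ((\<delta> / norm w) *\<^sub>R w) \<le> 1" using \<delta> feasible_hull[OF w] by blast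
    then have "\<delta> * norm w \<le> 1" using False by (simp add: dot_square_norm power2_eq_square)
    then show ?thesis using \<delta> by (simp add: pos_le_divide_eq mult.commute)
  qed (use \<delta> in simp)
  moreover have "norm y \<ge> \<delta>" if w: "feasible w" and y: "y \<in> tight w" for w y
  proof -
    have "1 = w \<bullet> y" using y by (simp add: tight_def)
    also have "\<dots> \<le> norm w * norm y" by (rule norm_cauchy_schwarz)
    also have "\<dots> \<le> 1 / \<delta> * norm y" using b[OF w] by (intro mult_right_mono) auto
    finally show ?thesis using \<delta> by (simp add: pos_le_divide_eq)
  qed
  ultimately show ?thesis using that \<delta>(1) by blast
qed

lemma finite_tight: "feasible w \<Longrightarrow> finite (tight w)"
proof -
  assume w: "feasible w"
  obtain \<delta> where "\<delta> > 0" "\<And>y. y \<in> tight w \<Longrightarrow> norm y \<ge> \<delta>" using feasible_bounded w by metis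
  then show ?thesis
    using locally_finite[of \<delta>] by (rule_tac finite_subset[of _ "N \<inter> {y. norm y \<ge> \<delta>}"]) (auto simp: tight_def)
qed

lemma card_tight:
  assumes "feasible w"
  shows "card (tight w) \<le> CARD('n)"
proof (rule ccontr)
  assume "\<not> ?thesis"
  then have "CARD('n option) \<le> card (tight w)" by simp
  then obtain x :: "'n option \<Rightarrow> real ^ 'n" where "x ` UNIV \<subseteq> tight w" "inj x"
    using card_le_inj[of "UNIV :: 'n option set" "tight w"] finite_tight[OF assms] by auto
  then show False
    using no_hyperplane[of x] by (auto simp: tight_def image_subset_iff)
qed

text \<open>Since \<open>N\<close> is infinite, a small set of points can always be completed. This
  transfers genericity from full tuples to smaller sets.\<close>

lemma extend_to_basis:
  assumes "K \<subseteq> N" "finite K" "card K \<le> CARD('n)"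
  obtains x :: "'n \<Rightarrow> real ^ 'n" where "inj x" "range x \<subseteq> N" "K \<subseteq> range x"
proof -
  obtain F where F: "K \<subseteq> F" "F \<subseteq> N" "finite F" "card F = CARD('n)"
  proof -
    have "infinite (N - K)" using infinite_N assms(2) by simp
    then obtain T where T: "finite T" "card T = CARD('n) - card K" "T \<subseteq> N - K"
      using infinite_arbitrarily_large by blast
    have "card (K \<union> T) = CARD('n)" using T assms by (subst card_Un_disjoint) auto
    then show ?thesis using that[of "K \<union> T"] T assms by auto
  qed
  then obtain x :: "'n \<Rightarrow> real ^ 'n" where "bij_betw x UNIV F"
    using finite_same_card_bij[of "UNIV :: 'n set" F] by auto
  then show ?thesis using that[of x] F by (auto simp: bij_betw_def)
qed

lemma independent_N:
  assumes "K \<subseteq> N" "finite K" "card K \<le> CARD('n)"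
  shows "independent K"
proof -
  obtain x :: "'n \<Rightarrow> real ^ 'n" where x: "inj x" "range x \<subseteq> N" "K \<subseteq> range x"
    using extend_to_basis[OF assms] .
  have "independent (range x)"
  proof (subst dependent_finite, simp, rule notI)
    assume "\<exists>u. (\<exists>v\<in>range x. u v \<noteq> 0) \<and> (\<Sum>v\<in>range x. u v *\<^sub>R v) = 0"
    then obtain u i where u: "u (x i) \<noteq> 0" "(\<Sum>v\<in>range x. u v *\<^sub>R v) = 0" by auto
    then have "0 = (\<Sum>i\<in>UNIV. u (x i) *\<^sub>R x i)"
      using x(1) by (simp add: sum.reindex)
    then have "coef (row_mat x) 0 i = u (x i)" by (rule coef_unique[OF det_nz[OF x(1,2)]])
    moreover have "coef (row_mat x) 0 i = 0" by (rule coef_unique[OF det_nz[OF x(1,2)]]) simp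
    ultimately show False using u by simp
  qed
  then show ?thesis using x(3) independent_mono by blast
qed

text \<open>In a basis completing \<open>K\<close>, a point outside \<open>K\<close> would receive
  coefficient 0, against \<open>c_generic\<close>.\<close>

lemma c_notin_span:
  assumes "K \<subseteq> N" "finite K" "card K < CARD('n)"
  shows "c \<notin> span K"
proof
  assume c: "c \<in> span K"
  obtain x :: "'n \<Rightarrow> real ^ 'n" where x: "inj x" "range x \<subseteq> N" "K \<subseteq> range x"
    using extend_to_basis[of K] assms by auto
  have "card (range x) = CARD('n)" using x(1) by (rule card_image)
  then obtain i where i: "x i \<notin> K"
    using assms x(3) by (metis (no_types) image_subsetI less_irrefl subset_antisym)
  obtain u where u: "c = (\<Sum>v\<in>K. u v *\<^sub>R v)"
    using c assms(2) by (auto simp: span_finite)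
  define u' where "u' = (\<lambda>v. if v \<in> K then u v else 0)"
  have "c = (\<Sum>v\<in>range x. u' v *\<^sub>R v)"
    unfolding u using x(3) by (intro sum.mono_neutral_cong_left) (auto simp: u'_def)
  also have "\<dots> = (\<Sum>i\<in>UNIV. u' (x i) *\<^sub>R x i)" using x(1) by (simp add: sum.reindex)
  finally have "coef (row_mat x) c i = u' (x i)" by (rule coef_unique[OF det_nz[OF x(1,2)]])
  then show False using c_generic[OF x(1,2)] i by (simp add: u'_def)
qed

text \<open>Infinitely many constraints must survive the perturbation. Points of norm below
  \<open>r\<close> satisfy theirs for every step \<open>e < 1\<close>, because
  \<open>(norm w + norm v) * r < 1\<close>. Among the finitely many others, active constraints use
  \<open>v \<bullet> y \<le> 0\<close> and inactive ones continuity.\<close>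

lemma feasible_perturb:
  assumes w: "feasible w" and v: "\<And>y. y \<in> tight w \<Longrightarrow> v \<bullet> y \<le> 0"
  obtains e where "e > 0" "feasible (w + e *\<^sub>R v)"
proof -
  define r where "r = 1 / (norm w + norm v + 1)"
  have r: "r > 0" by (simp add: r_def add_nonneg_pos)
  let ?F = "N \<inter> {y. norm y \<ge> r}"
  have "\<forall>\<^sub>F e in at_right 0. (w + e *\<^sub>R v) \<bullet> y \<le> 1" if y: "y \<in> ?F" for y
  proof (cases "w \<bullet> y = 1")
    case True
    then have "v \<bullet> y \<le> 0" using y v by (simp add: tight_def)
    then have "(w + e *\<^sub>R v) \<bullet> y \<le> 1" if "e > 0" for e
      using True that by (simp add: inner_add_left mult_nonneg_nonpos)
    then show ?thesis by (auto simp: eventually_at_right_less intro!: eventually_mono[OF eventually_at_right_less])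
  next
    case False
    then have lt: "w \<bullet> y < 1" using w y by (auto simp: feasible_def less_le)
    have "((\<lambda>e. (w + e *\<^sub>R v) \<bullet> y) \<longlongrightarrow> (w + 0 *\<^sub>R v) \<bullet> y) (at_right 0)"
      by (intro tendsto_intros)
    then have "\<forall>\<^sub>F e in at_right 0. (w + e *\<^sub>R v) \<bullet> y < 1"
      using lt by (intro order_tendstoD(2)) auto
    then show ?thesis by eventually_elim simp
  qed
  then have "\<forall>\<^sub>F e in at_right 0. \<forall>y\<in>?F. (w + e *\<^sub>R v) \<bullet> y \<le> 1"
    using locally_finite[OF r] by (intro eventually_ball_finite) auto
  moreover have "\<forall>\<^sub>F e in at_right (0::real). e < 1"
    by (rule eventually_at_right_real[THEN eventually_mono]) auto
  moreover have "\<forall>\<^sub>F e in at_right (0::real). 0 < e"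
    by (rule eventually_at_right_less)
  ultimately have "\<forall>\<^sub>F e in at_right (0::real). 0 < e \<and> e < 1 \<and> (\<forall>y\<in>?F. (w + e *\<^sub>R v) \<bullet> y \<le> 1)"
    by eventually_elim auto
  then obtain b :: real where b: "b > 0" "\<And>e. 0 < e \<Longrightarrow> e < b \<Longrightarrow> 0 < e \<and> e < 1 \<and> (\<forall>y\<in>?F. (w + e *\<^sub>R v) \<bullet> y \<le> 1)"
    unfolding eventually_at_right_field by blast
  define e where "e = b / 2"
  have e: "0 < e" "e < 1" "\<And>y. y \<in> ?F \<Longrightarrow> (w + e *\<^sub>R v) \<bullet> y \<le> 1"
    using b(2)[of e] b(1) by (auto simp: e_def)
  have "(w + e *\<^sub>R v) \<bullet> y \<le> 1" if y: "y \<in> N" for y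
  proof (cases "norm y \<ge> r")
    case False
    have "(w + e *\<^sub>R v) \<bullet> y \<le> norm (w + e *\<^sub>R v) * norm y" by (rule norm_cauchy_schwarz)
    also have "\<dots> \<le> (norm w + norm v) * norm y"
    proof (intro mult_right_mono)
      have "norm (e *\<^sub>R v) \<le> norm v" using e by (simp add: mult_left_le_one_le)
      then show "norm (w + e *\<^sub>R v) \<le> norm w + norm v" using norm_triangle_ineq[of w "e *\<^sub>R v"] by linarith
    qed simp
    also have "\<dots> \<le> (norm w + norm v + 1) * r"
      using False by (intro mult_mono) auto
    also have "\<dots> = 1" using r by (simp add: r_def add_nonneg_pos less_imp_neq[symmetric])
    finally show ?thesis .
  qed (use e y in auto)
  then show ?thesis using that[of e] e by (simp add: feasible_def)
qed

definition is_facet :: "(real ^ 'n) set \<Rightarrow> bool" where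
  "is_facet F \<longleftrightarrow> card F = CARD('n) \<and> (\<exists>w. feasible w \<and> tight w = F)"

text \<open>The optimality condition for maximising \<open>c\<close> over the face of the polar body
  on which the constraints of \<open>K\<close> are equalities: the multipliers have arbitrary sign
  on \<open>K\<close> and are positive elsewhere.\<close>

definition pos_outside :: "(real ^ 'n) set \<Rightarrow> (real ^ 'n) set \<Rightarrow> bool" where
  "pos_outside K F \<longleftrightarrow> (\<exists>u. c = (\<Sum>y\<in>F. u y *\<^sub>R y) \<and> (\<forall>y\<in>F - K. u y > 0))"

text \<open>The facet is the vertex of the polar polytope maximising \<open>c\<close> over the face dual to \<open>K\<close>.\<close>

lemma ex_facet:
  assumes w0: "feasible w0" "K \<subseteq> tight w0"
  shows "\<exists>F. is_facet F \<and> K \<subseteq> F \<and> pos_outside K F"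
proof -
  let ?Q = "{w. feasible w \<and> (\<forall>y\<in>K. w \<bullet> y = 1)}"
  have KN: "K \<subseteq> N" using w0 by (auto simp: tight_def)
  have "?Q = (\<Inter>y\<in>N. {w. y \<bullet> w \<le> 1}) \<inter> (\<Inter>y\<in>K. {w. y \<bullet> w = 1})"
    by (auto simp: feasible_def inner_commute)
  moreover have "closed \<dots>"
    by (intro closed_Int closed_INT ballI closed_halfspace_le closed_hyperplane)
  ultimately have "closed ?Q" by simp
  moreover have "bounded ?Q"
    using feasible_bounded unfolding bounded_iff by (metis (no_types, lifting) mem_Collect_eq)
  ultimately have "compact ?Q" by (simp add: compact_eq_bounded_closed)
  moreover have "?Q \<noteq> {}" using w0 by (auto simp: tight_def)
  moreover have "continuous_on ?Q (\<lambda>w. c \<bullet> w)" by (intro continuous_intros)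
  ultimately obtain w where w: "w \<in> ?Q" "\<And>w'. w' \<in> ?Q \<Longrightarrow> c \<bullet> w' \<le> c \<bullet> w"
    using continuous_attains_sup[of ?Q "\<lambda>w. c \<bullet> w"] by auto
  then have fw: "feasible w" and Kw: "K \<subseteq> tight w" using KN by (auto simp: tight_def)
  \<comment> \<open>A direction that keeps the points of \<open>K\<close> tight, respects the other
    active constraints and increases \<open>c\<close> would contradict maximality of
    \<open>w\<close>.\<close>
  have improve: False if v: "\<And>y. y \<in> tight w \<Longrightarrow> v \<bullet> y \<le> 0" "\<And>y. y \<in> K \<Longrightarrow> v \<bullet> y = 0" "c \<bullet> v > 0" for v
  proof -
    obtain e where e: "e > 0" "feasible (w + e *\<^sub>R v)"
      using feasible_perturb[OF fw] v(1) by metis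
    then have "w + e *\<^sub>R v \<in> ?Q" using w v(2) by (auto simp: inner_add_left)
    then have "c \<bullet> (w + e *\<^sub>R v) \<le> c \<bullet> w" by (rule w(2))
    moreover have "c \<bullet> (w + e *\<^sub>R v) > c \<bullet> w" using e v(3) by (simp add: inner_add_right)
    ultimately show False by simp
  qed
  have tN: "tight w \<subseteq> N" by (auto simp: tight_def)
  have card: "card (tight w) = CARD('n)"
  proof (rule ccontr)
    assume "\<not> ?thesis"
    then have "card (tight w) < CARD('n)" using card_tight[OF fw] by simp
    then have cs: "c \<notin> span (tight w)" using c_notin_span tN finite_tight[OF fw] by blast
    \<comment> \<open>With fewer than d active points, the component of \<open>c\<close> orthogonal
      to their span is nonzero and is a direction of ascent.\<close>
    obtain p v where pv: "p \<in> span (tight w)" "\<And>y. y \<in> span (tight w) \<Longrightarrow> orthogonal v y" "c = p + v"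
      using orthogonal_subspace_decomp_exists[of "tight w" c] by blast
    have "v \<bullet> y = 0" if "y \<in> tight w" for y
      using pv(2)[OF span_base[OF that]] by (simp add: orthogonal_def)
    moreover have "c \<bullet> v > 0"
    proof -
      have "v \<noteq> 0" using pv cs by auto
      moreover have "v \<bullet> p = 0" using pv(2)[OF pv(1)] by (simp add: orthogonal_def)
      ultimately show ?thesis by (simp add: pv(3) inner_add_left inner_add_right inner_commute)
    qed
    ultimately show False using improve[of v] Kw by auto
  qed
  obtain x :: "'n \<Rightarrow> real ^ 'n" where x: "bij_betw x UNIV (tight w)"
    using finite_same_card_bij[of "UNIV :: 'n set" "tight w"] finite_tight[OF fw] card by auto
  then have xi: "inj x" "range x = tight w" by (auto simp: bij_betw_def)
  then have d0: "det (row_mat x) \<noteq> 0" using det_nz tN by blast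
  define u where "u = (\<lambda>y. coef (row_mat x) c (inv x y))"
  have ux: "u (x i) = coef (row_mat x) c i" for i using xi(1) by (simp add: u_def)
  have cu: "c = (\<Sum>y\<in>tight w. u y *\<^sub>R y)"
  proof -
    have "(\<Sum>y\<in>tight w. u y *\<^sub>R y) = (\<Sum>i\<in>UNIV. coef (row_mat x) c i *\<^sub>R x i)"
      unfolding xi(2)[symmetric] using xi(1) by (simp add: sum.reindex ux)
    then show ?thesis using coef_sum[OF d0] by metis
  qed
  have "u y0 > 0" if y0: "y0 \<in> tight w - K" for y0
  proof (rule ccontr)
    assume neg: "\<not> ?thesis"
    obtain i where i: "y0 = x i" using y0 xi(2) by blast
    have "u y0 \<noteq> 0" using c_generic xi tN by (simp add: i ux)
    with neg have un: "u y0 < 0" by simp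
    \<comment> \<open>The direction that releases the constraint of \<open>y0\<close> and keeps all
      other active ones; along it \<open>c\<close> grows at the rate \<open>- u y0\<close>.\<close>
    define v where "v = dual_vec (row_mat x) (\<chi> j. if j = i then - 1 else 0)"
    have "row_mat x *v v = (\<chi> j. if j = i then - 1 else 0)"
      unfolding v_def using dual_vec_iff[OF d0] by blast
    then have vx: "v \<bullet> x j = (if j = i then - 1 else 0)" for j
      by (simp add: row_mat_vector_mult vec_eq_iff inner_commute)
    have "v \<bullet> y = 0" if "y \<in> K" for y
    proof -
      have "y \<in> range x" using subsetD[OF Kw that] unfolding xi(2) .
      then obtain j where j: "y = x j" by (rule imageE)
      have "y \<noteq> y0" using that y0 by (metis DiffD2)
      then have "j \<noteq> i" unfolding j i by (metis)
      then show ?thesis by (simp add: j vx)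
    qed
    moreover have "v \<bullet> y \<le> 0" if "y \<in> tight w" for y
    proof -
      have "y \<in> range x" using that unfolding xi(2) .
      then obtain j where "y = x j" by (rule imageE)
      then show ?thesis by (simp add: vx)
    qed
    moreover have "c \<bullet> v = - u y0"
    proof -
      have "c \<bullet> v = (\<Sum>j\<in>UNIV. coef (row_mat x) c j * (x j \<bullet> v))"
        using arg_cong[OF coef_sum[OF d0, of c], of "\<lambda>z. z \<bullet> v"] unfolding inner_sum_left inner_scaleR_left .
      also have "\<dots> = (\<Sum>j\<in>UNIV. if j = i then - coef (row_mat x) c i else 0)"
        using vx by (intro sum.cong) (auto simp: inner_commute)
      finally show ?thesis by (simp add: i ux)
    qed
    ultimately show False using improve[of v] un by auto
  qed
  then have "pos_outside K (tight w)" unfolding pos_outside_def using cu by blast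
  then show ?thesis using card fw Kw unfolding is_facet_def by blast
qed

text \<open>Complementary slackness: the multipliers of \<open>F\<close> show that its vertex
  maximises \<open>c\<close> among all feasible \<open>w'\<close> with
  \<open>K \<subseteq> tight w'\<close>, and that equality forces
  \<open>F \<subseteq> tight w'\<close>. By symmetry the two maxima agree, so
  \<open>F \<subseteq> F'\<close>, and both sets have d elements.\<close>

lemma facet_unique:
  assumes "is_facet F" "K \<subseteq> F" "pos_outside K F" and "is_facet F'" "K \<subseteq> F'" "pos_outside K F'"
  shows "F = F'"
proof -
  have fin: "finite F" if "is_facet F" for F
    using that by (auto simp: is_facet_def intro: card_ge_0_finite)
  have le: "c \<bullet> w' \<le> c \<bullet> w \<and> (c \<bullet> w' = c \<bullet> w \<longrightarrow> F \<subseteq> tight w')"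
    if F: "K \<subseteq> F" "pos_outside K F" and w: "feasible w" "tight w = F" and w': "feasible w'" "K \<subseteq> tight w'" and finF: "finite F" for F w w'
  proof -
    obtain u where u: "c = (\<Sum>y\<in>F. u y *\<^sub>R y)" "\<And>y. y \<in> F - K \<Longrightarrow> u y > 0"
      using F(2) unfolding pos_outside_def by blast
    have cw: "c \<bullet> z = (\<Sum>y\<in>F. u y * (y \<bullet> z))" for z
      by (simp add: u(1) inner_sum_left)
    have c1: "c \<bullet> w = (\<Sum>y\<in>F. u y)"
      unfolding cw using w by (intro sum.cong) (auto simp: tight_def inner_commute)
    have term_le: "u y * (y \<bullet> w') \<le> u y" if "y \<in> F" for y
    proof (cases "y \<in> K")
      case True
      then show ?thesis using w' by (auto simp: tight_def inner_commute)
    next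
      case False
      then have "u y > 0" using u that by blast
      moreover have "y \<bullet> w' \<le> 1" using w'(1) that w(2) by (auto simp: feasible_def tight_def inner_commute)
      ultimately show ?thesis using mult_left_mono[of "y \<bullet> w'" 1 "u y"] by simp
    qed
    have le: "c \<bullet> w' \<le> c \<bullet> w"
      unfolding c1 cw[of w'] by (rule sum_mono[OF term_le])
    moreover have "F \<subseteq> tight w'" if eq: "c \<bullet> w' = c \<bullet> w"
    proof
      fix y assume y: "y \<in> F"
      have "(\<Sum>y\<in>F. u y * (y \<bullet> w')) = (\<Sum>y\<in>F. u y)" using eq c1 cw by simp
      then have e: "u y * (y \<bullet> w') = u y"
        using sum_mono_inv[of "\<lambda>y. u y * (y \<bullet> w')" F u] term_le y finF by auto
      show "y \<in> tight w'"
      proof (cases "y \<in> K")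
        case False
        then have "u y > 0" using u y by blast
        then have "y \<bullet> w' = 1" using e by simp
        then show ?thesis using y w(2) by (auto simp: tight_def inner_commute)
      qed (use w' in blast)
    qed
    ultimately show ?thesis by blast
  qed
  obtain w where w: "feasible w" "tight w = F" using assms(1) by (auto simp: is_facet_def)
  obtain w' where w': "feasible w'" "tight w' = F'" using assms(4) by (auto simp: is_facet_def)
  have 1: "c \<bullet> w' \<le> c \<bullet> w \<and> (c \<bullet> w' = c \<bullet> w \<longrightarrow> F \<subseteq> tight w')"
    using le[OF assms(2,3) w w'(1)] assms(5) w'(2) fin[OF assms(1)] by blast
  have 2: "c \<bullet> w \<le> c \<bullet> w'"
    using le[OF assms(5,6) w' w(1)] assms(2) w(2) fin[OF assms(4)] by blast
  have "F \<subseteq> F'" using 1 2 w'(2) by auto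
  then show ?thesis
    using assms(1,4) fin[OF assms(4)] by (intro card_subset_eq) (auto simp: is_facet_def)
qed

section \<open>Double counting of faces and ordered facets\<close>

definition face_vertices :: "nat \<Rightarrow> (real ^ 'n) set set" where
  "face_vertices k = {K. card K = k \<and> (\<exists>w. feasible w \<and> K \<subseteq> tight w)}"

definition facet_tuples :: "'n set \<Rightarrow> ('n \<Rightarrow> real ^ 'n) set" where
  "facet_tuples I = {x. pos_coefs I c x \<and> range x \<subseteq> N \<and> N \<inter> facet_beyond x = {}}"

lemma facet_tuple_tight:
  assumes "x \<in> facet_tuples I"
  shows "feasible (facet_normal x)" "tight (facet_normal x) = range x" "is_facet (range x)" "inj x" "det (row_mat x) \<noteq> 0"
proof -
  show d: "det (row_mat x) \<noteq> 0" using assms by (simp add: facet_tuples_def pos_coefs_def)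
  then show i: "inj x" by (rule det_row_mat_inj)
  show f: "feasible (facet_normal x)"
    using assms by (auto simp: facet_tuples_def facet_beyond_def feasible_def not_less[symmetric])
  have sub: "range x \<subseteq> tight (facet_normal x)"
    using assms facet_normal_inner[OF d] by (auto simp: tight_def facet_tuples_def)
  have "card (range x) = CARD('n)" using i by (rule card_image)
  then have "range x = tight (facet_normal x)"
    using card_tight[OF f] finite_tight[OF f] sub by (intro card_seteq) auto
  then show t: "tight (facet_normal x) = range x" ..
  show "is_facet (range x)"
    using f t \<open>card (range x) = CARD('n)\<close> by (auto simp: is_facet_def)
qed

lemma finite_facet_tuples: "finite (facet_tuples I)"
proof -
  obtain \<delta> where \<delta>: "\<delta> > 0" "\<And>w y. feasible w \<Longrightarrow> y \<in> tight w \<Longrightarrow> norm y \<ge> \<delta>"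
    using feasible_bounded by metis
  have "facet_tuples I \<subseteq> PiE UNIV (\<lambda>_. N \<inter> {y. norm y \<ge> \<delta>})"
  proof
    fix x assume x: "x \<in> facet_tuples I"
    have "x i \<in> N \<inter> {y. norm y \<ge> \<delta>}" for i
      using \<delta>(2)[OF facet_tuple_tight(1)[OF x], of "x i"] facet_tuple_tight(2)[OF x] by (auto simp: tight_def)
    then show "x \<in> PiE UNIV (\<lambda>_. N \<inter> {y. norm y \<ge> \<delta>})" by auto
  qed
  then show ?thesis
    by (rule finite_subset) (intro finite_PiE locally_finite \<delta>, auto)
qed

lemma finite_face_vertices: "finite (face_vertices k)"
proof -
  obtain \<delta> where \<delta>: "\<delta> > 0" "\<And>w y. feasible w \<Longrightarrow> y \<in> tight w \<Longrightarrow> norm y \<ge> \<delta>"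
    using feasible_bounded by metis
  have "face_vertices k \<subseteq> Pow (N \<inter> {y. norm y \<ge> \<delta>})"
    using \<delta>(2) by (fastforce simp: face_vertices_def tight_def)
  then show ?thesis
    using locally_finite[OF \<delta>(1)] finite_subset by blast
qed

text \<open>The empty set is supported by any feasible vector, for instance 0. This instance
  calibrates the constant at the end.\<close>

lemma face_vertices_0: "card (face_vertices 0) = 1"
proof -
  have "face_vertices 0 = {{}}"
  proof (intro equalityI subsetI)
    fix K assume "K \<in> face_vertices 0"
    then obtain w where "card K = 0" "feasible w" "K \<subseteq> tight w" by (auto simp: face_vertices_def)
    then show "K \<in> {{}}" using finite_tight finite_subset by fastforce
  next
    fix K :: "(real^'n) set" assume "K \<in> {{}}"
    moreover have "feasible 0" by (simp add: feasible_def)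
    ultimately show "K \<in> face_vertices 0" by (auto simp: face_vertices_def)
  qed
  then show ?thesis by simp
qed

text \<open>Both sides count pairs of a \<open>k\<close>-set \<open>K\<close> and an enumeration
  \<open>x\<close> of the facet selected for \<open>K\<close> by \<open>c\<close>. The index set
  \<open>I\<close> records the positions of the points outside \<open>K\<close>, so positivity on
  \<open>I\<close> is exactly \<open>pos_outside\<close>.\<close>

lemma card_facet_tuples:
  assumes "k \<le> CARD('n)"
  shows "fact (CARD('n)) * card (face_vertices k) = (\<Sum>I | card I = CARD('n) - k. card (facet_tuples I))"
proof -
  define FK where "FK = (\<lambda>K. THE F. is_facet F \<and> K \<subseteq> F \<and> pos_outside K F)"
  have FK: "is_facet (FK K) \<and> K \<subseteq> FK K \<and> pos_outside K (FK K)" if "K \<in> face_vertices k" for K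
  proof -
    have "\<exists>!F. is_facet F \<and> K \<subseteq> F \<and> pos_outside K F"
      using that ex_facet facet_unique unfolding face_vertices_def by blast
    then show ?thesis unfolding FK_def by (rule theI')
  qed
  have FK_eq: "FK K = F" if "is_facet F" "K \<subseteq> F" "pos_outside K F" for K F
    unfolding FK_def by (rule the_equality) (use that facet_unique in blast)+
  let ?A = "SIGMA I:{I. card I = CARD('n) - k}. facet_tuples I"
  let ?B = "SIGMA K:face_vertices k. {x :: 'n \<Rightarrow> real^'n. bij_betw x UNIV (FK K)}"
  have finFK: "finite (FK K)" "card (FK K) = CARD('n)" if "K \<in> face_vertices k" for K
    using FK[OF that] by (auto simp: is_facet_def intro: card_ge_0_finite)
  have "bij_betw (\<lambda>(I, x). (x ` (- I), x)) ?A ?B"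
  proof (rule bij_betw_imageI)
    show "inj_on (\<lambda>(I, x). (x ` (- I), x)) ?A"
    proof (rule inj_onI)
      fix p q assume pq: "p \<in> ?A" "q \<in> ?A" "(\<lambda>(I, x). (x ` (- I), x)) p = (\<lambda>(I, x). (x ` (- I), x)) q"
      obtain I x J y where p: "p = (I, x)" and q: "q = (J, y)" by (metis surj_pair)
      have x: "x \<in> facet_tuples I" and y: "y = x" and eq: "x ` (- I) = x ` (- J)"
        using pq unfolding p q by auto
      have "- I = - J" using inj_image_eq_iff[OF facet_tuple_tight(4)[OF x], of "- I" "- J"] eq by simp
      then show "p = q" using y by (simp add: p q)
    qed
    show "(\<lambda>(I, x). (x ` (- I), x)) ` ?A = ?B"
    proof (intro equalityI subsetI)
      fix p assume "p \<in> (\<lambda>(I, x). (x ` (- I), x)) ` ?A"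
      then obtain z where z: "z \<in> ?A" "p = (\<lambda>(I, x). (x ` (- I), x)) z" by (rule imageE)
      obtain I x where zz: "z = (I, x)" by (cases z)
      have p: "p = (x ` (- I), x)" and I: "card I = CARD('n) - k" and x: "x \<in> facet_tuples I"
        using z unfolding zz by simp_all
      note t = facet_tuple_tight[OF x]
      have "card (x ` (- I)) = k"
      proof -
        have "card (x ` (- I)) = card (- I)" using t(4) by (intro card_image) (auto intro: inj_on_subset)
        also have "\<dots> = k" using I assms by (simp add: Compl_eq_Diff_UNIV card_Diff_subset)
        finally show ?thesis .
      qed
      then have K: "x ` (- I) \<in> face_vertices k"
        unfolding face_vertices_def using t(1,2) by blast
      have "pos_outside (x ` (- I)) (range x)"
        unfolding pos_outside_def
      proof (rule exI[of _ "\<lambda>y. coef (row_mat x) c (inv x y)"], intro conjI ballI)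
        let ?u = "\<lambda>y. coef (row_mat x) c (inv x y)"
        show "c = (\<Sum>y\<in>range x. ?u y *\<^sub>R y)"
        proof -
          have "(\<Sum>y\<in>range x. ?u y *\<^sub>R y) = (\<Sum>i\<in>UNIV. coef (row_mat x) c i *\<^sub>R x i)"
            using t(4) by (simp add: sum.reindex)
          then show ?thesis using coef_sum[OF t(5)] by metis
        qed
        fix y assume "y \<in> range x - x ` (- I)"
        then obtain i where i: "y = x i" "i \<in> I" by blast
        then have "coef (row_mat x) c i > 0" using x unfolding facet_tuples_def pos_coefs_def by blast
        then show "?u y > 0" using t(4) by (simp add: i(1))
      qed
      then have "FK (x ` (- I)) = range x" using t(3) by (intro FK_eq) blast+
      then show "p \<in> ?B" using K t(4) unfolding p by (simp add: bij_betw_def)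
    next
      fix p assume "p \<in> ?B"
      then obtain K x where p: "p = (K, x)" and K: "K \<in> face_vertices k" and x: "bij_betw x UNIV (FK K)"
        by (cases p) simp
      note F = FK[OF K]
      have xi: "inj x" "range x = FK K" using x by (auto simp: bij_betw_def)
      obtain w where w: "feasible w" "tight w = FK K" using F by (auto simp: is_facet_def)
      have xN: "range x \<subseteq> N" using xi w by (auto simp: tight_def)
      have d0: "det (row_mat x) \<noteq> 0" by (rule det_nz[OF xi(1) xN])
      define I where "I = {i. x i \<notin> K}"
      have xI: "x ` (- I) = K"
      proof -
        have "K \<subseteq> range x" using F unfolding xi(2) by blast
        then show ?thesis unfolding I_def by blast
      qed
      have "card K = card (- I)"
        unfolding xI[symmetric] using xi(1) by (intro card_image) (auto intro: inj_on_subset)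
      moreover have "card K = k" using K by (simp add: face_vertices_def)
      moreover have "card (- I) = CARD('n) - card I" by (simp add: Compl_eq_Diff_UNIV card_Diff_subset)
      moreover have "card I \<le> CARD('n)" by (rule card_mono) auto
      ultimately have cI: "card I = CARD('n) - k" by linarith
      obtain u where u: "c = (\<Sum>y\<in>FK K. u y *\<^sub>R y)" "\<And>y. y \<in> FK K - K \<Longrightarrow> u y > 0"
        using F unfolding pos_outside_def by blast
      have "c = (\<Sum>i\<in>UNIV. u (x i) *\<^sub>R x i)"
        using u(1) xi(1) unfolding xi(2)[symmetric] by (simp add: sum.reindex)
      then have "coef (row_mat x) c i = u (x i)" for i by (rule coef_unique[OF d0])
      moreover have "u (x i) > 0" if "i \<in> I" for i
        using that u(2)[of "x i"] xi(2) by (auto simp: I_def)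
      ultimately have "pos_coefs I c x" using d0 by (simp add: pos_coefs_def)
      moreover have "facet_normal x = w"
        using facet_normal_iff[OF d0, of w] w(2) xi(2) by (auto simp: tight_def)
      then have "N \<inter> facet_beyond x = {}"
        using w(1) by (auto simp: facet_beyond_def feasible_def not_less[symmetric])
      ultimately have "x \<in> facet_tuples I" using xN by (simp add: facet_tuples_def)
      then have "(I, x) \<in> ?A" using cI by simp
      moreover have "p = (\<lambda>(I, x). (x ` (- I), x)) (I, x)" by (simp add: p xI)
      ultimately show "p \<in> (\<lambda>(I, x). (x ` (- I), x)) ` ?A" by (rule rev_image_eqI)
    qed
  qed
  then have "card ?A = card ?B" by (rule bij_betw_same_card)
  moreover have "card ?A = (\<Sum>I | card I = CARD('n) - k. card (facet_tuples I))"
    by (intro card_SigmaI) (auto simp: finite_facet_tuples)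
  moreover have "card ?B = (\<Sum>K\<in>face_vertices k. card {x :: 'n \<Rightarrow> real^'n. bij_betw x UNIV (FK K)})"
  proof -
    have "finite {x :: 'n \<Rightarrow> real^'n. bij_betw x UNIV (FK K)}" if "K \<in> face_vertices k" for K
      by (rule card_ge_0_finite) (simp add: card_bij_betw_fact[OF finFK[OF that]])
    then show ?thesis
      using finite_face_vertices by simp
  qed
  moreover have "\<dots> = (\<Sum>K\<in>face_vertices k. fact (CARD('n)))"
    by (intro sum.cong refl card_bij_betw_fact finFK)
  ultimately show ?thesis by (simp add: mult.commute)
qed

section \<open>Faces of the hull as simplices on active points\<close>

lemma hull_Int_hyperplane:
  assumes "feasible w"
  shows "P \<inter> {p. w \<bullet> p = 1} = convex hull (tight w)"
proof (intro equalityI subsetI)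
  fix p assume p: "p \<in> P \<inter> {p. w \<bullet> p = 1}"
  then obtain T u where T: "finite T" "T \<subseteq> N" "\<And>y. y \<in> T \<Longrightarrow> 0 \<le> u y" "sum u T = 1" "(\<Sum>y\<in>T. u y *\<^sub>R y) = p"
    unfolding convex_hull_explicit by auto
  \<comment> \<open>All terms are nonnegative by feasibility and their sum vanishes, so the weight
    of \<open>p\<close> sits on active points only.\<close>
  have "(\<Sum>y\<in>T. u y * (1 - w \<bullet> y)) = 1 - w \<bullet> p"
    by (simp add: T(5)[symmetric] inner_sum_right right_diff_distrib sum_subtractf T(4))
  also have "\<dots> = 0" using p by simp
  finally have "\<forall>y\<in>T. u y * (1 - w \<bullet> y) = 0"
    using T assms by (subst sum_nonneg_eq_0_iff[symmetric]) (auto simp: feasible_def subset_iff)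
  then have tight: "y \<in> tight w" if "y \<in> T" "u y \<noteq> 0" for y
    using that T(2) by (auto simp: tight_def)
  let ?T = "{y\<in>T. u y \<noteq> 0}"
  have "sum u ?T = sum u T" "(\<Sum>y\<in>?T. u y *\<^sub>R y) = (\<Sum>y\<in>T. u y *\<^sub>R y)"
    by (rule sum.mono_neutral_left; use T(1) in auto)+
  then have "sum u ?T = 1" "(\<Sum>y\<in>?T. u y *\<^sub>R y) = p"
    unfolding T(4,5) .
  then show "p \<in> convex hull (tight w)"
    unfolding convex_hull_explicit using T tight by (intro CollectI exI[of _ ?T] exI[of _ u]) auto
next
  fix p assume p: "p \<in> convex hull (tight w)"
  have "convex hull (tight w) \<subseteq> P" by (rule hull_mono) (auto simp: tight_def)
  moreover have "convex hull (tight w) \<subseteq> {p. w \<bullet> p = 1}"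
    by (intro hull_minimal convex_hyperplane) (auto simp: tight_def)
  ultimately show "p \<in> P \<inter> {p. w \<bullet> p = 1}" using p by blast
qed

lemma tight_hull_face: "feasible w \<Longrightarrow> convex hull (tight w) face_of P"
  unfolding hull_Int_hyperplane[symmetric]
  by (intro face_of_Int_supporting_hyperplane_le convex_convex_hull feasible_hull)

lemma affine_independent_tight: "feasible w \<Longrightarrow> K \<subseteq> tight w \<Longrightarrow> \<not> affine_dependent K"
proof -
  assume w: "feasible w" and K: "K \<subseteq> tight w"
  have "independent (tight w)"
    by (rule independent_N) (auto simp: tight_def card_tight[OF w, unfolded tight_def] finite_tight[OF w, unfolded tight_def])
  then show ?thesis
    using K independent_mono affine_dependent_imp_dependent by blast
qed

text \<open>The hull of an active set is a simplex, so its faces are hulls of subsets, and its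
  vertices are recovered as extreme points. A proper face \<open>G\<close> is enclosed in such a
  simplex by a hyperplane supporting \<open>P\<close> at a relative interior point of
  \<open>G\<close>.\<close>

lemma face_number_eq:
  assumes "1 \<le> k" "k \<le> CARD('n)"
  shows "face_number (int k - 1) P = card (face_vertices k)"
proof -
  have ad: "aff_dim (convex hull K) = int k - 1" if K: "K \<in> face_vertices k" for K
    using K affine_independent_tight by (auto simp: face_vertices_def aff_dim_convex_hull aff_dim_affine_independent)
  have "bij_betw (\<lambda>K. convex hull K) (face_vertices k) {F. F face_of P \<and> aff_dim F = int k - 1}"
    unfolding bij_betw_def
  proof
    show "inj_on (\<lambda>K. convex hull K) (face_vertices k)"
    proof (rule inj_onI)
      fix K L assume KL: "K \<in> face_vertices k" "L \<in> face_vertices k" "convex hull K = convex hull L"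
      have a: "\<not> affine_dependent K" "\<not> affine_dependent L"
        using KL affine_independent_tight unfolding face_vertices_def by blast+
      show "K = L"
        using extreme_point_of_convex_hull_affine_independent[OF a(1)] extreme_point_of_convex_hull_affine_independent[OF a(2)] KL(3)
        by auto
    qed
    show "(\<lambda>K. convex hull K) ` face_vertices k = {F. F face_of P \<and> aff_dim F = int k - 1}"
    proof (intro equalityI subsetI)
      fix F assume "F \<in> (\<lambda>K. convex hull K) ` face_vertices k"
      then obtain K w where K: "K \<in> face_vertices k" "F = convex hull K" "feasible w" "K \<subseteq> tight w"
        by (auto simp: face_vertices_def)
      have "convex hull K face_of convex hull (tight w)"
        using K affine_independent_tight[OF K(3) order_refl] by (subst face_of_convex_hull_affine_independent) auto
      then have "F face_of P"
        unfolding K(2) using tight_hull_face[OF K(3)] by (rule face_of_trans)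
      then show "F \<in> {F. F face_of P \<and> aff_dim F = int k - 1}" using ad K by auto
    next
      fix G assume "G \<in> {F. F face_of P \<and> aff_dim F = int k - 1}"
      then have G: "G face_of P" "aff_dim G = int k - 1" by auto
      have intP: "interior P \<noteq> {}" using zero_interior by auto
      have riP: "rel_interior P = interior P" using intP by (rule rel_interior_nonempty_interior)
      have "aff_dim P = int (CARD('n))"
        using intP by (subst aff_dim_nonempty_interior) auto
      then have GP: "G \<noteq> P" using G(2) assms by auto
      have "G \<noteq> {}" using G(2) assms by auto
      moreover have cG: "convex G" using G(1) face_of_imp_convex by blast
      ultimately obtain g where g: "g \<in> rel_interior G"
        using rel_interior_eq_empty by blast
      have GsubP: "G \<subseteq> P" using G(1) by (rule face_of_imp_subset)
      have gG: "g \<in> G" using g rel_interior_subset by blast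
      have "g \<notin> rel_interior P"
        using face_of_disjoint_rel_interior[OF G(1) GP] gG by blast
      then obtain a where a: "a \<noteq> 0" "\<And>y. y \<in> P \<Longrightarrow> a \<bullet> g \<le> a \<bullet> y" "\<And>y. y \<in> rel_interior P \<Longrightarrow> a \<bullet> g < a \<bullet> y"
        using supporting_hyperplane_rel_boundary[of P g] gG GsubP by (metis convex_convex_hull subsetD)
      \<comment> \<open>Because 0 is interior, the supporting functional is strictly negative at
        \<open>g\<close>. Dividing by this value normalises it to 1 there and reverses the
        inequality.\<close>
      have ag: "a \<bullet> g < 0" using a(3)[of 0] zero_interior riP by simp
      define w where "w = (1 / (a \<bullet> g)) *\<^sub>R a"
      have fw: "feasible w"
        unfolding feasible_def
      proof
        fix y assume "y \<in> N"
        then have "y \<in> P" by (rule hull_inc)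
        then have "a \<bullet> g \<le> a \<bullet> y" by (rule a(2))
        then show "w \<bullet> y \<le> 1" using ag by (simp add: w_def neg_divide_le_eq)
      qed
      have wg: "w \<bullet> g = 1" using ag by (simp add: w_def)
      let ?F = "convex hull (tight w)"
      have "g \<in> ?F" using gG GsubP wg hull_Int_hyperplane[OF fw] by blast
      then have "G \<subseteq> ?F"
        using subset_of_face_of[OF tight_hull_face[OF fw] GsubP] g by (auto simp: disjnt_def)
      then have "G face_of ?F"
        using G(1) tight_hull_face[OF fw] face_of_imp_subset face_of_subset by metis
      then obtain K where K: "K \<subseteq> tight w" "G = convex hull K"
        using face_of_convex_hull_affine_independent[OF affine_independent_tight[OF fw order_refl]] by auto
      have "aff_dim G = int (card K) - 1"
        using affine_independent_tight[OF fw K(1)] by (simp add: K(2) aff_dim_convex_hull aff_dim_affine_independent)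
      then have "card K = k" using G(2) by simp
      then have "K \<in> face_vertices k" using fw K(1) by (auto simp: face_vertices_def)
      then show "G \<in> (\<lambda>K. convex hull K) ` face_vertices k" using K(2) by blast
    qed
  qed
  then show ?thesis
    unfolding face_number_def by (rule bij_betw_same_card[symmetric])
qed

end

section \<open>Almost sure genericity\<close>

context punctured_ppp
begin

text \<open>The void formula with an empty region. Its closed companion must contain the tuple, so
  it is \<open>range x\<close>, a finite set and hence null for a diffuse intensity.\<close>

lemma mecke_count:
  fixes P :: "('i::finite \<Rightarrow> 'a) \<Rightarrow> bool"
  assumes diffuse: "\<And>y. emeasure \<Lambda> {y} = 0"
    and P_inj: "\<And>x. P x \<Longrightarrow> inj x" "\<And>x i. P x \<Longrightarrow> x i \<noteq> 0"
    and P_open: "\<And>x. P x \<Longrightarrow> \<exists>e>0. \<forall>x'. (\<forall>i. dist (x' i) (x i) < e) \<longrightarrow> P x'"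
  defines "S \<equiv> \<lambda>\<omega>. emeasure (count_space UNIV) {x. P x \<and> range x \<subseteq> N \<omega>}"
  shows "\<exists>S'\<in>borel_measurable M. AE \<omega> in M. S \<omega> = S' \<omega>"
    and "(\<integral>\<^sup>+\<omega>. S \<omega> \<partial>M) = (\<integral>\<^sup>+x. indicator {x. P x} x \<partial>(PiM UNIV (\<lambda>_. \<Lambda>)))"
proof -
  have Ab_closed: "\<exists>e>0. \<forall>x'. (\<forall>i. dist (x' i) (x i) < e) \<longrightarrow> y \<notin> {}" for x :: "'i \<Rightarrow> 'a" and y :: 'a
    by (intro exI[of _ 1]) auto
  have pts: "emeasure \<Lambda> (range x - {}) = 0" for x :: "'i \<Rightarrow> 'a"
  proof -
    have "emeasure \<Lambda> (\<Union>i\<in>UNIV. {x i}) \<le> (\<Sum>i\<in>UNIV. emeasure \<Lambda> {x i})"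
      by (intro emeasure_subadditive_finite) (auto simp: sets_Lam)
    also have "(\<Union>i\<in>UNIV. {x i}) = range x - {}" by auto
    finally show ?thesis by (simp add: diffuse)
  qed
  have open': "\<exists>e>0. \<exists>r>0. \<forall>x'. (\<forall>i. dist (x' i) (x i) < e) \<longrightarrow> P x' \<and> {} \<subseteq> {y. norm y \<ge> r}" if Px: "P x" for x
  proof -
    obtain e where "e > 0" "\<forall>x'. (\<forall>i. dist (x' i) (x i) < e) \<longrightarrow> P x'" using P_open[OF Px] by blast
    then show ?thesis by (intro exI[of _ e] conjI exI[of _ 1]) auto
  qed
  have rb: "range x \<in> sets borel" for x :: "'i \<Rightarrow> 'a"
    by (intro borel_closed finite_imp_closed) simp
  let ?A = "\<lambda>_ :: 'i \<Rightarrow> 'a. {} :: 'a set" and ?Ab = "\<lambda>x :: 'i \<Rightarrow> 'a. range x"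
  have gen: "AE \<omega> in M. \<forall>x. P x \<and> range x \<subseteq> N \<omega> \<longrightarrow> N \<omega> \<inter> range x \<subseteq> {} \<union> range x" by simp
  have "\<exists>S'\<in>borel_measurable M. AE \<omega> in M. emeasure (count_space UNIV) {x. P x \<and> range x \<subseteq> N \<omega> \<and> N \<omega> \<inter> ?A x = {}} = S' \<omega>"
    by (rule mecke_void(1)[where P = P and A = ?A and Ab = ?Ab])
      (use P_inj open' Ab_closed rb pts gen in \<open>simp_all\<close>)
  then show "\<exists>S'\<in>borel_measurable M. AE \<omega> in M. S \<omega> = S' \<omega>" by (simp add: S_def)
  have "(\<integral>\<^sup>+\<omega>. emeasure (count_space UNIV) {x. P x \<and> range x \<subseteq> N \<omega> \<and> N \<omega> \<inter> ?A x = {}} \<partial>M)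
    = (\<integral>\<^sup>+x. indicator {x. P x} x * ennreal (exp (- measure \<Lambda> (?A x))) \<partial>(PiM UNIV (\<lambda>_. \<Lambda>)))"
    by (rule mecke_void(2)[where P = P and A = ?A and Ab = ?Ab])
      (use P_inj open' Ab_closed rb pts gen in \<open>simp_all\<close>)
  then show "(\<integral>\<^sup>+\<omega>. S \<omega> \<partial>M) = (\<integral>\<^sup>+x. indicator {x. P x} x \<partial>(PiM UNIV (\<lambda>_. \<Lambda>)))"
    by (simp add: S_def)
qed

text \<open>The counting formula handles open conditions, whereas \<open>B\<close> is closed.
  Therefore tuples in an open set \<open>U m\<close> are compared with those in \<open>U m\<close>
  minus \<open>B\<close>: the expected numbers agree because \<open>B\<close> is null, and since
  they are finite and one count dominates the other, the counts agree almost surely.\<close>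

lemma AE_avoid_null:
  fixes B :: "('i::finite \<Rightarrow> 'a) set"
  assumes diffuse: "\<And>y. emeasure \<Lambda> {y} = 0"
    and closed: "\<And>x. x \<notin> B \<Longrightarrow> \<exists>e>0. \<forall>x'. (\<forall>i. dist (x' i) (x i) < e) \<longrightarrow> x' \<notin> B"
    and null: "AE x in PiM UNIV (\<lambda>_. \<Lambda>). x \<notin> B"
  shows "AE \<omega> in M. \<forall>x. inj x \<and> range x \<subseteq> N \<omega> \<and> (\<forall>i. x i \<noteq> 0) \<longrightarrow> x \<notin> B"
proof -
  interpret P: product_sigma_finite "\<lambda>_::'i. \<Lambda>"
    by (simp add: product_sigma_finite_def sigma_finite_Lam)
  \<comment> \<open>An open condition with finite expected count; every tuple of distinct nonzero
    points satisfies it for some \<open>m\<close>.\<close>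
  define U where "U = (\<lambda>m (x::'i \<Rightarrow> 'a). inj x \<and> (\<forall>i. norm (x i) > 1 / Suc m))"
  have U_open: "\<exists>e>0. \<forall>x'. (\<forall>i. dist (x' i) (x i) < e) \<longrightarrow> U m x'" if Ux: "U m x" for m x
  proof -
    have fin: "finite (insert 1 ((\<lambda>(i, j). dist (x i) (x j) / 2) ` {(i, j). i \<noteq> j} \<union> (\<lambda>i. norm (x i) - 1 / Suc m) ` UNIV))" (is "finite ?S") by auto
    define e where "e = Min ?S"
    have e0: "e > 0"
      unfolding e_def using fin Ux by (subst Min_gr_iff) (auto simp: U_def inj_def)
    have e1: "e \<le> dist (x i) (x j) / 2" if "i \<noteq> j" for i j
      unfolding e_def by (rule Min_le[OF fin]) (use that in auto)
    have e2: "e \<le> norm (x i) - 1 / Suc m" for i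
      unfolding e_def by (rule Min_le[OF fin]) auto
    have "U m x'" if near: "\<forall>i. dist (x' i) (x i) < e" for x'
      unfolding U_def
    proof (intro conjI allI injI)
      fix i j assume eq: "x' i = x' j"
      show "i = j"
      proof (rule ccontr)
        assume "i \<noteq> j"
        have "dist (x i) (x j) \<le> dist (x' i) (x i) + dist (x' j) (x j)"
          using dist_triangle2[of "x i" "x j" "x' i"] eq by (simp add: dist_commute)
        then show False using near e1[OF \<open>i \<noteq> j\<close>] by (smt (verit) field_sum_of_halves)
      qed
    next
      fix i
      have "norm (x i) \<le> norm (x' i) + dist (x' i) (x i)"
        by (metis dist_commute dist_norm norm_triangle_sub add.commute norm_minus_commute)
      then show "norm (x' i) > 1 / Suc m" using near e2[of i] by (smt (verit))
    qed
    then show ?thesis using e0 by blast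
  qed
  have pos: "x i \<noteq> 0" if "U m x" for m x i
  proof -
    have "0 < 1 / real (Suc m)" by simp
    also have "\<dots> < norm (x i)" using that unfolding U_def by blast
    finally show ?thesis by auto
  qed
  have "AE \<omega> in M. \<forall>x. U m x \<and> range x \<subseteq> N \<omega> \<longrightarrow> x \<notin> B" for m
  proof -
    let ?V = "\<lambda>x. U m x \<and> x \<notin> B"
    have V_open: "\<exists>e>0. \<forall>x'. (\<forall>i. dist (x' i) (x i) < e) \<longrightarrow> ?V x'" if Vx: "?V x" for x
    proof -
      obtain e1 where e1: "e1 > 0" "\<forall>x'. (\<forall>i. dist (x' i) (x i) < e1) \<longrightarrow> U m x'" using U_open Vx by blast
      obtain e2 where e2: "e2 > 0" "\<forall>x'. (\<forall>i. dist (x' i) (x i) < e2) \<longrightarrow> x' \<notin> B" using closed Vx by blast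
      show ?thesis using e1 e2 by (intro exI[of _ "min e1 e2"]) auto
    qed
    define S1 where "S1 = (\<lambda>\<omega>. emeasure (count_space UNIV) {x. U m x \<and> range x \<subseteq> N \<omega>})"
    define S2 where "S2 = (\<lambda>\<omega>. emeasure (count_space UNIV) {x. ?V x \<and> range x \<subseteq> N \<omega>})"
    have U_inj: "inj x" if "U m x" for x using that by (simp add: U_def)
    have V_inj: "inj x" if "?V x" for x using that U_inj by blast
    have V_pos: "x i \<noteq> 0" if "?V x" for x i using that pos by blast
    have c1: "\<exists>S'\<in>borel_measurable M. AE \<omega> in M. S1 \<omega> = S' \<omega>"
        "(\<integral>\<^sup>+\<omega>. S1 \<omega> \<partial>M) = (\<integral>\<^sup>+x. indicator {x. U m x} x \<partial>(PiM UNIV (\<lambda>_. \<Lambda>)))"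
      unfolding S1_def
      by (rule mecke_count(1)[where P = "U m", OF diffuse], erule U_inj, erule pos, erule U_open)
        (rule mecke_count(2)[where P = "U m", OF diffuse], erule U_inj, erule pos, erule U_open)
    have c2: "\<exists>S'\<in>borel_measurable M. AE \<omega> in M. S2 \<omega> = S' \<omega>"
        "(\<integral>\<^sup>+\<omega>. S2 \<omega> \<partial>M) = (\<integral>\<^sup>+x. indicator {x. ?V x} x \<partial>(PiM UNIV (\<lambda>_. \<Lambda>)))"
      unfolding S2_def
      by (rule mecke_count(1)[where P = ?V, OF diffuse], erule V_inj, erule V_pos, erule V_open)
        (rule mecke_count(2)[where P = ?V, OF diffuse], erule V_inj, erule V_pos, erule V_open)
    \<comment> \<open>The counts are known to be measurable only up to null sets, so the subtraction
      is carried out for representatives.\<close>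
    obtain S1' where S1': "S1' \<in> borel_measurable M" "AE \<omega> in M. S1 \<omega> = S1' \<omega>" using c1(1) by blast
    obtain S2' where S2': "S2' \<in> borel_measurable M" "AE \<omega> in M. S2 \<omega> = S2' \<omega>" using c2(1) by blast
    have int1: "(\<integral>\<^sup>+\<omega>. S1' \<omega> \<partial>M) = (\<integral>\<^sup>+x. indicator {x. U m x} x \<partial>(PiM UNIV (\<lambda>_. \<Lambda>)))"
      using nn_integral_cong_AE[OF S1'(2)] c1(2) by simp
    have "(\<integral>\<^sup>+\<omega>. S2' \<omega> \<partial>M) = (\<integral>\<^sup>+x. indicator {x. ?V x} x \<partial>(PiM UNIV (\<lambda>_. \<Lambda>)))"
      using nn_integral_cong_AE[OF S2'(2)] c2(2) by simp
    also have "\<dots> = (\<integral>\<^sup>+x. indicator {x. U m x} x \<partial>(PiM UNIV (\<lambda>_. \<Lambda>)))"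
      by (rule nn_integral_cong_AE) (use null in eventually_elim, auto simp: indicator_def)
    finally have int2: "(\<integral>\<^sup>+\<omega>. S2' \<omega> \<partial>M) = (\<integral>\<^sup>+\<omega>. S1' \<omega> \<partial>M)" using int1 by simp
    have "(\<integral>\<^sup>+\<omega>. S1' \<omega> \<partial>M) \<le> (\<integral>\<^sup>+x. indicator (PiE (UNIV :: 'i set) (\<lambda>_. {y. norm y \<ge> 1 / Suc m})) x \<partial>(PiM UNIV (\<lambda>_. \<Lambda>)))"
      unfolding int1 by (rule nn_integral_mono) (auto simp: indicator_def U_def PiE_UNIV_domain less_imp_le)
    also have "\<dots> = (\<Prod>i\<in>(UNIV::'i set). emeasure \<Lambda> {y. norm y \<ge> 1 / Suc m})"
      by (subst nn_integral_indicator) (auto simp: P.emeasure_PiM sets_Lam intro!: sets_PiM_I_finite)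
    also have "\<dots> < \<infinity>"
      using finite_away[of "1 / Suc m"] by (simp add: power_less_top_ennreal)
    finally have fin: "(\<integral>\<^sup>+\<omega>. S1' \<omega> \<partial>M) < \<infinity>" .
    have le: "S2 \<omega> \<le> S1 \<omega>" for \<omega>
      unfolding S1_def S2_def by (rule emeasure_mono) auto
    have le': "AE \<omega> in M. S2' \<omega> \<le> S1' \<omega>"
      using S1'(2) S2'(2)
    proof eventually_elim
      case (elim \<omega>)
      then show ?case using le[of \<omega>] by simp
    qed
    have "(\<integral>\<^sup>+\<omega>. S1' \<omega> - S2' \<omega> \<partial>M) = (\<integral>\<^sup>+\<omega>. S1' \<omega> \<partial>M) - (\<integral>\<^sup>+\<omega>. S2' \<omega> \<partial>M)"
      using S1' S2' le' fin int2 by (intro nn_integral_diff) auto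
    also have "\<dots> = 0" using fin int2 by simp
    finally have "AE \<omega> in M. S1' \<omega> - S2' \<omega> = 0"
      using S1'(1) S2'(1) by (subst (asm) nn_integral_0_iff_AE) auto
    moreover have "AE \<omega> in M. S1' \<omega> \<noteq> \<infinity>"
      using S1'(1) fin by (intro nn_integral_PInf_AE) auto
    ultimately show ?thesis
      using S1'(2) S2'(2) le'
    proof eventually_elim
      case (elim \<omega>)
      have eq: "S1 \<omega> = S2 \<omega>"
        using elim le[of \<omega>] by (metis diff_eq_0_iff_ennreal antisym less_top infinity_ennreal_def)
      let ?X = "{x. U m x \<and> range x \<subseteq> N \<omega>}"
      let ?Y = "{x. ?V x \<and> range x \<subseteq> N \<omega>}"
      have "emeasure (count_space UNIV) ?X \<noteq> \<infinity>" using elim by (simp add: S1_def)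
      then have fX: "finite ?X" by (auto simp: emeasure_count_space split: if_splits)
      have sub: "?Y \<subseteq> ?X" by auto
      then have fY: "finite ?Y" using fX finite_subset by blast
      have "card ?Y = card ?X"
        using eq fX fY unfolding S1_def S2_def by (simp add: emeasure_count_space)
      then have "?Y = ?X" using fX sub by (intro card_subset_eq) auto
      then show ?case by blast
    qed
  qed
  then have "AE \<omega> in M. \<forall>m. \<forall>x. U m x \<and> range x \<subseteq> N \<omega> \<longrightarrow> x \<notin> B"
    by (simp add: AE_all_countable)
  then show ?thesis
  proof eventually_elim
    case (elim \<omega>)
    show ?case
    proof (intro allI impI)
      fix x :: "'i \<Rightarrow> 'a" assume x: "inj x \<and> range x \<subseteq> N \<omega> \<and> (\<forall>i. x i \<noteq> 0)"
      have fin: "finite ((\<lambda>i. norm (x i)) ` UNIV)" by simp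
      let ?m = "Min ((\<lambda>i. norm (x i)) ` UNIV)"
      have "?m > 0"
        by (subst Min_gr_iff) (use x in auto)
      from reals_Archimedean[OF this] obtain m where "inverse (real (Suc m)) < ?m" ..
      then have m: "1 / Suc m < ?m" unfolding inverse_eq_divide .
      have "1 / Suc m < norm (x i)" for i
        using m Min_le[OF fin, of "norm (x i)"] by fastforce
      then have "U m x" using x by (simp add: U_def)
      then show "x \<notin> B" using elim x by blast
    qed
  qed
qed

end

section \<open>Continuity of determinants, coordinates and normals\<close>

lemma near_sequentially:
  fixes x :: "'i::finite \<Rightarrow> 'a::metric_space"
  assumes "\<And>X. (\<And>i. (\<lambda>n. X n i) \<longlonglongrightarrow> x i) \<Longrightarrow> eventually (\<lambda>n. Q (X n)) sequentially"
  shows "\<exists>e>0. \<forall>x'. (\<forall>i. dist (x' i) (x i) < e) \<longrightarrow> Q x'"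
proof (rule ccontr)
  assume "\<not> ?thesis"
  then have "\<forall>n::nat. \<exists>x'. (\<forall>i. dist (x' i) (x i) < 1 / Suc n) \<and> \<not> Q x'"
    by (metis of_nat_0_less_iff zero_less_Suc zero_less_divide_1_iff)
  then obtain X where X: "\<And>n i. dist (X n i) (x i) < 1 / Suc n" "\<And>n. \<not> Q (X n)" by metis
  have "(\<lambda>n. X n i) \<longlonglongrightarrow> x i" for i
  proof (rule metric_tendsto_imp_tendsto)
    show "(\<lambda>n. inverse (real (Suc n))) \<longlonglongrightarrow> 0" by (rule LIMSEQ_inverse_real_of_nat)
    show "\<forall>\<^sub>F n in sequentially. dist (X n i) (x i) \<le> dist (inverse (real (Suc n))) 0"
      using X(1) by (auto simp: inverse_eq_divide less_imp_le intro!: always_eventually)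
  qed
  then have "eventually (\<lambda>n. Q (X n)) sequentially" by (rule assms)
  then show False using X(2) by simp
qed

lemma tendsto_det:
  fixes A :: "'b \<Rightarrow> real ^ 'n ^ 'n"
  assumes "\<And>i j. ((\<lambda>x. A x $ i $ j) \<longlongrightarrow> B $ i $ j) F"
  shows "((\<lambda>x. det (A x)) \<longlongrightarrow> det B) F"
  unfolding det_def by (intro tendsto_intros assms)

lemma tendsto_row_det:
  fixes X :: "'b \<Rightarrow> 'n::finite \<Rightarrow> real ^ 'n"
  assumes "\<And>i. ((\<lambda>t. X t i) \<longlongrightarrow> x i) F"
  shows "((\<lambda>t. det (row_mat (X t))) \<longlongrightarrow> det (row_mat x)) F"
  by (rule tendsto_det) (auto simp: row_mat_def intro!: tendsto_vec_nth assms)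

lemma coef_row_mat: "coef (row_mat x) c i = det (row_mat (x(i := c))) / det (row_mat x)"
  unfolding coef_def row_mat_def by (rule arg_cong2[where f = "(/)"]) (auto intro!: arg_cong[where f = det] simp: vec_eq_iff)

lemma tendsto_coef:
  fixes X :: "'b \<Rightarrow> 'n::finite \<Rightarrow> real ^ 'n"
  assumes "\<And>i. ((\<lambda>t. X t i) \<longlongrightarrow> x i) F" "det (row_mat x) \<noteq> 0"
  shows "((\<lambda>t. coef (row_mat (X t)) c i) \<longlongrightarrow> coef (row_mat x) c i) F"
  unfolding coef_row_mat
proof (intro tendsto_divide tendsto_row_det assms)
  show "((\<lambda>t. ((X t)(i := c)) j) \<longlongrightarrow> (x(i := c)) j) F" for j
    using assms(1) by (cases "j = i") auto
qed

text \<open>The numerators in Cramer's rule. Being polynomial in the points, they stay continuous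
  where the determinant vanishes, which expresses a common hyperplane by a closed condition without
  division.\<close>

definition cramer_num :: "('n::finite \<Rightarrow> real ^ 'n) \<Rightarrow> real ^ 'n" where
  "cramer_num x = (\<chi> k. det (\<chi> i j. if j = k then 1 else x i $ j))"

lemma facet_normal_cramer: "facet_normal x = (1 / det (row_mat x)) *\<^sub>R cramer_num x"
  by (simp add: facet_normal_def dual_vec_def cramer_num_def row_mat_def vec_eq_iff cong: if_cong)

lemma tendsto_cramer_num:
  fixes X :: "'b \<Rightarrow> 'n::finite \<Rightarrow> real ^ 'n"
  assumes "\<And>i. ((\<lambda>t. X t i) \<longlongrightarrow> x i) F"
  shows "((\<lambda>t. cramer_num (X t)) \<longlongrightarrow> cramer_num x) F"
proof (rule vec_tendstoI)
  fix k
  have "((\<lambda>t. det (\<chi> i j. if j = k then 1 else X t i $ j)) \<longlongrightarrow> det (\<chi> i j. if j = k then 1 else x i $ j)) F"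
  proof (rule tendsto_det)
    fix i j
    show "((\<lambda>t. (\<chi> i j. if j = k then 1 else X t i $ j) $ i $ j) \<longlongrightarrow> (\<chi> i j. if j = k then 1 else x i $ j) $ i $ j) F"
      using assms by (cases "j = k") (auto intro!: tendsto_vec_nth)
  qed
  then show "((\<lambda>t. cramer_num (X t) $ k) \<longlongrightarrow> cramer_num x $ k) F"
    by (simp add: cramer_num_def)
qed

lemma tendsto_facet_normal:
  fixes X :: "'b \<Rightarrow> 'n::finite \<Rightarrow> real ^ 'n"
  assumes "\<And>i. ((\<lambda>t. X t i) \<longlongrightarrow> x i) F" "det (row_mat x) \<noteq> 0"
  shows "((\<lambda>t. facet_normal (X t)) \<longlongrightarrow> facet_normal x) F"
  unfolding facet_normal_cramer
  by (intro tendsto_scaleR tendsto_divide tendsto_const tendsto_row_det tendsto_cramer_num assms)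

section \<open>Degenerate tuples are null for the product intensity\<close>

lemma AE_PiM_insert:
  fixes S :: "'i set" and s :: 'i
  assumes P: "product_sigma_finite (\<lambda>_::'i. L :: 'a measure)" and S: "finite S" "s \<notin> S"
    and meas: "{z \<in> space (PiM (insert s S) (\<lambda>_. L)). \<not> Q z} \<in> sets (PiM (insert s S) (\<lambda>_. L))"
    and AE: "AE x in PiM S (\<lambda>_. L). AE y in L. Q (x(s := y))"
  shows "AE z in PiM (insert s S) (\<lambda>_. L). Q z"
proof -
  interpret product_sigma_finite "\<lambda>_::'i. L" by (rule P)
  let ?N = "{z \<in> space (PiM (insert s S) (\<lambda>_. L)). \<not> Q z}"
  have "emeasure (PiM (insert s S) (\<lambda>_. L)) ?N = (\<integral>\<^sup>+z. indicator ?N z \<partial>PiM (insert s S) (\<lambda>_. L))"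
    using meas by simp
  also have "\<dots> = (\<integral>\<^sup>+x. \<integral>\<^sup>+y. indicator ?N (x(s := y)) \<partial>L \<partial>PiM S (\<lambda>_. L))"
    by (rule product_nn_integral_insert[OF S]) (use meas in auto)
  also have "\<dots> = (\<integral>\<^sup>+x. 0 \<partial>PiM S (\<lambda>_. L))"
  proof (rule nn_integral_cong_AE, use AE in eventually_elim)
    fix x assume "AE y in L. Q (x(s := y))"
    then have "AE y in L. indicator ?N (x(s := y)) = (0::ennreal)"
      by eventually_elim simp
    then have "(\<integral>\<^sup>+y. indicator ?N (x(s := y)) \<partial>L) = (\<integral>\<^sup>+y. 0 \<partial>L)"
      by (rule nn_integral_cong_AE)
    then show "(\<integral>\<^sup>+y. indicator ?N (x(s := y)) \<partial>L) = 0" by simp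
  qed
  finally have "emeasure (PiM (insert s S) (\<lambda>_. L)) ?N = 0" by simp
  then show ?thesis
    by (intro AE_I[of _ _ ?N]) (use meas in auto)
qed


lemma linear_functional_hyperplane_null:
  fixes f :: "real ^ 'n \<Rightarrow> real"
  assumes "linear f" "f y0 \<noteq> 0"
  shows "AE y in stable_intensity 2. f y \<noteq> 0"
proof -
  have sub: "subspace {y. f y = 0}"
    using assms(1) by (auto intro!: subspaceI simp: linear_0 linear_add linear_scale)
  have "dim {y. f y = 0} < DIM(real ^ 'n)"
  proof -
    have "span {y. f y = 0} \<noteq> UNIV"
      using assms(2) span_eq_iff[THEN iffD2, OF sub] by (metis UNIV_I mem_Collect_eq)
    then have "dim {y. f y = 0} \<noteq> DIM(real ^ 'n)"
      using dim_eq_full[of "{y. f y = 0}"] by auto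
    then show ?thesis
      using dim_subset_UNIV[of "{y. f y = 0}"] by linarith
  qed
  then have "negligible {y. f y = 0}" by (rule negligible_lowdim)
  moreover have cl: "{y. f y = 0} \<in> sets borel"
    using closed_subspace[OF sub] by simp
  ultimately have "emeasure lborel {y. f y = 0} = 0"
    by (simp add: negligible_iff_null_sets null_sets_def)
  then have "emeasure (stable_intensity 2) {y. f y = 0} = 0"
    using cl by (intro stable_intensity_2_null)
  then show ?thesis
    using cl by (intro AE_I[of _ _ "{y. f y = 0}"]) auto
qed

lemma hyperplane_null:
  fixes a :: "real ^ 'n"
  assumes "a \<noteq> 0"
  shows "emeasure (stable_intensity 2) {y. a \<bullet> y = b} = 0"
proof -
  have "negligible {y. a \<bullet> y = b}" using assms by (intro negligible_hyperplane) auto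
  moreover have m: "{y. a \<bullet> y = b} \<in> sets borel" by (simp add: closed_hyperplane)
  ultimately have "emeasure lborel {y. a \<bullet> y = b} = 0"
    by (simp add: negligible_iff_null_sets null_sets_def)
  then show ?thesis using m by (intro stable_intensity_2_null)
qed

lemma singleton_null: "emeasure (stable_intensity 2) {y :: real ^ 'n} = 0"
  by (rule stable_intensity_2_null) auto

lemma linear_det_row:
  fixes x :: "'n::finite \<Rightarrow> real ^ 'n"
  shows "linear (\<lambda>y. det (row_mat (x(k := y))))"
proof -
  have *: "row_mat (x(k := y)) = (\<chi> i. if i = k then y else x i)" for y
    by (simp add: row_mat_def vec_eq_iff)
  show ?thesis
  proof (rule linearI)
    show "det (row_mat (x(k := a + b))) = det (row_mat (x(k := a))) + det (row_mat (x(k := b)))" for a b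
      unfolding * by (rule det_row_add[of k "\<lambda>_. a" "\<lambda>_. b" x])
    show "det (row_mat (x(k := r *\<^sub>R b))) = r *\<^sub>R det (row_mat (x(k := b)))" for r b
      unfolding * using det_row_mul[of k r "\<lambda>_. b" x] unfolding scalar_mult_eq_scaleR by simp
  qed
qed

lemma product_sigma_finite_stable:
  assumes "punctured_ppp M N (stable_intensity 2 :: (real ^ 'n) measure)"
  shows "product_sigma_finite (\<lambda>_::'i. stable_intensity 2 :: (real ^ 'n) measure)"
  using punctured_ppp.sigma_finite_Lam[OF assms] by (simp add: product_sigma_finite_def)

lemma row_mat_measurable [measurable (raw)]:
  assumes [measurable]: "\<And>i. (\<lambda>x. f x i) \<in> borel_measurable M"
  shows "(\<lambda>x. row_mat (f x)) \<in> borel_measurable M"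
  unfolding row_mat_def by measurable

lemma cramer_num_measurable [measurable (raw)]:
  assumes [measurable]: "\<And>i. (\<lambda>x. f x i) \<in> borel_measurable M"
  shows "(\<lambda>x. cramer_num (f x)) \<in> borel_measurable M"
  unfolding cramer_num_def by measurable

text \<open>Replacing the rows of an invertible matrix one by one by independent points keeps it almost surely
  invertible, because the determinant is a nonzero linear functional of each row.\<close>

lemma AE_det_nz:
  fixes h :: "'n::finite \<Rightarrow> 'i" and b :: "'n \<Rightarrow> real ^ 'n"
  assumes P: "product_sigma_finite (\<lambda>_::'i. stable_intensity 2 :: (real ^ 'n) measure)"
    and h: "inj h" and S: "finite S" "S \<subseteq> range h" and b: "det (row_mat b) \<noteq> 0"
  shows "AE x in PiM S (\<lambda>_. stable_intensity 2). det (row_mat (\<lambda>k. if h k \<in> S then x (h k) else b k)) \<noteq> 0"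
  using S
proof (induction S rule: finite_induct)
  case empty
  then show ?case using b by simp
next
  case (insert s S)
  obtain k0 where k0: "s = h k0" using insert.prems by blast
  have m: "(\<lambda>x. if h k \<in> insert s S then x (h k) else b k) \<in> borel_measurable (PiM (insert s S) (\<lambda>_. stable_intensity 2))" for k
    by (cases "h k \<in> insert s S") auto
  show ?case
  proof (rule AE_PiM_insert[OF P insert.hyps])
    note m[measurable]
    show "{z \<in> space (PiM (insert s S) (\<lambda>_. stable_intensity 2)). \<not> det (row_mat (\<lambda>k. if h k \<in> insert s S then z (h k) else b k)) \<noteq> 0} \<in> sets (PiM (insert s S) (\<lambda>_. stable_intensity 2))"
      by measurable
    have "AE x in PiM S (\<lambda>_. stable_intensity 2). det (row_mat (\<lambda>k. if h k \<in> S then x (h k) else b k)) \<noteq> 0"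
      using insert by auto
    then show "AE x in PiM S (\<lambda>_. stable_intensity 2). AE y in stable_intensity 2. det (row_mat (\<lambda>k. if h k \<in> insert s S then (x(s := y)) (h k) else b k)) \<noteq> 0"
    proof eventually_elim
      fix x :: "'i \<Rightarrow> real ^ 'n" assume x: "det (row_mat (\<lambda>k. if h k \<in> S then x (h k) else b k)) \<noteq> 0"
      define z where "z = (\<lambda>k. if h k \<in> S then x (h k) else b k)"
      have eq: "(\<lambda>k. if h k \<in> insert s S then (x(s := y)) (h k) else b k) = z(k0 := y)" for y
        using injD[OF h] insert.hyps by (auto simp: z_def k0 fun_eq_iff)
      have "det (row_mat (z(k0 := z k0))) \<noteq> 0" using x unfolding z_def[symmetric] fun_upd_triv .
      then have "AE y in stable_intensity 2. det (row_mat (z(k0 := y))) \<noteq> 0"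
        by (intro linear_functional_hyperplane_null linear_det_row)
      then show "AE y in stable_intensity 2. det (row_mat (\<lambda>k. if h k \<in> insert s S then (x(s := y)) (h k) else b k)) \<noteq> 0"
        unfolding eq .
    qed
  qed
qed

lemma det_row_mat_axis: "det (row_mat (\<lambda>k::'n::finite. axis k 1 :: real ^ 'n)) \<noteq> 0"
proof -
  have "row_mat (\<lambda>k::'n. axis k 1) = (mat 1 :: real ^ 'n ^ 'n)"
    by (simp add: row_mat_def mat_def vec_eq_iff axis_def eq_commute)
  then show ?thesis by simp
qed

lemma AE_rows_det_nz:
  assumes P: "product_sigma_finite (\<lambda>_::'n::finite. stable_intensity 2 :: (real ^ 'n) measure)"
  shows "AE x in PiM UNIV (\<lambda>_. stable_intensity 2). det (row_mat (x :: 'n \<Rightarrow> real ^ 'n)) \<noteq> 0"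
  using AE_det_nz[OF P, of id UNIV "\<lambda>k. axis k 1"] det_row_mat_axis by simp

text \<open>The replacement of rows has to start from an invertible matrix whose row
  \<open>k\<close> is \<open>c\<close>. An orthogonal matrix sending the unit vector
  \<open>k\<close> to the direction of \<open>c\<close> supplies its other rows. Coordinate
  \<open>k\<close> of the tuple is overwritten by \<open>c\<close> and is split off as a dummy
  variable.\<close>

lemma AE_rows_upd_det_nz:
  fixes c :: "real ^ 'n"
  assumes P: "product_sigma_finite (\<lambda>_::'n. stable_intensity 2 :: (real ^ 'n) measure)" and "c \<noteq> 0"
  shows "AE x in PiM UNIV (\<lambda>_. stable_intensity 2). det (row_mat (x(k := c))) \<noteq> 0"
proof -
  obtain B :: "real ^ 'n ^ 'n" where B: "\<bar>det B\<bar> = 1" "B *v axis k 1 = (1 / norm c) *\<^sub>R c"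
  proof -
    have "norm (axis k 1 :: real ^ 'n) = norm ((1 / norm c) *\<^sub>R c)" using assms(2) by simp
    then show thesis by (rule orthogonal_matrix_exists) (rule that)
  qed
  define b where "b = (\<lambda>i. B *v axis i 1)(k := c)"
  have "row_mat (\<lambda>i. B *v axis i 1) = (\<chi> i. B *v (row_mat (\<lambda>i. axis i 1)) $ i)"
    by (simp add: row_mat_def)
  then have dB: "det (row_mat (\<lambda>i. B *v axis i 1)) \<noteq> 0"
    using det_rows_linear[of B "row_mat (\<lambda>i. axis i 1)"] det_row_mat_axis B(1) by auto
  have "c = norm c *\<^sub>R (B *v axis k 1)" using assms(2) by (simp add: B(2))
  then have "det (row_mat b) = norm c * det (row_mat ((\<lambda>i. B *v axis i 1)(k := B *v axis k 1)))"
    unfolding b_def using linear_scale[OF linear_det_row[of "\<lambda>i. B *v axis i 1" k], of "norm c" "B *v axis k 1"] by simp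
  then have db: "det (row_mat b) \<noteq> 0" using dB assms(2) by (simp add: fun_upd_idem)
  have U: "insert k (UNIV - {k}) = UNIV" by auto
  have "AE x in PiM (insert k (UNIV - {k})) (\<lambda>_. stable_intensity 2). det (row_mat (x(k := c))) \<noteq> 0"
  proof (rule AE_PiM_insert[OF P])
    have m: "(\<lambda>z. (z(k := c)) i) \<in> borel_measurable (PiM (insert k (UNIV - {k})) (\<lambda>_. stable_intensity 2))" for i
      by (cases "i = k") auto
    note m[measurable]
    show "{z \<in> space (PiM (insert k (UNIV - {k})) (\<lambda>_. stable_intensity 2)). \<not> det (row_mat (z(k := c))) \<noteq> 0} \<in> sets (PiM (insert k (UNIV - {k})) (\<lambda>_. stable_intensity 2))"
      by measurable
    have "AE x in PiM (UNIV - {k}) (\<lambda>_. stable_intensity 2). det (row_mat (\<lambda>i. if id i \<in> UNIV - {k} then x (id i) else b i)) \<noteq> 0"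
      by (rule AE_det_nz[OF P _ _ _ db]) auto
    then show "AE x in PiM (UNIV - {k}) (\<lambda>_. stable_intensity 2). AE y in stable_intensity 2. det (row_mat ((x(k := y))(k := c))) \<noteq> 0"
    proof eventually_elim
      fix x :: "'n \<Rightarrow> real ^ 'n" assume x: "det (row_mat (\<lambda>i. if id i \<in> UNIV - {k} then x (id i) else b i)) \<noteq> 0"
      have "(\<lambda>i. if id i \<in> UNIV - {k} then x (id i) else b i) = x(k := c)"
        by (auto simp: b_def)
      then show "AE y in stable_intensity 2. det (row_mat ((x(k := y))(k := c))) \<noteq> 0"
        using x by simp
    qed
  qed auto
  then show ?thesis unfolding U .
qed

text \<open>Given the d points indexed by \<open>Some\<close>, the remaining point must hit the
  hyperplane through them, which is null. The equation is cleared of the denominator of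
  \<open>facet_normal\<close>, so it also makes sense for dependent points.\<close>

lemma AE_no_common_hyperplane:
  assumes P: "product_sigma_finite (\<lambda>_::'n::finite option. stable_intensity 2 :: (real ^ 'n) measure)"
  shows "AE x in PiM UNIV (\<lambda>_. stable_intensity 2). cramer_num (\<lambda>k::'n. x (Some k)) \<bullet> x None \<noteq> det (row_mat (\<lambda>k. x (Some k)))"
proof -
  have U: "insert None (range Some) = (UNIV :: 'n option set)"
    by (auto simp: UNIV_option_conv)
  have "AE x in PiM (insert None (range Some)) (\<lambda>_. stable_intensity 2). cramer_num (\<lambda>k::'n. x (Some k)) \<bullet> x None \<noteq> det (row_mat (\<lambda>k. x (Some k)))"
  proof (rule AE_PiM_insert[OF P])
    have m: "(\<lambda>z. z i) \<in> borel_measurable (PiM (insert None (range Some)) (\<lambda>_. stable_intensity 2 :: (real ^ 'n) measure))" for i :: "'n option"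
      using measurable_component_singleton[of i "insert None (range Some)" "\<lambda>_. stable_intensity 2 :: (real ^ 'n) measure"] unfolding U by simp
    note m[measurable]
    show "{z \<in> space (PiM (insert None (range Some)) (\<lambda>_. stable_intensity 2)). \<not> cramer_num (\<lambda>k::'n. z (Some k)) \<bullet> z None \<noteq> det (row_mat (\<lambda>k. z (Some k)))} \<in> sets (PiM (insert None (range Some)) (\<lambda>_. stable_intensity 2))"
      unfolding not_not by measurable
    have "AE x in PiM (range Some) (\<lambda>_. stable_intensity 2). det (row_mat (\<lambda>k::'n. if Some k \<in> range Some then x (Some k) else axis k 1)) \<noteq> 0"
      by (rule AE_det_nz[OF P _ _ _ det_row_mat_axis]) auto
    then show "AE x in PiM (range Some) (\<lambda>_. stable_intensity 2). AE y in stable_intensity 2. cramer_num (\<lambda>k::'n. (x(None := y)) (Some k)) \<bullet> (x(None := y)) None \<noteq> det (row_mat (\<lambda>k. (x(None := y)) (Some k)))"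
    proof eventually_elim
      fix x :: "'n option \<Rightarrow> real ^ 'n" assume x: "det (row_mat (\<lambda>k::'n. if Some k \<in> range Some then x (Some k) else axis k 1)) \<noteq> 0"
      let ?z = "\<lambda>k. x (Some k)"
      have d: "det (row_mat ?z) \<noteq> 0" using x by simp
      have "cramer_num ?z \<noteq> 0"
      proof
        assume "cramer_num ?z = 0"
        then have "facet_normal ?z = 0" by (simp add: facet_normal_cramer)
        then show False using facet_normal_inner[OF d, of undefined] by simp
      qed
      then have "emeasure (stable_intensity 2) {y. cramer_num ?z \<bullet> y = det (row_mat ?z)} = 0"
        by (rule hyperplane_null)
      then have "AE y in stable_intensity 2. y \<notin> {y. cramer_num ?z \<bullet> y = det (row_mat ?z)}"
        by (intro AE_not_in) (auto simp: null_sets_def closed_hyperplane)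
      then show "AE y in stable_intensity 2. cramer_num (\<lambda>k::'n. (x(None := y)) (Some k)) \<bullet> (x(None := y)) None \<noteq> det (row_mat (\<lambda>k. (x(None := y)) (Some k)))"
        by simp
    qed
  qed auto
  then show ?thesis unfolding U .
qed

section \<open>Expected face numbers\<close>

locale stable_process =
  fixes M :: "'w measure" and N :: "'w \<Rightarrow> (real ^ 'n) set"
  assumes stable_ppp: "poisson_point_process M N (stable_intensity 2)"
    and no_origin: "\<And>\<omega>. \<omega> \<in> space M \<Longrightarrow> 0 \<notin> N \<omega>"
begin

sublocale punctured_ppp M N "stable_intensity 2"
  by unfold_locales (use stable_ppp stable_intensity_away_from_0 singleton_null in auto)

lemma product_sigma_finite_intensity:
  "product_sigma_finite (\<lambda>_::'i. stable_intensity 2 :: (real ^ 'n) measure)"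
  by (rule product_sigma_finite_stable[OF punctured_ppp_axioms])

text \<open>By self-similarity the dilates \<open>t B\<close> of a fixed ball \<open>B\<close> have intensity \<open>t\<^sup>-\<^sup>2 \<Lambda>(B)\<close>, so some arbitrarily
  small dilate is charged.\<close>

lemma AE_charges_dilates:
  fixes B :: "(real ^ 'n) set"
  assumes B: "open B" "B \<noteq> {}" and r: "r > 0" "\<And>x. x \<in> B \<Longrightarrow> norm x \<ge> r"
  shows "AE \<omega> in M. \<forall>k. \<exists>n\<ge>k. N \<omega> \<inter> (\<lambda>x. (1 / real (Suc n)) *\<^sub>R x) ` B \<noteq> {}"
proof -
  let ?L = "stable_intensity 2 :: (real ^ 'n) measure"
  let ?B = "\<lambda>n. (\<lambda>x. (1 / real (Suc n)) *\<^sub>R x) ` B"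
  have open_B: "open (?B n)" for n using B(1) by (intro open_scaling) auto
  have sub: "?B n \<subseteq> {y. norm y \<ge> r / Suc n}" for n
    using r(2) by (auto simp: divide_right_mono)
  have fin: "emeasure ?L (?B n) < \<infinity>" for n
    using Lam_finite_mono[OF sub[of n]] r(1) by simp
  have fB: "emeasure ?L B < \<infinity>"
    by (rule Lam_finite_mono[of B r]) (use r in auto)
  define m where "m = measure ?L B"
  have m: "m > 0"
    unfolding m_def measure_def using stable_intensity_open_pos[OF B] fB by (simp add: enn2real_positive_iff)
  have meas: "measure ?L (?B n) = (real (Suc n))\<^sup>2 * m" for n
    using stable_intensity_scale[of "1 / real (Suc n)" B] B(1)
    by (simp add: measure_def m_def enn2real_mult power_divide)
  have count[measurable]: "(\<lambda>\<omega>. card (N \<omega> \<inter> ?B n)) \<in> measurable M (count_space UNIV)" for n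
    using fin open_B by (intro count_measurable) auto
  have "AE \<omega> in M. \<not> (\<forall>n\<ge>k. card (N \<omega> \<inter> ?B n) = 0)" for k
  proof -
    let ?E = "{\<omega> \<in> space M. \<forall>n\<ge>k. card (N \<omega> \<inter> ?B n) = 0}"
    have E: "?E \<in> sets M" by measurable
    \<comment> \<open>One dilate at a time gives this bound, which tends to 0 because the intensity
      of the dilates grows without limit.\<close>
    have "prob ?E \<le> exp (- (real (Suc n))\<^sup>2 * m)" if "n \<ge> k" for n
    proof -
      have "prob ?E \<le> prob {\<omega> \<in> space M. card (N \<omega> \<inter> ?B n) = 0}"
        by (intro finite_measure_mono) (use that in blast, measurable)
      also have "\<dots> = exp (- (real (Suc n))\<^sup>2 * m)"
        using prob_count[OF borel_open[OF open_B] fin, of n 0] unfolding meas by simp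
      finally show ?thesis .
    qed
    moreover have "(\<lambda>n. exp (- (real (Suc n))\<^sup>2 * m)) \<longlonglongrightarrow> 0"
      using m by real_asymp
    ultimately have "prob ?E \<le> 0"
      by (intro LIMSEQ_le_const[of _ 0 "prob ?E"]) blast+
    then have "prob ?E = 0" using measure_nonneg[of M ?E] by linarith
    then have "emeasure M ?E = 0" by (simp only: emeasure_eq_measure ennreal_0)
    then have "AE \<omega> in M. \<omega> \<notin> ?E" using E by (intro AE_not_in null_setsI)
    then show ?thesis using AE_space by eventually_elim blast
  qed
  then have "AE \<omega> in M. \<forall>k. \<not> (\<forall>n\<ge>k. card (N \<omega> \<inter> ?B n) = 0)"
    by (simp add: AE_all_countable)
  then show ?thesis
  proof eventually_elim
    case (elim \<omega>)
    show ?case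
    proof
      fix k
      obtain n where "n \<ge> k" "card (N \<omega> \<inter> ?B n) \<noteq> 0" using elim by blast
      then show "\<exists>n\<ge>k. N \<omega> \<inter> ?B n \<noteq> {}" by (metis card.empty)
    qed
  qed
qed

text \<open>Countably many centres \<open>q\<close> suffice. If \<open>q\<close> lies within
  \<open>norm a / 4\<close> of \<open>a\<close>, every \<open>x\<close> in its ball satisfies
  \<open>norm (a - x) < norm a\<close>, hence \<open>a \<bullet> x > 0\<close>; a sufficiently late
  dilate brings the point below norm \<open>r\<close>.\<close>

lemma AE_surround: "AE \<omega> in M. \<forall>a r. a \<noteq> 0 \<and> r > 0 \<longrightarrow> (\<exists>y\<in>N \<omega>. a \<bullet> y > 0 \<and> norm y < r)"
proof -
  obtain D :: "(real ^ 'n) set" where D: "countable D" "\<And>X. open X \<Longrightarrow> X \<noteq> {} \<Longrightarrow> \<exists>q\<in>D. q \<in> X"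
    by (rule countable_dense_setE) blast
  let ?B = "\<lambda>q n. (\<lambda>x. (1 / real (Suc n)) *\<^sub>R x) ` ball q (norm q / 4)"
  have "AE \<omega> in M. \<forall>q\<in>D - {0}. \<forall>k. \<exists>n\<ge>k. N \<omega> \<inter> ?B q n \<noteq> {}"
  proof (subst AE_ball_countable)
    show "countable (D - {0})" using D(1) by simp
    show "\<forall>q\<in>D - {0}. AE \<omega> in M. \<forall>k. \<exists>n\<ge>k. N \<omega> \<inter> ?B q n \<noteq> {}"
    proof
      fix q assume q: "q \<in> D - {0}"
      show "AE \<omega> in M. \<forall>k. \<exists>n\<ge>k. N \<omega> \<inter> ?B q n \<noteq> {}"
      proof (rule AE_charges_dilates[where r = "norm q / 2"])
        fix x assume "x \<in> ball q (norm q / 4)"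
        then have "norm (q - x) < norm q / 4" by (simp add: dist_norm)
        moreover have "norm q \<le> norm x + norm (q - x)" by (rule norm_triangle_sub)
        ultimately show "norm x \<ge> norm q / 2" using norm_ge_zero[of q] by linarith
      qed (use q in auto)
    qed
  qed
  then show ?thesis
  proof eventually_elim
    case (elim \<omega>)
    show ?case
    proof (intro allI impI, elim conjE)
      fix a :: "real ^ 'n" and r :: real assume a: "a \<noteq> 0" and r: "r > 0"
      then obtain q where q: "q \<in> D" "norm (a - q) < norm a / 4"
        using D(2)[of "ball a (norm a / 4)"] by (auto simp: dist_norm)
      have na: "norm a > 0" using a by simp
      have "q \<noteq> 0" using q(2) na by auto
      have nq: "norm q < 5 / 4 * norm a"
        using norm_triangle_ineq4[of a "a - q"] q(2) by simp
      obtain k where k: "inverse (real (Suc k)) < r / (2 * norm a)"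
        using reals_Archimedean[of "r / (2 * norm a)"] r na by auto
      obtain n where n: "n \<ge> k" "N \<omega> \<inter> ?B q n \<noteq> {}" using elim q(1) \<open>q \<noteq> 0\<close> by blast
      then obtain x where x: "norm (q - x) < norm q / 4" "(1 / real (Suc n)) *\<^sub>R x \<in> N \<omega>"
        by (auto simp: dist_norm)
      have "norm (a - x) \<le> norm (a - q) + norm (q - x)"
        using norm_triangle_ineq[of "a - q" "q - x"] by simp
      then have xa: "norm (a - x) < norm a" using q(2) x(1) nq na by linarith
      have "norm x < 2 * norm a"
        using norm_triangle_ineq4[of a "a - x"] xa by simp
      then have "norm ((1 / real (Suc n)) *\<^sub>R x) \<le> (1 / real (Suc n)) * (2 * norm a)"
        by (simp add: divide_right_mono)
      also have "\<dots> \<le> inverse (real (Suc k)) * (2 * norm a)"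
        using n(1) na by (intro mult_right_mono) (auto simp: field_simps)
      also have "\<dots> < r" using k na by (simp add: pos_less_divide_eq)
      finally have small: "norm ((1 / real (Suc n)) *\<^sub>R x) < r" .
      have "a \<bullet> (a - x) \<le> norm a * norm (a - x)" by (rule norm_cauchy_schwarz)
      also have "\<dots> < norm a * norm a" using xa na by simp
      also have "\<dots> = a \<bullet> a" by (simp add: dot_square_norm power2_eq_square)
      finally have "a \<bullet> x > 0" by (simp add: inner_diff_right)
      then have "a \<bullet> ((1 / real (Suc n)) *\<^sub>R x) > 0" by simp
      then show "\<exists>y\<in>N \<omega>. a \<bullet> y > 0 \<and> norm y < r" using small x(2) by blast
    qed
  qed
qed

text \<open>The algebraic conditions say that closed null sets of tuples are avoided: dependent
  points, points dependent after one of them is replaced by \<open>c\<close>, and d + 1 points on a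
  common hyperplane.\<close>

lemma AE_generic_configuration:
  assumes c: "c \<noteq> 0"
  shows "AE \<omega> in M. generic_configuration (N \<omega>) c"
proof -
  let ?L = "stable_intensity 2 :: (real ^ 'n) measure"
  let ?B1 = "{x :: 'n \<Rightarrow> real ^ 'n. det (row_mat x) = 0}"
  let ?B2 = "\<lambda>k. {x :: 'n \<Rightarrow> real ^ 'n. det (row_mat (x(k := c))) = 0}"
  let ?B3 = "{x :: 'n option \<Rightarrow> real ^ 'n. cramer_num (\<lambda>k. x (Some k)) \<bullet> x None = det (row_mat (\<lambda>k. x (Some k)))}"
  have B1: "AE \<omega> in M. \<forall>x. inj x \<and> range x \<subseteq> N \<omega> \<and> (\<forall>i. x i \<noteq> 0) \<longrightarrow> x \<notin> ?B1"
  proof (rule AE_avoid_null)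
    fix x assume "x \<notin> ?B1"
    then have x: "det (row_mat x) \<noteq> 0" by simp
    show "\<exists>e>0. \<forall>x'. (\<forall>i. dist (x' i) (x i) < e) \<longrightarrow> x' \<notin> ?B1"
    proof (rule near_sequentially)
      fix X assume "\<And>i. (\<lambda>n. X n i) \<longlonglongrightarrow> x i"
      then have "(\<lambda>n. det (row_mat (X n))) \<longlonglongrightarrow> det (row_mat x)" by (rule tendsto_row_det)
      then show "\<forall>\<^sub>F n in sequentially. X n \<notin> ?B1"
        using tendsto_imp_eventually_ne x by fastforce
    qed
  next
    show "AE x in PiM UNIV (\<lambda>_. ?L). x \<notin> ?B1"
      using AE_rows_det_nz[OF product_sigma_finite_intensity] by simp
  qed (rule singleton_null)
  have "AE \<omega> in M. \<forall>x. inj x \<and> range x \<subseteq> N \<omega> \<and> (\<forall>i. x i \<noteq> 0) \<longrightarrow> x \<notin> ?B2 k" for k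
  proof (rule AE_avoid_null)
    fix x assume "x \<notin> ?B2 k"
    then have x: "det (row_mat (x(k := c))) \<noteq> 0" by simp
    show "\<exists>e>0. \<forall>x'. (\<forall>i. dist (x' i) (x i) < e) \<longrightarrow> x' \<notin> ?B2 k"
    proof (rule near_sequentially)
      fix X assume X: "\<And>i. (\<lambda>n. X n i) \<longlonglongrightarrow> x i"
      have "(\<lambda>n. ((X n)(k := c)) i) \<longlonglongrightarrow> (x(k := c)) i" for i
        using X by (cases "i = k") auto
      then have "(\<lambda>n. det (row_mat ((X n)(k := c)))) \<longlonglongrightarrow> det (row_mat (x(k := c)))" by (rule tendsto_row_det)
      then show "\<forall>\<^sub>F n in sequentially. X n \<notin> ?B2 k"
        using tendsto_imp_eventually_ne x by fastforce
    qed
  next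
    show "AE x in PiM UNIV (\<lambda>_. ?L). x \<notin> ?B2 k"
      using AE_rows_upd_det_nz[OF product_sigma_finite_intensity c] by simp
  qed (rule singleton_null)
  then have B2: "AE \<omega> in M. \<forall>k x. inj x \<and> range x \<subseteq> N \<omega> \<and> (\<forall>i. x i \<noteq> 0) \<longrightarrow> x \<notin> ?B2 k"
    by (subst AE_all_countable) blast
  have B3: "AE \<omega> in M. \<forall>x. inj x \<and> range x \<subseteq> N \<omega> \<and> (\<forall>i. x i \<noteq> 0) \<longrightarrow> x \<notin> ?B3"
  proof (rule AE_avoid_null)
    fix x assume "x \<notin> ?B3"
    then have x: "cramer_num (\<lambda>k. x (Some k)) \<bullet> x None - det (row_mat (\<lambda>k. x (Some k))) \<noteq> 0" by simp
    show "\<exists>e>0. \<forall>x'. (\<forall>i. dist (x' i) (x i) < e) \<longrightarrow> x' \<notin> ?B3"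
    proof (rule near_sequentially)
      fix X assume X: "\<And>i. (\<lambda>n. X n i) \<longlonglongrightarrow> x i"
      have "(\<lambda>n. cramer_num (\<lambda>k. X n (Some k)) \<bullet> X n None - det (row_mat (\<lambda>k. X n (Some k))))
        \<longlonglongrightarrow> cramer_num (\<lambda>k. x (Some k)) \<bullet> x None - det (row_mat (\<lambda>k. x (Some k)))"
        by (intro tendsto_diff tendsto_inner tendsto_cramer_num tendsto_row_det X)
      then have "\<forall>\<^sub>F n in sequentially. cramer_num (\<lambda>k. X n (Some k)) \<bullet> X n None - det (row_mat (\<lambda>k. X n (Some k))) \<noteq> 0"
        using tendsto_imp_eventually_ne x by blast
      then show "\<forall>\<^sub>F n in sequentially. X n \<notin> ?B3" by eventually_elim simp
    qed
  next
    show "AE x in PiM UNIV (\<lambda>_. ?L). x \<notin> ?B3"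
      using AE_no_common_hyperplane[OF product_sigma_finite_intensity] by simp
  qed (rule singleton_null)
  show ?thesis
    using B1 B2 B3 AE_surround AE_locally_finite AE_space
  proof eventually_elim
    case (elim \<omega>)
    have nz: "0 \<notin> N \<omega>" using no_origin elim(6) by blast
    have det_nz: "det (row_mat x) \<noteq> 0" if "inj x" "range x \<subseteq> N \<omega>" for x :: "'n \<Rightarrow> real ^ 'n"
    proof -
      have "x i \<noteq> 0" for i using that(2) nz by (metis range_subsetD)
      then show ?thesis using elim(1) that by blast
    qed
    show ?case
    proof
      show "\<exists>y\<in>N \<omega>. a \<bullet> y > 0 \<and> norm y < r" if "a \<noteq> 0" "r > 0" for a r
        using elim(4) that by blast
      show "finite (N \<omega> \<inter> {y. norm y \<ge> r})" if "r > 0" for r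
        using elim(5) that by blast
      show "\<not> (\<exists>w. \<forall>i. w \<bullet> x i = 1)" if x: "inj x" "range x \<subseteq> N \<omega>" for x :: "'n option \<Rightarrow> real ^ 'n"
      proof
        assume "\<exists>w. \<forall>i. w \<bullet> x i = 1"
        then obtain w where w: "\<And>i. w \<bullet> x i = 1" by blast
        let ?z = "\<lambda>k. x (Some k)"
        have "inj ?z" using x(1) by (auto simp: inj_def)
        moreover have "range ?z \<subseteq> N \<omega>" using x(2) by blast
        ultimately have d: "det (row_mat ?z) \<noteq> 0" by (rule det_nz)
        then have "w = facet_normal ?z" using facet_normal_iff[of ?z w] w by blast
        then have "cramer_num ?z \<bullet> x None = det (row_mat ?z)"
          using w[of None] d by (simp add: facet_normal_cramer)
        moreover have "x i \<noteq> 0" for i using x(2) nz by (metis range_subsetD)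
        ultimately show False using elim(3) x by blast
      qed
      show "coef (row_mat x) c i \<noteq> 0" if x: "inj x" "range x \<subseteq> N \<omega>" for x i
      proof -
        have "x i \<noteq> 0" for i using x(2) nz by (metis range_subsetD)
        then have "det (row_mat (x(i := c))) \<noteq> 0" using elim(2) x by blast
        then show ?thesis using det_nz[OF x] by (simp add: coef_row_mat)
      qed
    qed (use nz det_nz in auto)
  qed
qed

end

lemma nn_integral_PiM_density:
  fixes g :: "'a::euclidean_space \<Rightarrow> ennreal" and f :: "('i::finite \<Rightarrow> 'a) \<Rightarrow> ennreal"
  assumes [measurable]: "g \<in> borel_measurable borel" "f \<in> borel_measurable (PiM UNIV (\<lambda>_. lborel))"
    and sigma: "sigma_finite_measure (density lborel g)"
  shows "(\<integral>\<^sup>+x. f x \<partial>PiM UNIV (\<lambda>_. density lborel g)) = (\<integral>\<^sup>+x. (\<Prod>i\<in>UNIV. g (x i)) * f x \<partial>PiM UNIV (\<lambda>_. lborel))"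
proof -
  interpret L: product_sigma_finite "\<lambda>_::'i. lborel :: 'a measure" by (rule product_sigma_finite_lborel)
  interpret D: product_sigma_finite "\<lambda>_::'i. density lborel g"
    using sigma unfolding product_sigma_finite_def by blast
  have "density (PiM UNIV (\<lambda>_::'i. lborel)) (\<lambda>x. \<Prod>i\<in>UNIV. g (x i)) = PiM UNIV (\<lambda>_. density lborel g)"
  proof (rule D.PiM_eqI)
    show "sets (density (PiM UNIV (\<lambda>_::'i. lborel)) (\<lambda>x. \<Prod>i\<in>UNIV. g (x i))) = sets (PiM UNIV (\<lambda>_. density lborel g))"
      by (simp cong: sets_PiM_cong)
    fix A :: "'i \<Rightarrow> 'a set" assume "\<And>i. i \<in> UNIV \<Longrightarrow> A i \<in> sets (density lborel g)"
    then have A[measurable]: "A i \<in> sets borel" for i by simp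
    have "emeasure (density (PiM UNIV (\<lambda>_::'i. lborel)) (\<lambda>x. \<Prod>i\<in>UNIV. g (x i))) (PiE UNIV A)
      = (\<integral>\<^sup>+x. (\<Prod>i\<in>UNIV. g (x i)) * indicator (PiE UNIV A) x \<partial>PiM UNIV (\<lambda>_. lborel))"
      by (subst emeasure_density) (auto intro!: sets_PiM_I_finite)
    also have "\<dots> = (\<integral>\<^sup>+x. (\<Prod>i\<in>UNIV. g (x i) * indicator (A i) (x i)) \<partial>PiM UNIV (\<lambda>_. lborel))"
    proof (rule nn_integral_cong)
      fix x :: "'i \<Rightarrow> 'a"
      show "(\<Prod>i\<in>UNIV. g (x i)) * indicator (PiE UNIV A) x = (\<Prod>i\<in>UNIV. g (x i) * indicator (A i) (x i))"
      proof (cases "\<forall>i. x i \<in> A i")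
        case False
        then have "(\<Prod>i\<in>UNIV. g (x i) * indicator (A i) (x i)) = 0"
          by (intro prod_zero) (auto simp: indicator_def)
        then show ?thesis using False by (simp add: PiE_UNIV_domain indicator_def Pi_iff)
      qed (simp add: PiE_UNIV_domain indicator_def Pi_iff)
    qed
    also have "\<dots> = (\<Prod>i\<in>UNIV. \<integral>\<^sup>+x. g x * indicator (A i) x \<partial>lborel)"
      by (rule L.product_nn_integral_prod) auto
    also have "\<dots> = (\<Prod>i\<in>UNIV. emeasure (density lborel g) (A i))"
      by (simp add: emeasure_density)
    finally show "emeasure (density (PiM UNIV (\<lambda>_::'i. lborel)) (\<lambda>x. \<Prod>i\<in>UNIV. g (x i))) (PiE UNIV A)
      = (\<Prod>i\<in>UNIV. emeasure (density lborel g) (A i))" .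
  qed simp
  then show ?thesis
    by (simp add: nn_integral_density flip: \<open>_ = PiM UNIV (\<lambda>_. density lborel g)\<close>)
qed

context stable_process
begin

definition facet_count :: "'n set \<Rightarrow> real ^ 'n \<Rightarrow> 'w \<Rightarrow> ennreal" where
  "facet_count I c \<omega> = emeasure (count_space UNIV) {x. pos_coefs I c x \<and> range x \<subseteq> N \<omega> \<and> N \<omega> \<inter> facet_beyond x = {}}"

text \<open>The void formula with the open halfspace beyond the facet as its region and the closed
  halfspace as companion. They differ by a hyperplane, which is null and, by
  \<open>no_hyperplane\<close>, contains no point of the process outside the tuple.\<close>

lemma
  assumes c: "c \<noteq> 0"
  shows facet_count_AE_measurable: "\<exists>S'\<in>borel_measurable M. AE \<omega> in M. facet_count I c \<omega> = S' \<omega>" (is ?A)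
    and nn_integral_facet_count: "(\<integral>\<^sup>+\<omega>. facet_count I c \<omega> \<partial>M) =
      (\<integral>\<^sup>+x. indicator {x. pos_coefs I c x} x * ennreal (exp (- measure (stable_intensity 2) (facet_beyond x))) \<partial>PiM UNIV (\<lambda>_. stable_intensity 2))" (is ?B)
proof -
  let ?L = "stable_intensity 2 :: (real ^ 'n) measure"
  let ?P = "pos_coefs I c"
  let ?Ab = "\<lambda>x :: 'n \<Rightarrow> real ^ 'n. {y. facet_normal x \<bullet> y \<ge> 1}"
  have d: "det (row_mat x) \<noteq> 0" if "?P x" for x using that by (simp add: pos_coefs_def)
  have on: "facet_normal x \<bullet> x i = 1" if "?P x" for x i by (rule facet_normal_inner[OF d[OF that]])
  have inj: "inj x" if "?P x" for x by (rule det_row_mat_inj[OF d[OF that]])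
  have nz: "x i \<noteq> 0" if "?P x" for x i using on[OF that, of i] by auto
  have "?P x \<Longrightarrow> facet_normal x \<noteq> 0" for x using on[of x undefined] by auto
  then have null: "?P x \<Longrightarrow> emeasure ?L {y. facet_normal x \<bullet> y = 1} = 0" for x by (intro hyperplane_null)
  have opn: "\<exists>e>0. \<exists>r>0. \<forall>x'. (\<forall>i. dist (x' i) (x i) < e) \<longrightarrow> ?P x' \<and> facet_beyond x' \<subseteq> {y. norm y \<ge> r}" if Px: "?P x" for x
  proof -
    \<comment> \<open>Near \<open>x\<close> all normals have norm below \<open>R\<close>, so the
      halfspaces beyond stay outside the ball of radius \<open>1 / R\<close>.\<close>
    define R where "R = norm (facet_normal x) + 1"
    have R: "R > 0" by (simp add: R_def add_nonneg_pos)
    have "\<exists>e>0. \<forall>x'. (\<forall>i. dist (x' i) (x i) < e) \<longrightarrow> ?P x' \<and> norm (facet_normal x') < R"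
    proof (rule near_sequentially)
      fix X assume X: "\<And>i. (\<lambda>n. X n i) \<longlonglongrightarrow> x i"
      have "\<forall>\<^sub>F n in sequentially. det (row_mat (X n)) \<noteq> 0"
        using tendsto_row_det[OF X] d[OF Px] by (rule tendsto_imp_eventually_ne)
      moreover have "\<forall>\<^sub>F n in sequentially. \<forall>i\<in>I. coef (row_mat (X n)) c i > 0"
      proof (rule eventually_ball_finite)
        show "\<forall>i\<in>I. \<forall>\<^sub>F n in sequentially. coef (row_mat (X n)) c i > 0"
        proof
          fix i assume "i \<in> I"
          then have "coef (row_mat x) c i > 0" using Px by (simp add: pos_coefs_def)
          then show "\<forall>\<^sub>F n in sequentially. coef (row_mat (X n)) c i > 0"
            by (rule order_tendstoD(1)[OF tendsto_coef[OF X d[OF Px]]])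
        qed
      qed simp
      moreover have "\<forall>\<^sub>F n in sequentially. norm (facet_normal (X n)) < R"
        using tendsto_norm[OF tendsto_facet_normal[OF X d[OF Px]]] by (rule order_tendstoD) (simp add: R_def)
      ultimately show "\<forall>\<^sub>F n in sequentially. ?P (X n) \<and> norm (facet_normal (X n)) < R"
        by eventually_elim (simp add: pos_coefs_def)
    qed
    then obtain e where e: "e > 0" "\<And>x'. \<forall>i. dist (x' i) (x i) < e \<Longrightarrow> ?P x' \<and> norm (facet_normal x') < R" by blast
    have "facet_beyond x' \<subseteq> {y. norm y \<ge> 1 / R}" if near: "\<forall>i. dist (x' i) (x i) < e" for x'
    proof
      fix y assume "y \<in> facet_beyond x'"
      then have "1 < facet_normal x' \<bullet> y" by (simp add: facet_beyond_def)
      also have "\<dots> \<le> norm (facet_normal x') * norm y" by (rule norm_cauchy_schwarz)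
      also have "\<dots> \<le> R * norm y" using e(2)[OF near] by (intro mult_right_mono) auto
      finally show "y \<in> {y. norm y \<ge> 1 / R}" using R by (simp add: field_simps)
    qed
    moreover have "1 / R > 0" using R by simp
    ultimately show ?thesis using e by blast
  qed
  have A_open: "open (facet_beyond x)" for x
    by (simp add: facet_beyond_def open_halfspace_gt)
  have A_self: "x i \<notin> facet_beyond x" if "?P x" for x i
    using on[OF that] by (simp add: facet_beyond_def)
  have Ab: "facet_beyond x \<subseteq> ?Ab x" for x by (auto simp: facet_beyond_def)
  have Ab': "x i \<in> ?Ab x" if "?P x" for x i using on[OF that] by simp
  have closed: "\<exists>e>0. \<forall>x'. (\<forall>i. dist (x' i) (x i) < e) \<longrightarrow> y \<notin> facet_beyond x'" if Px: "?P x" and y: "y \<notin> ?Ab x" for x y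
  proof (rule near_sequentially)
    fix X assume X: "\<And>i. (\<lambda>n. X n i) \<longlonglongrightarrow> x i"
    have "(\<lambda>n. facet_normal (X n) \<bullet> y) \<longlonglongrightarrow> facet_normal x \<bullet> y"
      by (intro tendsto_inner tendsto_const tendsto_facet_normal X d[OF Px])
    then have "\<forall>\<^sub>F n in sequentially. facet_normal (X n) \<bullet> y < 1"
      by (rule order_tendstoD) (use y in simp)
    then show "\<forall>\<^sub>F n in sequentially. y \<notin> facet_beyond (X n)"
      by eventually_elim (simp add: facet_beyond_def)
  qed
  have Ab_borel: "?Ab x \<in> sets borel" for x by (intro borel_closed closed_halfspace_ge)
  have Ab_null: "emeasure ?L (?Ab x - facet_beyond x) = 0" if "?P x" for x
  proof -
    have "?Ab x - facet_beyond x = {y. facet_normal x \<bullet> y = 1}" by (auto simp: facet_beyond_def)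
    then show ?thesis using null[OF that] by simp
  qed
  have generic: "AE \<omega> in M. \<forall>x. ?P x \<and> range x \<subseteq> N \<omega> \<longrightarrow> N \<omega> \<inter> ?Ab x \<subseteq> facet_beyond x \<union> range x"
    using AE_generic_configuration[OF c]
  proof eventually_elim
    case (elim \<omega>)
    interpret generic_configuration "N \<omega>" c by (rule elim)
    show ?case
    proof (intro allI impI subsetI, elim conjE)
      fix x y assume x: "?P x" "range x \<subseteq> N \<omega>" and y: "y \<in> N \<omega> \<inter> ?Ab x"
      show "y \<in> facet_beyond x \<union> range x"
      proof (rule ccontr)
        assume ny: "y \<notin> facet_beyond x \<union> range x"
        let ?z = "case_option y x"
        have "inj ?z"
        proof (rule injI)
          fix i j assume "?z i = ?z j"
          then show "i = j"
            using injD[OF inj[OF x(1)]] ny by (cases i; cases j) auto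
        qed
        moreover have "?z i \<in> N \<omega>" for i using x(2) y by (cases i) auto
        then have "range ?z \<subseteq> N \<omega>" by blast
        moreover have "facet_normal x \<bullet> ?z i = 1" for i
          using on[OF x(1)] y ny by (cases i) (auto simp: facet_beyond_def)
        ultimately show False using no_hyperplane[of ?z] by blast
      qed
    qed
  qed
  show ?A unfolding facet_count_def
    by (rule mecke_void(1)[where P = ?P and A = facet_beyond and Ab = ?Ab])
      (erule inj, erule nz, erule opn, rule A_open, erule A_self, rule Ab, erule Ab', erule (1) closed,
        rule Ab_borel, erule Ab_null, rule generic)
  show ?B unfolding facet_count_def
    by (rule mecke_void(2)[where P = ?P and A = facet_beyond and Ab = ?Ab])
      (erule inj, erule nz, erule opn, rule A_open, erule A_self, rule Ab, erule Ab', erule (1) closed,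
        rule Ab_borel, erule Ab_null, rule generic)
qed

end

text \<open>The inner part of \<open>facet_integral\<close> at fixed \<open>c\<close>. The Mecke
  formula holds for each nonzero \<open>c\<close> and is averaged only afterwards.\<close>

definition facet_weight :: "real \<Rightarrow> 'n::finite set \<Rightarrow> real ^ 'n \<Rightarrow> ennreal" where
  "facet_weight \<kappa> I c = (\<integral>\<^sup>+X. pos_ind I X c *
     ennreal (exp (- \<kappa> * (norm (dual_vec X (\<chi> i. 1)))\<^sup>2)) * (\<Prod>i\<in>UNIV. power_density (X $ i)) \<partial>lborel)"

lemma facet_weight_measurable [measurable]: "facet_weight \<kappa> I \<in> borel_measurable borel"
  unfolding facet_weight_def[abs_def] by measurable

lemma facet_integral_eq:
  "facet_integral \<kappa> I = (\<integral>\<^sup>+c. ennreal (exp (- (norm c)\<^sup>2 / 2)) * facet_weight \<kappa> I c \<partial>lborel)"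
  unfolding facet_integral_def facet_weight_def
  by (intro nn_integral_cong nn_integral_cmult) measurable

lemma pos_ind_row_mat: "pos_ind I (row_mat x) c = indicator {x. pos_coefs I c x} x"
proof (cases "\<forall>i\<in>I. coef (row_mat x) c i > 0")
  case False
  then have "(\<Prod>i\<in>I. indicator {0<..} (coef (row_mat x) c i)) = (0 :: ennreal)"
    by (intro prod_zero) (auto simp: indicator_def)
  then show ?thesis using False by (auto simp: pos_ind_def pos_coefs_def indicator_def)
qed (auto simp: pos_ind_def pos_coefs_def indicator_def)

lemma fact_ennreal: "(fact n :: ennreal) \<noteq> 0" "(fact n :: ennreal) \<noteq> \<top>"
proof -
  have *: "(fact n :: ennreal) = of_nat (fact n)" by (simp only: of_nat_fact)
  show "(fact n :: ennreal) \<noteq> 0" "(fact n :: ennreal) \<noteq> \<top>"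
    unfolding * by (simp_all only: of_nat_eq_0_iff fact_nonzero ennreal_of_nat_neq_top not_False_eq_True)
qed

context stable_process
begin

lemma nn_integral_facet_count_eq_weight:
  fixes c :: "real ^ 'n"
  assumes \<kappa>: "\<And>w::real^'n. emeasure (stable_intensity 2) {y. w \<bullet> y > 1} = ennreal (\<kappa> * (norm w)\<^sup>2)" "\<kappa> \<ge> 0"
    and c: "c \<noteq> 0"
  shows "(\<integral>\<^sup>+\<omega>. facet_count I c \<omega> \<partial>M) = facet_weight \<kappa> I c"
proof -
  let ?f = "\<lambda>X. pos_ind I X c * ennreal (exp (- \<kappa> * (norm (dual_vec X (\<chi> i. 1)))\<^sup>2))"
  have row: "row_mat x = (\<chi> i. x i)" for x :: "'n \<Rightarrow> real ^ 'n" by (simp add: row_mat_def)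
  have "(\<integral>\<^sup>+\<omega>. facet_count I c \<omega> \<partial>M) = (\<integral>\<^sup>+x. ?f (row_mat x) \<partial>PiM UNIV (\<lambda>_. stable_intensity 2))"
    unfolding nn_integral_facet_count[OF c]
    using \<kappa> by (intro nn_integral_cong)
      (simp add: pos_ind_row_mat facet_beyond_def measure_def facet_normal_def)
  also have "\<dots> = (\<integral>\<^sup>+x. (\<Prod>i\<in>UNIV. power_density (x i)) * ?f (row_mat x) \<partial>PiM UNIV (\<lambda>_. lborel))"
    unfolding stable_intensity_2
    using sigma_finite_Lam unfolding stable_intensity_2 by (intro nn_integral_PiM_density) measurable
  also have "\<dots> = (\<integral>\<^sup>+X. (\<Prod>i\<in>UNIV. power_density (X $ i)) * ?f X \<partial>lborel)"
    by (subst nn_integral_lborel_vec) (simp_all add: row)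
  finally show ?thesis by (simp add: facet_weight_def mult.commute mult.left_commute)
qed

text \<open>\<open>F\<close> is any version of the number of \<open>k\<close>-sets on a supporting
  hyperplane, so the constant 1 for \<open>k = 0\<close> and the face numbers for positive
  \<open>k\<close> are treated at once. The left-hand side is free of \<open>c\<close>, which is
  what permits averaging the right-hand side.\<close>

lemma fact_mult_expected_faces:
  fixes c :: "real ^ 'n"
  assumes \<kappa>: "\<And>w::real^'n. emeasure (stable_intensity 2) {y. w \<bullet> y > 1} = ennreal (\<kappa> * (norm w)\<^sup>2)" "\<kappa> \<ge> 0"
    and c: "c \<noteq> 0" and k: "k \<le> CARD('n)"
    and F: "AE \<omega> in M. F \<omega> = of_nat (card (generic_configuration.face_vertices (N \<omega>) k))"
  shows "fact (CARD('n)) * (\<integral>\<^sup>+\<omega>. F \<omega> \<partial>M) = (\<Sum>I | card I = CARD('n) - k. facet_weight \<kappa> I c)"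
proof -
  let ?d = "CARD('n)"
  have "\<forall>I. \<exists>S. S \<in> borel_measurable M \<and> (AE \<omega> in M. facet_count I c \<omega> = S \<omega>)"
    using facet_count_AE_measurable[OF c] by blast
  then obtain S where S[measurable]: "\<And>I. S I \<in> borel_measurable M" and S_eq: "\<And>I. AE \<omega> in M. facet_count I c \<omega> = S I \<omega>"
    by metis
  have all: "AE \<omega> in M. \<forall>I. facet_count I c \<omega> = S I \<omega>"
    using S_eq by (simp add: AE_all_countable)
  have fact_pos: "(fact ?d :: ennreal) \<noteq> 0" "(fact ?d :: ennreal) \<noteq> \<top>"
    by (rule fact_ennreal)+
  then have inv: "inverse (fact ?d) * fact ?d = (1 :: ennreal)"
    using ennreal_divide_self[of "fact ?d"] by (simp add: divide_ennreal_def mult.commute less_top[symmetric])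
  \<comment> \<open>Division by the factorial presents \<open>F\<close> almost surely as a
    combination of measurable functions, to which linearity of the integral applies.\<close>
  have "AE \<omega> in M. F \<omega> = inverse (fact ?d) * (\<Sum>I | card I = ?d - k. S I \<omega>)"
    using F all AE_generic_configuration[OF c]
  proof eventually_elim
    case (elim \<omega>)
    interpret generic_configuration "N \<omega>" c by (rule elim)
    have "S I \<omega> = of_nat (card (facet_tuples I))" for I
    proof -
      have "facet_count I c \<omega> = of_nat (card (facet_tuples I))"
        using finite_facet_tuples[of I] by (simp add: facet_count_def facet_tuples_def emeasure_count_space)
      then show ?thesis using elim(2) by metis
    qed
    then have "(\<Sum>I | card I = ?d - k. S I \<omega>) = of_nat (fact ?d * card (face_vertices k))"
      unfolding card_facet_tuples[OF k] by simp
    then have "inverse (fact ?d) * (\<Sum>I | card I = ?d - k. S I \<omega>) = (inverse (fact ?d) * fact ?d) * of_nat (card (face_vertices k))"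
      by (simp add: mult.assoc)
    also have "inverse (fact ?d) * fact ?d = (1 :: ennreal)"
      by (rule inv)
    finally show ?case using elim(1) by simp
  qed
  then have "(\<integral>\<^sup>+\<omega>. F \<omega> \<partial>M) = (\<integral>\<^sup>+\<omega>. inverse (fact ?d) * (\<Sum>I | card I = ?d - k. S I \<omega>) \<partial>M)"
    by (rule nn_integral_cong_AE)
  also have "\<dots> = inverse (fact ?d) * (\<Sum>I | card I = ?d - k. \<integral>\<^sup>+\<omega>. S I \<omega> \<partial>M)"
    by (subst nn_integral_cmult, measurable) (subst nn_integral_sum, auto)
  also have "(\<lambda>I. \<integral>\<^sup>+\<omega>. S I \<omega> \<partial>M) = (\<lambda>I. facet_weight \<kappa> I c)"
    using nn_integral_cong_AE[OF S_eq] nn_integral_facet_count_eq_weight[OF \<kappa> c] by (simp add: fun_eq_iff)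
  finally have "fact ?d * (\<integral>\<^sup>+\<omega>. F \<omega> \<partial>M) = (fact ?d * inverse (fact ?d)) * (\<Sum>I | card I = ?d - k. facet_weight \<kappa> I c)"
    by (simp add: mult.assoc)
  also have "fact ?d * inverse (fact ?d) = (1 :: ennreal)"
    using inv by (simp only: mult.commute)
  finally show ?thesis by simp
qed

end

theorem theorem2p5:
  fixes M :: "'w measure"
    and N :: "'w \<Rightarrow> (real ^ 'n) set"
    and k :: nat
  assumes ppp: "poisson_point_process M N (stable_intensity 2)"
    and no_origin: "\<forall>\<omega> \<in> space M. 0 \<notin> N \<omega>"
    and k: "1 \<le> k" "k \<le> CARD('n)"
  shows "(\<integral>\<^sup>+ \<omega>. of_nat (face_number (int k - 1) (convex hull (N \<omega>))) \<partial>M)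
           = of_nat ((CARD('n) choose k) * ((CARD('n) + k) choose k))"
proof -
  interpret stable_process M N
    using ppp no_origin by unfold_locales blast+
  let ?d = "CARD('n)"
  let ?\<phi> = "\<lambda>c::real ^ 'n. ennreal (exp (- (norm c)\<^sup>2 / 2))"
  define \<Gamma> where "\<Gamma> = (\<integral>\<^sup>+c. ?\<phi> c \<partial>lborel)"
  have \<Gamma>: "\<Gamma> = ennreal (sqrt (2 * pi) * sqrt (2 * pi) ^ (?d - 1))"
    using nn_integral_gauss_vec[where f = "\<lambda>_. 1" and 'n = 'n]
    unfolding \<Gamma>_def mult_1_right nn_integral_gauss by (simp add: ennreal_mult'' ennreal_power)
  have \<Gamma>_pos: "\<Gamma> \<noteq> 0" "\<Gamma> \<noteq> \<top>" unfolding \<Gamma> by (simp_all add: ennreal_eq_0_iff not_le)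
  obtain \<kappa> where \<kappa>: "\<And>w::real^'n. emeasure (stable_intensity 2) {y. w \<bullet> y > 1} = ennreal (\<kappa> * (norm w)\<^sup>2)" "\<kappa> \<ge> 0"
    by (rule stable_intensity_halfspace) blast
  obtain A where A: "\<And>I::'n set. facet_integral \<kappa> I = A * of_nat ((?d + card (- I)) choose card (- I))"
    using facet_integral_binomial by blast
  have cne: "AE c in lborel. c \<noteq> (0 :: real ^ 'n)"
    by (rule AE_lborel_singleton)
  \<comment> \<open>The Gaussian average of the identity at fixed \<open>c\<close> turns
    \<open>facet_weight\<close> into \<open>facet_integral\<close>; the exceptional value
    \<open>c = 0\<close> is null. \<open>A\<close> does not depend on \<open>j\<close>.\<close>
  have main: "fact ?d * \<Gamma> * (\<integral>\<^sup>+\<omega>. F \<omega> \<partial>M) = A * of_nat ((?d choose j) * ((?d + j) choose j))"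
    if j: "j \<le> ?d" and F: "\<And>c :: real ^ 'n. c \<noteq> 0 \<Longrightarrow> AE \<omega> in M. F \<omega> = of_nat (card (generic_configuration.face_vertices (N \<omega>) j))" for F j
  proof -
    have card_I: "card (- I) = j" if "card I = ?d - j" for I :: "'n set"
      using that j by (simp add: Compl_eq_Diff_UNIV card_Diff_subset)
    have "fact ?d * \<Gamma> * (\<integral>\<^sup>+\<omega>. F \<omega> \<partial>M) = (\<integral>\<^sup>+c. ?\<phi> c * (fact ?d * (\<integral>\<^sup>+\<omega>. F \<omega> \<partial>M)) \<partial>lborel)"
      unfolding \<Gamma>_def by (subst nn_integral_multc) (simp_all add: mult_ac)
    also have "\<dots> = (\<integral>\<^sup>+c. (\<Sum>I | card I = ?d - j. ?\<phi> c * facet_weight \<kappa> I c) \<partial>lborel)"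
    proof (rule nn_integral_cong_AE, use cne in eventually_elim)
      case (elim c)
      show ?case
        unfolding fact_mult_expected_faces[OF \<kappa> elim j F[OF elim]] by (rule sum_distrib_left)
    qed
    also have "\<dots> = (\<Sum>I | card (I :: 'n set) = ?d - j. facet_integral \<kappa> I)"
      unfolding facet_integral_eq by (rule nn_integral_sum) measurable
    also have "\<dots> = (\<Sum>I | card (I :: 'n set) = ?d - j. A * of_nat ((?d + j) choose j))"
      using card_I by (intro sum.cong) (auto simp: A)
    also have "\<dots> = A * of_nat (card {I :: 'n set. card I = ?d - j} * ((?d + j) choose j))"
      by (simp add: mult_ac)
    also have "card {I :: 'n set. card I = ?d - j} = ?d choose j"
      using n_subsets[of "UNIV :: 'n set" "?d - j"] binomial_symmetric[OF j] by simp
    finally show ?thesis .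
  qed
  \<comment> \<open>The empty face is counted exactly once, so its expectation 1 yields
    \<open>A = fact d * \<Gamma>\<close>. This value is positive and finite and can therefore be
    cancelled in the identity for \<open>k\<close>.\<close>
  have "fact ?d * \<Gamma> * (\<integral>\<^sup>+\<omega>. 1 \<partial>M) = A * of_nat ((?d choose 0) * ((?d + 0) choose 0))"
  proof (rule main)
    fix c :: "real ^ 'n" assume c: "c \<noteq> 0"
    show "AE \<omega> in M. 1 = of_nat (card (generic_configuration.face_vertices (N \<omega>) 0))"
      using AE_generic_configuration[OF c]
    proof eventually_elim
      case (elim \<omega>)
      then show ?case by (simp add: generic_configuration.face_vertices_0)
    qed
  qed simp
  then have A_eq: "A = fact ?d * \<Gamma>" by (simp add: emeasure_space_1)
  have "fact ?d * \<Gamma> * (\<integral>\<^sup>+\<omega>. of_nat (face_number (int k - 1) (convex hull (N \<omega>))) \<partial>M)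
    = A * of_nat ((?d choose k) * ((?d + k) choose k))"
  proof (rule main[OF k(2)])
    fix c :: "real ^ 'n" assume c: "c \<noteq> 0"
    show "AE \<omega> in M. of_nat (face_number (int k - 1) (convex hull (N \<omega>))) = of_nat (card (generic_configuration.face_vertices (N \<omega>) k))"
      using AE_generic_configuration[OF c]
    proof eventually_elim
      case (elim \<omega>)
      show ?case by (simp only: generic_configuration.face_number_eq[OF elim k])
    qed
  qed
  then show ?thesis
    unfolding A_eq using fact_ennreal[of ?d] \<Gamma>_pos
    by (simp add: ennreal_mult_cancel_left ennreal_mult_eq_top_iff)
qed

end
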